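(* The functors $K^{brd}\colon\mathrm{BrdShSkMulti}_{lr}\to\mathrm{BrdSkMon}$ and $K^{sym}\colon\mathrm{SymShSkMulti}_{lr}\to\mathrm{SymSkMon}$, from braided (resp. symmetric) left representable short skew multicategories to braided (resp. symmetric) skew monoidal categories (defined in the context), are equivalences of categories.
   Context: For $x,y\in\{t,l\}$ put $x\circ_iy=t$ if ($x=y=t$ and $i=1$) or ($x=t$ and $i\ne1$), and $x\circ_iy=l$ otherwise. ($t$ = "tight", $l$ = "loose".) **Short skew multicategories.** A short skew multicategory $\mathbb C$ consists of a category $\mathcal C$; functors $\mathbb C^t_n(-;-)\colon(\mathcal C^n)^{op}\times\mathcal C\to\mathrm{Set}$ for $1\le n\le4$ with $\mathbb C^t_1(-;-)=\mathcal C(-,-)$; functors $\mathbb C^l_n(-;-)\colon(\mathcal C^n)^{op}\times\mathcal C\to\mathrm{Set}$ for $n=0,1,2$; natural transformations $j\colon\mathbb C^t_n\to\mathbb C^l_n$ for $n=1,2$. Nullary maps are loose. The functorial action of tight unary maps (morphisms of $\mathcal C$) is written $q\circ f$ (codomain) and $f\circ_ip$ ($i$-th input). Furthermore there are substitution functions $\circ_i\colon\mathbb C^x_n(\bar b;c)\times\mathbb C^y_m(\bar a;b_i)\to\mathbb C^{x\circ_iy}_{n+m-1}(\bar b_{<i},\bar a,\bar b_{>i};c)$, natural in all $a_k$, $b_k$ ($k\neq i$), $c$ and dinatural in $b_i$, in the following cases: tight binary into tight binary or tight ternary; tight ternary into tight binary; nullary into tight binary or tight ternary; nullary into loose unary;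 loose unary into tight binary; tight binary into loose unary. Axioms: for $f$ tight binary, $g$ $n$-ary, $h$ $p$-ary (all tight except that nullary maps are loose), (A) $f\circ_i(g\circ_jh)=(f\circ_ig)\circ_{j+i-1}h$ for $1\le i\le2$, $1\le j\le n$, when $(n,p)\in\{(2,2),(2,0)\}$; (B) $(f\circ_1g)\circ_{n+1}h=(f\circ_2h)\circ_1g$ when $(n,p)\in\{(2,2),(2,0),(0,2),(0,0)\}$; and compatibility of $j$: for $g$ tight binary, $p,q$ tight unary, $v$ nullary, $g\circ_2jp=g\circ_2p$, $g\circ_1jp=j(g\circ_1p)$, $q\circ jp=j(q\circ p)$, $jp\circ g=j(p\circ g)$, $jp\circ v=p\circ v$. A morphism $F\colon\mathbb C\to\mathbb D$ is a functor $F\colon\mathcal C\to\mathcal D$ with natural families $F^t_n\colon\mathbb C^t_n(\bar a;b)\to\mathbb D^t_n(F\bar a;Fb)$ ($1\le n\le4$, $F^t_1=F$) and $F^l_n\colon\mathbb C^l_n(\bar a;b)\to\mathbb D^l_n(F\bar a;Fb)$ ($0\le n\le2$) commuting with all substitutions and with $j$. **Left representability (short skew).** $\mathbb C$ is left representable if there are tight binary maps $\theta_{a,b}\colon a,b\to ab$ (all $a,b$) such that $-\circ_1\theta_{a,b}\colon\mathbb C^t_n(ab,\bar x;d)\to\mathbb C^t_{n+1}(a,b,\bar x;d)$ is bijective for $n=1,2,3$, and a nullary map $u\in\mathbb C^l_0(\,;i)$ such that $-\circ_1u\colon\mathbb C^t_{n+1}(i,\bar x;d)\to\mathbb C^l_n(\bar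 x;d)$ is bijective for $n=0,1,2$. **Short braidings.** A short braiding on $\mathbb C$ consists of natural isomorphisms $\beta^3_2\colon\mathbb C^t_3(a_1,a_2,a_3;b)\to\mathbb C^t_3(a_1,a_3,a_2;b)$, $\beta^4_2\colon\mathbb C^t_4(a_1,a_2,a_3,a_4;b)\to\mathbb C^t_4(a_1,a_3,a_2,a_4;b)$, $\beta^4_3\colon\mathbb C^t_4(a_1,a_2,a_3,a_4;b)\to\mathbb C^t_4(a_1,a_2,a_4,a_3;b)$ such that: $\beta^4_2\beta^4_3\beta^4_2(h)=\beta^4_3\beta^4_2\beta^4_3(h)$ for $h$ tight 4-ary; $g\circ_1\beta^3_2(f)=\beta^4_2(g\circ_1f)$ and $g\circ_2\beta^3_2(f)=\beta^4_3(g\circ_2f)$ for $g$ tight binary, $f$ tight ternary; $\beta^4_3(g\circ_1f)=\beta^3_2(g)\circ_1f$, $\beta^4_2\beta^4_3(g\circ_2f)=\beta^3_2(g)\circ_3f$, $\beta^4_3\beta^4_2(g\circ_3f)=\beta^3_2(g)\circ_2f$ for $g$ tight ternary, $f$ tight binary. It is a short symmetry if moreover $\beta^3_2\beta^3_2=1$. A morphism of short skew multicategories is braided if $F^t_3\beta^3_2=\beta^3_2F^t_3$, $F^t_4\beta^4_2=\beta^4_2F^t_4$, $F^t_4\beta^4_3=\beta^4_3F^t_4$. $\mathrm{BrdShSkMulti}_{lr}$ is the category of left representable short skew multicategories with a short braiding, and braided morphisms; $\mathrm{SymShSkMulti}_{lr}$ is its full subcategory on those whose short braiding is a short symmetry.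 **Skew monoidal categories.** A (left) skew monoidal category is a category $\mathcal C$ with a functor $(a,b)\mapsto ab$, $\mathcal C\times\mathcal C\to\mathcal C$, an object $i$, and natural families $\alpha_{a,b,c}\colon(ab)c\to a(bc)$, $\lambda_a\colon ia\to a$, $\rho_a\colon a\to ai$ (not necessarily invertible) satisfying $\alpha_{a,b,cd}\alpha_{ab,c,d}=(a\,\alpha_{b,c,d})\alpha_{a,bc,d}(\alpha_{a,b,c}\,d)$, $\lambda_{ab}\alpha_{i,a,b}=\lambda_a b$, $\alpha_{a,b,i}\rho_{ab}=a\rho_b$, $(a\lambda_b)\alpha_{a,i,b}(\rho_a b)=1_{ab}$, $\lambda_i\rho_i=1_i$. A lax monoidal functor is a functor $F$ with a map $f_0\colon i\to Fi$ and a natural family $f_2\colon FaFb\to F(ab)$ such that $F\alpha\circ f_2\circ(f_2\cdot Fc)=f_2\circ(Fa\cdot f_2)\circ\alpha$, $F\lambda\circ f_2\circ(f_0\cdot Fa)=\lambda$, $f_2\circ(Fa\cdot f_0)\circ\rho=F\rho$. A braiding on a skew monoidal category consists of natural isomorphisms $s_{x,a,b}\colon(xa)b\to(xb)a$ with $s_{xc,a,b}(s_{x,a,c}\,b)s_{xa,b,c}=(s_{x,b,c}\,a)s_{xb,a,c}(s_{x,a,b}\,c)$; $s_{x,a,bc}\,\alpha_{xa,b,c}=(\alpha_{x,b,c}\,a)s_{xb,a,c}(s_{x,a,b}\,c)$; $s_{x,ab,c}(\alpha_{x,a,b}\,c)=\alpha_{xc,a,b}(s_{x,a,c}\,b)s_{xa,b,c}$;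 $(x\,s_{a,b,c})\alpha_{x,ab,c}(\alpha_{x,a,b}\,c)=\alpha_{x,ac,b}(\alpha_{x,a,c}\,b)s_{xa,b,c}$. It is a symmetry if $s_{x,b,a}=s_{x,a,b}^{-1}$. A lax monoidal functor is braided if $Fs\circ f_2\circ(f_2\cdot Fb)=f_2\circ(f_2\cdot Fa)\circ s\colon(FxFa)Fb\to F((xb)a)$. $\mathrm{BrdSkMon}$ is the category of braided skew monoidal categories and braided lax monoidal functors; $\mathrm{SymSkMon}$ is the full subcategory of symmetric ones. **The functors.** For each left representable short skew multicategory fix a choice of tight binary maps $\theta_{a,b}\colon a,b\to ab$ (all $a,b$) such that $-\circ_1\theta_{a,b}\colon\mathbb C^t_n(ab,\bar x;d)\to\mathbb C^t_{n+1}(a,b,\bar x;d)$ is bijective for $n=1,2,3$, and of a nullary map $u\in\mathbb C^l_0(\,;i)$ such that $-\circ_1u\colon\mathbb C^t_{n+1}(i,\bar x;d)\to\mathbb C^l_n(\bar x;d)$ is bijective for $n=0,1,2$. $K^s\mathbb C$ has underlying category $\mathcal C$, tensor $ab$, unit $i$; for tight unary $f\colon a\to b$, $g\colon c\to d$, $fg$ is the unique map with $(fg)\circ\theta_{a,c}=(\theta_{b,d}\circ_1f)\circ_2g$; $\alpha$ is the unique map with $(\alpha\circ\theta_{ab,c})\circ_1\theta_{a,b}=\theta_{a,bc}\circ_2\theta_{b,c}$; $\lambda_a$ is the unique map with $(\lambda_a\circ\theta_{i,a})\circ_1u=j(1_a)$; $\rho_a=\theta_{a,i}\circ_2u$. On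 a morphism $F$, $K^sF=(F,f_0,f_2)$ with $f_2$ unique such that $f_2\circ\theta_{Fa,Fb}=F^t_2(\theta_{a,b})$ and $f_0$ unique such that $f_0\circ u=F^l_0(u)$. $K^{brd}$ sends a braided $\mathbb C$ to $K^s\mathbb C$ with braiding $s_{x,a,b}$ the unique map such that $s_{x,a,b}\circ(\theta_{xa,b}\circ_1\theta_{x,a})=\beta^3_2(\theta_{xb,a}\circ_1\theta_{x,b})$, and acts on morphisms as $K^s$; $K^{sym}$ is its restriction to symmetric objects. *)

theory Defs
  imports "HOL-Library.FuncSet"
begin

section \<open>Categories, functors, natural transformations\<close>

record ('o, 'm) cat =
  Obj :: "'o set"
  Arr :: "'m set"
  Dom :: "'m \<Rightarrow> 'o"
  Cod :: "'m \<Rightarrow> 'o"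
  Comp :: "'m \<Rightarrow> 'm \<Rightarrow> 'm"  (infixr "\<cdot>\<index>" 55)
  Idn :: "'o \<Rightarrow> 'm"

definition hom :: "('o, 'm) cat \<Rightarrow> 'o \<Rightarrow> 'o \<Rightarrow> 'm set" where
  "hom C a b = {f \<in> Arr C. Dom C f = a \<and> Cod C f = b}"

locale category =
  fixes C :: "('o, 'm) cat" (structure)
  assumes dom_in_Obj: "f \<in> Arr C \<Longrightarrow> Dom C f \<in> Obj C"
    and cod_in_Obj: "f \<in> Arr C \<Longrightarrow> Cod C f \<in> Obj C"
    and idn_in_hom: "a \<in> Obj C \<Longrightarrow> Idn C a \<in> hom C a a"
    and comp_in_hom: "\<lbrakk>f \<in> hom C a b; g \<in> hom C b c\<rbrakk> \<Longrightarrow> g \<cdot> f \<in> hom C a c"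
    and comp_idn: "f \<in> hom C a b \<Longrightarrow> f \<cdot> Idn C a = f"
    and idn_comp: "f \<in> hom C a b \<Longrightarrow> Idn C b \<cdot> f = f"
    and comp_assoc: "\<lbrakk>f \<in> hom C a b; g \<in> hom C b c; h \<in> hom C c d\<rbrakk> \<Longrightarrow> (h \<cdot> g) \<cdot> f = h \<cdot> (g \<cdot> f)"

definition inverse_arrows :: "('o, 'm) cat \<Rightarrow> 'm \<Rightarrow> 'm \<Rightarrow> bool" where
  "inverse_arrows C f g \<longleftrightarrow>
     f \<in> Arr C \<and> g \<in> Arr C \<and> Dom C g = Cod C f \<and> Cod C g = Dom C f \<and>
     Comp C g f = Idn C (Dom C f) \<and> Comp C f g = Idn C (Cod C f)"

definition is_iso :: "('o, 'm) cat \<Rightarrow> 'm \<Rightarrow> bool" where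
  "is_iso C f \<longleftrightarrow> (\<exists>g. inverse_arrows C f g)"

text \<open>Functors and natural transformations are extensional, so that HOL equality of the records is
  equality of functors (of natural transformations).\<close>

record ('o, 'm, 'p, 'n) functr =
  fobj :: "'o \<Rightarrow> 'p"
  fmap :: "'m \<Rightarrow> 'n"

definition is_functor ::
  "('o, 'm) cat \<Rightarrow> ('p, 'n) cat \<Rightarrow> ('o, 'm, 'p, 'n) functr \<Rightarrow> bool" where
  "is_functor C D F \<longleftrightarrow>
     category C \<and> category D \<and>
     fobj F \<in> extensional (Obj C) \<and> fmap F \<in> extensional (Arr C) \<and>
     (\<forall>a\<in>Obj C. fobj F a \<in> Obj D) \<and>
     (\<forall>f\<in>Arr C. fmap F f \<in> hom D (fobj F (Dom C f)) (fobj F (Cod C f))) \<and>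
     (\<forall>a\<in>Obj C. fmap F (Idn C a) = Idn D (fobj F a)) \<and>
     (\<forall>a b c. \<forall>f\<in>hom C a b. \<forall>g\<in>hom C b c. fmap F (Comp C g f) = Comp D (fmap F g) (fmap F f))"

definition id_functor :: "('o, 'm) cat \<Rightarrow> ('o, 'm, 'o, 'm) functr" where
  "id_functor C = \<lparr>fobj = (\<lambda>a\<in>Obj C. a), fmap = (\<lambda>f\<in>Arr C. f)\<rparr>"

definition comp_functor ::
  "('o, 'm) cat \<Rightarrow> ('p, 'n, 'q, 'k) functr \<Rightarrow> ('o, 'm, 'p, 'n) functr \<Rightarrow> ('o, 'm, 'q, 'k) functr" where
  "comp_functor C G F = \<lparr>fobj = compose (Obj C) (fobj G) (fobj F), fmap = compose (Arr C) (fmap G) (fmap F)\<rparr>"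

definition nat_trans ::
  "('o, 'm) cat \<Rightarrow> ('p, 'n) cat \<Rightarrow> ('o, 'm, 'p, 'n) functr \<Rightarrow> ('o, 'm, 'p, 'n) functr \<Rightarrow> ('o \<Rightarrow> 'n) \<Rightarrow> bool" where
  "nat_trans C D F G \<eta> \<longleftrightarrow>
     is_functor C D F \<and> is_functor C D G \<and> \<eta> \<in> extensional (Obj C) \<and>
     (\<forall>a\<in>Obj C. \<eta> a \<in> hom D (fobj F a) (fobj G a)) \<and>
     (\<forall>f\<in>Arr C. Comp D (\<eta> (Cod C f)) (fmap F f) = Comp D (fmap G f) (\<eta> (Dom C f)))"

definition nat_iso ::
  "('o, 'm) cat \<Rightarrow> ('p, 'n) cat \<Rightarrow> ('o, 'm, 'p, 'n) functr \<Rightarrow> ('o, 'm, 'p, 'n) functr \<Rightarrow> ('o \<Rightarrow> 'n) \<Rightarrow> bool" where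
  "nat_iso C D F G \<eta> \<longleftrightarrow> nat_trans C D F G \<eta> \<and> (\<forall>a\<in>Obj C. is_iso D (\<eta> a))"

definition equivalence_of_categories ::
  "('o, 'm) cat \<Rightarrow> ('p, 'n) cat \<Rightarrow> ('o, 'm, 'p, 'n) functr \<Rightarrow> bool" where
  "equivalence_of_categories C D F \<longleftrightarrow>
     is_functor C D F \<and>
     (\<exists>G. is_functor D C G \<and>
        (\<exists>\<eta>. nat_iso C C (id_functor C) (comp_functor C G F) \<eta>) \<and>
        (\<exists>\<epsilon>. nat_iso D D (comp_functor D F G) (id_functor D) \<epsilon>))"

definition full_subcat :: "('o, 'm) cat \<Rightarrow> ('o \<Rightarrow> bool) \<Rightarrow> ('o, 'm) cat" where
  "full_subcat C P = C\<lparr>Obj := {a \<in> Obj C. P a}, Arr := {f \<in> Arr C. P (Dom C f) \<and> P (Cod C f)}\<rparr>"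

definition restrict_functor :: "('o, 'm) cat \<Rightarrow> ('o, 'm, 'p, 'n) functr \<Rightarrow> ('o, 'm, 'p, 'n) functr" where
  "restrict_functor C' F = \<lparr>fobj = restrict (fobj F) (Obj C'), fmap = restrict (fmap F) (Arr C')\<rparr>"

definition op_cat :: "('o, 'm) cat \<Rightarrow> ('o, 'm) cat" where
  "op_cat C = \<lparr>Obj = Obj C, Arr = Arr C, Dom = Cod C, Cod = Dom C, Comp = (\<lambda>g f. Comp C f g), Idn = Idn C\<rparr>"

definition prod_cat :: "('o, 'm) cat \<Rightarrow> ('p, 'n) cat \<Rightarrow> ('o \<times> 'p, 'm \<times> 'n) cat" where
  "prod_cat C D =
     \<lparr>Obj = Obj C \<times> Obj D, Arr = Arr C \<times> Arr D,
      Dom = map_prod (Dom C) (Dom D), Cod = map_prod (Cod C) (Cod D),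
      Comp = (\<lambda>(g, g') (f, f'). (Comp C g f, Comp D g' f')), Idn = map_prod (Idn C) (Idn D)\<rparr>"

definition power_cat :: "('o, 'm) cat \<Rightarrow> nat \<Rightarrow> ('o list, 'm list) cat" where
  "power_cat C n =
     \<lparr>Obj = {as. length as = n \<and> set as \<subseteq> Obj C}, Arr = {ps. length ps = n \<and> set ps \<subseteq> Arr C},
      Dom = map (Dom C), Cod = map (Cod C), Comp = map2 (Comp C), Idn = map (Idn C)\<rparr>"

text \<open>A family of possibly overlapping hom-sets gives a category whose arrows are the triples
  (source, element, target).\<close>

definition cat_of_homs ::
  "'o set \<Rightarrow> ('o \<Rightarrow> 'o \<Rightarrow> 'h set) \<Rightarrow> ('o \<Rightarrow> 'o \<Rightarrow> 'o \<Rightarrow> 'h \<Rightarrow> 'h \<Rightarrow> 'h) \<Rightarrow> ('o \<Rightarrow> 'h) \<Rightarrow> ('o, 'o \<times> 'h \<times> 'o) cat" where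
  "cat_of_homs Ob H cmp i =
     \<lparr>Obj = Ob, Arr = {(A, f, B). A \<in> Ob \<and> B \<in> Ob \<and> f \<in> H A B},
      Dom = (\<lambda>(A, f, B). A), Cod = (\<lambda>(A, f, B). B),
      Comp = (\<lambda>(B, g, C) (A, f, _). (A, cmp A B C g f, C)), Idn = (\<lambda>A. (A, i A, A))\<rparr>"

type_synonym 'm set_arr = "'m set \<times> ('m \<Rightarrow> 'm) \<times> 'm set"

definition set_cat :: "('m set, 'm set_arr) cat" where
  "set_cat = cat_of_homs UNIV (\<lambda>A B. A \<rightarrow>\<^sub>E B) (\<lambda>A B C g f. compose A g f) (\<lambda>A. \<lambda>x\<in>A. x)"

definition ap :: "'m set_arr \<Rightarrow> 'm \<Rightarrow> 'm" where
  "ap t = fst (snd t)"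


section \<open>Short skew multicategories\<close>

datatype tl = Tight | Loose

definition tl_comp :: "tl \<Rightarrow> nat \<Rightarrow> tl \<Rightarrow> tl" where
  "tl_comp x i y = (if (x = Tight \<and> y = Tight \<and> i = 1) \<or> (x = Tight \<and> i \<noteq> 1) then Tight else Loose)"

definition mm_kinds :: "(tl \<times> nat) set" where
  "mm_kinds = {(Tight, 1), (Tight, 2), (Tight, 3), (Tight, 4), (Loose, 0), (Loose, 1), (Loose, 2)}"

text \<open>The pairs ((x, n), (y, m)) for which a substitution of y-multimaps of arity m into x-multimaps
  of arity n is part of the structure (beyond the functorial actions).\<close>

definition sub_cases :: "((tl \<times> nat) \<times> (tl \<times> nat)) set" where
  "sub_cases = {((Tight, 2), (Tight, 2)), ((Tight, 3), (Tight, 2)), ((Tight, 2), (Tight, 3)),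
     ((Tight, 2), (Loose, 0)), ((Tight, 3), (Loose, 0)), ((Loose, 1), (Loose, 0)),
     ((Tight, 2), (Loose, 1)), ((Loose, 1), (Tight, 2))}"

definition mdom :: "('o, 'm) cat \<Rightarrow> nat \<Rightarrow> ('o list \<times> 'o, 'm list \<times> 'm) cat" where
  "mdom C n = prod_cat (op_cat (power_cat C n)) C"

definition mdom_functor ::
  "('o, 'm) cat \<Rightarrow> nat \<Rightarrow> ('o, 'm, 'p, 'n) functr \<Rightarrow> ('o list \<times> 'o, 'm list \<times> 'm, 'p list \<times> 'p, 'n list \<times> 'n) functr" where
  "mdom_functor C n F =
     \<lparr>fobj = (\<lambda>(as, b)\<in>Obj (mdom C n). (map (fobj F) as, fobj F b)),
      fmap = (\<lambda>(ps, q)\<in>Arr (mdom C n). (map (fmap F) ps, fmap F q))\<rparr>"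

text \<open>Input positions \<open>i\<close> are counted from 1. As hom-sets may overlap, substitution takes the
  sources and targets explicitly: \<open>msub M x bs c i y as g f\<close> is \<open>g \<circ>\<^sub>i f\<close> for an x-multimap
  \<open>g : bs \<rightarrow> c\<close> and a y-multimap \<open>f : as \<rightarrow> b\<^sub>i\<close>.\<close>

record ('o, 'm) ssm =
  mcat :: "('o, 'm) cat"
  mfun :: "tl \<times> nat \<Rightarrow> ('o list \<times> 'o, 'm list \<times> 'm, 'm set, 'm set_arr) functr"
  mj :: "nat \<Rightarrow> 'o list \<times> 'o \<Rightarrow> 'm set_arr"
  msub :: "tl \<Rightarrow> 'o list \<Rightarrow> 'o \<Rightarrow> nat \<Rightarrow> tl \<Rightarrow> 'o list \<Rightarrow> 'm \<Rightarrow> 'm \<Rightarrow> 'm"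

definition mm :: "('o, 'm) ssm \<Rightarrow> tl \<Rightarrow> 'o list \<Rightarrow> 'o \<Rightarrow> 'm set" where
  "mm M x as b = fobj (mfun M (x, length as)) (as, b)"

text \<open>\<open>post M x as q f\<close> is \<open>q \<circ> f\<close> and \<open>pre M x bs c i p g\<close> is \<open>g \<circ>\<^sub>i p\<close>, for tight unary \<open>p\<close>, \<open>q\<close>.\<close>

definition post :: "('o, 'm) ssm \<Rightarrow> tl \<Rightarrow> 'o list \<Rightarrow> 'm \<Rightarrow> 'm \<Rightarrow> 'm" where
  "post M x as q f = ap (fmap (mfun M (x, length as)) (map (Idn (mcat M)) as, q)) f"

definition pre :: "('o, 'm) ssm \<Rightarrow> tl \<Rightarrow> 'o list \<Rightarrow> 'o \<Rightarrow> nat \<Rightarrow> 'm \<Rightarrow> 'm \<Rightarrow> 'm" where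
  "pre M x bs c i p g =
     ap (fmap (mfun M (x, length bs)) ((map (Idn (mcat M)) bs)[i - 1 := p], Idn (mcat M) c)) g"

definition jm :: "('o, 'm) ssm \<Rightarrow> 'o list \<Rightarrow> 'o \<Rightarrow> 'm \<Rightarrow> 'm" where
  "jm M as b f = ap (mj M (length as) (as, b)) f"

definition plug :: "'o list \<Rightarrow> nat \<Rightarrow> 'o list \<Rightarrow> 'o list" where
  "plug bs i as = take (i - 1) bs @ as @ drop i bs"

text \<open>The operation \<open>\<circ>\<^sub>i\<close>, covering both the substitutions and the actions of tight unary maps. For two
  tight unary maps the first two branches agree, both being composition in the category.\<close>

definition circ ::
  "('o, 'm) ssm \<Rightarrow> tl \<Rightarrow> 'o list \<Rightarrow> 'o \<Rightarrow> nat \<Rightarrow> tl \<Rightarrow> 'o list \<Rightarrow> 'm \<Rightarrow> 'm \<Rightarrow> 'm" where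
  "circ M x bs c i y as g f =
     (if y = Tight \<and> length as = 1 then pre M x bs c i f g
      else if x = Tight \<and> length bs = 1 then post M y as g f
      else msub M x bs c i y as g f)"

locale short_skew_multicategory =
  fixes M :: "('o, 'm) ssm"
  assumes category: "category (mcat M)"
    and functorial: "(z, n) \<in> mm_kinds \<Longrightarrow> is_functor (mdom (mcat M) n) set_cat (mfun M (z, n))"
    and tight_unary: "\<lbrakk>a \<in> Obj (mcat M); b \<in> Obj (mcat M)\<rbrakk> \<Longrightarrow> mm M Tight [a] b = hom (mcat M) a b"
    and tight_unary_action:
      "\<lbrakk>p \<in> hom (mcat M) a' a; f \<in> hom (mcat M) a b; q \<in> hom (mcat M) b b'\<rbrakk> \<Longrightarrow>
       ap (fmap (mfun M (Tight, 1)) ([p], q)) f = Comp (mcat M) q (Comp (mcat M) f p)"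
    and j_nat: "n \<in> {1, 2} \<Longrightarrow> nat_trans (mdom (mcat M) n) set_cat (mfun M (Tight, n)) (mfun M (Loose, n)) (mj M n)"
    and sub_type:
      "\<lbrakk>((x, length bs), (y, length as)) \<in> sub_cases;
        set bs \<subseteq> Obj (mcat M); c \<in> Obj (mcat M); set as \<subseteq> Obj (mcat M); 1 \<le> i; i \<le> length bs;
        g \<in> mm M x bs c; f \<in> mm M y as (bs ! (i - 1))\<rbrakk> \<Longrightarrow>
       msub M x bs c i y as g f \<in> mm M (tl_comp x i y) (plug bs i as) c"
    and sub_nat_target:
      "\<lbrakk>((x, length bs), (y, length as)) \<in> sub_cases;
        set bs \<subseteq> Obj (mcat M); c \<in> Obj (mcat M); set as \<subseteq> Obj (mcat M); 1 \<le> i; i \<le> length bs;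
        g \<in> mm M x bs c; f \<in> mm M y as (bs ! (i - 1)); q \<in> hom (mcat M) c c'\<rbrakk> \<Longrightarrow>
       msub M x bs c' i y as (post M x bs q g) f =
       post M (tl_comp x i y) (plug bs i as) q (msub M x bs c i y as g f)"
    and sub_nat_inner:
      "\<lbrakk>((x, length bs), (y, length as)) \<in> sub_cases;
        set bs \<subseteq> Obj (mcat M); c \<in> Obj (mcat M); set as \<subseteq> Obj (mcat M); 1 \<le> i; i \<le> length bs;
        g \<in> mm M x bs c; f \<in> mm M y as (bs ! (i - 1));
        1 \<le> k; k \<le> length as; p \<in> hom (mcat M) a' (as ! (k - 1))\<rbrakk> \<Longrightarrow>
       msub M x bs c i y (as[k - 1 := a']) g (pre M y as (bs ! (i - 1)) k p f) =
       pre M (tl_comp x i y) (plug bs i as) c (i + k - 1) p (msub M x bs c i y as g f)"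
    and sub_nat_outer:
      "\<lbrakk>((x, length bs), (y, length as)) \<in> sub_cases;
        set bs \<subseteq> Obj (mcat M); c \<in> Obj (mcat M); set as \<subseteq> Obj (mcat M); 1 \<le> i; i \<le> length bs;
        g \<in> mm M x bs c; f \<in> mm M y as (bs ! (i - 1));
        1 \<le> k; k \<le> length bs; k \<noteq> i; p \<in> hom (mcat M) b' (bs ! (k - 1))\<rbrakk> \<Longrightarrow>
       msub M x (bs[k - 1 := b']) c i y as (pre M x bs c k p g) f =
       pre M (tl_comp x i y) (plug bs i as) c (if k < i then k else k + length as - 1) p
         (msub M x bs c i y as g f)"
    and sub_dinat:
      "\<lbrakk>((x, length bs), (y, length as)) \<in> sub_cases;
        set bs \<subseteq> Obj (mcat M); c \<in> Obj (mcat M); set as \<subseteq> Obj (mcat M); 1 \<le> i; i \<le> length bs;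
        g \<in> mm M x bs c; p \<in> hom (mcat M) b' (bs ! (i - 1)); f \<in> mm M y as b'\<rbrakk> \<Longrightarrow>
       msub M x (bs[i - 1 := b']) c i y as (pre M x bs c i p g) f =
       msub M x bs c i y as g (post M y as p f)"
    and assoc_nested:
      "\<lbrakk>(z, length ds) \<in> {(Tight, 2), (Loose, 0)}; length bs = 2; length as = 2;
        set bs \<subseteq> Obj (mcat M); c \<in> Obj (mcat M); set as \<subseteq> Obj (mcat M); set ds \<subseteq> Obj (mcat M);
        1 \<le> i; i \<le> 2; 1 \<le> j; j \<le> 2;
        f \<in> mm M Tight bs c; g \<in> mm M Tight as (bs ! (i - 1)); h \<in> mm M z ds (as ! (j - 1))\<rbrakk> \<Longrightarrow>
       circ M Tight bs c i (tl_comp Tight j z) (plug as j ds) f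
         (circ M Tight as (bs ! (i - 1)) j z ds g h) =
       circ M (tl_comp Tight i Tight) (plug bs i as) c (j + i - 1) z ds
         (circ M Tight bs c i Tight as f g) h"
    and assoc_parallel:
      "\<lbrakk>(y, length as) \<in> {(Tight, 2), (Loose, 0)}; (z, length ds) \<in> {(Tight, 2), (Loose, 0)};
        b1 \<in> Obj (mcat M); b2 \<in> Obj (mcat M); c \<in> Obj (mcat M); set as \<subseteq> Obj (mcat M); set ds \<subseteq> Obj (mcat M);
        f \<in> mm M Tight [b1, b2] c; g \<in> mm M y as b1; h \<in> mm M z ds b2\<rbrakk> \<Longrightarrow>
       circ M (tl_comp Tight 1 y) (as @ [b2]) c (length as + 1) z ds
         (circ M Tight [b1, b2] c 1 y as f g) h =
       circ M (tl_comp Tight 2 z) (b1 # ds) c 1 y as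
         (circ M Tight [b1, b2] c 2 z ds f h) g"
    and j_second:
      "\<lbrakk>a \<in> Obj (mcat M); b1 \<in> Obj (mcat M); b2 \<in> Obj (mcat M); c \<in> Obj (mcat M);
        g \<in> mm M Tight [b1, b2] c; p \<in> hom (mcat M) a b2\<rbrakk> \<Longrightarrow>
       circ M Tight [b1, b2] c 2 Loose [a] g (jm M [a] b2 p) = circ M Tight [b1, b2] c 2 Tight [a] g p"
    and j_first:
      "\<lbrakk>a \<in> Obj (mcat M); b1 \<in> Obj (mcat M); b2 \<in> Obj (mcat M); c \<in> Obj (mcat M);
        g \<in> mm M Tight [b1, b2] c; p \<in> hom (mcat M) a b1\<rbrakk> \<Longrightarrow>
       circ M Tight [b1, b2] c 1 Loose [a] g (jm M [a] b1 p) =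
       jm M [a, b2] c (circ M Tight [b1, b2] c 1 Tight [a] g p)"
    and j_post:
      "\<lbrakk>p \<in> hom (mcat M) a b; q \<in> hom (mcat M) b c\<rbrakk> \<Longrightarrow>
       circ M Tight [b] c 1 Loose [a] q (jm M [a] b p) = jm M [a] c (circ M Tight [b] c 1 Tight [a] q p)"
    and j_binary:
      "\<lbrakk>a1 \<in> Obj (mcat M); a2 \<in> Obj (mcat M); g \<in> mm M Tight [a1, a2] b; p \<in> hom (mcat M) b c\<rbrakk> \<Longrightarrow>
       circ M Loose [b] c 1 Tight [a1, a2] (jm M [b] c p) g =
       jm M [a1, a2] c (circ M Tight [b] c 1 Tight [a1, a2] p g)"
    and j_nullary:
      "\<lbrakk>v \<in> mm M Loose [] b; p \<in> hom (mcat M) b c\<rbrakk> \<Longrightarrow>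
       circ M Loose [b] c 1 Loose [] (jm M [b] c p) v = circ M Tight [b] c 1 Loose [] p v"

record ('o, 'm) ssm_mor =
  mm_fun :: "('o, 'm, 'o, 'm) functr"
  mm_maps :: "tl \<times> nat \<Rightarrow> 'o list \<times> 'o \<Rightarrow> 'm set_arr"

definition mmap :: "('o, 'm) ssm_mor \<Rightarrow> tl \<Rightarrow> 'o list \<Rightarrow> 'o \<Rightarrow> 'm \<Rightarrow> 'm" where
  "mmap F x as b f = ap (mm_maps F (x, length as) (as, b)) f"

definition ssm_morphism :: "('o, 'm) ssm \<Rightarrow> ('o, 'm) ssm \<Rightarrow> ('o, 'm) ssm_mor \<Rightarrow> bool" where
  "ssm_morphism M N F \<longleftrightarrow>
     is_functor (mcat M) (mcat N) (mm_fun F) \<and>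
     mm_maps F \<in> extensional mm_kinds \<and>
     (\<forall>k\<in>mm_kinds. nat_trans (mdom (mcat M) (snd k)) set_cat (mfun M k)
        (comp_functor (mdom (mcat M) (snd k)) (mfun N k) (mdom_functor (mcat M) (snd k) (mm_fun F)))
        (mm_maps F k)) \<and>
     (\<forall>a\<in>Obj (mcat M). \<forall>b\<in>Obj (mcat M). \<forall>f\<in>hom (mcat M) a b. mmap F Tight [a] b f = fmap (mm_fun F) f) \<and>
     (\<forall>x bs c i y as g f.
        ((x, length bs), (y, length as)) \<in> sub_cases \<and>
        set bs \<subseteq> Obj (mcat M) \<and> c \<in> Obj (mcat M) \<and> set as \<subseteq> Obj (mcat M) \<and> 1 \<le> i \<and> i \<le> length bs \<and>
        g \<in> mm M x bs c \<and> f \<in> mm M y as (bs ! (i - 1)) \<longrightarrow>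
        mmap F (tl_comp x i y) (plug bs i as) c (msub M x bs c i y as g f) =
        msub N x (map (fobj (mm_fun F)) bs) (fobj (mm_fun F) c) i y (map (fobj (mm_fun F)) as)
          (mmap F x bs c g) (mmap F y as (bs ! (i - 1)) f)) \<and>
     (\<forall>as b f. length as \<in> {1, 2} \<and> set as \<subseteq> Obj (mcat M) \<and> b \<in> Obj (mcat M) \<and> f \<in> mm M Tight as b \<longrightarrow>
        mmap F Loose as b (jm M as b f) =
        jm N (map (fobj (mm_fun F)) as) (fobj (mm_fun F) b) (mmap F Tight as b f))"

definition ssm_id :: "('o, 'm) ssm \<Rightarrow> ('o, 'm) ssm_mor" where
  "ssm_id M = \<lparr>mm_fun = id_functor (mcat M),
     mm_maps = (\<lambda>k\<in>mm_kinds. \<lambda>t\<in>Obj (mdom (mcat M) (snd k)). Idn set_cat (fobj (mfun M k) t))\<rparr>"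

definition ssm_comp :: "('o, 'm) ssm \<Rightarrow> ('o, 'm) ssm_mor \<Rightarrow> ('o, 'm) ssm_mor \<Rightarrow> ('o, 'm) ssm_mor" where
  "ssm_comp M G F = \<lparr>mm_fun = comp_functor (mcat M) (mm_fun G) (mm_fun F),
     mm_maps = (\<lambda>k\<in>mm_kinds. \<lambda>t\<in>Obj (mdom (mcat M) (snd k)).
       Comp set_cat (mm_maps G k (fobj (mdom_functor (mcat M) (snd k) (mm_fun F)) t)) (mm_maps F k t))\<rparr>"


section \<open>Left representability\<close>

record ('o, 'm) lr_data =
  lr_tensor :: "'o \<Rightarrow> 'o \<Rightarrow> 'o"
  lr_theta :: "'o \<Rightarrow> 'o \<Rightarrow> 'm"
  lr_unit :: "'o"
  lr_u :: "'m"

definition is_lr_data :: "('o, 'm) ssm \<Rightarrow> ('o, 'm) lr_data \<Rightarrow> bool" where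
  "is_lr_data M D \<longleftrightarrow>
     (\<forall>a\<in>Obj (mcat M). \<forall>b\<in>Obj (mcat M).
        lr_tensor D a b \<in> Obj (mcat M) \<and> lr_theta D a b \<in> mm M Tight [a, b] (lr_tensor D a b) \<and>
        (\<forall>xs d. length xs \<le> 2 \<and> set xs \<subseteq> Obj (mcat M) \<and> d \<in> Obj (mcat M) \<longrightarrow>
           bij_betw (\<lambda>f. circ M Tight (lr_tensor D a b # xs) d 1 Tight [a, b] f (lr_theta D a b))
             (mm M Tight (lr_tensor D a b # xs) d) (mm M Tight (a # b # xs) d))) \<and>
     lr_unit D \<in> Obj (mcat M) \<and> lr_u D \<in> mm M Loose [] (lr_unit D) \<and>
     (\<forall>xs d. length xs \<le> 2 \<and> set xs \<subseteq> Obj (mcat M) \<and> d \<in> Obj (mcat M) \<longrightarrow>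
        bij_betw (\<lambda>f. circ M Tight (lr_unit D # xs) d 1 Loose [] f (lr_u D))
          (mm M Tight (lr_unit D # xs) d) (mm M Loose xs d))"

definition left_representable :: "('o, 'm) ssm \<Rightarrow> bool" where
  "left_representable M \<longleftrightarrow> (\<exists>D. is_lr_data M D)"


section \<open>Short braidings\<close>

record ('o, 'm) sbraid =
  beta32 :: "'o list \<times> 'o \<Rightarrow> 'm set_arr"
  beta42 :: "'o list \<times> 'o \<Rightarrow> 'm set_arr"
  beta43 :: "'o list \<times> 'o \<Rightarrow> 'm set_arr"

text \<open>Exchange of the positions \<open>k\<close> and \<open>k + 1\<close>, counted from 1.\<close>

definition swap_at :: "nat \<Rightarrow> 'a list \<Rightarrow> 'a list" where
  "swap_at k xs = xs[k - 1 := xs ! k, k := xs ! (k - 1)]"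

definition swap_functor :: "('o, 'm) cat \<Rightarrow> nat \<Rightarrow> nat \<Rightarrow>
    ('o list \<times> 'o, 'm list \<times> 'm, 'o list \<times> 'o, 'm list \<times> 'm) functr" where
  "swap_functor C n k =
     \<lparr>fobj = (\<lambda>(as, b)\<in>Obj (mdom C n). (swap_at k as, b)),
      fmap = (\<lambda>(ps, q)\<in>Arr (mdom C n). (swap_at k ps, q))\<rparr>"

definition is_exchange :: "('o, 'm) ssm \<Rightarrow> nat \<Rightarrow> nat \<Rightarrow> ('o list \<times> 'o \<Rightarrow> 'm set_arr) \<Rightarrow> bool" where
  "is_exchange M n k \<beta> \<longleftrightarrow>
     nat_iso (mdom (mcat M) n) set_cat (mfun M (Tight, n))
       (comp_functor (mdom (mcat M) n) (mfun M (Tight, n)) (swap_functor (mcat M) n k)) \<beta>"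

definition b32 :: "('o, 'm) sbraid \<Rightarrow> 'o list \<Rightarrow> 'o \<Rightarrow> 'm \<Rightarrow> 'm" where
  "b32 B as b = ap (beta32 B (as, b))"

definition b42 :: "('o, 'm) sbraid \<Rightarrow> 'o list \<Rightarrow> 'o \<Rightarrow> 'm \<Rightarrow> 'm" where
  "b42 B as b = ap (beta42 B (as, b))"

definition b43 :: "('o, 'm) sbraid \<Rightarrow> 'o list \<Rightarrow> 'o \<Rightarrow> 'm \<Rightarrow> 'm" where
  "b43 B as b = ap (beta43 B (as, b))"

locale short_braiding = short_skew_multicategory M
  for M :: "('o, 'm) ssm" and B :: "('o, 'm) sbraid" +
  assumes beta32: "is_exchange M 3 2 (beta32 B)"
    and beta42: "is_exchange M 4 2 (beta42 B)"
    and beta43: "is_exchange M 4 3 (beta43 B)"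
    and yang_baxter:
      "\<lbrakk>set [a1, a2, a3, a4, c] \<subseteq> Obj (mcat M); h \<in> mm M Tight [a1, a2, a3, a4] c\<rbrakk> \<Longrightarrow>
       b42 B [a1, a3, a4, a2] c (b43 B [a1, a3, a2, a4] c (b42 B [a1, a2, a3, a4] c h)) =
       b43 B [a1, a4, a2, a3] c (b42 B [a1, a2, a4, a3] c (b43 B [a1, a2, a3, a4] c h))"
    and binary_ternary_1:
      "\<lbrakk>set [a1, a2, a3, b1, b2, c] \<subseteq> Obj (mcat M); g \<in> mm M Tight [b1, b2] c; f \<in> mm M Tight [a1, a2, a3] b1\<rbrakk> \<Longrightarrow>
       circ M Tight [b1, b2] c 1 Tight [a1, a3, a2] g (b32 B [a1, a2, a3] b1 f) =
       b42 B [a1, a2, a3, b2] c (circ M Tight [b1, b2] c 1 Tight [a1, a2, a3] g f)"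
    and binary_ternary_2:
      "\<lbrakk>set [a1, a2, a3, b1, b2, c] \<subseteq> Obj (mcat M); g \<in> mm M Tight [b1, b2] c; f \<in> mm M Tight [a1, a2, a3] b2\<rbrakk> \<Longrightarrow>
       circ M Tight [b1, b2] c 2 Tight [a1, a3, a2] g (b32 B [a1, a2, a3] b2 f) =
       b43 B [b1, a1, a2, a3] c (circ M Tight [b1, b2] c 2 Tight [a1, a2, a3] g f)"
    and ternary_binary_1:
      "\<lbrakk>set [a1, a2, b1, b2, b3, c] \<subseteq> Obj (mcat M); g \<in> mm M Tight [b1, b2, b3] c; f \<in> mm M Tight [a1, a2] b1\<rbrakk> \<Longrightarrow>
       b43 B [a1, a2, b2, b3] c (circ M Tight [b1, b2, b3] c 1 Tight [a1, a2] g f) =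
       circ M Tight [b1, b3, b2] c 1 Tight [a1, a2] (b32 B [b1, b2, b3] c g) f"
    and ternary_binary_2:
      "\<lbrakk>set [a1, a2, b1, b2, b3, c] \<subseteq> Obj (mcat M); g \<in> mm M Tight [b1, b2, b3] c; f \<in> mm M Tight [a1, a2] b2\<rbrakk> \<Longrightarrow>
       b42 B [b1, a1, b3, a2] c (b43 B [b1, a1, a2, b3] c (circ M Tight [b1, b2, b3] c 2 Tight [a1, a2] g f)) =
       circ M Tight [b1, b3, b2] c 3 Tight [a1, a2] (b32 B [b1, b2, b3] c g) f"
    and ternary_binary_3:
      "\<lbrakk>set [a1, a2, b1, b2, b3, c] \<subseteq> Obj (mcat M); g \<in> mm M Tight [b1, b2, b3] c; f \<in> mm M Tight [a1, a2] b3\<rbrakk> \<Longrightarrow>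
       b43 B [b1, a1, b2, a2] c (b42 B [b1, b2, a1, a2] c (circ M Tight [b1, b2, b3] c 3 Tight [a1, a2] g f)) =
       circ M Tight [b1, b3, b2] c 2 Tight [a1, a2] (b32 B [b1, b2, b3] c g) f"

definition short_symmetry :: "('o, 'm) ssm \<Rightarrow> ('o, 'm) sbraid \<Rightarrow> bool" where
  "short_symmetry M B \<longleftrightarrow> short_braiding M B \<and>
     (\<forall>a1 a2 a3 c f. set [a1, a2, a3, c] \<subseteq> Obj (mcat M) \<and> f \<in> mm M Tight [a1, a2, a3] c \<longrightarrow>
        b32 B [a1, a3, a2] c (b32 B [a1, a2, a3] c f) = f)"

definition braided_morphism ::
  "('o, 'm) ssm \<times> ('o, 'm) sbraid \<Rightarrow> ('o, 'm) ssm \<times> ('o, 'm) sbraid \<Rightarrow> ('o, 'm) ssm_mor \<Rightarrow> bool" where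
  "braided_morphism = (\<lambda>(M, B) (N, B') F.
     ssm_morphism M N F \<and>
     (\<forall>a1 a2 a3 c f. set [a1, a2, a3, c] \<subseteq> Obj (mcat M) \<and> f \<in> mm M Tight [a1, a2, a3] c \<longrightarrow>
        mmap F Tight [a1, a3, a2] c (b32 B [a1, a2, a3] c f) =
        b32 B' (map (fobj (mm_fun F)) [a1, a2, a3]) (fobj (mm_fun F) c) (mmap F Tight [a1, a2, a3] c f)) \<and>
     (\<forall>a1 a2 a3 a4 c f. set [a1, a2, a3, a4, c] \<subseteq> Obj (mcat M) \<and> f \<in> mm M Tight [a1, a2, a3, a4] c \<longrightarrow>
        mmap F Tight [a1, a3, a2, a4] c (b42 B [a1, a2, a3, a4] c f) =
        b42 B' (map (fobj (mm_fun F)) [a1, a2, a3, a4]) (fobj (mm_fun F) c) (mmap F Tight [a1, a2, a3, a4] c f) \<and>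
        mmap F Tight [a1, a2, a4, a3] c (b43 B [a1, a2, a3, a4] c f) =
        b43 B' (map (fobj (mm_fun F)) [a1, a2, a3, a4]) (fobj (mm_fun F) c) (mmap F Tight [a1, a2, a3, a4] c f)))"

definition BrdShSkMulti_lr ::
  "(('o, 'm) ssm \<times> ('o, 'm) sbraid,
    (('o, 'm) ssm \<times> ('o, 'm) sbraid) \<times> ('o, 'm) ssm_mor \<times> (('o, 'm) ssm \<times> ('o, 'm) sbraid)) cat" where
  "BrdShSkMulti_lr =
     cat_of_homs {(M, B). short_braiding M B \<and> left_representable M}
       (\<lambda>X Y. {F. braided_morphism X Y F})
       (\<lambda>X Y Z G F. ssm_comp (fst X) G F) (\<lambda>X. ssm_id (fst X))"

definition SymShSkMulti_lr ::
  "(('o, 'm) ssm \<times> ('o, 'm) sbraid,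
    (('o, 'm) ssm \<times> ('o, 'm) sbraid) \<times> ('o, 'm) ssm_mor \<times> (('o, 'm) ssm \<times> ('o, 'm) sbraid)) cat" where
  "SymShSkMulti_lr = full_subcat BrdShSkMulti_lr (\<lambda>(M, B). short_symmetry M B)"


section \<open>Skew monoidal categories\<close>

record ('o, 'm) smc =
  scat :: "('o, 'm) cat"
  stens :: "('o \<times> 'o, 'm \<times> 'm, 'o, 'm) functr"
  sunit :: "'o"  ("\<I>\<index>")
  alpha :: "'o \<Rightarrow> 'o \<Rightarrow> 'o \<Rightarrow> 'm"
  lambda :: "'o \<Rightarrow> 'm"
  rho :: "'o \<Rightarrow> 'm"

definition sobj :: "('o, 'm) smc \<Rightarrow> 'o set" where
  "sobj S = Obj (scat S)"

definition shom :: "('o, 'm) smc \<Rightarrow> 'o \<Rightarrow> 'o \<Rightarrow> 'm set" where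
  "shom S = hom (scat S)"

definition scomp :: "('o, 'm) smc \<Rightarrow> 'm \<Rightarrow> 'm \<Rightarrow> 'm"  (infixr "\<bullet>\<index>" 55) where
  "scomp S = Comp (scat S)"

definition sid :: "('o, 'm) smc \<Rightarrow> 'o \<Rightarrow> 'm"  ("\<one>\<index>") where
  "sid S = Idn (scat S)"

definition tens_obj :: "('o, 'm) smc \<Rightarrow> 'o \<Rightarrow> 'o \<Rightarrow> 'o"  (infixl "\<odot>\<index>" 70) where
  "tens_obj S a b = fobj (stens S) (a, b)"

definition tens_arr :: "('o, 'm) smc \<Rightarrow> 'm \<Rightarrow> 'm \<Rightarrow> 'm"  (infixl "\<otimes>\<index>" 70) where
  "tens_arr S f g = fmap (stens S) (f, g)"

locale skew_monoidal_category =
  fixes S :: "('o, 'm) smc" (structure)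
  assumes category: "category (scat S)"
    and tensor: "is_functor (prod_cat (scat S) (scat S)) (scat S) (stens S)"
    and unit: "\<I> \<in> sobj S"
    and alpha: "\<lbrakk>a \<in> sobj S; b \<in> sobj S; c \<in> sobj S\<rbrakk> \<Longrightarrow> alpha S a b c \<in> shom S ((a \<odot> b) \<odot> c) (a \<odot> (b \<odot> c))"
    and alpha_nat:
      "\<lbrakk>f \<in> shom S a a'; g \<in> shom S b b'; h \<in> shom S c c'\<rbrakk> \<Longrightarrow>
       alpha S a' b' c' \<bullet> ((f \<otimes> g) \<otimes> h) = (f \<otimes> (g \<otimes> h)) \<bullet> alpha S a b c"
    and lambda: "a \<in> sobj S \<Longrightarrow> lambda S a \<in> shom S (\<I> \<odot> a) a"
    and lambda_nat: "f \<in> shom S a a' \<Longrightarrow> lambda S a' \<bullet> (\<one> \<I> \<otimes> f) = f \<bullet> lambda S a"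
    and rho: "a \<in> sobj S \<Longrightarrow> rho S a \<in> shom S a (a \<odot> \<I>)"
    and rho_nat: "f \<in> shom S a a' \<Longrightarrow> rho S a' \<bullet> f = (f \<otimes> \<one> \<I>) \<bullet> rho S a"
    and pentagon:
      "\<lbrakk>a \<in> sobj S; b \<in> sobj S; c \<in> sobj S; d \<in> sobj S\<rbrakk> \<Longrightarrow>
       alpha S a b (c \<odot> d) \<bullet> alpha S (a \<odot> b) c d =
       (\<one> a \<otimes> alpha S b c d) \<bullet> alpha S a (b \<odot> c) d \<bullet> (alpha S a b c \<otimes> \<one> d)"
    and lambda_alpha:
      "\<lbrakk>a \<in> sobj S; b \<in> sobj S\<rbrakk> \<Longrightarrow> lambda S (a \<odot> b) \<bullet> alpha S \<I> a b = lambda S a \<otimes> \<one> b"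
    and alpha_rho:
      "\<lbrakk>a \<in> sobj S; b \<in> sobj S\<rbrakk> \<Longrightarrow> alpha S a b \<I> \<bullet> rho S (a \<odot> b) = \<one> a \<otimes> rho S b"
    and lambda_alpha_rho:
      "\<lbrakk>a \<in> sobj S; b \<in> sobj S\<rbrakk> \<Longrightarrow>
       (\<one> a \<otimes> lambda S b) \<bullet> alpha S a \<I> b \<bullet> (rho S a \<otimes> \<one> b) = \<one> (a \<odot> b)"
    and lambda_rho: "lambda S \<I> \<bullet> rho S \<I> = \<one> \<I>"

record ('o, 'm) lax_mor =
  lax_fun :: "('o, 'm, 'o, 'm) functr"
  lax0 :: "'m"
  lax2 :: "'o \<times> 'o \<Rightarrow> 'm"

locale lax_monoidal_functor =
  source: skew_monoidal_category S + target: skew_monoidal_category T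
  for S :: "('o, 'm) smc" (structure) and T :: "('o, 'm) smc" (structure)
    and L :: "('o, 'm) lax_mor" +
  fixes F F2
  defines "F \<equiv> lax_fun L" and "F2 \<equiv> \<lambda>a b. lax2 L (a, b)"
  assumes functorial: "is_functor (scat S) (scat T) F"
    and lax0: "lax0 L \<in> shom T \<I>\<^bsub>T\<^esub> (fobj F \<I>\<^bsub>S\<^esub>)"
    and lax2_ext: "lax2 L \<in> extensional (sobj S \<times> sobj S)"
    and lax2: "\<lbrakk>a \<in> sobj S; b \<in> sobj S\<rbrakk> \<Longrightarrow> F2 a b \<in> shom T (fobj F a \<odot>\<^bsub>T\<^esub> fobj F b) (fobj F (a \<odot>\<^bsub>S\<^esub> b))"
    and lax2_nat:
      "\<lbrakk>f \<in> shom S a a'; g \<in> shom S b b'\<rbrakk> \<Longrightarrow>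
       F2 a' b' \<bullet>\<^bsub>T\<^esub> (fmap F f \<otimes>\<^bsub>T\<^esub> fmap F g) = fmap F (f \<otimes>\<^bsub>S\<^esub> g) \<bullet>\<^bsub>T\<^esub> F2 a b"
    and lax_alpha:
      "\<lbrakk>a \<in> sobj S; b \<in> sobj S; c \<in> sobj S\<rbrakk> \<Longrightarrow>
       fmap F (alpha S a b c) \<bullet>\<^bsub>T\<^esub> F2 (a \<odot>\<^bsub>S\<^esub> b) c \<bullet>\<^bsub>T\<^esub> (F2 a b \<otimes>\<^bsub>T\<^esub> \<one>\<^bsub>T\<^esub> (fobj F c)) =
       F2 a (b \<odot>\<^bsub>S\<^esub> c) \<bullet>\<^bsub>T\<^esub> (\<one>\<^bsub>T\<^esub> (fobj F a) \<otimes>\<^bsub>T\<^esub> F2 b c) \<bullet>\<^bsub>T\<^esub> alpha T (fobj F a) (fobj F b) (fobj F c)"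
    and lax_lambda:
      "a \<in> sobj S \<Longrightarrow>
       fmap F (lambda S a) \<bullet>\<^bsub>T\<^esub> F2 \<I>\<^bsub>S\<^esub> a \<bullet>\<^bsub>T\<^esub> (lax0 L \<otimes>\<^bsub>T\<^esub> \<one>\<^bsub>T\<^esub> (fobj F a)) = lambda T (fobj F a)"
    and lax_rho:
      "a \<in> sobj S \<Longrightarrow>
       F2 a \<I>\<^bsub>S\<^esub> \<bullet>\<^bsub>T\<^esub> (\<one>\<^bsub>T\<^esub> (fobj F a) \<otimes>\<^bsub>T\<^esub> lax0 L) \<bullet>\<^bsub>T\<^esub> rho T (fobj F a) = fmap F (rho S a)"

definition lax_id :: "('o, 'm) smc \<Rightarrow> ('o, 'm) lax_mor" where
  "lax_id S = \<lparr>lax_fun = id_functor (scat S), lax0 = \<one>\<^bsub>S\<^esub> \<I>\<^bsub>S\<^esub>,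
     lax2 = (\<lambda>(a, b)\<in>sobj S \<times> sobj S. \<one>\<^bsub>S\<^esub> (a \<odot>\<^bsub>S\<^esub> b))\<rparr>"

text \<open>Composite of lax monoidal functors \<open>F : S \<rightarrow> T\<close> and \<open>G : T \<rightarrow> U\<close>.\<close>

definition lax_comp ::
  "('o, 'm) smc \<Rightarrow> ('o, 'm) smc \<Rightarrow> ('o, 'm) smc \<Rightarrow> ('o, 'm) lax_mor \<Rightarrow> ('o, 'm) lax_mor \<Rightarrow> ('o, 'm) lax_mor" where
  "lax_comp S T U G F =
     \<lparr>lax_fun = comp_functor (scat S) (lax_fun G) (lax_fun F),
      lax0 = fmap (lax_fun G) (lax0 F) \<bullet>\<^bsub>U\<^esub> lax0 G,
      lax2 = (\<lambda>(a, b)\<in>sobj S \<times> sobj S.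
        fmap (lax_fun G) (lax2 F (a, b)) \<bullet>\<^bsub>U\<^esub> lax2 G (fobj (lax_fun F) a, fobj (lax_fun F) b))\<rparr>"

locale braiding = skew_monoidal_category S
  for S :: "('o, 'm) smc" (structure) and s :: "'o \<Rightarrow> 'o \<Rightarrow> 'o \<Rightarrow> 'm" +
  assumes braid: "\<lbrakk>x \<in> sobj S; a \<in> sobj S; b \<in> sobj S\<rbrakk> \<Longrightarrow> s x a b \<in> shom S ((x \<odot> a) \<odot> b) ((x \<odot> b) \<odot> a)"
    and braid_iso: "\<lbrakk>x \<in> sobj S; a \<in> sobj S; b \<in> sobj S\<rbrakk> \<Longrightarrow> is_iso (scat S) (s x a b)"
    and braid_nat:
      "\<lbrakk>f \<in> shom S x x'; g \<in> shom S a a'; h \<in> shom S b b'\<rbrakk> \<Longrightarrow>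
       s x' a' b' \<bullet> ((f \<otimes> g) \<otimes> h) = ((f \<otimes> h) \<otimes> g) \<bullet> s x a b"
    and braid_braid:
      "\<lbrakk>x \<in> sobj S; a \<in> sobj S; b \<in> sobj S; c \<in> sobj S\<rbrakk> \<Longrightarrow>
       s (x \<odot> c) a b \<bullet> (s x a c \<otimes> \<one> b) \<bullet> s (x \<odot> a) b c =
       (s x b c \<otimes> \<one> a) \<bullet> s (x \<odot> b) a c \<bullet> (s x a b \<otimes> \<one> c)"
    and braid_alpha_1:
      "\<lbrakk>x \<in> sobj S; a \<in> sobj S; b \<in> sobj S; c \<in> sobj S\<rbrakk> \<Longrightarrow>
       s x a (b \<odot> c) \<bullet> alpha S (x \<odot> a) b c =
       (alpha S x b c \<otimes> \<one> a) \<bullet> s (x \<odot> b) a c \<bullet> (s x a b \<otimes> \<one> c)"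
    and braid_alpha_2:
      "\<lbrakk>x \<in> sobj S; a \<in> sobj S; b \<in> sobj S; c \<in> sobj S\<rbrakk> \<Longrightarrow>
       s x (a \<odot> b) c \<bullet> (alpha S x a b \<otimes> \<one> c) =
       alpha S (x \<odot> c) a b \<bullet> (s x a c \<otimes> \<one> b) \<bullet> s (x \<odot> a) b c"
    and braid_alpha_3:
      "\<lbrakk>x \<in> sobj S; a \<in> sobj S; b \<in> sobj S; c \<in> sobj S\<rbrakk> \<Longrightarrow>
       (\<one> x \<otimes> s a b c) \<bullet> alpha S x (a \<odot> b) c \<bullet> (alpha S x a b \<otimes> \<one> c) =
       alpha S x (a \<odot> c) b \<bullet> (alpha S x a c \<otimes> \<one> b) \<bullet> s (x \<odot> a) b c"

definition symmetry :: "('o, 'm) smc \<Rightarrow> ('o \<Rightarrow> 'o \<Rightarrow> 'o \<Rightarrow> 'm) \<Rightarrow> bool" where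
  "symmetry S s \<longleftrightarrow> braiding S s \<and>
     (\<forall>x\<in>sobj S. \<forall>a\<in>sobj S. \<forall>b\<in>sobj S. inverse_arrows (scat S) (s x a b) (s x b a))"

definition braided_lax ::
  "('o, 'm) smc \<times> ('o \<Rightarrow> 'o \<Rightarrow> 'o \<Rightarrow> 'm) \<Rightarrow> ('o, 'm) smc \<times> ('o \<Rightarrow> 'o \<Rightarrow> 'o \<Rightarrow> 'm) \<Rightarrow> ('o, 'm) lax_mor \<Rightarrow> bool" where
  "braided_lax = (\<lambda>(S, s) (T, t) L.
     lax_monoidal_functor S T L \<and>
     (\<forall>x\<in>sobj S. \<forall>a\<in>sobj S. \<forall>b\<in>sobj S.
        let F = fobj (lax_fun L); F2 = (\<lambda>a b. lax2 L (a, b)) in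
        fmap (lax_fun L) (s x a b) \<bullet>\<^bsub>T\<^esub> F2 (x \<odot>\<^bsub>S\<^esub> a) b \<bullet>\<^bsub>T\<^esub> (F2 x a \<otimes>\<^bsub>T\<^esub> \<one>\<^bsub>T\<^esub> (F b)) =
        F2 (x \<odot>\<^bsub>S\<^esub> b) a \<bullet>\<^bsub>T\<^esub> (F2 x b \<otimes>\<^bsub>T\<^esub> \<one>\<^bsub>T\<^esub> (F a)) \<bullet>\<^bsub>T\<^esub> t (F x) (F a) (F b)))"

definition BrdSkMon ::
  "(('o, 'm) smc \<times> ('o \<Rightarrow> 'o \<Rightarrow> 'o \<Rightarrow> 'm),
    (('o, 'm) smc \<times> ('o \<Rightarrow> 'o \<Rightarrow> 'o \<Rightarrow> 'm)) \<times> ('o, 'm) lax_mor \<times> (('o, 'm) smc \<times> ('o \<Rightarrow> 'o \<Rightarrow> 'o \<Rightarrow> 'm))) cat" where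
  "BrdSkMon =
     cat_of_homs {(S, s). braiding S s} (\<lambda>X Y. {L. braided_lax X Y L})
       (\<lambda>X Y Z G F. lax_comp (fst X) (fst Y) (fst Z) G F) (\<lambda>X. lax_id (fst X))"

definition SymSkMon ::
  "(('o, 'm) smc \<times> ('o \<Rightarrow> 'o \<Rightarrow> 'o \<Rightarrow> 'm),
    (('o, 'm) smc \<times> ('o \<Rightarrow> 'o \<Rightarrow> 'o \<Rightarrow> 'm)) \<times> ('o, 'm) lax_mor \<times> (('o, 'm) smc \<times> ('o \<Rightarrow> 'o \<Rightarrow> 'o \<Rightarrow> 'm))) cat" where
  "SymSkMon = full_subcat BrdSkMon (\<lambda>(S, s). symmetry S s)"


section \<open>The functors\<close>

definition K_tens_arr :: "('o, 'm) lr_data \<Rightarrow> ('o, 'm) ssm \<Rightarrow> 'm \<Rightarrow> 'm \<Rightarrow> 'm" where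
  "K_tens_arr D M f g =
     (let a = Dom (mcat M) f; b = Cod (mcat M) f; c = Dom (mcat M) g; d = Cod (mcat M) g;
          ac = lr_tensor D a c; bd = lr_tensor D b d in
      THE h. h \<in> hom (mcat M) ac bd \<and>
        circ M Tight [ac] bd 1 Tight [a, c] h (lr_theta D a c) =
        circ M Tight [a, d] bd 2 Tight [c] (circ M Tight [b, d] bd 1 Tight [a] (lr_theta D b d) f) g)"

definition K_alpha :: "('o, 'm) lr_data \<Rightarrow> ('o, 'm) ssm \<Rightarrow> 'o \<Rightarrow> 'o \<Rightarrow> 'o \<Rightarrow> 'm" where
  "K_alpha D M a b c =
     (let ab = lr_tensor D a b; bc = lr_tensor D b c; ab_c = lr_tensor D ab c; a_bc = lr_tensor D a bc in
      THE h. h \<in> hom (mcat M) ab_c a_bc \<and>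
        circ M Tight [ab, c] a_bc 1 Tight [a, b]
          (circ M Tight [ab_c] a_bc 1 Tight [ab, c] h (lr_theta D ab c)) (lr_theta D a b) =
        circ M Tight [a, bc] a_bc 2 Tight [b, c] (lr_theta D a bc) (lr_theta D b c))"

definition K_lambda :: "('o, 'm) lr_data \<Rightarrow> ('o, 'm) ssm \<Rightarrow> 'o \<Rightarrow> 'm" where
  "K_lambda D M a =
     (let i = lr_unit D; ia = lr_tensor D i a in
      THE h. h \<in> hom (mcat M) ia a \<and>
        circ M Tight [i, a] a 1 Loose [] (circ M Tight [ia] a 1 Tight [i, a] h (lr_theta D i a)) (lr_u D) =
        jm M [a] a (Idn (mcat M) a))"

definition K_rho :: "('o, 'm) lr_data \<Rightarrow> ('o, 'm) ssm \<Rightarrow> 'o \<Rightarrow> 'm" where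
  "K_rho D M a =
     (let i = lr_unit D in circ M Tight [a, i] (lr_tensor D a i) 2 Loose [] (lr_theta D a i) (lr_u D))"

definition K_s_obj :: "('o, 'm) lr_data \<Rightarrow> ('o, 'm) ssm \<Rightarrow> ('o, 'm) smc" where
  "K_s_obj D M =
     \<lparr>scat = mcat M,
      stens = \<lparr>fobj = (\<lambda>(a, b)\<in>Obj (mcat M) \<times> Obj (mcat M). lr_tensor D a b),
               fmap = (\<lambda>(f, g)\<in>Arr (mcat M) \<times> Arr (mcat M). K_tens_arr D M f g)\<rparr>,
      sunit = lr_unit D,
      alpha = K_alpha D M, lambda = K_lambda D M, rho = K_rho D M\<rparr>"

definition K_braid :: "('o, 'm) lr_data \<Rightarrow> ('o, 'm) ssm \<Rightarrow> ('o, 'm) sbraid \<Rightarrow> 'o \<Rightarrow> 'o \<Rightarrow> 'o \<Rightarrow> 'm" where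
  "K_braid D M B x a b =
     (let xa = lr_tensor D x a; xb = lr_tensor D x b; xa_b = lr_tensor D xa b; xb_a = lr_tensor D xb a in
      THE h. h \<in> hom (mcat M) xa_b xb_a \<and>
        circ M Tight [xa_b] xb_a 1 Tight [x, a, b] h
          (circ M Tight [xa, b] xa_b 1 Tight [x, a] (lr_theta D xa b) (lr_theta D x a)) =
        b32 B [x, b, a] xb_a
          (circ M Tight [xb, a] xb_a 1 Tight [x, b] (lr_theta D xb a) (lr_theta D x b)))"

definition K_s_mor ::
  "('o, 'm) lr_data \<Rightarrow> ('o, 'm) lr_data \<Rightarrow> ('o, 'm) ssm \<Rightarrow> ('o, 'm) ssm \<Rightarrow> ('o, 'm) ssm_mor \<Rightarrow> ('o, 'm) lax_mor" where
  "K_s_mor D D' M N F =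
     (let Fo = fobj (mm_fun F) in
      \<lparr>lax_fun = mm_fun F,
       lax0 = (THE h. h \<in> hom (mcat N) (lr_unit D') (Fo (lr_unit D)) \<and>
         circ N Tight [lr_unit D'] (Fo (lr_unit D)) 1 Loose [] h (lr_u D') =
         mmap F Loose [] (lr_unit D) (lr_u D)),
       lax2 = (\<lambda>(a, b)\<in>Obj (mcat M) \<times> Obj (mcat M).
         THE h. h \<in> hom (mcat N) (lr_tensor D' (Fo a) (Fo b)) (Fo (lr_tensor D a b)) \<and>
           circ N Tight [lr_tensor D' (Fo a) (Fo b)] (Fo (lr_tensor D a b)) 1 Tight [Fo a, Fo b] h
             (lr_theta D' (Fo a) (Fo b)) =
           mmap F Tight [a, b] (lr_tensor D a b) (lr_theta D a b))\<rparr>)"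

text \<open>\<open>ch\<close> is the fixed choice of the tensor and unit multimaps of every left representable short
  skew multicategory.\<close>

definition K_brd_obj where
  "K_brd_obj ch = (\<lambda>(M, B). (K_s_obj (ch M) M, K_braid (ch M) M B))"

definition K_brd :: "(('o, 'm) ssm \<Rightarrow> ('o, 'm) lr_data) \<Rightarrow>
  (('o, 'm) ssm \<times> ('o, 'm) sbraid,
   (('o, 'm) ssm \<times> ('o, 'm) sbraid) \<times> ('o, 'm) ssm_mor \<times> (('o, 'm) ssm \<times> ('o, 'm) sbraid),
   ('o, 'm) smc \<times> ('o \<Rightarrow> 'o \<Rightarrow> 'o \<Rightarrow> 'm),
   (('o, 'm) smc \<times> ('o \<Rightarrow> 'o \<Rightarrow> 'o \<Rightarrow> 'm)) \<times> ('o, 'm) lax_mor \<times> (('o, 'm) smc \<times> ('o \<Rightarrow> 'o \<Rightarrow> 'o \<Rightarrow> 'm))) functr" where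
  "K_brd ch =
     \<lparr>fobj = (\<lambda>X\<in>Obj BrdShSkMulti_lr. K_brd_obj ch X),
      fmap = (\<lambda>(X, F, Y)\<in>Arr BrdShSkMulti_lr.
        (K_brd_obj ch X, K_s_mor (ch (fst X)) (ch (fst Y)) (fst X) (fst Y) F, K_brd_obj ch Y))\<rparr>"

definition K_sym :: "(('o, 'm) ssm \<Rightarrow> ('o, 'm) lr_data) \<Rightarrow>
  (('o, 'm) ssm \<times> ('o, 'm) sbraid,
   (('o, 'm) ssm \<times> ('o, 'm) sbraid) \<times> ('o, 'm) ssm_mor \<times> (('o, 'm) ssm \<times> ('o, 'm) sbraid),
   ('o, 'm) smc \<times> ('o \<Rightarrow> 'o \<Rightarrow> 'o \<Rightarrow> 'm),
   (('o, 'm) smc \<times> ('o \<Rightarrow> 'o \<Rightarrow> 'o \<Rightarrow> 'm)) \<times> ('o, 'm) lax_mor \<times> (('o, 'm) smc \<times> ('o \<Rightarrow> 'o \<Rightarrow> 'o \<Rightarrow> 'm))) functr" where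
  "K_sym ch = restrict_functor SymShSkMulti_lr (K_brd ch)"

end

theory Submission
  imports Defs
begin

text \<open>
  A functor that is fully faithful and essentially surjective is an equivalence, and it restricts to an
  equivalence of full subcategories if it and the choice of preimages respect them
  (\<open>equivalence_if_fully_faithful\<close>, \<open>equivalence_full_subcat\<close>). So the symmetric case follows from
  the braided one.

  In a left representable multicategory the maps \<open>\<theta> a b\<close> and \<open>u\<close> represent all multimaps: a tight map
  is an arrow precomposed with copies of \<open>\<theta>\<close> in the first position, and a loose map is a tight one with \<open>u\<close>
  in the first position (\<open>multimap_induct\<close>). Hence two arrows out of a tensor product are equal once they
  agree after precomposition with \<open>\<theta>\<close> or \<open>u\<close>. All the equations of a braided skew monoidal category
  reduce in this way to the associativity laws of substitution, the compatibility axioms of \<open>j\<close> and the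
  axioms of the short braiding, and so do the equations of a braided lax monoidal functor.

  Faithfulness is the same induction: a morphism is determined by its underlying functor and its
  values on \<open>\<theta>\<close> and \<open>u\<close>, and these are recovered from \<open>f\<^sub>2\<close> and \<open>f\<^sub>0\<close>. For fullness, a lax functor \<open>L\<close>
  gives an operation \<open>\<Phi>\<close> that replaces \<open>\<theta>\<close> and \<open>u\<close> in such a decomposition by \<open>\<phi> = f\<^sub>2 \<circ> \<theta>\<close> and
  \<open>\<phi>0 = f\<^sub>0 \<circ> u\<close>. The point is that \<open>\<Phi>\<close> preserves substitution (\<open>Phi_comp_at\<close>). Substitution into
  a first input is immediate from the definition. For a later input, associativity reduces to the
  composites \<open>\<theta> \<circ>\<^sub>2 \<theta>\<close> and \<open>\<theta> \<circ>\<^sub>2 u\<close>, which are \<open>\<alpha>\<close> and \<open>\<rho>\<close> precomposed with copies of \<open>\<theta>\<close>, and these are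
  preserved by the coherence of \<open>L\<close>.

  For essential surjectivity, a skew monoidal category \<open>S\<close> gives a multicategory \<open>T\<close> in which a tight map
  out of \<open>a\<^sub>1, \<dots>, a\<^sub>n\<close> is an arrow out of \<open>(\<dots>(a\<^sub>1 a\<^sub>2)\<dots>) a\<^sub>n\<close>, and a loose one has an additional leading
  unit \<open>\<I>\<close>; substitution whiskers and rebrackets with \<open>\<alpha>\<close> and \<open>\<rho>\<close>. Identity arrows serve as \<open>\<theta>\<close> and
  \<open>u\<close>, and with them \<open>K\<close> gives back the structure of \<open>S\<close> (\<open>K_identity_data\<close>). The fixed choice may
  select other universal maps for \<open>T\<close>, but the identity morphism of \<open>T\<close> relates any two choices by an
  isomorphism (\<open>K_independent_of_choice\<close>).
\<close>

section \<open>Equivalences of categories\<close>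

lemma homD:
  assumes "f \<in> hom C a b"
  shows "f \<in> Arr C" "Dom C f = a" "Cod C f = b"
  using assms by (auto simp: hom_def)

lemma (in category) hom_objD:
  assumes "f \<in> hom C a b"
  shows "a \<in> Obj C" "b \<in> Obj C"
  using assms dom_in_Obj cod_in_Obj by (auto simp: hom_def)

lemma (in category) inverse_arrows_homD:
  assumes "inverse_arrows C f g" "f \<in> hom C a b"
  shows "g \<in> hom C b a" "g \<cdot> f = Idn C a" "f \<cdot> g = Idn C b"
  using assms by (auto simp: hom_def inverse_arrows_def)

lemma inverse_arrowsI:
  assumes "f \<in> hom C a b" "g \<in> hom C b a" "Comp C g f = Idn C a" "Comp C f g = Idn C b"
  shows "inverse_arrows C f g"
  using assms by (auto simp: hom_def inverse_arrows_def)

lemma category_cat_of_homs: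
  assumes idn: "\<And>A. A \<in> Ob \<Longrightarrow> i A \<in> H A A"
    and cmp: "\<And>A B C f g. \<lbrakk>A \<in> Ob; B \<in> Ob; C \<in> Ob; f \<in> H A B; g \<in> H B C\<rbrakk> \<Longrightarrow> cmp A B C g f \<in> H A C"
    and cmp_idn: "\<And>A B f. \<lbrakk>A \<in> Ob; B \<in> Ob; f \<in> H A B\<rbrakk> \<Longrightarrow> cmp A A B f (i A) = f"
    and idn_cmp: "\<And>A B f. \<lbrakk>A \<in> Ob; B \<in> Ob; f \<in> H A B\<rbrakk> \<Longrightarrow> cmp A B B (i B) f = f"
    and assoc: "\<And>A B C D f g h. \<lbrakk>A \<in> Ob; B \<in> Ob; C \<in> Ob; D \<in> Ob; f \<in> H A B; g \<in> H B C; h \<in> H C D\<rbrakk> \<Longrightarrow>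
      cmp A B D (cmp B C D h g) f = cmp A C D h (cmp A B C g f)"
  shows "category (cat_of_homs Ob H cmp i)"
  by unfold_locales (auto simp: cat_of_homs_def hom_def idn cmp cmp_idn idn_cmp assoc)

lemma is_functorD:
  assumes "is_functor C D F"
  shows "category C" "category D" "fobj F \<in> extensional (Obj C)" "fmap F \<in> extensional (Arr C)"
    and "a \<in> Obj C \<Longrightarrow> fobj F a \<in> Obj D"
    and "f \<in> hom C a b \<Longrightarrow> fmap F f \<in> hom D (fobj F a) (fobj F b)"
    and "a \<in> Obj C \<Longrightarrow> fmap F (Idn C a) = Idn D (fobj F a)"
    and "\<lbrakk>f \<in> hom C a b; g \<in> hom C b c\<rbrakk> \<Longrightarrow> fmap F (Comp C g f) = Comp D (fmap F g) (fmap F f)"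
  using assms by (auto simp: is_functor_def hom_def)

lemma is_functorI:
  assumes "category C" "category D" "fobj F \<in> extensional (Obj C)" "fmap F \<in> extensional (Arr C)"
    and "\<And>a. a \<in> Obj C \<Longrightarrow> fobj F a \<in> Obj D"
    and "\<And>f a b. f \<in> hom C a b \<Longrightarrow> fmap F f \<in> hom D (fobj F a) (fobj F b)"
    and "\<And>a. a \<in> Obj C \<Longrightarrow> fmap F (Idn C a) = Idn D (fobj F a)"
    and "\<And>f g a b c. \<lbrakk>f \<in> hom C a b; g \<in> hom C b c\<rbrakk> \<Longrightarrow> fmap F (Comp C g f) = Comp D (fmap F g) (fmap F f)"
  shows "is_functor C D F"
  unfolding is_functor_def using assms by (auto intro!: assms(6) simp: hom_def)

lemma functr_eqI:
  assumes "fobj F \<in> extensional A" "fobj G \<in> extensional A" "fmap F \<in> extensional B" "fmap G \<in> extensional B"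
    and "\<And>a. a \<in> A \<Longrightarrow> fobj F a = fobj G a" "\<And>f. f \<in> B \<Longrightarrow> fmap F f = fmap G f"
  shows "F = (G :: ('o, 'm, 'p, 'n) functr)"
proof -
  have "fobj F = fobj G" "fmap F = fmap G"
    using assms by (blast intro: extensionalityI)+
  then show ?thesis by simp
qed

lemma is_functor_id: "category C \<Longrightarrow> is_functor C C (id_functor C)"
  by (rule is_functorI) (auto simp: id_functor_def category.idn_in_hom[THEN homD(1)] hom_def
      category.dom_in_Obj category.cod_in_Obj
      category.comp_in_hom[of C, unfolded hom_def, simplified])

lemma comp_functor_apply:
  "a \<in> Obj C \<Longrightarrow> fobj (comp_functor C G F) a = fobj G (fobj F a)"
  "f \<in> Arr C \<Longrightarrow> fmap (comp_functor C G F) f = fmap G (fmap F f)"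
  by (simp_all add: comp_functor_def compose_def)

lemma id_functor_apply:
  "a \<in> Obj C \<Longrightarrow> fobj (id_functor C) a = a"
  "f \<in> Arr C \<Longrightarrow> fmap (id_functor C) f = f"
  by (simp_all add: id_functor_def)

lemma is_functor_comp:
  assumes F: "is_functor C D F" and G: "is_functor D E G"
  shows "is_functor C E (comp_functor C G F)"
proof (rule is_functorI)
  interpret C: category C using F by (rule is_functorD)
  interpret D: category D using F by (rule is_functorD)
  show "category C" "category E" using F G by (auto dest: is_functorD)
  show "fobj (comp_functor C G F) \<in> extensional (Obj C)" "fmap (comp_functor C G F) \<in> extensional (Arr C)"
    by (simp_all add: comp_functor_def)
  show "a \<in> Obj C \<Longrightarrow> fobj (comp_functor C G F) a \<in> Obj E" for a
    by (simp add: comp_functor_apply is_functorD(5)[OF F] is_functorD(5)[OF G])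
  show "fmap (comp_functor C G F) f \<in> hom E (fobj (comp_functor C G F) a) (fobj (comp_functor C G F) b)"
    if "f \<in> hom C a b" for f a b
    using that C.hom_objD[OF that]
    by (simp add: comp_functor_apply homD(1)[OF that] is_functorD(6)[OF F] is_functorD(6)[OF G])
  show "fmap (comp_functor C G F) (Idn C a) = Idn E (fobj (comp_functor C G F) a)" if "a \<in> Obj C" for a
    using that C.idn_in_hom[OF that]
    by (simp add: comp_functor_apply homD(1) is_functorD(5,7)[OF F] is_functorD(7)[OF G])
  show "fmap (comp_functor C G F) (Comp C g f) = Comp E (fmap (comp_functor C G F) g) (fmap (comp_functor C G F) f)"
    if "f \<in> hom C a b" "g \<in> hom C b c" for f g a b c
    using that C.comp_in_hom[OF that]
    by (simp add: comp_functor_apply homD(1) is_functorD(8)[OF F that]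
        is_functorD(8)[OF G is_functorD(6)[OF F that(1)] is_functorD(6)[OF F that(2)]])
qed

definition fully_faithful where
  "fully_faithful C D F \<longleftrightarrow>
     (\<forall>a\<in>Obj C. \<forall>b\<in>Obj C. bij_betw (fmap F) (hom C a b) (hom D (fobj F a) (fobj F b)))"

text \<open>The weak inverse sends an object \<open>d\<close> to a chosen \<open>c\<close> with an isomorphism \<open>F c \<rightarrow> d\<close>; full
  faithfulness transports everything else along these isomorphisms.\<close>

lemma equivalence_if_fully_faithful:
  assumes F: "is_functor C D F" and ff: "fully_faithful C D F"
    and eso: "\<And>d. d \<in> Obj D \<Longrightarrow> \<exists>c\<in>Obj C. \<exists>h\<in>hom D (fobj F c) d. is_iso D h"
  shows "equivalence_of_categories C D F"
proof -
  interpret C: category C using F by (rule is_functorD)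
  interpret D: category D using F by (rule is_functorD)
  note Fobj = is_functorD(5)[OF F] and Fhom = is_functorD(6)[OF F]
    and Fid = is_functorD(7)[OF F] and Fcomp = is_functorD(8)[OF F]
  have "\<forall>d\<in>Obj D. \<exists>c h h'. c \<in> Obj C \<and> h \<in> hom D (fobj F c) d \<and> inverse_arrows D h h'"
    using eso unfolding is_iso_def by blast
  then obtain g e e' where g: "\<And>d. d \<in> Obj D \<Longrightarrow> g d \<in> Obj C"
    and e: "\<And>d. d \<in> Obj D \<Longrightarrow> e d \<in> hom D (fobj F (g d)) d"
    and inv: "\<And>d. d \<in> Obj D \<Longrightarrow> inverse_arrows D (e d) (e' d)"
    by metis
  have e': "e' d \<in> hom D d (fobj F (g d))" and e'e: "Comp D (e' d) (e d) = Idn D (fobj F (g d))"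
    and ee': "Comp D (e d) (e' d) = Idn D d" if "d \<in> Obj D" for d
    using D.inverse_arrows_homD[OF inv e] that by auto
  have inj: "f = f'" if "f \<in> hom C a b" "f' \<in> hom C a b" "fmap F f = fmap F f'" for f f' a b
    using ff that C.hom_objD[OF that(1)] by (auto simp: fully_faithful_def bij_betw_def dest: inj_onD)
  have surj: "\<exists>f\<in>hom C a b. fmap F f = k" if "k \<in> hom D (fobj F a) (fobj F b)" "a \<in> Obj C" "b \<in> Obj C" for a b k
    using ff that unfolding fully_faithful_def bij_betw_def by (metis imageE)
  define conj where "conj k = Comp D (e' (Cod D k)) (Comp D k (e (Dom D k)))" for k
  have conj: "conj k \<in> hom D (fobj F (g a)) (fobj F (g b))" if "k \<in> hom D a b" for k a b
    using that D.hom_objD[OF that] homD(2,3)[OF that]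
    by (auto simp: conj_def intro!: D.comp_in_hom e e')
  define gm where "gm k = (SOME f. f \<in> hom C (g (Dom D k)) (g (Cod D k)) \<and> fmap F f = conj k)" for k
  have gm: "gm k \<in> hom C (g a) (g b)" "fmap F (gm k) = conj k" if "k \<in> hom D a b" for k a b
  proof -
    have "\<exists>f. f \<in> hom C (g (Dom D k)) (g (Cod D k)) \<and> fmap F f = conj k"
      using surj[OF conj[OF that]] g D.hom_objD[OF that] homD[OF that] by auto
    from someI_ex[OF this] show "gm k \<in> hom C (g a) (g b)" "fmap F (gm k) = conj k"
      using homD[OF that] by (auto simp: gm_def)
  qed
  define G where "G = \<lparr>fobj = restrict g (Obj D), fmap = restrict gm (Arr D)\<rparr>"
  have Gobj: "fobj G d = g d" if "d \<in> Obj D" for d using that by (simp add: G_def)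
  have Gmap: "fmap G k = gm k" if "k \<in> hom D a b" for k a b using that by (simp add: G_def homD)
  have G: "is_functor D C G"
  proof (rule is_functorI)
    show "fobj G \<in> extensional (Obj D)" "fmap G \<in> extensional (Arr D)" by (simp_all add: G_def)
    show "a \<in> Obj D \<Longrightarrow> fobj G a \<in> Obj C" for a by (simp add: Gobj g)
    show "fmap G f \<in> hom C (fobj G a) (fobj G b)" if "f \<in> hom D a b" for f a b
      using gm(1)[OF that] D.hom_objD[OF that] by (simp add: Gmap[OF that] Gobj)
    show "fmap G (Idn D a) = Idn C (fobj G a)" if a: "a \<in> Obj D" for a
    proof -
      have i: "Idn D a \<in> hom D a a" by (rule D.idn_in_hom[OF a])
      have "fmap F (gm (Idn D a)) = fmap F (Idn C (g a))"
        using gm(2)[OF i] homD[OF i] e[OF a] e'e[OF a]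
        by (simp add: conj_def Fid g a D.idn_comp)
      from inj[OF gm(1)[OF i] C.idn_in_hom[OF g[OF a]] this] show ?thesis
        using a by (simp add: Gmap[OF i] Gobj)
    qed
    show "fmap G (Comp D k h) = Comp C (fmap G k) (fmap G h)" if h: "h \<in> hom D a b" and k: "k \<in> hom D b c" for h k a b c
    proof -
      note kh = D.comp_in_hom[OF h k]
      note ob = D.hom_objD[OF h] D.hom_objD[OF k]
      note ee = e[OF ob(1)] e[OF ob(2)] e[OF ob(4)] e'[OF ob(1)] e'[OF ob(2)] e'[OF ob(4)]
      have "fmap F (gm (Comp D k h)) = Comp D (e' c) (Comp D (Comp D k h) (e a))"
        using gm(2)[OF kh] homD[OF kh] by (simp add: conj_def)
      also have "\<dots> = Comp D (e' c) (Comp D k (Comp D (Comp D (e b) (e' b)) (Comp D h (e a))))"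
        using ob ee h k D.comp_in_hom[OF ee(1) h] by (simp add: ee' D.idn_comp D.comp_assoc)
      also have "\<dots> = Comp D (e' c) (Comp D k (Comp D (e b) (conj h)))"
        using ee h by (simp add: conj_def homD(2,3)[OF h] D.comp_assoc[OF D.comp_in_hom[OF ee(1) h] ee(5) ee(2)])
      also have "\<dots> = Comp D (conj k) (conj h)"
        using ee h k conj[OF h] by (simp add: conj_def[of k] homD(2,3)[OF k] D.comp_assoc[OF _ ee(2) k] D.comp_assoc[OF _ D.comp_in_hom[OF ee(2) k] ee(6)])
      also have "\<dots> = fmap F (Comp C (gm k) (gm h))"
        using Fcomp[OF gm(1)[OF h] gm(1)[OF k]] gm(2)[OF h] gm(2)[OF k] by simp
      finally have "gm (Comp D k h) = Comp C (gm k) (gm h)"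
        by (rule inj[OF gm(1)[OF kh] C.comp_in_hom[OF gm(1)[OF h] gm(1)[OF k]]])
      then show ?thesis by (simp add: Gmap[OF h] Gmap[OF k] Gmap[OF kh])
    qed
  qed (unfold_locales)
  have eps: "nat_iso D D (comp_functor D F G) (id_functor D) (restrict e (Obj D))"
    unfolding nat_iso_def nat_trans_def
  proof (intro conjI ballI)
    show "is_functor D D (comp_functor D F G)" by (rule is_functor_comp[OF G F])
    show "is_functor D D (id_functor D)" by (rule is_functor_id) unfold_locales
    show "restrict e (Obj D) \<in> extensional (Obj D)" by simp
    show "restrict e (Obj D) a \<in> hom D (fobj (comp_functor D F G) a) (fobj (id_functor D) a)" if "a \<in> Obj D" for a
      using that e by (simp add: comp_functor_apply id_functor_apply Gobj)
    show "is_iso D (restrict e (Obj D) a)" if "a \<in> Obj D" for a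
      using that inv by (auto simp: is_iso_def)
    show "Comp D (restrict e (Obj D) (Cod D f)) (fmap (comp_functor D F G) f) =
        Comp D (fmap (id_functor D) f) (restrict e (Obj D) (Dom D f))" if "f \<in> Arr D" for f
    proof -
      define a b where "a = Dom D f" and "b = Cod D f"
      have f: "f \<in> hom D a b" using that by (simp add: hom_def a_def b_def)
      note ob = D.hom_objD[OF f]
      have "Comp D (e b) (conj f) = Comp D (Comp D (e b) (e' b)) (Comp D f (e a))"
        using D.comp_assoc[OF D.comp_in_hom[OF e[OF ob(1)] f] e'[OF ob(2)] e[OF ob(2)]] homD[OF f]
        by (simp add: conj_def)
      also have "\<dots> = Comp D f (e a)"
        using D.comp_in_hom[OF e[OF ob(1)] f] by (simp add: ee' ob D.idn_comp)
      finally show ?thesis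
        using ob homD[OF f] by (simp add: comp_functor_apply id_functor_apply Gmap[OF f] gm(2)[OF f])
    qed
  qed
  define h where "h c = (SOME k. k \<in> hom C c (g (fobj F c)) \<and> fmap F k = e' (fobj F c))" for c
  have h: "h c \<in> hom C c (g (fobj F c))" "fmap F (h c) = e' (fobj F c)" if c: "c \<in> Obj C" for c
  proof -
    have "\<exists>k. k \<in> hom C c (g (fobj F c)) \<and> fmap F k = e' (fobj F c)"
      using surj[OF e'[OF Fobj[OF c]] c g[OF Fobj[OF c]]] by blast
    from someI_ex[OF this] show "h c \<in> hom C c (g (fobj F c))" "fmap F (h c) = e' (fobj F c)"
      by (auto simp: h_def)
  qed
  have eta: "nat_iso C C (id_functor C) (comp_functor C G F) (restrict h (Obj C))"
    unfolding nat_iso_def nat_trans_def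
  proof (intro conjI ballI)
    show "is_functor C C (comp_functor C G F)" by (rule is_functor_comp[OF F G])
    show "is_functor C C (id_functor C)" by (rule is_functor_id) unfold_locales
    show "restrict h (Obj C) \<in> extensional (Obj C)" by simp
    show "restrict h (Obj C) a \<in> hom C (fobj (id_functor C) a) (fobj (comp_functor C G F) a)" if "a \<in> Obj C" for a
      using that h(1) by (simp add: comp_functor_apply id_functor_apply Gobj Fobj)
    show "is_iso C (restrict h (Obj C) a)" if a: "a \<in> Obj C" for a
    proof -
      note Fa = Fobj[OF a]
      obtain k where k: "k \<in> hom C (g (fobj F a)) a" "fmap F k = e (fobj F a)"
        using surj[OF e[OF Fa] g[OF Fa] a] by blast
      have "Comp C k (h a) = Idn C a"
        by (rule inj[OF C.comp_in_hom[OF h(1)[OF a] k(1)] C.idn_in_hom[OF a]])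
          (simp add: Fcomp[OF h(1)[OF a] k(1)] h(2)[OF a] k(2) ee' Fa Fid a)
      moreover have "Comp C (h a) k = Idn C (g (fobj F a))"
        by (rule inj[OF C.comp_in_hom[OF k(1) h(1)[OF a]] C.idn_in_hom[OF g[OF Fa]]])
          (simp add: Fcomp[OF k(1) h(1)[OF a]] h(2)[OF a] k(2) e'e Fa Fid a g)
      ultimately show ?thesis
        using inverse_arrowsI[OF h(1)[OF a] k(1)] a by (auto simp: is_iso_def)
    qed
    show "Comp C (restrict h (Obj C) (Cod C f)) (fmap (id_functor C) f) =
        Comp C (fmap (comp_functor C G F) f) (restrict h (Obj C) (Dom C f))" if "f \<in> Arr C" for f
    proof -
      define a b where "a = Dom C f" and "b = Cod C f"
      have f: "f \<in> hom C a b" using that by (simp add: hom_def a_def b_def)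
      note ob = C.hom_objD[OF f]
      note Ff = Fhom[OF f]
      note ha = h[OF ob(1)] and hb = h[OF ob(2)]
      note Fa = Fobj[OF ob(1)] and Fb = Fobj[OF ob(2)]
      have "fmap F (Comp C (h b) f) = Comp D (e' (fobj F b)) (fmap F f)"
        by (simp add: Fcomp[OF f hb(1)] hb(2))
      also have "\<dots> = Comp D (e' (fobj F b)) (Comp D (fmap F f) (Comp D (e (fobj F a)) (e' (fobj F a))))"
        using Ff by (simp add: ee' Fa D.comp_idn)
      also have "\<dots> = Comp D (conj (fmap F f)) (e' (fobj F a))"
        by (simp add: conj_def homD(2,3)[OF Ff] D.comp_assoc[OF e'[OF Fa] e[OF Fa] Ff]
            D.comp_assoc[OF e'[OF Fa] D.comp_in_hom[OF e[OF Fa] Ff] e'[OF Fb]])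
      also have "\<dots> = fmap F (Comp C (gm (fmap F f)) (h a))"
        by (simp add: Fcomp[OF ha(1) gm(1)[OF Ff]] ha(2) gm(2)[OF Ff])
      finally have "Comp C (h b) f = Comp C (gm (fmap F f)) (h a)"
        by (rule inj[OF C.comp_in_hom[OF f hb(1)] C.comp_in_hom[OF ha(1) gm(1)[OF Ff]]])
      then show ?thesis
        using ob homD[OF f] by (simp add: comp_functor_apply id_functor_apply Gmap[OF Ff])
    qed
  qed
  show ?thesis
    unfolding equivalence_of_categories_def using F G eta eps by blast
qed

lemma hom_full_subcat:
  "hom (full_subcat C P) a b = (if P a \<and> P b then hom C a b else {})"
  by (auto simp: hom_def full_subcat_def)

lemma category_full_subcat:
  assumes "category C" shows "category (full_subcat C P)"
proof -
  interpret category C by fact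
  show ?thesis
    by unfold_locales
      (auto simp: hom_full_subcat comp_idn idn_comp comp_assoc intro: comp_in_hom split: if_splits,
        auto simp: full_subcat_def idn_in_hom dom_in_Obj cod_in_Obj
          intro: comp_in_hom comp_idn idn_comp comp_assoc)
qed

lemma is_functor_restrict:
  assumes F: "is_functor C D F" and PQ: "\<And>c. c \<in> Obj C \<Longrightarrow> P c \<Longrightarrow> Q (fobj F c)"
  shows "is_functor (full_subcat C P) (full_subcat D Q) (restrict_functor (full_subcat C P) F)"
proof (rule is_functorI)
  interpret C: category C using F by (rule is_functorD)
  interpret D: category D using F by (rule is_functorD)
  show "category (full_subcat C P)" "category (full_subcat D Q)"
    using C.category_axioms D.category_axioms by (auto intro: category_full_subcat)
qed (use F PQ in \<open>auto simp: restrict_functor_def full_subcat_def hom_def is_functor_def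
    category.idn_in_hom[of C, unfolded hom_def, simplified]
    category.comp_in_hom[of C, unfolded hom_def, simplified] category.dom_in_Obj category.cod_in_Obj\<close>)

lemma equivalence_full_subcat:
  assumes F: "is_functor C D F" and ff: "fully_faithful C D F"
    and PQ: "\<And>c. c \<in> Obj C \<Longrightarrow> P c \<Longrightarrow> Q (fobj F c)"
    and eso: "\<And>d. d \<in> Obj D \<Longrightarrow> Q d \<Longrightarrow> \<exists>c\<in>Obj C. P c \<and> (\<exists>h\<in>hom D (fobj F c) d. is_iso D h)"
  shows "equivalence_of_categories (full_subcat C P) (full_subcat D Q) (restrict_functor (full_subcat C P) F)"
proof (rule equivalence_if_fully_faithful)
  let ?F = "restrict_functor (full_subcat C P) F"
  interpret D: category D using F by (rule is_functorD)
  interpret C: category C using F by (rule is_functorD)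
  show "is_functor (full_subcat C P) (full_subcat D Q) ?F"
    using F by (rule is_functor_restrict) (rule PQ)
  show "fully_faithful (full_subcat C P) (full_subcat D Q) ?F"
    unfolding fully_faithful_def
  proof (intro ballI)
    fix a b assume "a \<in> Obj (full_subcat C P)" "b \<in> Obj (full_subcat C P)"
    then have ab: "a \<in> Obj C" "b \<in> Obj C" "P a" "P b" by (auto simp: full_subcat_def)
    have "bij_betw (fmap F) (hom C a b) (hom D (fobj F a) (fobj F b))"
      using ff ab by (simp add: fully_faithful_def)
    then have "bij_betw (fmap ?F) (hom C a b) (hom D (fobj F a) (fobj F b))"
      by (rule bij_betw_cong[THEN iffD1, rotated])
        (use ab in \<open>auto simp: restrict_functor_def full_subcat_def hom_def\<close>)
    moreover have "fobj ?F a = fobj F a" "fobj ?F b = fobj F b"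
      using ab by (simp_all add: restrict_functor_def full_subcat_def)
    ultimately show "bij_betw (fmap ?F) (hom (full_subcat C P) a b) (hom (full_subcat D Q) (fobj ?F a) (fobj ?F b))"
      using ab PQ by (simp add: hom_full_subcat)
  qed
  show "\<exists>c\<in>Obj (full_subcat C P). \<exists>h\<in>hom (full_subcat D Q) (fobj ?F c) d. is_iso (full_subcat D Q) h"
    if d: "d \<in> Obj (full_subcat D Q)" for d
  proof -
    from d have d': "d \<in> Obj D" "Q d" by (auto simp: full_subcat_def)
    obtain c h k where c: "c \<in> Obj C" "P c" and h: "h \<in> hom D (fobj F c) d" and hk: "inverse_arrows D h k"
      using eso[OF d'] unfolding is_iso_def by blast
    note k = D.inverse_arrows_homD[OF hk h]
    have Fc: "fobj ?F c = fobj F c" using c by (simp add: restrict_functor_def full_subcat_def)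
    have h': "h \<in> hom (full_subcat D Q) (fobj F c) d"
      unfolding hom_full_subcat using h d'(2) PQ[OF c] by simp
    have k': "k \<in> hom (full_subcat D Q) d (fobj F c)"
      unfolding hom_full_subcat using k(1) d'(2) PQ[OF c] by simp
    have "is_iso (full_subcat D Q) h"
      unfolding is_iso_def
    proof
      show "inverse_arrows (full_subcat D Q) h k"
        by (rule inverse_arrowsI[OF h' k']) (simp_all add: full_subcat_def k(2,3))
    qed
    moreover have "c \<in> Obj (full_subcat C P)" using c by (simp add: full_subcat_def)
    ultimately show ?thesis using h' Fc by metis
  qed
qed

section \<open>Powers, products and set-valued functors\<close>

lemma category_op: "category C \<Longrightarrow> category (op_cat C)"
  unfolding category_def op_cat_def hom_def by auto

lemma category_prod: "category C \<Longrightarrow> category D \<Longrightarrow> category (prod_cat C D)"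
  unfolding category_def prod_cat_def hom_def by auto

lemma hom_power_cat:
  "ps \<in> hom (power_cat C n) as bs \<longleftrightarrow>
     length ps = n \<and> set ps \<subseteq> Arr C \<and> map (Dom C) ps = as \<and> map (Cod C) ps = bs"
  by (auto simp: hom_def power_cat_def)

lemma hom_power_cat_nth:
  "ps \<in> hom (power_cat C n) as bs \<longleftrightarrow>
     length ps = n \<and> length as = n \<and> length bs = n \<and> (\<forall>i<n. ps ! i \<in> hom C (as ! i) (bs ! i))"
  unfolding hom_power_cat by (auto simp: hom_def list_eq_iff_nth_eq set_conv_nth)

lemma category_power: "category C \<Longrightarrow> category (power_cat C n)"
proof -
  assume "category C"
  then interpret category C .
  have c: "Comp (power_cat C n) qs ps = map2 (Comp C) qs ps" for qs ps by (simp add: power_cat_def)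
  show ?thesis
  proof unfold_locales
    fix f g h a b c d
    assume f: "f \<in> hom (power_cat C n) a b"
    have i: "Idn (power_cat C n) as = map (Idn C) as" for as by (simp add: power_cat_def)
    show "Comp (power_cat C n) f (Idn (power_cat C n) a) = f"
      "Comp (power_cat C n) (Idn (power_cat C n) b) f = f"
      using f by (auto simp: hom_power_cat_nth c i comp_idn idn_comp intro!: nth_equalityI)
    assume g: "g \<in> hom (power_cat C n) b c"
    show "Comp (power_cat C n) g f \<in> hom (power_cat C n) a c"
      using f g by (auto simp: hom_power_cat_nth c intro: comp_in_hom)
    assume "h \<in> hom (power_cat C n) c d"
    then show "Comp (power_cat C n) (Comp (power_cat C n) h g) f = Comp (power_cat C n) h (Comp (power_cat C n) g f)"
      using f g by (auto simp: hom_power_cat_nth c intro!: nth_equalityI comp_assoc)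
  next
    fix a assume "a \<in> Obj (power_cat C n)"
    then show "Idn (power_cat C n) a \<in> hom (power_cat C n) a a"
      unfolding hom_power_cat_nth by (auto simp: power_cat_def intro!: idn_in_hom)
  qed (auto simp: power_cat_def subset_iff intro: dom_in_Obj cod_in_Obj)
qed

lemma category_mdom: "category C \<Longrightarrow> category (mdom C n)"
  unfolding mdom_def by (intro category_prod category_op category_power)

lemma mdom_simps:
  "(as, b) \<in> Obj (mdom C n) \<longleftrightarrow> length as = n \<and> set as \<subseteq> Obj C \<and> b \<in> Obj C"
  "(ps, q) \<in> Arr (mdom C n) \<longleftrightarrow> length ps = n \<and> set ps \<subseteq> Arr C \<and> q \<in> Arr C"
  "Dom (mdom C n) (ps, q) = (map (Cod C) ps, Dom C q)"
  "Cod (mdom C n) (ps, q) = (map (Dom C) ps, Cod C q)"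
  "Idn (mdom C n) (as, b) = (map (Idn C) as, Idn C b)"
  "Comp (mdom C n) (ps', q') (ps, q) = (map2 (Comp C) ps ps', Comp C q' q)"
  by (auto simp: mdom_def prod_cat_def op_cat_def power_cat_def)

lemma hom_mdom:
  "(ps, q) \<in> hom (mdom C n) (as, b) (as', b') \<longleftrightarrow>
     length ps = n \<and> length as = n \<and> length as' = n \<and> (\<forall>i<n. ps ! i \<in> hom C (as' ! i) (as ! i)) \<and> q \<in> hom C b b'"
  unfolding hom_def by (auto simp: mdom_simps list_eq_iff_nth_eq set_conv_nth)

lemma is_functor_mdom_functor:
  assumes F: "is_functor C D F"
  shows "is_functor (mdom C n) (mdom D n) (mdom_functor C n F)"
proof (rule is_functorI)
  show "category (mdom C n)" "category (mdom D n)"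
    using F by (auto intro: category_mdom dest: is_functorD)
  interpret category C using F by (rule is_functorD)
  note [simp] = is_functorD(5,7)[OF F]
  have [simp]: "p \<in> Arr C \<Longrightarrow> fmap F p \<in> Arr D" "p \<in> Arr C \<Longrightarrow> Dom D (fmap F p) = fobj F (Dom C p)"
    "p \<in> Arr C \<Longrightarrow> Cod D (fmap F p) = fobj F (Cod C p)" for p
    using is_functorD(6)[OF F, of p "Dom C p" "Cod C p"] by (auto simp: hom_def)
  show "a \<in> Obj (mdom C n) \<Longrightarrow> fobj (mdom_functor C n F) a \<in> Obj (mdom D n)" for a
    by (cases a) (auto simp: mdom_functor_def mdom_simps)
  show "fmap (mdom_functor C n F) f \<in> hom (mdom D n) (fobj (mdom_functor C n F) a) (fobj (mdom_functor C n F) b)"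
    if "f \<in> hom (mdom C n) a b" for f a b
  proof -
    obtain ps q where f: "f = (ps, q)" by (cases f)
    have "set ps \<subseteq> Arr C" "q \<in> Arr C" "length ps = n" "a = (map (Cod C) ps, Dom C q)" "b = (map (Dom C) ps, Cod C q)"
      using that by (auto simp: f hom_def mdom_simps)
    then show ?thesis
      by (auto simp: f hom_def mdom_functor_def mdom_simps subset_iff dom_in_Obj cod_in_Obj)
  qed
  show "fmap (mdom_functor C n F) (Idn (mdom C n) a) = Idn (mdom D n) (fobj (mdom_functor C n F) a)"
    if "a \<in> Obj (mdom C n)" for a
    using that idn_in_hom by (cases a) (auto simp: mdom_functor_def mdom_simps hom_def)
  show "fmap (mdom_functor C n F) (Comp (mdom C n) g f) =
      Comp (mdom D n) (fmap (mdom_functor C n F) g) (fmap (mdom_functor C n F) f)"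
    if fg: "f \<in> hom (mdom C n) a b" "g \<in> hom (mdom C n) b c" for f g a b c
  proof -
    obtain ps q ps' q' as1 b1 as2 b2 as3 b3 where [simp]: "f = (ps, q)" "g = (ps', q')" "a = (as1, b1)" "b = (as2, b2)" "c = (as3, b3)"
      by (cases f, cases g, cases a, cases b, cases c)
    have "Comp (mdom C n) g f \<in> Arr (mdom C n)"
      using category.comp_in_hom[OF category_mdom[OF category_axioms] fg] by (rule homD)
    then show ?thesis using fg homD(1)[OF fg(1)] homD(1)[OF fg(2)]
      by (auto simp: mdom_functor_def mdom_simps(1,2,6) hom_mdom is_functorD(8)[OF F] intro!: nth_equalityI is_functorD(8)[OF F])
  qed
qed (simp_all add: mdom_functor_def)

lemma hom_set_cat: "t \<in> hom set_cat A B \<longleftrightarrow> (\<exists>f\<in>A \<rightarrow>\<^sub>E B. t = (A, f, B))"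
  by (auto simp: hom_def set_cat_def cat_of_homs_def)

lemma category_set_cat: "category set_cat"
  unfolding set_cat_def
  by (rule category_cat_of_homs) (auto simp: compose_def PiE_iff extensional_def fun_eq_iff)

lemma set_cat_ap:
  "t \<in> hom set_cat A B \<Longrightarrow> x \<in> A \<Longrightarrow> ap t x \<in> B"
  "t \<in> hom set_cat A B \<Longrightarrow> x \<in> A \<Longrightarrow> ap (Comp set_cat s t) x = ap s (ap t x)"
  "x \<in> A \<Longrightarrow> ap (Idn set_cat A) x = x"
  by (auto simp: hom_set_cat ap_def, auto simp: set_cat_def cat_of_homs_def compose_def split: prod.splits)

lemma set_cat_eqI:
  "s \<in> hom set_cat A B \<Longrightarrow> t \<in> hom set_cat A B \<Longrightarrow> (\<And>x. x \<in> A \<Longrightarrow> ap s x = ap t x) \<Longrightarrow> s = t"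
  by (auto simp: hom_set_cat ap_def intro: PiE_ext)

lemma is_iso_set_cat:
  assumes t: "t \<in> hom set_cat A B"
  shows "is_iso set_cat t \<longleftrightarrow> bij_betw (ap t) A B"
proof
  assume "is_iso set_cat t"
  then obtain s where "inverse_arrows set_cat t s" by (auto simp: is_iso_def)
  note s = category.inverse_arrows_homD[OF category_set_cat this t]
  show "bij_betw (ap t) A B"
  proof (rule bij_betw_byWitness[where f' = "ap s"])
    show "\<forall>a\<in>A. ap s (ap t a) = a" "\<forall>b\<in>B. ap t (ap s b) = b"
      using set_cat_ap(2)[OF t, of _ s] set_cat_ap(2)[OF s(1), of _ t] s(2,3) set_cat_ap(3) by metis+
    show "ap t ` A \<subseteq> B" using set_cat_ap(1)[OF t] by blast
    show "ap s ` B \<subseteq> A" using set_cat_ap(1)[OF s(1)] by blast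
  qed
next
  assume b: "bij_betw (ap t) A B"
  define s where "s = (B, restrict (the_inv_into A (ap t)) B, A)"
  have s: "s \<in> hom set_cat B A"
  proof -
    have "the_inv_into A (ap t) y \<in> A" if "y \<in> B" for y
      using the_inv_into_into[of "ap t" A y A] that b by (simp add: bij_betw_def)
    then have "restrict (the_inv_into A (ap t)) B \<in> B \<rightarrow>\<^sub>E A" by (rule restrict_PiE_iff[THEN iffD2, rule_format])
    then show ?thesis unfolding hom_set_cat s_def by blast
  qed
  have aps: "x \<in> B \<Longrightarrow> ap s x = the_inv_into A (ap t) x" for x by (simp add: s_def ap_def)
  note inC = category.comp_in_hom[OF category_set_cat] and inI = category.idn_in_hom[OF category_set_cat]
  have ob: "X \<in> Obj set_cat" for X by (simp add: set_cat_def cat_of_homs_def)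
  have st: "ap s (ap t x) = x" if "x \<in> A" for x
    using b set_cat_ap(1)[OF t that] that by (simp add: aps bij_betw_def the_inv_into_f_f)
  have ts: "ap t (ap s x) = x" if "x \<in> B" for x
    using b that by (simp add: aps bij_betw_def f_the_inv_into_f)
  have "inverse_arrows set_cat t s"
  proof (rule inverse_arrowsI[OF t s])
    show "Comp set_cat s t = Idn set_cat A"
      by (rule set_cat_eqI[OF inC[OF t s] inI[OF ob]]) (simp add: set_cat_ap(2)[OF t] set_cat_ap(3) st)
    show "Comp set_cat t s = Idn set_cat B"
      by (rule set_cat_eqI[OF inC[OF s t] inI[OF ob]]) (simp add: set_cat_ap(2)[OF s] set_cat_ap(3) ts)
  qed
  then show "is_iso set_cat t" unfolding is_iso_def by blast
qed

lemma set_functor_ap: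
  assumes F: "is_functor X set_cat F"
  shows "t \<in> hom X a b \<Longrightarrow> x \<in> fobj F a \<Longrightarrow> ap (fmap F t) x \<in> fobj F b"
    and "t \<in> hom X a b \<Longrightarrow> s \<in> hom X b c \<Longrightarrow> x \<in> fobj F a \<Longrightarrow> ap (fmap F (Comp X s t)) x = ap (fmap F s) (ap (fmap F t) x)"
    and "a \<in> Obj X \<Longrightarrow> x \<in> fobj F a \<Longrightarrow> ap (fmap F (Idn X a)) x = x"
  by (auto simp: is_functorD(6-8)[OF F] set_cat_ap(2)[OF is_functorD(6)[OF F]]
      set_cat_ap(1)[OF is_functorD(6)[OF F]] set_cat_ap(3))

lemma nat_transD:
  assumes "nat_trans X D F G \<eta>"
  shows "is_functor X D F" "is_functor X D G" "\<eta> \<in> extensional (Obj X)"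
    and "a \<in> Obj X \<Longrightarrow> \<eta> a \<in> hom D (fobj F a) (fobj G a)"
    and "f \<in> hom X a b \<Longrightarrow> Comp D (\<eta> b) (fmap F f) = Comp D (fmap G f) (\<eta> a)"
  using assms by (auto simp: nat_trans_def hom_def)

lemma set_nat_trans_ap:
  assumes n: "nat_trans X set_cat F G \<eta>" and t: "t \<in> hom X a b" and x: "x \<in> fobj F a"
  shows "ap (\<eta> b) (ap (fmap F t) x) = ap (fmap G t) (ap (\<eta> a) x)"
proof -
  have "a \<in> Obj X" "b \<in> Obj X"
    using category.hom_objD[OF is_functorD(1)[OF nat_transD(1)[OF n]] t] .
  then show ?thesis
    using set_cat_ap(2)[OF is_functorD(6)[OF nat_transD(1)[OF n] t] x, of "\<eta> b"]
      set_cat_ap(2)[OF nat_transD(4)[OF n] x, of "fmap G t"] nat_transD(5)[OF n t] by simp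
qed

lemma set_nat_transI:
  assumes F: "is_functor X set_cat F" and G: "is_functor X set_cat G" and ext: "\<eta> \<in> extensional (Obj X)"
    and ty: "\<And>a. a \<in> Obj X \<Longrightarrow> \<eta> a \<in> hom set_cat (fobj F a) (fobj G a)"
    and nat: "\<And>t a b x. t \<in> hom X a b \<Longrightarrow> x \<in> fobj F a \<Longrightarrow> ap (\<eta> b) (ap (fmap F t) x) = ap (fmap G t) (ap (\<eta> a) x)"
  shows "nat_trans X set_cat F G \<eta>"
  unfolding nat_trans_def
proof (intro conjI ballI F G ext ty)
  interpret X: category X using F by (rule is_functorD)
  fix t assume t: "t \<in> Arr X"
  define a b where "a = Dom X t" and "b = Cod X t"
  have h: "t \<in> hom X a b" using t by (simp add: hom_def a_def b_def)
  note ob = X.hom_objD[OF h]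
  note Ft = is_functorD(6)[OF F h] and Gt = is_functorD(6)[OF G h]
  have "Comp set_cat (\<eta> b) (fmap F t) = Comp set_cat (fmap G t) (\<eta> a)"
  proof (rule set_cat_eqI)
    show "Comp set_cat (\<eta> b) (fmap F t) \<in> hom set_cat (fobj F a) (fobj G b)"
      "Comp set_cat (fmap G t) (\<eta> a) \<in> hom set_cat (fobj F a) (fobj G b)"
      by (rule category.comp_in_hom[OF category_set_cat], (rule Ft ty[OF ob(1)]), (rule Gt ty[OF ob(2)]))+
    show "ap (Comp set_cat (\<eta> b) (fmap F t)) x = ap (Comp set_cat (fmap G t) (\<eta> a)) x" if "x \<in> fobj F a" for x
      using that nat[OF h that] by (simp add: set_cat_ap(2)[OF Ft] set_cat_ap(2)[OF ty[OF ob(1)]])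
  qed
  then show "Comp set_cat (\<eta> (Cod X t)) (fmap F t) = Comp set_cat (fmap G t) (\<eta> (Dom X t))"
    by (simp add: a_def b_def)
qed

section \<open>Multimaps that carry their types\<close>

text \<open>Hom-sets of a short skew multicategory may overlap, so substitution needs sources and targets as
  arguments. Packing them together with the multimap lets substitution be a binary operation for each
  position, and its laws read as in the mathematical notation.\<close>

datatype ('o, 'm) tmap = TM (knd: tl) (src: "'o list") (tgt: 'o) (elt: 'm)

lemma tmap_eqI: "\<lbrakk>knd f = knd g; src f = src g; tgt f = tgt g; elt f = elt g\<rbrakk> \<Longrightarrow> f = g"
  by (cases f, cases g) simp

definition mtype :: "('o, 'm) tmap \<Rightarrow> tl \<times> nat" where
  "mtype f = (knd f, length (src f))"

definition valid :: "('o, 'm) ssm \<Rightarrow> ('o, 'm) tmap \<Rightarrow> bool" where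
  "valid M f \<longleftrightarrow> mtype f \<in> mm_kinds \<and> set (src f) \<subseteq> Obj (mcat M) \<and> tgt f \<in> Obj (mcat M) \<and>
     elt f \<in> mm M (knd f) (src f) (tgt f)"

definition comp_at :: "('o, 'm) ssm \<Rightarrow> ('o, 'm) tmap \<Rightarrow> nat \<Rightarrow> ('o, 'm) tmap \<Rightarrow> ('o, 'm) tmap" where
  "comp_at M g i f = TM (tl_comp (knd g) i (knd f)) (plug (src g) i (src f)) (tgt g)
     (circ M (knd g) (src g) (tgt g) i (knd f) (src f) (elt g) (elt f))"

definition jmap :: "('o, 'm) ssm \<Rightarrow> ('o, 'm) tmap \<Rightarrow> ('o, 'm) tmap" where
  "jmap M f = TM Loose (src f) (tgt f) (jm M (src f) (tgt f) (elt f))"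

definition unary :: "('o, 'm) ssm \<Rightarrow> 'm \<Rightarrow> ('o, 'm) tmap" where
  "unary M p = TM Tight [Dom (mcat M) p] (Cod (mcat M) p) p"

definition composable :: "tl \<times> nat \<Rightarrow> tl \<times> nat \<Rightarrow> bool" where
  "composable t s \<longleftrightarrow> (t, s) \<in> sub_cases \<or> s = (Tight, 1) \<and> t \<in> mm_kinds \<or> t = (Tight, 1) \<and> s \<in> mm_kinds"

definition assoc_types :: "tl \<times> nat \<Rightarrow> tl \<times> nat \<Rightarrow> tl \<times> nat \<Rightarrow> bool" where
  "assoc_types t s r \<longleftrightarrow> t = (Tight, 1) \<and> composable s r \<or> s = (Tight, 1) \<and> composable t r \<or>
     r = (Tight, 1) \<and> composable t s \<or> t = (Tight, 2) \<and> s = (Tight, 2) \<and> r \<in> {(Tight, 2), (Loose, 0)}"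

definition parallel_types :: "tl \<times> nat \<Rightarrow> tl \<times> nat \<Rightarrow> tl \<times> nat \<Rightarrow> bool" where
  "parallel_types t s r \<longleftrightarrow> s = (Tight, 1) \<and> composable t r \<or> r = (Tight, 1) \<and> composable t s \<or>
     t = (Tight, 2) \<and> s \<in> {(Tight, 2), (Loose, 0)} \<and> r \<in> {(Tight, 2), (Loose, 0)}"

lemma comp_at_sel [simp]:
  "knd (comp_at M g i f) = tl_comp (knd g) i (knd f)"
  "src (comp_at M g i f) = plug (src g) i (src f)"
  "tgt (comp_at M g i f) = tgt g"
  by (simp_all add: comp_at_def)

lemma jmap_sel [simp]: "knd (jmap M f) = Loose" "src (jmap M f) = src f" "tgt (jmap M f) = tgt f"
  by (simp_all add: jmap_def)

lemma unary_sel [simp]: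
  "knd (unary M p) = Tight" "src (unary M p) = [Dom (mcat M) p]" "tgt (unary M p) = Cod (mcat M) p" "elt (unary M p) = p"
  by (simp_all add: unary_def)

lemma plug_single [simp]: "1 \<le> i \<Longrightarrow> i \<le> length bs \<Longrightarrow> plug bs i [a] = bs[i - 1 := a]"
  by (cases i) (simp_all add: plug_def upd_conv_take_nth_drop)

lemma plug_1: "plug (b # bs) (Suc 0) as = as @ bs"
  by (simp add: plug_def)

lemma length_plug: "1 \<le> i \<Longrightarrow> i \<le> length bs \<Longrightarrow> length (plug bs i as) = length bs - 1 + length as"
  by (simp add: plug_def)

lemma set_plug: "set bs \<subseteq> A \<Longrightarrow> set as \<subseteq> A \<Longrightarrow> set (plug bs i as) \<subseteq> A"
  unfolding plug_def using set_take_subset[of "i - 1" bs] set_drop_subset[of i bs] by auto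

lemma tl_comp_simps [simp]: "tl_comp x i Tight = x" "tl_comp Tight (Suc 0) y = y"
  "tl_comp Loose i y = Loose"
  by (cases x; cases y; simp add: tl_comp_def)+

lemma composable_comp_kinds:
  assumes "composable (x, length bs) (y, length as)" "1 \<le> i" "i \<le> length bs"
  shows "(tl_comp x i y, length (plug bs i as)) \<in> mm_kinds"
proof -
  have "i = 1 \<or> i = 2 \<or> i = 3 \<or> i = 4"
    using assms by (auto simp: composable_def sub_cases_def mm_kinds_def)
  then show ?thesis
    using assms by (auto simp: composable_def sub_cases_def mm_kinds_def length_plug tl_comp_def)
qed

context short_skew_multicategory
begin

abbreviation comp_syntax ("_ \<star>\<^bsub>_\<^esub> _" [65, 0, 66] 65) where
  "g \<star>\<^bsub>i\<^esub> f \<equiv> comp_at M g i f"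
abbreviation comp1_syntax (infixl "\<star>" 65) where "g \<star> f \<equiv> comp_at M g (Suc 0) f"
abbreviation comp2_syntax (infixl "\<star>\<^sub>2" 65) where "g \<star>\<^sub>2 f \<equiv> comp_at M g 2 f"
abbreviation comp3_syntax (infixl "\<star>\<^sub>3" 65) where "g \<star>\<^sub>3 f \<equiv> comp_at M g 3 f"

abbreviation C where "C \<equiv> mcat M"
abbreviation ob where "ob a \<equiv> a \<in> Obj C"
abbreviation ar where "ar p \<equiv> p \<in> Arr C"

sublocale C: category C by (rule category)

definition act :: "tl \<Rightarrow> 'm list \<Rightarrow> 'm \<Rightarrow> 'm \<Rightarrow> 'm" where
  "act x ps q f = ap (fmap (mfun M (x, length ps)) (ps, q)) f"

lemma act_in:
  assumes "(x, length ps) \<in> mm_kinds" "set ps \<subseteq> Arr C" "ar q" "f \<in> mm M x (map (Cod C) ps) (Dom C q)"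
  shows "act x ps q f \<in> mm M x (map (Dom C) ps) (Cod C q)"
  using set_functor_ap(1)[OF functorial[OF assms(1)], of "(ps, q)" "(map (Cod C) ps, Dom C q)"
      "(map (Dom C) ps, Cod C q)" f] assms
  by (simp add: act_def mm_def hom_def mdom_simps)

lemma act_act:
  assumes "(x, length ps) \<in> mm_kinds" "set ps \<subseteq> Arr C" "ar q" "f \<in> mm M x (map (Cod C) ps) (Dom C q)"
    and "set ps' \<subseteq> Arr C" "ar q'" "map (Cod C) ps' = map (Dom C) ps" "Dom C q' = Cod C q"
  shows "act x ps' q' (act x ps q f) = act x (map2 (Comp C) ps ps') (Comp C q' q) f"
proof -
  have l: "length ps' = length ps" using map_eq_imp_length_eq[OF assms(7)] .
  show ?thesis
    using set_functor_ap(2)[OF functorial[OF assms(1)], of "(ps, q)" "(map (Cod C) ps, Dom C q)"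
      "(map (Dom C) ps, Cod C q)" "(ps', q')" "(map (Dom C) ps', Cod C q')" f] assms
    by (simp add: act_def mm_def hom_def mdom_simps l)
qed

lemma act_idn:
  assumes "(x, length as) \<in> mm_kinds" "set as \<subseteq> Obj C" "ob b" "f \<in> mm M x as b"
  shows "act x (map (Idn C) as) (Idn C b) f = f"
  using set_functor_ap(3)[OF functorial[OF assms(1)], of "(as, b)" f] assms
  by (simp add: act_def mm_def mdom_simps)

lemma post_eq: "post M x as q f = act x (map (Idn C) as) q f"
  by (simp add: post_def act_def)

lemma pre_eq: "pre M x bs c i p f = act x ((map (Idn C) bs)[i - 1 := p]) (Idn C c) f"
  by (simp add: pre_def act_def)

lemma idn_simps [simp]:
  "ob a \<Longrightarrow> Idn C a \<in> Arr C" "ob a \<Longrightarrow> Dom C (Idn C a) = a" "ob a \<Longrightarrow> Cod C (Idn C a) = a"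
  using C.idn_in_hom by (auto simp: hom_def)

lemma comp_simps [simp]:
  assumes "ar f" "ar g" "Dom C g = Cod C f"
  shows "Comp C g f \<in> Arr C" "Dom C (Comp C g f) = Dom C f" "Cod C (Comp C g f) = Cod C g"
  using C.comp_in_hom[of f "Dom C f" "Cod C f" g "Cod C g"] assms by (auto simp: hom_def)

lemma obj_simps [simp]:
  "ar f \<Longrightarrow> Dom C f \<in> Obj C" "ar f \<Longrightarrow> Cod C f \<in> Obj C"
  using C.dom_in_Obj C.cod_in_Obj by auto

lemma comp_idn_simps [simp]:
  "ar f \<Longrightarrow> Dom C f = a \<Longrightarrow> Comp C f (Idn C a) = f" "ar f \<Longrightarrow> Cod C f = a \<Longrightarrow> Comp C (Idn C a) f = f"
  using C.comp_idn C.idn_comp by (auto simp: hom_def)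

lemma map_dom_idn: "set bs \<subseteq> Obj C \<Longrightarrow> map (Dom C) (map (Idn C) bs) = bs"
  unfolding map_map by (rule map_idI) auto

lemma map_cod_idn: "set bs \<subseteq> Obj C \<Longrightarrow> map (Cod C) (map (Idn C) bs) = bs"
  unfolding map_map by (rule map_idI) auto

lemma dom_list_update: "set bs \<subseteq> Obj C \<Longrightarrow> map (Dom C) ((map (Idn C) bs)[i := p]) = bs[i := Dom C p]"
  using map_dom_idn by (simp only: map_update)

lemma cod_list_update:
  "set bs \<subseteq> Obj C \<Longrightarrow> Cod C p = bs ! i \<Longrightarrow> map (Cod C) ((map (Idn C) bs)[i := p]) = bs"
  using map_cod_idn by (simp only: map_update list_update_id)

lemma arr_list_update: "set bs \<subseteq> Obj C \<Longrightarrow> ar p \<Longrightarrow> set ((map (Idn C) bs)[i := p]) \<subseteq> Arr C"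
  by (rule subset_trans[OF set_update_subset_insert]) auto

lemma pre_in:
  assumes "(x, length bs) \<in> mm_kinds" "set bs \<subseteq> Obj C" "ob c" "g \<in> mm M x bs c"
    "ar p" "Cod C p = bs ! (i - 1)"
  shows "pre M x bs c i p g \<in> mm M x (bs[i - 1 := Dom C p]) c"
  using act_in[of x "(map (Idn C) bs)[i - 1 := p]" "Idn C c" g] assms
  by (simp add: pre_eq dom_list_update cod_list_update arr_list_update)

lemma post_in:
  assumes "(x, length as) \<in> mm_kinds" "set as \<subseteq> Obj C" "f \<in> mm M x as (Dom C q)" "ar q"
  shows "post M x as q f \<in> mm M x as (Cod C q)"
proof -
  have "set (map (Idn C) as) \<subseteq> Arr C" using assms(2) by auto
  then show ?thesis
    using act_in[of x "map (Idn C) as" q f] assms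
    by (simp only: post_eq length_map map_cod_idn map_dom_idn)
qed

lemma mm_unary: "ob a \<Longrightarrow> ob b \<Longrightarrow> mm M Tight [a] b = hom C a b"
  by (rule tight_unary)

lemma act_unary:
  "ar p \<Longrightarrow> ar f \<Longrightarrow> ar q \<Longrightarrow> Cod C p = Dom C f \<Longrightarrow> Dom C q = Cod C f \<Longrightarrow>
    act Tight [p] q f = Comp C q (Comp C f p)"
  using tight_unary_action[of p "Dom C p" "Dom C f" f "Cod C f" q "Cod C q"] by (simp add: act_def hom_def)

lemma valid_unary_iff:
  assumes "knd f = Tight" "src f = [a]"
  shows "valid M f \<longleftrightarrow> elt f \<in> Arr C \<and> Dom C (elt f) = a \<and> Cod C (elt f) = tgt f"
proof -
  have "ob a \<and> tgt f \<in> Obj C" if "elt f \<in> Arr C" "Dom C (elt f) = a" "Cod C (elt f) = tgt f"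
    using that obj_simps by metis
  then show ?thesis using assms mm_unary
    by (auto simp: valid_def mtype_def mm_kinds_def hom_def)
qed

lemma unary_valid [simp]: "ar p \<Longrightarrow> valid M (unary M p)"
  by (simp add: valid_unary_iff)

lemma unary_elt: "valid M f \<Longrightarrow> mtype f = (Tight, 1) \<Longrightarrow> unary M (elt f) = f"
  using valid_unary_iff[of f "hd (src f)"]
  by (intro tmap_eqI) (auto simp: mtype_def length_Suc_conv)

lemma comp_at_pre:
  assumes "1 \<le> i" "i \<le> length (src g)" "mtype f = (Tight, 1)"
  shows "g \<star>\<^bsub>i\<^esub> f = TM (knd g) ((src g)[i - 1 := hd (src f)]) (tgt g)
     (pre M (knd g) (src g) (tgt g) i (elt f) (elt g))"
  using assms by (auto simp: comp_at_def circ_def mtype_def length_Suc_conv)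

lemma comp_at_post:
  assumes f: "valid M f" and g: "valid M g" "mtype g = (Tight, 1)" "src g = [tgt f]"
  shows "g \<star> f = TM (knd f) (src f) (tgt g) (post M (knd f) (src f) (elt g) (elt f))"
proof (cases "mtype f = (Tight, 1)")
  case True
  then obtain a where a: "src f = [a]" "knd f = Tight" by (auto simp: mtype_def length_Suc_conv)
  have b: "knd g = Tight" using g by (auto simp: mtype_def)
  have e: "elt f \<in> Arr C" "Dom C (elt f) = a" "Cod C (elt f) = tgt f"
    "elt g \<in> Arr C" "Dom C (elt g) = tgt f" "Cod C (elt g) = tgt g"
    using f g(1) valid_unary_iff[OF a(2,1)] valid_unary_iff[OF b g(3)] by auto
  have o: "ob a" "tgt g \<in> Obj C" using f g(1) a by (auto simp: valid_def)
  have "pre M Tight [tgt f] (tgt g) 1 (elt f) (elt g) = Comp C (elt g) (elt f)"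
    using e o by (simp add: pre_eq act_unary)
  moreover have "post M Tight [a] (elt g) (elt f) = Comp C (elt g) (elt f)"
    using e o by (simp add: post_eq act_unary)
  ultimately show ?thesis
    using a b g(3) by (simp add: comp_at_def circ_def plug_def)
next
  case False
  then show ?thesis using g by (cases "knd f") (auto simp: comp_at_def circ_def plug_def mtype_def tl_comp_def)
qed

lemma comp_at_msub:
  assumes "(mtype g, mtype f) \<in> sub_cases"
  shows "g \<star>\<^bsub>i\<^esub> f = TM (tl_comp (knd g) i (knd f)) (plug (src g) i (src f)) (tgt g)
     (msub M (knd g) (src g) (tgt g) i (knd f) (src f) (elt g) (elt f))"
  using assms by (auto simp: comp_at_def circ_def mtype_def sub_cases_def)

lemma valid_comp_at:
  assumes g: "valid M g" and f: "valid M f" and t: "composable (mtype g) (mtype f)"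
    and i: "1 \<le> i" "i \<le> length (src g)" "tgt f = src g ! (i - 1)"
  shows "valid M (g \<star>\<^bsub>i\<^esub> f)"
proof -
  have k: "mtype (g \<star>\<^bsub>i\<^esub> f) \<in> mm_kinds"
    using composable_comp_kinds t i by (simp add: mtype_def)
  have s: "set (src (g \<star>\<^bsub>i\<^esub> f)) \<subseteq> Obj C" using f g by (simp add: set_plug valid_def)
  have gk: "(knd g, length (src g)) \<in> mm_kinds" and fk: "(knd f, length (src f)) \<in> mm_kinds"
    using f g by (auto simp: valid_def mtype_def)
  consider (sub) "(mtype g, mtype f) \<in> sub_cases" | (pre) "mtype f = (Tight, 1)" | (post) "mtype g = (Tight, 1)"
    using t by (auto simp: composable_def)
  then have "elt (g \<star>\<^bsub>i\<^esub> f) \<in> mm M (tl_comp (knd g) i (knd f)) (plug (src g) i (src f)) (tgt g)"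
  proof cases
    case sub
    have "msub M (knd g) (src g) (tgt g) i (knd f) (src f) (elt g) (elt f)
        \<in> mm M (tl_comp (knd g) i (knd f)) (plug (src g) i (src f)) (tgt g)"
    proof (rule sub_type)
      show "((knd g, length (src g)), knd f, length (src f)) \<in> sub_cases" using sub by (simp add: mtype_def)
      show "elt f \<in> mm M (knd f) (src f) (src g ! (i - 1))" using f i(3) by (simp add: valid_def)
    qed (use f g i in \<open>simp_all add: valid_def\<close>)
    then show ?thesis by (simp add: comp_at_msub[OF sub])
  next
    case pre
    then obtain a where a: "knd f = Tight" "src f = [a]" by (auto simp: mtype_def length_Suc_conv)
    have e: "elt f \<in> Arr C" "Dom C (elt f) = a" "Cod C (elt f) = src g ! (i - 1)"
      using f a i(3) by (simp_all add: valid_unary_iff)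
    have "pre M (knd g) (src g) (tgt g) i (elt f) (elt g) \<in> mm M (knd g) ((src g)[i - 1 := a]) (tgt g)"
      using pre_in[OF gk _ _ _ e(1,3), of "tgt g" "elt g"] g e(2) by (simp add: valid_def)
    then show ?thesis using i a by (simp add: comp_at_pre[OF i(1,2) pre])
  next
    case post
    then obtain b where b: "knd g = Tight" "src g = [b]" by (auto simp: mtype_def length_Suc_conv)
    with i have i1: "i = 1" by simp
    have "elt (g \<star> f) = post M (knd f) (src f) (elt g) (elt f)"
      using comp_at_post[OF f g post] b i by simp
    moreover have e: "elt g \<in> Arr C" "Dom C (elt g) = tgt f" "Cod C (elt g) = tgt g"
      using g b i by (simp_all add: valid_unary_iff)
    moreover have "post M (knd f) (src f) (elt g) (elt f) \<in> mm M (knd f) (src f) (tgt g)"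
      using post_in[OF fk, of "elt f" "elt g"] f e by (simp add: valid_def)
    ultimately show ?thesis using b by (simp add: i1 plug_1)
  qed
  then show ?thesis using k s g by (simp add: valid_def)
qed

lemma valid_mtype: "valid M f \<Longrightarrow> mtype f \<in> mm_kinds"
  by (simp add: valid_def)

end

section \<open>The laws of substitution\<close>

lemma plug_update_inner:
  assumes "1 \<le> i" "i \<le> length bs" "1 \<le> j" "j \<le> length as"
  shows "plug bs i (as[j - 1 := x]) = (plug bs i as)[j + i - 1 - 1 := x]"
proof -
  obtain i' j' where [simp]: "i = Suc i'" "j = Suc j'" using assms by (cases i; cases j) auto
  show ?thesis using assms by (simp add: plug_def list_update_append)
qed

lemma plug_update_outer:
  assumes "1 \<le> i" "i \<le> length bs" "1 \<le> k" "k \<le> length bs" "k \<noteq> i"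
  shows "plug (bs[k - 1 := x]) i as = (plug bs i as)[(if k < i then k else k + length as - 1) - 1 := x]"
proof -
  obtain i' k' where [simp]: "i = Suc i'" "k = Suc k'" using assms by (cases i; cases k) auto
  show ?thesis
  proof (cases "k' < i'")
    case True
    then show ?thesis using assms
      by (simp add: plug_def list_update_append take_update_swap drop_update_cancel)
  next
    case False
    then obtain d where [simp]: "k' = Suc (i' + d)" using assms by (metis \<open>i = Suc i'\<close> \<open>k = Suc k'\<close> less_imp_Suc_add linorder_neqE_nat)
    show ?thesis using assms
      by (simp add: plug_def list_update_append take_update_cancel drop_update_swap)
  qed
qed

context short_skew_multicategory
begin

lemma map2_comp_idn:
  assumes bs: "set bs \<subseteq> Obj C" and i: "i < length bs" and p: "ar p" "Cod C p = bs ! i"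
  shows "map2 (Comp C) ((map (Idn C) bs)[i := p]) (map (Idn C) (bs[i := Dom C p])) = (map (Idn C) bs)[i := p]"
    and "map2 (Comp C) (map (Idn C) bs) ((map (Idn C) bs)[i := p]) = (map (Idn C) bs)[i := p]"
    and "ar p' \<Longrightarrow> Cod C p' = Dom C p \<Longrightarrow>
      map2 (Comp C) ((map (Idn C) bs)[i := p]) ((map (Idn C) (bs[i := Dom C p]))[i := p']) = (map (Idn C) bs)[i := Comp C p p']"
    and "k < length bs \<Longrightarrow> k \<noteq> i \<Longrightarrow> ar r \<Longrightarrow> Cod C r = bs ! k \<Longrightarrow>
      map2 (Comp C) ((map (Idn C) bs)[i := p]) ((map (Idn C) (bs[i := Dom C p]))[k := r]) = (map (Idn C) bs)[i := p, k := r]"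
proof -
  have [simp]: "bs ! k \<in> Obj C" if "k < length bs" for k using bs that by auto
  note [simp] = nth_list_update and [intro!] = nth_equalityI
  show "map2 (Comp C) ((map (Idn C) bs)[i := p]) (map (Idn C) (bs[i := Dom C p])) = (map (Idn C) bs)[i := p]"
    using p i by auto
  show "map2 (Comp C) (map (Idn C) bs) ((map (Idn C) bs)[i := p]) = (map (Idn C) bs)[i := p]"
    using p i by auto
  show "ar p' \<Longrightarrow> Cod C p' = Dom C p \<Longrightarrow>
      map2 (Comp C) ((map (Idn C) bs)[i := p]) ((map (Idn C) (bs[i := Dom C p]))[i := p']) = (map (Idn C) bs)[i := Comp C p p']"
    using p i by auto
  show "k < length bs \<Longrightarrow> k \<noteq> i \<Longrightarrow> ar r \<Longrightarrow> Cod C r = bs ! k \<Longrightarrow>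
      map2 (Comp C) ((map (Idn C) bs)[i := p]) ((map (Idn C) (bs[i := Dom C p]))[k := r]) = (map (Idn C) bs)[i := p, k := r]"
    using p i by auto
qed

lemma map2_idn_idn: "set bs \<subseteq> Obj C \<Longrightarrow> map2 (Comp C) (map (Idn C) bs) (map (Idn C) bs) = map (Idn C) bs"
  by (intro nth_equalityI) (auto simp: subset_iff)

lemma arr_idn: "set bs \<subseteq> Obj C \<Longrightarrow> set (map (Idn C) bs) \<subseteq> Arr C"
  by auto

lemma act_act_eq:
  assumes "(x, length ps) \<in> mm_kinds" "set ps \<subseteq> Arr C" "ar q" "map (Cod C) ps = bs" "Dom C q = c" "f \<in> mm M x bs c"
    and "set ps' \<subseteq> Arr C" "ar q'" "map (Cod C) ps' = as" "map (Dom C) ps = as" "Dom C q' = Cod C q"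
    and "map2 (Comp C) ps ps' = ps''" "Comp C q' q = q''"
  shows "act x ps' q' (act x ps q f) = act x ps'' q'' f"
  using act_act[of x ps q f ps' q'] assms by simp

context
  fixes x :: tl and bs :: "'o list" and c :: 'o and g :: 'm
  assumes k: "(x, length bs) \<in> mm_kinds" and bs: "set bs \<subseteq> Obj C" and c: "ob c" and g: "g \<in> mm M x bs c"
begin

lemma pre_pre_same:
  assumes i: "1 \<le> i" "i \<le> length bs" and p: "ar p" "Cod C p = bs ! (i - 1)" and p': "ar p'" "Cod C p' = Dom C p"
  shows "pre M x (bs[i - 1 := Dom C p]) c i p' (pre M x bs c i p g) = pre M x bs c i (Comp C p p') g"
proof -
  have i': "i - 1 < length bs" using i by simp
  have bs': "set (bs[i - 1 := Dom C p]) \<subseteq> Obj C" using bs p by (simp add: set_update_subsetI)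
  have e: "Cod C p' = bs[i - 1 := Dom C p] ! (i - 1)" using p' i' by simp
  show ?thesis unfolding pre_eq
    by (rule act_act_eq[OF _ arr_list_update[OF bs p(1)] _ cod_list_update[OF bs p(2)] _ g
          arr_list_update[OF bs' p'(1)] _ cod_list_update[OF bs' e] dom_list_update[OF bs] _ map2_comp_idn(3)[OF bs i' p p']])
      (use c k in simp_all)
qed

lemma pre_pre_diff:
  assumes i: "1 \<le> i" "i \<le> length bs" and p: "ar p" "Cod C p = bs ! (i - 1)"
    and k': "1 \<le> k" "k \<le> length bs" "k \<noteq> i" and r: "ar r" "Cod C r = bs ! (k - 1)"
  shows "pre M x (bs[i - 1 := Dom C p]) c k r (pre M x bs c i p g) =
    pre M x (bs[k - 1 := Dom C r]) c i p (pre M x bs c k r g)"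
proof -
  have *: "pre M x (bs[i - 1 := Dom C p]) c k r (pre M x bs c i p g) =
      act x ((map (Idn C) bs)[i - 1 := p, k - 1 := r]) (Idn C c) g"
    if i: "1 \<le> i" "i \<le> length bs" and p: "ar p" "Cod C p = bs ! (i - 1)"
    and k': "1 \<le> k" "k \<le> length bs" "k \<noteq> i" and r: "ar r" "Cod C r = bs ! (k - 1)" for i p k r
  proof -
    have i': "i - 1 < length bs" "k - 1 < length bs" "k - 1 \<noteq> i - 1" using i k' by auto
    have bs': "set (bs[i - 1 := Dom C p]) \<subseteq> Obj C" using bs p by (simp add: set_update_subsetI)
    have e: "Cod C r = bs[i - 1 := Dom C p] ! (k - 1)" using r i' by simp
    show ?thesis unfolding pre_eq
      by (rule act_act_eq[OF _ arr_list_update[OF bs p(1)] _ cod_list_update[OF bs p(2)] _ g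
          arr_list_update[OF bs' r(1)] _ cod_list_update[OF bs' e] dom_list_update[OF bs] _ map2_comp_idn(4)[OF bs i'(1) p i'(2,3) r]])
        (use c \<open>(x, length bs) \<in> mm_kinds\<close> in simp_all)
  qed
  have "k - 1 \<noteq> i - 1" using k' i by auto
  then show ?thesis using *[OF i p k' r] *[OF k'(1,2) r i k'(3)[symmetric] p]
    by (simp add: list_update_swap)
qed

lemma post_pre:
  assumes i: "1 \<le> i" "i \<le> length bs" and p: "ar p" "Cod C p = bs ! (i - 1)" and q: "ar q" "Dom C q = c"
  shows "post M x (bs[i - 1 := Dom C p]) q (pre M x bs c i p g) = pre M x bs (Cod C q) i p (post M x bs q g)"
proof -
  have i': "i - 1 < length bs" using i by simp
  have bs': "set (bs[i - 1 := Dom C p]) \<subseteq> Obj C" using bs p by (simp add: set_update_subsetI)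
  have "post M x (bs[i - 1 := Dom C p]) q (pre M x bs c i p g) = act x ((map (Idn C) bs)[i - 1 := p]) q g"
    unfolding pre_eq post_eq
    by (rule act_act_eq[OF _ arr_list_update[OF bs p(1)] _ cod_list_update[OF bs p(2)] _ g
          arr_idn[OF bs'] _ map_cod_idn[OF bs'] dom_list_update[OF bs] _ map2_comp_idn(1)[OF bs i' p]])
      (use c k q in simp_all)
  moreover have "pre M x bs (Cod C q) i p (post M x bs q g) = act x ((map (Idn C) bs)[i - 1 := p]) q g"
    unfolding pre_eq post_eq
    by (rule act_act_eq[OF _ arr_idn[OF bs] _ map_cod_idn[OF bs] _ g
          arr_list_update[OF bs p(1)] _ cod_list_update[OF bs p(2)] map_dom_idn[OF bs] _ map2_comp_idn(2)[OF bs i' p]])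
      (use c k q in simp_all)
  ultimately show ?thesis by simp
qed

lemma post_post:
  assumes q: "ar q" "Dom C q = c" and q': "ar q'" "Dom C q' = Cod C q"
  shows "post M x bs q' (post M x bs q g) = post M x bs (Comp C q' q) g"
  unfolding post_eq
  by (rule act_act_eq[OF _ arr_idn[OF bs] _ map_cod_idn[OF bs] _ g
        arr_idn[OF bs] _ map_cod_idn[OF bs] map_dom_idn[OF bs] _ map2_idn_idn[OF bs]])
    (use c k q q' in simp_all)

lemma pre_idn:
  assumes "1 \<le> i" "i \<le> length bs" shows "pre M x bs c i (Idn C (bs ! (i - 1))) g = g"
proof -
  have "(map (Idn C) bs)[i - 1 := Idn C (bs ! (i - 1))] = map (Idn C) bs"
    using assms by (metis list_update_id map_update)
  then show ?thesis using act_idn[OF k bs c g] by (simp add: pre_eq)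
qed

lemma post_idn: "post M x bs (Idn C c) g = g"
  using act_idn[OF k bs c g] by (simp add: post_eq)

end

lemma unary_cases:
  assumes "valid M f" "mtype f = (Tight, 1)"
  obtains p where "ar p" "f = unary M p"
proof -
  obtain a where "knd f = Tight" "src f = [a]" using assms by (auto simp: mtype_def length_Suc_conv)
  with assms have "elt f \<in> Arr C" by (simp add: valid_unary_iff)
  with unary_elt[OF assms] show ?thesis by (metis that)
qed

lemma mtype_unary [simp]: "mtype (unary M p) = (Tight, 1)"
  by (simp add: mtype_def)

lemma comp_at_unary:
  assumes "1 \<le> i" "i \<le> length (src g)"
  shows "g \<star>\<^bsub>i\<^esub> unary M p = TM (knd g) ((src g)[i - 1 := Dom C p]) (tgt g)
     (pre M (knd g) (src g) (tgt g) i p (elt g))"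
  using assms by (simp add: comp_at_pre)

lemma unary_comp_at:
  assumes "valid M f" "ar p" "Dom C p = tgt f"
  shows "unary M p \<star> f = TM (knd f) (src f) (Cod C p) (post M (knd f) (src f) p (elt f))"
  using assms by (simp add: comp_at_post)

lemma unary_unary:
  assumes "ar p" "ar q" "Dom C q = Cod C p"
  shows "unary M q \<star> unary M p = unary M (Comp C q p)"
  using assms by (simp add: unary_comp_at) (simp add: unary_def post_eq act_unary)

lemma comp_at_idn:
  assumes "valid M g" "1 \<le> i" "i \<le> length (src g)" "a = src g ! (i - 1)"
  shows "g \<star>\<^bsub>i\<^esub> unary M (Idn C a) = g"
proof -
  have "ob a" using assms nth_mem[of "i - 1" "src g"] by (auto simp: valid_def simp del: nth_mem)
  then show ?thesis using assms pre_idn[of "knd g" "src g" "tgt g" "elt g" i]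
    by (intro tmap_eqI) (simp_all add: comp_at_unary valid_def mtype_def)
qed

lemma idn_comp_at:
  assumes "valid M f" "a = tgt f"
  shows "unary M (Idn C a) \<star> f = f"
proof -
  have "ob a" using assms by (auto simp: valid_def)
  then show ?thesis using assms post_idn[of "knd f" "src f" "tgt f" "elt f"]
    by (intro tmap_eqI) (simp_all add: unary_comp_at valid_def mtype_def)
qed

lemma validD:
  assumes "valid M f"
  shows "(knd f, length (src f)) \<in> mm_kinds" "set (src f) \<subseteq> Obj C" "tgt f \<in> Obj C" "elt f \<in> mm M (knd f) (src f) (tgt f)"
  using assms by (auto simp: valid_def mtype_def)

lemma assoc_post:
  assumes q: "ar q" "Dom C q = tgt g" and g: "valid M g" and h: "valid M h"
    and t: "composable (mtype g) (mtype h)" and j: "1 \<le> j" "j \<le> length (src g)" "tgt h = src g ! (j - 1)"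
  shows "unary M q \<star> (g \<star>\<^bsub>j\<^esub> h) = (unary M q \<star> g) \<star>\<^bsub>j\<^esub> h"
proof -
  note gh = valid_comp_at[OF g h t j]
  consider (sub) "(mtype g, mtype h) \<in> sub_cases" | (pre) "mtype h = (Tight, 1)" | (post) "mtype g = (Tight, 1)"
    using t by (auto simp: composable_def)
  then show ?thesis
  proof cases
    case sub
    have q': "q \<in> hom C (tgt g) (Cod C q)" using q by (simp add: hom_def)
    have qg: "unary M q \<star> g = TM (knd g) (src g) (Cod C q) (post M (knd g) (src g) q (elt g))"
      using unary_comp_at[OF g q] .
    have t': "(mtype (TM (knd g) (src g) (Cod C q) (post M (knd g) (src g) q (elt g))), mtype h) \<in> sub_cases"
      using sub by (simp add: mtype_def)
    have l: "unary M q \<star> (g \<star>\<^bsub>j\<^esub> h) = TM (tl_comp (knd g) j (knd h)) (plug (src g) j (src h)) (Cod C q)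
        (post M (tl_comp (knd g) j (knd h)) (plug (src g) j (src h)) q (elt (g \<star>\<^bsub>j\<^esub> h)))"
      using unary_comp_at[OF gh q(1)] q(2) by simp
    show ?thesis
      unfolding l unfolding qg comp_at_msub[OF sub] comp_at_msub[OF t']
      using sub_nat_target[OF sub[unfolded mtype_def] _ _ _ j(1,2) _ _ q'] validD[OF g] validD[OF h] j by simp
  next
    case pre
    then obtain p where p: "ar p" "h = unary M p" using unary_cases h by blast
    have gp: "g \<star>\<^bsub>j\<^esub> h = TM (knd g) ((src g)[j - 1 := Dom C p]) (tgt g) (pre M (knd g) (src g) (tgt g) j p (elt g))"
      using j by (simp add: p comp_at_unary)
    show ?thesis
      using post_pre[OF validD[OF g] j(1,2) p(1), of q] gh q j(3) p j
        unary_comp_at[OF gh q(1)]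
      unfolding gp by (simp add: unary_comp_at[OF g] comp_at_unary)
  next
    case post
    then obtain p where p: "ar p" "g = unary M p" using unary_cases g by blast
    then have j1: "j = 1" and h': "tgt h = Dom C p" using j by auto
    have ph: "unary M p \<star> h = TM (knd h) (src h) (Cod C p) (post M (knd h) (src h) p (elt h))"
      using unary_comp_at[OF h] p h' by simp
    show ?thesis
      using post_post[OF validD[OF h], of p q] p q gh h'
        unary_comp_at[OF gh q(1)] unary_comp_at[OF h, of "Comp C q p"]
      by (simp add: p j1 unary_unary) (simp add: ph plug_1)
  qed
qed

lemma assoc_mid:
  assumes f: "valid M f" and p: "ar p" and h: "valid M h" "tgt h = Dom C p"
    and t: "composable (mtype f) (mtype h)" and i: "1 \<le> i" "i \<le> length (src f)" "Cod C p = src f ! (i - 1)"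
  shows "f \<star>\<^bsub>i\<^esub> (unary M p \<star> h) = (f \<star>\<^bsub>i\<^esub> unary M p) \<star>\<^bsub>i\<^esub> h"
proof -
  have ph: "unary M p \<star> h = TM (knd h) (src h) (Cod C p) (post M (knd h) (src h) p (elt h))"
    using unary_comp_at[OF h(1)] p h by simp
  consider (sub) "(mtype f, mtype h) \<in> sub_cases" | (pre) "mtype h = (Tight, 1)" | (post) "mtype f = (Tight, 1)"
    using t by (auto simp: composable_def)
  then show ?thesis
  proof cases
    case sub
    have p': "p \<in> hom C (Dom C p) (src f ! (i - 1))" using p i by (simp add: hom_def)
    have fp: "f \<star>\<^bsub>i\<^esub> unary M p = TM (knd f) ((src f)[i - 1 := Dom C p]) (tgt f) (pre M (knd f) (src f) (tgt f) i p (elt f))"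
      using i by (simp add: comp_at_unary)
    have t1: "(mtype (TM (knd f) ((src f)[i - 1 := Dom C p]) (tgt f) (pre M (knd f) (src f) (tgt f) i p (elt f))), mtype h) \<in> sub_cases"
      and t2: "(mtype f, mtype (TM (knd h) (src h) (Cod C p) (post M (knd h) (src h) p (elt h)))) \<in> sub_cases"
      using sub by (simp_all add: mtype_def)
    have pl: "plug ((src f)[i - 1 := Dom C p]) i (src h) = plug (src f) i (src h)"
      using i by (simp add: plug_def)
    show ?thesis
      unfolding ph fp comp_at_msub[OF t1] comp_at_msub[OF t2]
      using sub_dinat[OF sub[unfolded mtype_def] _ _ _ i(1,2) _ p'] validD[OF f] validD[OF h(1)] i h pl by simp
  next
    case pre
    then obtain r where r: "ar r" "h = unary M r" using unary_cases h by blast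
    show ?thesis
      using pre_pre_same[OF validD[OF f] i(1,2) p i(3) r(1)] r h p i
      by (simp add: unary_unary) (simp add: comp_at_unary)
  next
    case post
    then obtain q where q: "ar q" "f = unary M q" using unary_cases f by blast
    then have i1: "i = 1" using i by simp
    then show ?thesis
      using assoc_post[OF q(1), of "unary M p" h] q p h i
      by (simp add: composable_def valid_mtype)
  qed
qed

lemma assoc_pre:
  assumes f: "valid M f" and g: "valid M g" and p: "ar p" "Cod C p = src g ! (j - 1)"
    and t: "composable (mtype f) (mtype g)" and i: "1 \<le> i" "i \<le> length (src f)" "tgt g = src f ! (i - 1)"
    and j: "1 \<le> j" "j \<le> length (src g)"
  shows "f \<star>\<^bsub>i\<^esub> (g \<star>\<^bsub>j\<^esub> unary M p) = (f \<star>\<^bsub>i\<^esub> g) \<star>\<^bsub>j + i - 1\<^esub> unary M p"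
proof -
  consider (sub) "(mtype f, mtype g) \<in> sub_cases" | (pre) "mtype g = (Tight, 1)" | (post) "mtype f = (Tight, 1)"
    using t by (auto simp: composable_def)
  then show ?thesis
  proof cases
    case sub
    have p': "p \<in> hom C (Dom C p) (src g ! (j - 1))" using p by (simp add: hom_def)
    have gp: "g \<star>\<^bsub>j\<^esub> unary M p = TM (knd g) ((src g)[j - 1 := Dom C p]) (tgt g) (pre M (knd g) (src g) (tgt g) j p (elt g))"
      using j by (simp add: comp_at_unary)
    have t1: "(mtype f, mtype (TM (knd g) ((src g)[j - 1 := Dom C p]) (tgt g) (pre M (knd g) (src g) (tgt g) j p (elt g)))) \<in> sub_cases"
      using sub by (simp_all add: mtype_def)
    have l: "j + i - 1 \<le> length (plug (src f) i (src g))" "1 \<le> j + i - 1"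
      using i j by (auto simp: length_plug)
    have pl: "plug (src f) i ((src g)[j - 1 := Dom C p]) = (plug (src f) i (src g))[j + i - Suc (Suc 0) := Dom C p]"
      using plug_update_inner[OF i(1,2) j] by simp
    have ij: "i + j - 1 = j + i - 1" by simp
    show ?thesis
      using sub_nat_inner[OF sub[unfolded mtype_def] _ _ _ i(1,2) _ _ j p'] validD[OF f] validD[OF g] i l pl
      unfolding gp comp_at_msub[OF t1] comp_at_msub[OF sub] ij by (simp add: comp_at_unary)
  next
    case pre
    then obtain r where r: "ar r" "g = unary M r" using unary_cases g by blast
    then show ?thesis
      using assoc_mid[OF f r(1) unary_valid[OF p(1)]] valid_mtype[OF f] p i j by (simp add: composable_def)
  next
    case post
    then obtain q where q: "ar q" "f = unary M q" using unary_cases f by blast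
    then show ?thesis
      using assoc_post[OF q(1), of g "unary M p" j] g q p i j
      by (simp add: composable_def valid_mtype)
  qed
qed

text \<open>Actions of unary maps count as substitutions, so that functoriality, naturality and dinaturality are
  cases of this law, next to the associativity axiom.\<close>

theorem comp_at_assoc:
  assumes f: "valid M f" and g: "valid M g" and h: "valid M h"
    and t: "assoc_types (mtype f) (mtype g) (mtype h)"
    and i: "1 \<le> i" "i \<le> length (src f)" "tgt g = src f ! (i - 1)"
    and j: "1 \<le> j" "j \<le> length (src g)" "tgt h = src g ! (j - 1)"
  shows "f \<star>\<^bsub>i\<^esub> (g \<star>\<^bsub>j\<^esub> h) = (f \<star>\<^bsub>i\<^esub> g) \<star>\<^bsub>j + i - 1\<^esub> h"
proof -
  consider (1) "mtype f = (Tight, 1)" "composable (mtype g) (mtype h)" | (2) "mtype g = (Tight, 1)" "composable (mtype f) (mtype h)"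
    | (3) "mtype h = (Tight, 1)" "composable (mtype f) (mtype g)"
    | (4) "mtype f = (Tight, 2)" "mtype g = (Tight, 2)" "mtype h \<in> {(Tight, 2), (Loose, 0)}"
    using t by (auto simp: assoc_types_def)
  then show ?thesis
  proof cases
    case 1
    then obtain q where q: "ar q" "f = unary M q" using unary_cases f by blast
    then show ?thesis using assoc_post[OF q(1) _ g h 1(2) j] i by simp
  next
    case 2
    then obtain p where p: "ar p" "g = unary M p" using unary_cases g by blast
    then show ?thesis using assoc_mid[OF f p(1) h _ 2(2) i(1,2)] i j by simp
  next
    case 3
    then obtain p where p: "ar p" "h = unary M p" using unary_cases h by blast
    then show ?thesis using assoc_pre[OF f g p(1) _ 3(2) i j(1,2)] j by simp
  next
    case 4
    have "(knd h, length (src h)) \<in> {(Tight, 2), (Loose, 0)}" "knd f = Tight" "knd g = Tight"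
      "length (src f) = 2" "length (src g) = 2"
      using 4 by (simp_all add: mtype_def)
    then show ?thesis
      using assoc_nested[of "knd h" "src h" "src f" "src g" "tgt f" i j "elt f" "elt g" "elt h"] validD[OF f] validD[OF g] validD[OF h] i j
      by (simp add: comp_at_def) (auto simp: plug_def tl_comp_def numeral_2_eq_2 le_Suc_eq length_Suc_conv)
  qed
qed

lemma parallel_pre:
  assumes f: "valid M f" and g: "valid M g" and p: "ar p" "Cod C p = src f ! (k - 1)"
    and t: "composable (mtype f) (mtype g)" and i: "1 \<le> i" "i \<le> length (src f)" "tgt g = src f ! (i - 1)"
    and k: "1 \<le> k" "k \<le> length (src f)" "k \<noteq> i"
  shows "(f \<star>\<^bsub>k\<^esub> unary M p) \<star>\<^bsub>i\<^esub> g =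
    (f \<star>\<^bsub>i\<^esub> g) \<star>\<^bsub>if k < i then k else k + length (src g) - 1\<^esub> unary M p"
proof -
  let ?k = "if k < i then k else k + length (src g) - 1"
  have fp: "f \<star>\<^bsub>k\<^esub> unary M p = TM (knd f) ((src f)[k - 1 := Dom C p]) (tgt f) (pre M (knd f) (src f) (tgt f) k p (elt f))"
    using k by (simp add: comp_at_unary)
  consider (sub) "(mtype f, mtype g) \<in> sub_cases" | (pre) "mtype g = (Tight, 1)" | (post) "mtype f = (Tight, 1)"
    using t by (auto simp: composable_def)
  then show ?thesis
  proof cases
    case sub
    have p': "p \<in> hom C (Dom C p) (src f ! (k - 1))" using p by (simp add: hom_def)
    have t1: "(mtype (TM (knd f) ((src f)[k - 1 := Dom C p]) (tgt f) (pre M (knd f) (src f) (tgt f) k p (elt f))), mtype g) \<in> sub_cases"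
      using sub by (simp_all add: mtype_def)
    have l: "?k \<le> length (plug (src f) i (src g))" "1 \<le> ?k"
      using i k by (auto simp: length_plug)
    have pl: "plug ((src f)[k - 1 := Dom C p]) i (src g) = (plug (src f) i (src g))[?k - 1 := Dom C p]"
      by (rule plug_update_outer[OF i(1,2) k])
    show ?thesis
      using sub_nat_outer[OF sub[unfolded mtype_def] _ _ _ i(1,2) _ _ k p'] validD[OF f] validD[OF g] i pl comp_at_unary[of ?k "f \<star>\<^bsub>i\<^esub> g" p] l
      unfolding fp comp_at_msub[OF t1] comp_at_msub[OF sub] by simp
  next
    case pre
    then obtain r where r: "ar r" "g = unary M r" using unary_cases g by blast
    have "?k = k" using k r by auto
    moreover have "k - 1 \<noteq> i - 1" using i k by auto
    ultimately show ?thesis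
      using pre_pre_diff[OF validD[OF f] i(1,2) r(1) _ k p] r i k
      by (simp add: comp_at_unary list_update_swap)
  next
    case post
    then show ?thesis using i k by (simp add: mtype_def)
  qed
qed

theorem comp_at_parallel:
  assumes f: "valid M f" and g: "valid M g" and h: "valid M h"
    and t: "parallel_types (mtype f) (mtype g) (mtype h)"
    and i: "1 \<le> i" "tgt g = src f ! (i - 1)"
    and k: "i < k" "k \<le> length (src f)" "tgt h = src f ! (k - 1)"
  shows "(f \<star>\<^bsub>i\<^esub> g) \<star>\<^bsub>k + length (src g) - 1\<^esub> h = (f \<star>\<^bsub>k\<^esub> h) \<star>\<^bsub>i\<^esub> g"
proof -
  consider (1) "mtype g = (Tight, 1)" "composable (mtype f) (mtype h)" | (2) "mtype h = (Tight, 1)" "composable (mtype f) (mtype g)"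
    | (3) "mtype f = (Tight, 2)" "mtype g \<in> {(Tight, 2), (Loose, 0)}" "mtype h \<in> {(Tight, 2), (Loose, 0)}"
    using t by (auto simp: parallel_types_def)
  then show ?thesis
  proof cases
    case 1
    then obtain p where p: "ar p" "g = unary M p" using unary_cases g by blast
    then show ?thesis using parallel_pre[OF f h p(1) _ 1(2), of i k] i k by simp
  next
    case 2
    then obtain p where p: "ar p" "h = unary M p" using unary_cases h by blast
    then show ?thesis using parallel_pre[OF f g p(1) _ 2(2), of k i] i k by simp
  next
    case 3
    then obtain b1 b2 where b: "src f = [b1, b2]" by (auto simp: mtype_def numeral_2_eq_2 length_Suc_conv)
    have kd: "(knd h, length (src h)) \<in> {(Tight, 2), (Loose, 0)}" "(knd g, length (src g)) \<in> {(Tight, 2), (Loose, 0)}" "knd f = Tight"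
      using 3 by (simp_all add: mtype_def)
    have ik: "i = Suc 0" "k = 2" using i k b by auto
    have eq: "circ M (tl_comp Tight 1 (knd g)) (src g @ [b2]) (tgt f) (length (src g) + 1) (knd h) (src h)
         (circ M Tight [b1, b2] (tgt f) 1 (knd g) (src g) (elt f) (elt g)) (elt h) =
       circ M (tl_comp Tight 2 (knd h)) (b1 # src h) (tgt f) 1 (knd g) (src g)
         (circ M Tight [b1, b2] (tgt f) 2 (knd h) (src h) (elt f) (elt h)) (elt g)"
      by (rule assoc_parallel[OF kd(2,1)])
        (use validD[OF f] validD[OF g] validD[OF h] i k b ik kd(3) in auto)
    have pl: "plug [b1, b2] (Suc 0) (src g) = src g @ [b2]" "plug [b1, b2] 2 (src h) = b1 # src h"
      "plug (src g @ [b2]) (Suc (length (src g))) (src h) = src g @ src h"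
      "plug (b1 # src h) (Suc 0) (src g) = src g @ src h"
      by (simp_all add: plug_def)
    have tl: "tl_comp (knd g) (Suc (length (src g))) (knd h) = tl_comp (tl_comp Tight 2 (knd h)) (Suc 0) (knd g)"
      using 3 by (auto simp: mtype_def tl_comp_def)
    show ?thesis
      using eq by (simp add: comp_at_def b ik pl kd(3) tl)
  qed
qed

end

section \<open>Tensor and unit multimaps\<close>

lemma mm_kinds_Suc [simp]:
  "(Tight, Suc 0) \<in> mm_kinds" "(Tight, Suc (Suc 0)) \<in> mm_kinds" "(Tight, Suc (Suc (Suc 0))) \<in> mm_kinds"
  "(Tight, Suc (Suc (Suc (Suc 0)))) \<in> mm_kinds"
  "(Loose, 0) \<in> mm_kinds" "(Loose, Suc 0) \<in> mm_kinds" "(Loose, Suc (Suc 0)) \<in> mm_kinds"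
  by (simp_all add: mm_kinds_def)

lemma composable_Suc [simp]:
  "composable (Tight, Suc (Suc 0)) (Tight, Suc (Suc 0))" "composable (Tight, Suc (Suc (Suc 0))) (Tight, Suc (Suc 0))"
  "composable (Tight, Suc (Suc 0)) (Tight, Suc (Suc (Suc 0)))" "composable (Tight, Suc (Suc 0)) (Loose, 0)"
  "composable (Tight, Suc (Suc (Suc 0))) (Loose, 0)" "composable (Loose, Suc 0) (Loose, 0)"
  "composable (Tight, Suc (Suc 0)) (Loose, Suc 0)" "composable (Loose, Suc 0) (Tight, Suc (Suc 0))"
  "composable (Tight, Suc 0) s \<longleftrightarrow> s \<in> mm_kinds" "composable t (Tight, Suc 0) \<longleftrightarrow> t \<in> mm_kinds"
  by (auto simp: composable_def sub_cases_def mm_kinds_def)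

lemma assoc_types_Suc [simp]:
  "assoc_types (Tight, Suc 0) s r \<longleftrightarrow> composable s r \<or> s = (Tight, Suc 0) \<and> r \<in> mm_kinds \<or> r = (Tight, Suc 0) \<and> s \<in> mm_kinds"
  "assoc_types t (Tight, Suc 0) r \<longleftrightarrow> composable t r \<or> t = (Tight, Suc 0) \<and> r \<in> mm_kinds \<or> r = (Tight, Suc 0) \<and> t \<in> mm_kinds"
  "assoc_types t s (Tight, Suc 0) \<longleftrightarrow> composable t s \<or> t = (Tight, Suc 0) \<and> s \<in> mm_kinds \<or> s = (Tight, Suc 0) \<and> t \<in> mm_kinds"
  "assoc_types (Tight, Suc (Suc 0)) (Tight, Suc (Suc 0)) (Tight, Suc (Suc 0))"
  "assoc_types (Tight, Suc (Suc 0)) (Tight, Suc (Suc 0)) (Loose, 0)"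
  by (auto simp: assoc_types_def composable_def mm_kinds_def sub_cases_def)

lemma parallel_types_Suc [simp]:
  "composable t r \<Longrightarrow> parallel_types t (Tight, Suc 0) r"
  "composable t s \<Longrightarrow> parallel_types t s (Tight, Suc 0)"
  "parallel_types (Tight, Suc (Suc 0)) (Tight, Suc (Suc 0)) (Tight, Suc (Suc 0))"
  "parallel_types (Tight, Suc (Suc 0)) (Tight, Suc (Suc 0)) (Loose, 0)"
  "parallel_types (Tight, Suc (Suc 0)) (Loose, 0) (Tight, Suc (Suc 0))"
  "parallel_types (Tight, Suc (Suc 0)) (Loose, 0) (Loose, 0)"
  by (auto simp: parallel_types_def)

lemma plug_simps [simp]:
  "plug (b # bs) (Suc 0) as = as @ bs" "plug (b # b' # bs) 2 as = b # as @ bs" "plug (b # b' # b'' # bs) 3 as = b # b' # as @ bs"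
  by (simp_all add: plug_def)

lemma tl_comp_numeral [simp]: "tl_comp Tight 2 y = Tight" "tl_comp Tight 3 y = Tight"
  by (simp_all add: tl_comp_def)

context short_skew_multicategory
begin

abbreviation unary_syntax ("{|_|}") where "{|p|} \<equiv> unary M p"

lemma valid_comp [simp]:
  assumes "valid M g" "valid M f" "composable (knd g, length (src g)) (knd f, length (src f))"
    "Suc 0 \<le> i" "i \<le> length (src g)" "tgt f = src g ! (i - Suc 0)"
  shows "valid M (g \<star>\<^bsub>i\<^esub> f)"
  using valid_comp_at[OF assms(1,2)] assms by (simp add: mtype_def)

text \<open>The laws of substitution with the resulting position as a separate parameter, so that they apply
  to concrete positions.\<close>

lemma assoc:
  assumes "valid M f" "valid M g" "valid M h"
    and "assoc_types (knd f, length (src f)) (knd g, length (src g)) (knd h, length (src h))"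
    and "Suc 0 \<le> i" "i \<le> length (src f)" "tgt g = src f ! (i - Suc 0)"
    and "Suc 0 \<le> j" "j \<le> length (src g)" "tgt h = src g ! (j - Suc 0)" "k = j + i - Suc 0"
  shows "f \<star>\<^bsub>i\<^esub> (g \<star>\<^bsub>j\<^esub> h) = (f \<star>\<^bsub>i\<^esub> g) \<star>\<^bsub>k\<^esub> h"
  using comp_at_assoc[OF assms(1-3), of i j] assms by (simp add: mtype_def)

lemma parallel:
  assumes "valid M f" "valid M g" "valid M h"
    and "parallel_types (knd f, length (src f)) (knd g, length (src g)) (knd h, length (src h))"
    and "Suc 0 \<le> i" "tgt g = src f ! (i - Suc 0)"
    and "i < k" "k \<le> length (src f)" "tgt h = src f ! (k - Suc 0)" "l = k + length (src g) - Suc 0"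
  shows "(f \<star>\<^bsub>i\<^esub> g) \<star>\<^bsub>l\<^esub> h = (f \<star>\<^bsub>k\<^esub> h) \<star>\<^bsub>i\<^esub> g"
  using comp_at_parallel[OF assms(1-3), of i k] assms by (simp add: mtype_def)

lemma unary_comp_arrow:
  assumes "ar p" "ar q" "Dom C q = Cod C p"
  shows "{|Comp C q p|} = {|q|} \<star> {|p|}"
  using unary_unary[OF assms] by simp

lemma unary_inj: "{|p|} = {|q|} \<Longrightarrow> p = q"
  by (simp add: unary_def)

lemma jmap_valid [simp]:
  assumes f: "valid M f" and k: "knd f = Tight" "src f \<noteq> []" "length (src f) \<le> 2"
  shows "valid M (jmap M f)"
proof -
  have n: "length (src f) \<in> {1, 2}" using k by (cases "src f") (auto simp: le_Suc_eq numeral_2_eq_2)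
  note nt = j_nat[OF n]
  have "(src f, tgt f) \<in> Obj (mdom C (length (src f)))" using validD[OF f] by (simp add: mdom_simps)
  from set_cat_ap(1)[OF nat_transD(4)[OF nt this]] have "jm M (src f) (tgt f) (elt f) \<in> mm M Loose (src f) (tgt f)"
    using validD(4)[OF f] k by (simp add: jm_def mm_def)
  then show ?thesis using validD[OF f] n by (auto simp: valid_def mtype_def jmap_def mm_kinds_def)
qed

lemma jmap_act:
  assumes n: "length ps \<in> {1, 2}" and ps: "set ps \<subseteq> Arr C" "ar q" and f: "f \<in> mm M Tight (map (Cod C) ps) (Dom C q)"
  shows "jm M (map (Dom C) ps) (Cod C q) (act Tight ps q f) = act Loose ps q (jm M (map (Cod C) ps) (Dom C q) f)"
  using set_nat_trans_ap[OF j_nat[OF n], of "(ps, q)" "(map (Cod C) ps, Dom C q)" "(map (Dom C) ps, Cod C q)" f] assms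
  by (simp add: act_def jm_def mm_def hom_def mdom_simps)

lemma jmap_pre:
  assumes f: "valid M f" and k: "knd f = Tight" "src f \<noteq> []" "length (src f) \<le> 2"
    and p: "ar p" "Suc 0 \<le> i" "i \<le> length (src f)" "Cod C p = src f ! (i - Suc 0)"
  shows "jmap M (f \<star>\<^bsub>i\<^esub> {|p|}) = jmap M f \<star>\<^bsub>i\<^esub> {|p|}"
proof -
  have "length (src f) \<in> {1, 2}" using k by (cases "src f") (auto simp: le_Suc_eq numeral_2_eq_2)
  then have n: "length ((map (Idn C) (src f))[i - 1 := p]) \<in> {1, 2}" by simp
  note v = validD[OF f]
  show ?thesis using jmap_act[OF n arr_list_update[OF v(2) p(1)], of "Idn C (tgt f)" "elt f"] v p
    by (simp add: comp_at_unary jmap_def dom_list_update cod_list_update k pre_eq)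
qed

lemma jmap_post:
  assumes f: "valid M f" and k: "knd f = Tight" "src f \<noteq> []" "length (src f) \<le> 2"
    and q: "ar q" "Dom C q = tgt f"
  shows "jmap M ({|q|} \<star> f) = {|q|} \<star> jmap M f"
proof -
  have n: "length (map (Idn C) (src f)) \<in> {1, 2}" using k by (cases "src f") (auto simp: le_Suc_eq numeral_2_eq_2)
  note v = validD[OF f]
  show ?thesis
    unfolding unary_comp_at[OF f q] unary_comp_at[OF jmap_valid[OF f k], of q, simplified, OF q]
    using jmap_act[OF n arr_idn[OF v(2)], of q "elt f"] v q
    by (simp only: jmap_def k post_eq map_dom_idn map_cod_idn tmap.sel)
qed

lemma jmap_second:
  assumes g: "valid M g" "knd g = Tight" "src g = [b1, Cod C p]" and p: "ar p"
  shows "g \<star>\<^sub>2 jmap M {|p|} = g \<star>\<^sub>2 {|p|}"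
  using j_second[of "Dom C p" b1 "Cod C p" "tgt g" "elt g" p] validD[OF g(1)] g p
  by (simp add: comp_at_def jmap_def hom_def)

lemma jmap_first:
  assumes g: "valid M g" "knd g = Tight" "src g = [Cod C p, b2]" and p: "ar p"
  shows "g \<star> jmap M {|p|} = jmap M (g \<star> {|p|})"
  using j_first[of "Dom C p" "Cod C p" b2 "tgt g" "elt g" p] validD[OF g(1)] g p
  by (simp add: comp_at_def jmap_def hom_def)

lemma jmap_binary:
  assumes g: "valid M g" "knd g = Tight" "src g = [a1, a2]" and p: "ar p" "Dom C p = tgt g"
  shows "jmap M {|p|} \<star> g = jmap M ({|p|} \<star> g)"
  using j_binary[of a1 a2 "elt g" "tgt g" p "Cod C p"] validD[OF g(1)] g p
  by (simp add: comp_at_def jmap_def hom_def)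

lemma jmap_nullary:
  assumes v: "valid M v" "knd v = Loose" "src v = []" and p: "ar p" "Dom C p = tgt v"
  shows "jmap M {|p|} \<star> v = {|p|} \<star> v"
  using j_nullary[of "elt v" "tgt v" p "Cod C p"] validD[OF v(1)] v p
  by (simp add: comp_at_def jmap_def hom_def)

end

locale representable = short_skew_multicategory M for M :: "('o, 'm) ssm" +
  fixes D :: "('o, 'm) lr_data"
  assumes lr: "is_lr_data M D"
begin

abbreviation tensor (infixl "\<box>" 70) where "a \<box> b \<equiv> lr_tensor D a b"
abbreviation I where "I \<equiv> lr_unit D"
abbreviation tensor_arr (infixl "\<Otimes>" 70) where "p \<Otimes> q \<equiv> K_tens_arr D M p q"

definition \<theta> where "\<theta> a b = TM Tight [a, b] (a \<box> b) (lr_theta D a b)"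
definition u where "u = TM Loose [] I (lr_u D)"

lemma theta_sel [simp]: "knd (\<theta> a b) = Tight" "src (\<theta> a b) = [a, b]" "tgt (\<theta> a b) = a \<box> b"
  by (simp_all add: \<theta>_def)

lemma u_sel [simp]: "knd u = Loose" "src u = []" "tgt u = I"
  by (simp_all add: u_def)

lemma tensor_obj [simp]: "ob a \<Longrightarrow> ob b \<Longrightarrow> a \<box> b \<in> Obj C"
  and I_obj [simp]: "ob I"
  using lr by (auto simp: is_lr_data_def)

lemma theta_valid [simp]: "ob a \<Longrightarrow> ob b \<Longrightarrow> valid M (\<theta> a b)"
  using lr by (simp add: is_lr_data_def valid_def \<theta>_def mtype_def)

lemma u_valid [simp]: "valid M u"
  using lr by (simp add: is_lr_data_def valid_def u_def mtype_def)

lemma kind_Cons_le: "length xs \<le> 2 \<Longrightarrow> (Tight, Suc (length xs)) \<in> mm_kinds"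
  "length xs \<le> 2 \<Longrightarrow> (Tight, Suc (Suc (length xs))) \<in> mm_kinds" "length xs \<le> 2 \<Longrightarrow> (Loose, length xs) \<in> mm_kinds"
  by (auto simp: mm_kinds_def le_Suc_eq numeral_2_eq_2)

lemma theta_inj:
  assumes f: "valid M f" "knd f = Tight" "src f = a \<box> b # xs" and g: "valid M g" "knd g = Tight" "src g = a \<box> b # xs"
    and ab: "ob a" "ob b" and xs: "length xs \<le> 2" and t: "tgt f = tgt g" and eq: "f \<star> \<theta> a b = g \<star> \<theta> a b"
  shows "f = g"
proof (rule tmap_eqI)
  have "bij_betw (\<lambda>f. circ M Tight (a \<box> b # xs) (tgt g) 1 Tight [a, b] f (lr_theta D a b))
      (mm M Tight (a \<box> b # xs) (tgt g)) (mm M Tight (a # b # xs) (tgt g))"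
    using lr ab xs validD[OF g(1)] g by (auto simp: is_lr_data_def)
  from inj_onD[OF bij_betw_imp_inj_on[OF this], of "elt f" "elt g"]
  show "elt f = elt g" using validD(4)[OF f(1)] validD(4)[OF g(1)] f g t eq by (simp add: comp_at_def \<theta>_def)
qed (use assms in simp_all)

lemma theta_surj:
  assumes f: "valid M f" "knd f = Tight" "src f = a # b # xs" and xs: "length xs \<le> 2"
  shows "\<exists>g. valid M g \<and> knd g = Tight \<and> src g = a \<box> b # xs \<and> tgt g = tgt f \<and> g \<star> \<theta> a b = f"
proof -
  note v = validD[OF f(1)]
  have "bij_betw (\<lambda>f. circ M Tight (a \<box> b # xs) (tgt f') 1 Tight [a, b] f (lr_theta D a b))
      (mm M Tight (a \<box> b # xs) (tgt f')) (mm M Tight (a # b # xs) (tgt f'))" if "f' = f" for f'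
    using lr xs v f that by (auto simp: is_lr_data_def)
  from bij_betw_imp_surj_on[OF this[OF refl]] v(4) f
  obtain m where m: "m \<in> mm M Tight (a \<box> b # xs) (tgt f)"
    "elt f = circ M Tight (a \<box> b # xs) (tgt f) 1 Tight [a, b] m (lr_theta D a b)" by fastforce
  have "valid M (TM Tight (a \<box> b # xs) (tgt f) m)"
    using m v f xs kind_Cons_le(1)[OF xs] by (simp add: valid_def mtype_def)
  moreover have "TM Tight (a \<box> b # xs) (tgt f) m \<star> \<theta> a b = f"
    using m f by (intro tmap_eqI) (simp_all add: comp_at_def \<theta>_def)
  ultimately show ?thesis by fastforce
qed

lemma u_inj:
  assumes f: "valid M f" "knd f = Tight" "src f = I # xs" and g: "valid M g" "knd g = Tight" "src g = I # xs"
    and xs: "length xs \<le> 2" and t: "tgt f = tgt g" and eq: "f \<star> u = g \<star> u"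
  shows "f = g"
proof (rule tmap_eqI)
  have "bij_betw (\<lambda>f. circ M Tight (I # xs) (tgt g) 1 Loose [] f (lr_u D))
      (mm M Tight (I # xs) (tgt g)) (mm M Loose xs (tgt g))"
    using lr xs validD[OF g(1)] g by (auto simp: is_lr_data_def)
  from inj_onD[OF bij_betw_imp_inj_on[OF this], of "elt f" "elt g"]
  show "elt f = elt g" using validD(4)[OF f(1)] validD(4)[OF g(1)] f g t eq by (simp add: comp_at_def u_def)
qed (use assms in simp_all)

lemma u_surj:
  assumes f: "valid M f" "knd f = Loose"
  shows "\<exists>g. valid M g \<and> knd g = Tight \<and> src g = I # src f \<and> tgt g = tgt f \<and> g \<star> u = f"
proof -
  note v = validD[OF f(1)]
  have xs: "length (src f) \<le> 2" using v(1) f(2) unfolding mm_kinds_def by auto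
  have "bij_betw (\<lambda>m. circ M Tight (I # src f) (tgt f) 1 Loose [] m (lr_u D))
      (mm M Tight (I # src f) (tgt f)) (mm M Loose (src f) (tgt f))"
    using lr xs v f by (auto simp: is_lr_data_def)
  from bij_betw_imp_surj_on[OF this] v(4) f
  obtain m where m: "m \<in> mm M Tight (I # src f) (tgt f)"
    "elt f = circ M Tight (I # src f) (tgt f) 1 Loose [] m (lr_u D)" by fastforce
  have "valid M (TM Tight (I # src f) (tgt f) m)"
    using m v f kind_Cons_le(1)[OF xs] by (simp add: valid_def mtype_def)
  moreover have "TM Tight (I # src f) (tgt f) m \<star> u = f"
    using m f by (intro tmap_eqI) (simp_all add: comp_at_def u_def)
  ultimately show ?thesis by fastforce
qed

lemma arrow_eqI:
  assumes "ar p" "ar q" "Dom C p = a \<box> b" "Dom C q = a \<box> b" "Cod C p = Cod C q" "ob a" "ob b"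
    and "{|p|} \<star> \<theta> a b = {|q|} \<star> \<theta> a b"
  shows "p = q"
  by (rule unary_inj, rule theta_inj[of _ a b "[]"]) (use assms in simp_all)

lemma arrow_eqI_3:
  assumes "ar p" "ar q" "Dom C p = a \<box> b \<box> c" "Dom C q = a \<box> b \<box> c" "Cod C p = Cod C q"
    and "ob a" "ob b" "ob c"
    and "{|p|} \<star> \<theta> (a \<box> b) c \<star> \<theta> a b = {|q|} \<star> \<theta> (a \<box> b) c \<star> \<theta> a b"
  shows "p = q"
  by (rule arrow_eqI, (rule assms | simp add: assms)+, rule theta_inj[of _ a b "[c]"]) (use assms in simp_all)

lemma arrow_eqI_4:
  assumes "ar p" "ar q" "Dom C p = a \<box> b \<box> c \<box> d" "Dom C q = a \<box> b \<box> c \<box> d" "Cod C p = Cod C q"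
    and "ob a" "ob b" "ob c" "ob d"
    and "{|p|} \<star> \<theta> (a \<box> b \<box> c) d \<star> \<theta> (a \<box> b) c \<star> \<theta> a b = {|q|} \<star> \<theta> (a \<box> b \<box> c) d \<star> \<theta> (a \<box> b) c \<star> \<theta> a b"
  shows "p = q"
  by (rule arrow_eqI_3[of p q "a \<box> b" c d], (rule assms | simp add: assms)+, rule theta_inj[of _ a b "[c, d]"])
    (use assms in simp_all)

lemma arrow_eqI_u:
  assumes "ar p" "ar q" "Dom C p = I" "Dom C q = I" "Cod C p = Cod C q" "{|p|} \<star> u = {|q|} \<star> u"
  shows "p = q"
  by (rule unary_inj, rule u_inj[of _ "[]"]) (use assms in simp_all)

lemma arrow_ex:
  assumes f: "valid M f" "knd f = Tight" "src f = [a, b]"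
  shows "\<exists>!p. p \<in> hom C (a \<box> b) (tgt f) \<and> {|p|} \<star> \<theta> a b = f"
proof -
  have ab: "ob a" "ob b" using validD[OF f(1)] f by auto
  obtain g where g: "valid M g" "knd g = Tight" "src g = [a \<box> b]" "tgt g = tgt f" "g \<star> \<theta> a b = f"
    using theta_surj[of f a b "[]"] f by auto
  have "mtype g = (Tight, 1)" using g by (simp add: mtype_def)
  then obtain p where p: "ar p" "g = {|p|}" using unary_cases g by blast
  then have "p \<in> hom C (a \<box> b) (tgt f) \<and> {|p|} \<star> \<theta> a b = f" using g by (auto simp: hom_def)
  moreover have "q = p" if "q \<in> hom C (a \<box> b) (tgt f) \<and> {|q|} \<star> \<theta> a b = f" for q
    by (rule arrow_eqI[of _ _ a b]) (use that p g ab in \<open>auto simp: hom_def\<close>)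
  ultimately show ?thesis by blast
qed

lemma arrow_ex_3:
  assumes f: "valid M f" "knd f = Tight" "src f = [a, b, c]"
  shows "\<exists>!p. p \<in> hom C (a \<box> b \<box> c) (tgt f) \<and> {|p|} \<star> \<theta> (a \<box> b) c \<star> \<theta> a b = f"
proof -
  have abc: "ob a" "ob b" "ob c" using validD[OF f(1)] f by auto
  obtain g where g: "valid M g" "knd g = Tight" "src g = [a \<box> b, c]" "tgt g = tgt f" "g \<star> \<theta> a b = f"
    using theta_surj[of f a b "[c]"] f by auto
  obtain p where p: "p \<in> hom C (a \<box> b \<box> c) (tgt f)" "{|p|} \<star> \<theta> (a \<box> b) c = g"
    using arrow_ex[OF g(1-3)] g by auto
  moreover have "q = p" if "q \<in> hom C (a \<box> b \<box> c) (tgt f)" "{|q|} \<star> \<theta> (a \<box> b) c \<star> \<theta> a b = f" for q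
    by (rule arrow_eqI_3[of _ _ a b c]) (use that p g abc in \<open>auto simp: hom_def\<close>)
  ultimately show ?thesis using g by blast
qed

lemma arrow_ex_u:
  assumes f: "valid M f" "knd f = Loose" "src f = []"
  shows "\<exists>!p. p \<in> hom C I (tgt f) \<and> {|p|} \<star> u = f"
proof -
  obtain g where g: "valid M g" "knd g = Tight" "src g = [I]" "tgt g = tgt f" "g \<star> u = f"
    using u_surj[of f] f by auto
  have "mtype g = (Tight, 1)" using g by (simp add: mtype_def)
  then obtain p where p: "ar p" "g = {|p|}" using unary_cases g by blast
  then have "p \<in> hom C I (tgt f) \<and> {|p|} \<star> u = f" using g by (auto simp: hom_def)
  moreover have "q = p" if "q \<in> hom C I (tgt f) \<and> {|q|} \<star> u = f" for q
    by (rule arrow_eqI_u) (use that p g in \<open>auto simp: hom_def\<close>)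
  ultimately show ?thesis by blast
qed

lemma arrow_ex_u2:
  assumes f: "valid M f" "knd f = Loose" "src f = [a]"
  shows "\<exists>!p. p \<in> hom C (I \<box> a) (tgt f) \<and> {|p|} \<star> \<theta> I a \<star> u = f"
proof -
  have a: "ob a" using validD[OF f(1)] f by auto
  obtain g where g: "valid M g" "knd g = Tight" "src g = [I, a]" "tgt g = tgt f" "g \<star> u = f"
    using u_surj[of f] f by auto
  obtain p where p: "p \<in> hom C (I \<box> a) (tgt f)" "{|p|} \<star> \<theta> I a = g"
    using arrow_ex[OF g(1-3)] g by auto
  moreover have "q = p" if "q \<in> hom C (I \<box> a) (tgt f)" "{|q|} \<star> \<theta> I a \<star> u = f" for q
    by (rule arrow_eqI[of _ _ I a], (use that p g a in \<open>auto simp: hom_def\<close>)[7], rule u_inj[of _ "[a]"])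
      (use that p g a in \<open>auto simp: hom_def\<close>)
  ultimately show ?thesis using g by blast
qed

lemma arrow_eqI_2u:
  assumes "ar p" "ar q" "Dom C p = I \<box> a" "Dom C q = I \<box> a" "Cod C p = Cod C q" "ob a"
    and "{|p|} \<star> \<theta> I a \<star> u = {|q|} \<star> \<theta> I a \<star> u"
  shows "p = q"
  by (rule arrow_eqI[of _ _ I a], (use assms in simp_all)[7], rule u_inj[of _ "[a]"]) (use assms in simp_all)

lemma arrow_eqI_3u:
  assumes "ar p" "ar q" "Dom C p = I \<box> a \<box> b" "Dom C q = I \<box> a \<box> b" "Cod C p = Cod C q" "ob a" "ob b"
    and "{|p|} \<star> \<theta> (I \<box> a) b \<star> \<theta> I a \<star> u = {|q|} \<star> \<theta> (I \<box> a) b \<star> \<theta> I a \<star> u"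
  shows "p = q"
  by (rule arrow_eqI_3[of _ _ I a b], (use assms in simp_all)[8], rule u_inj[of _ "[a, b]"]) (use assms in simp_all)

end

section \<open>The skew monoidal category of a left representable multicategory\<close>

context representable
begin

abbreviation \<alpha> where "\<alpha> \<equiv> K_alpha D M"
abbreviation \<Lambda> where "\<Lambda> \<equiv> K_lambda D M"
abbreviation \<rho> where "\<rho> \<equiv> K_rho D M"

lemma tensor_arr_props:
  assumes p: "ar p" and q: "ar q"
  shows "p \<Otimes> q \<in> hom C (Dom C p \<box> Dom C q) (Cod C p \<box> Cod C q)"
    and "{|p \<Otimes> q|} \<star> \<theta> (Dom C p) (Dom C q) = \<theta> (Cod C p) (Cod C q) \<star> {|p|} \<star>\<^sub>2 {|q|}"
proof -
  let ?f = "\<theta> (Cod C p) (Cod C q) \<star> {|p|} \<star>\<^sub>2 {|q|}"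
  have f: "valid M ?f" "knd ?f = Tight" "src ?f = [Dom C p, Dom C q]" using p q by simp_all
  have "p \<Otimes> q = (THE h. h \<in> hom C (Dom C p \<box> Dom C q) (tgt ?f) \<and> {|h|} \<star> \<theta> (Dom C p) (Dom C q) = ?f)"
    unfolding K_tens_arr_def Let_def
    by (rule arg_cong[where f = The]) (auto simp: fun_eq_iff comp_at_def \<theta>_def hom_def)
  with theI'[OF arrow_ex[OF f]]
  show "p \<Otimes> q \<in> hom C (Dom C p \<box> Dom C q) (Cod C p \<box> Cod C q)" "{|p \<Otimes> q|} \<star> \<theta> (Dom C p) (Dom C q) = ?f"
    by simp_all
qed

lemma tensor_arr [simp]:
  assumes "ar p" "ar q"
  shows "p \<Otimes> q \<in> Arr C" "Dom C (p \<Otimes> q) = Dom C p \<box> Dom C q" "Cod C (p \<Otimes> q) = Cod C p \<box> Cod C q"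
  using homD[OF tensor_arr_props(1)[OF assms]] by auto

lemma tensor_theta:
  "ar p \<Longrightarrow> ar q \<Longrightarrow> Dom C p = a \<Longrightarrow> Dom C q = b \<Longrightarrow>
    {|p \<Otimes> q|} \<star> \<theta> a b = \<theta> (Cod C p) (Cod C q) \<star> {|p|} \<star>\<^sub>2 {|q|}"
  using tensor_arr_props(2) by blast

lemma alpha_props:
  assumes "ob a" "ob b" "ob c"
  shows "\<alpha> a b c \<in> hom C (a \<box> b \<box> c) (a \<box> (b \<box> c))"
    and "{|\<alpha> a b c|} \<star> \<theta> (a \<box> b) c \<star> \<theta> a b = \<theta> a (b \<box> c) \<star>\<^sub>2 \<theta> b c"
proof -
  let ?f = "\<theta> a (b \<box> c) \<star>\<^sub>2 \<theta> b c"
  have f: "valid M ?f" "knd ?f = Tight" "src ?f = [a, b, c]" using assms by simp_all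
  have "\<alpha> a b c = (THE h. h \<in> hom C (a \<box> b \<box> c) (tgt ?f) \<and> {|h|} \<star> \<theta> (a \<box> b) c \<star> \<theta> a b = ?f)"
    unfolding K_alpha_def Let_def
    by (rule arg_cong[where f = The]) (auto simp: fun_eq_iff comp_at_def \<theta>_def hom_def)
  with theI'[OF arrow_ex_3[OF f]]
  show "\<alpha> a b c \<in> hom C (a \<box> b \<box> c) (a \<box> (b \<box> c))" "{|\<alpha> a b c|} \<star> \<theta> (a \<box> b) c \<star> \<theta> a b = ?f"
    by simp_all
qed

lemma alpha_arr [simp]:
  assumes "ob a" "ob b" "ob c"
  shows "\<alpha> a b c \<in> Arr C" "Dom C (\<alpha> a b c) = a \<box> b \<box> c" "Cod C (\<alpha> a b c) = a \<box> (b \<box> c)"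
  using homD[OF alpha_props(1)[OF assms]] by auto

lemma alpha_theta:
  assumes "ob a" "ob b" "ob c"
  shows "{|\<alpha> a b c|} \<star> (\<theta> (a \<box> b) c \<star> \<theta> a b) = \<theta> a (b \<box> c) \<star>\<^sub>2 \<theta> b c"
  unfolding alpha_props(2)[OF assms, symmetric] by (rule assoc; simp add: assms)

lemma lambda_props:
  assumes "ob a"
  shows "\<Lambda> a \<in> hom C (I \<box> a) a" and "{|\<Lambda> a|} \<star> \<theta> I a \<star> u = jmap M {|Idn C a|}"
proof -
  let ?f = "jmap M {|Idn C a|}"
  have f: "valid M ?f" "knd ?f = Loose" "src ?f = [a]" using assms by simp_all
  have "\<Lambda> a = (THE h. h \<in> hom C (I \<box> a) (tgt ?f) \<and> {|h|} \<star> \<theta> I a \<star> u = ?f)"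
    unfolding K_lambda_def Let_def
    by (rule arg_cong[where f = The]) (use assms in \<open>auto simp: fun_eq_iff comp_at_def \<theta>_def u_def hom_def jmap_def\<close>)
  with theI'[OF arrow_ex_u2[OF f]] assms
  show "\<Lambda> a \<in> hom C (I \<box> a) a" "{|\<Lambda> a|} \<star> \<theta> I a \<star> u = ?f"
    by simp_all
qed

lemma lambda_arr [simp]:
  assumes "ob a" shows "\<Lambda> a \<in> Arr C" "Dom C (\<Lambda> a) = I \<box> a" "Cod C (\<Lambda> a) = a"
  using homD[OF lambda_props(1)[OF assms]] by auto

lemma lambda_theta:
  assumes "ob a"
  shows "{|\<Lambda> a|} \<star> (\<theta> I a \<star> u) = jmap M {|Idn C a|}"
  unfolding lambda_props(2)[OF assms, symmetric] by (rule assoc; simp add: assms)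

lemma rho_unary:
  assumes "ob a" shows "{|\<rho> a|} = \<theta> a I \<star>\<^sub>2 u" and rho_arr [simp]: "\<rho> a \<in> Arr C"
    and rho_dom [simp]: "Dom C (\<rho> a) = a" and rho_cod [simp]: "Cod C (\<rho> a) = a \<box> I"
proof -
  have v: "valid M (\<theta> a I \<star>\<^sub>2 u)" "mtype (\<theta> a I \<star>\<^sub>2 u) = (Tight, 1)" using assms by (simp_all add: mtype_def)
  then obtain p where p: "ar p" "\<theta> a I \<star>\<^sub>2 u = {|p|}" using unary_cases by blast
  have "elt (\<theta> a I \<star>\<^sub>2 u) = \<rho> a" by (simp add: K_rho_def Let_def comp_at_def \<theta>_def u_def)
  then have "p = \<rho> a" using p by simp
  with p show eq: "{|\<rho> a|} = \<theta> a I \<star>\<^sub>2 u" and "\<rho> a \<in> Arr C" by simp_all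
  have "src {|\<rho> a|} = [a]" "tgt {|\<rho> a|} = a \<box> I" unfolding eq by simp_all
  then show "Dom C (\<rho> a) = a" "Cod C (\<rho> a) = a \<box> I" by simp_all
qed

lemma comp_push:
  assumes "ar p" "ar q" "Dom C q = Cod C p" "valid M f" "tgt f = Dom C p"
  shows "{|Comp C q p|} \<star> f = {|q|} \<star> ({|p|} \<star> f)"
  unfolding unary_comp_arrow[OF assms(1-3)]
  by (rule assoc[symmetric]) (use assms validD(1)[OF assms(4)] in simp_all)

lemma unary_push:
  assumes "ar p" "valid M g" "valid M h" "composable (knd g, length (src g)) (knd h, length (src h))"
    "Suc 0 \<le> j" "j \<le> length (src g)" "tgt h = src g ! (j - Suc 0)" "Dom C p = tgt g"
  shows "{|p|} \<star> (g \<star>\<^bsub>j\<^esub> h) = ({|p|} \<star> g) \<star>\<^bsub>j\<^esub> h"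
  by (rule assoc) (use assms in simp_all)

text \<open>Tensoring with an identity acts on the corresponding input of \<open>\<theta>\<close>.\<close>

lemma whisker_left:
  assumes "ar p" "ob c" "valid M f" "tgt f = Dom C p" "composable (Tight, 2) (knd f, length (src f))"
  shows "{|p \<Otimes> Idn C c|} \<star> (\<theta> (Dom C p) c \<star> f) = \<theta> (Cod C p) c \<star> ({|p|} \<star> f)"
proof -
  note [simp] = assms(1-4) validD(1)[OF assms(3)] assms(5)[unfolded numeral_2_eq_2]
  have "{|p \<Otimes> Idn C c|} \<star> (\<theta> (Dom C p) c \<star> f) = ({|p \<Otimes> Idn C c|} \<star> \<theta> (Dom C p) c) \<star> f"
    by (rule unary_push; simp)
  also have "\<dots> = \<theta> (Cod C p) c \<star> {|p|} \<star> f"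
    by (simp add: tensor_theta comp_at_idn)
  also have "\<dots> = \<theta> (Cod C p) c \<star> ({|p|} \<star> f)"
    by (rule assoc[symmetric]; simp)
  finally show ?thesis .
qed

lemma whisker_right:
  assumes "ar p" "ob c" "valid M f" "tgt f = Dom C p" "composable (Tight, 2) (knd f, length (src f))"
  shows "{|Idn C c \<Otimes> p|} \<star> (\<theta> c (Dom C p) \<star>\<^sub>2 f) = \<theta> c (Cod C p) \<star>\<^sub>2 ({|p|} \<star> f)"
proof -
  note [simp] = assms(1-4) validD(1)[OF assms(3)] assms(5)[unfolded numeral_2_eq_2]
  have "{|Idn C c \<Otimes> p|} \<star> (\<theta> c (Dom C p) \<star>\<^sub>2 f) = ({|Idn C c \<Otimes> p|} \<star> \<theta> c (Dom C p)) \<star>\<^sub>2 f"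
    by (rule unary_push; simp)
  also have "\<dots> = \<theta> c (Cod C p) \<star>\<^sub>2 {|p|} \<star>\<^sub>2 f"
    by (simp add: tensor_theta comp_at_idn)
  also have "\<dots> = \<theta> c (Cod C p) \<star>\<^sub>2 ({|p|} \<star> f)"
    by (rule assoc[symmetric]; simp)
  finally show ?thesis .
qed

lemma tensor_idn:
  assumes "ob a" "ob b" shows "Idn C a \<Otimes> Idn C b = Idn C (a \<box> b)"
  by (rule arrow_eqI[of _ _ a b]) (simp_all add: assms tensor_theta comp_at_idn idn_comp_at)

lemma tensor_comp:
  assumes "ar p" "ar q" "Dom C q = Cod C p" "ar p'" "ar q'" "Dom C q' = Cod C p'"
  shows "Comp C q p \<Otimes> Comp C q' p' = Comp C (q \<Otimes> q') (p \<Otimes> p')"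
proof (rule arrow_eqI[of _ _ "Dom C p" "Dom C p'"])
  note [simp] = assms
  let ?t = "\<theta> (Cod C q) (Cod C q')"
  have "{|Comp C (q \<Otimes> q') (p \<Otimes> p')|} \<star> \<theta> (Dom C p) (Dom C p') =
      {|q \<Otimes> q'|} \<star> (\<theta> (Dom C q) (Dom C q') \<star> {|p|} \<star>\<^sub>2 {|p'|})"
    by (simp add: comp_push tensor_theta)
  also have "\<dots> = {|q \<Otimes> q'|} \<star> (\<theta> (Dom C q) (Dom C q') \<star> {|p|}) \<star>\<^sub>2 {|p'|}"
    by (rule unary_push; simp)
  also have "{|q \<Otimes> q'|} \<star> (\<theta> (Dom C q) (Dom C q') \<star> {|p|}) = {|q \<Otimes> q'|} \<star> \<theta> (Dom C q) (Dom C q') \<star> {|p|}"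
    by (rule unary_push; simp)
  also have "{|q \<Otimes> q'|} \<star> \<theta> (Dom C q) (Dom C q') = ?t \<star> {|q|} \<star>\<^sub>2 {|q'|}"
    by (rule tensor_theta; simp)
  also have "?t \<star> {|q|} \<star>\<^sub>2 {|q'|} \<star> {|p|} = ?t \<star> {|q|} \<star> {|p|} \<star>\<^sub>2 {|q'|}"
    by (rule parallel[symmetric]; simp)
  also have "?t \<star> {|q|} \<star> {|p|} = ?t \<star> {|Comp C q p|}"
    unfolding unary_comp_arrow[OF assms(1-3)] by (rule assoc[symmetric]; simp)
  also have "?t \<star> {|Comp C q p|} \<star>\<^sub>2 {|q'|} \<star>\<^sub>2 {|p'|} = ?t \<star> {|Comp C q p|} \<star>\<^sub>2 {|Comp C q' p'|}"
    unfolding unary_comp_arrow[OF assms(4-6)] by (rule assoc[symmetric]; simp)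
  finally show "{|Comp C q p \<Otimes> Comp C q' p'|} \<star> \<theta> (Dom C p) (Dom C p') =
      {|Comp C (q \<Otimes> q') (p \<Otimes> p')|} \<star> \<theta> (Dom C p) (Dom C p')"
    by (simp add: tensor_theta)
qed (use assms in simp_all)

lemma tensor3_left:
  assumes "ar f" "ar g" "ar h" "Dom C f = a" "Dom C g = b" "Dom C h = c"
  shows "{|f \<Otimes> g \<Otimes> h|} \<star> (\<theta> (a \<box> b) c \<star> \<theta> a b) =
    \<theta> (Cod C f \<box> Cod C g) (Cod C h) \<star> \<theta> (Cod C f) (Cod C g) \<star> {|f|} \<star>\<^sub>2 {|g|} \<star>\<^sub>3 {|h|}"
proof -
  have [simp]: "ob a" "ob b" "ob c" using assms by auto
  note [simp] = assms
  let ?t = "\<theta> (Cod C f \<box> Cod C g) (Cod C h)" and ?t' = "\<theta> (Cod C f) (Cod C g)"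
  have "{|f \<Otimes> g \<Otimes> h|} \<star> (\<theta> (a \<box> b) c \<star> \<theta> a b) = {|f \<Otimes> g \<Otimes> h|} \<star> \<theta> (a \<box> b) c \<star> \<theta> a b"
    by (rule unary_push; simp)
  also have "\<dots> = ?t \<star> {|f \<Otimes> g|} \<star>\<^sub>2 {|h|} \<star> \<theta> a b"
    by (simp add: tensor_theta)
  also have "\<dots> = ?t \<star> {|f \<Otimes> g|} \<star> \<theta> a b \<star>\<^sub>3 {|h|}"
    by (rule parallel[symmetric]; simp)
  also have "?t \<star> {|f \<Otimes> g|} \<star> \<theta> a b = ?t \<star> ({|f \<Otimes> g|} \<star> \<theta> a b)"
    by (rule assoc[symmetric]; simp)
  also have "\<dots> = ?t \<star> (?t' \<star> {|f|} \<star>\<^sub>2 {|g|})"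
    by (simp add: tensor_theta)
  also have "\<dots> = ?t \<star> (?t' \<star> {|f|}) \<star>\<^sub>2 {|g|}"
    by (rule assoc; simp)
  also have "?t \<star> (?t' \<star> {|f|}) = ?t \<star> ?t' \<star> {|f|}"
    by (rule assoc; simp)
  finally show ?thesis .
qed

lemma tensor3_right:
  assumes "ar f" "ar g" "ar h" "Dom C f = a" "Dom C g = b" "Dom C h = c"
  shows "{|f \<Otimes> (g \<Otimes> h)|} \<star> (\<theta> a (b \<box> c) \<star>\<^sub>2 \<theta> b c) =
    \<theta> (Cod C f) (Cod C g \<box> Cod C h) \<star>\<^sub>2 \<theta> (Cod C g) (Cod C h) \<star> {|f|} \<star>\<^sub>2 {|g|} \<star>\<^sub>3 {|h|}"
proof -
  have [simp]: "ob a" "ob b" "ob c" using assms by auto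
  note [simp] = assms
  let ?t = "\<theta> (Cod C f) (Cod C g \<box> Cod C h)" and ?t' = "\<theta> (Cod C g) (Cod C h)"
  have "{|f \<Otimes> (g \<Otimes> h)|} \<star> (\<theta> a (b \<box> c) \<star>\<^sub>2 \<theta> b c) = {|f \<Otimes> (g \<Otimes> h)|} \<star> \<theta> a (b \<box> c) \<star>\<^sub>2 \<theta> b c"
    by (rule unary_push; simp)
  also have "\<dots> = ?t \<star> {|f|} \<star>\<^sub>2 {|g \<Otimes> h|} \<star>\<^sub>2 \<theta> b c"
    by (simp add: tensor_theta)
  also have "\<dots> = ?t \<star> {|f|} \<star>\<^sub>2 ({|g \<Otimes> h|} \<star> \<theta> b c)"
    by (rule assoc[symmetric]; simp)
  also have "\<dots> = ?t \<star> {|f|} \<star>\<^sub>2 (?t' \<star> {|g|} \<star>\<^sub>2 {|h|})"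
    by (simp add: tensor_theta)
  also have "\<dots> = ?t \<star> {|f|} \<star>\<^sub>2 (?t' \<star> {|g|}) \<star>\<^sub>3 {|h|}"
    by (rule assoc; simp)
  also have "?t \<star> {|f|} \<star>\<^sub>2 (?t' \<star> {|g|}) = ?t \<star> {|f|} \<star>\<^sub>2 ?t' \<star>\<^sub>2 {|g|}"
    by (rule assoc; simp)
  also have "?t \<star> {|f|} \<star>\<^sub>2 ?t' = ?t \<star>\<^sub>2 ?t' \<star> {|f|}"
    by (rule parallel; simp)
  finally show ?thesis .
qed

lemma unary_push_3:
  assumes "ar p" "valid M t" "knd t = Tight" "src t = [Cod C f, Cod C g, Cod C h]" "tgt t = Dom C p"
    "ar f" "ar g" "ar h"
  shows "{|p|} \<star> (t \<star> {|f|} \<star>\<^sub>2 {|g|} \<star>\<^sub>3 {|h|}) = {|p|} \<star> t \<star> {|f|} \<star>\<^sub>2 {|g|} \<star>\<^sub>3 {|h|}"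
proof -
  note [simp] = assms
  have "{|p|} \<star> (t \<star> {|f|} \<star>\<^sub>2 {|g|} \<star>\<^sub>3 {|h|}) = {|p|} \<star> (t \<star> {|f|} \<star>\<^sub>2 {|g|}) \<star>\<^sub>3 {|h|}"
    by (rule unary_push; simp)
  also have "{|p|} \<star> (t \<star> {|f|} \<star>\<^sub>2 {|g|}) = {|p|} \<star> (t \<star> {|f|}) \<star>\<^sub>2 {|g|}"
    by (rule unary_push; simp)
  also have "{|p|} \<star> (t \<star> {|f|}) = {|p|} \<star> t \<star> {|f|}"
    by (rule unary_push; simp)
  finally show ?thesis .
qed

lemma arrow_eqI_3':
  assumes "ar p" "ar q" "Dom C p = a \<box> b \<box> c" "Dom C q = a \<box> b \<box> c" "Cod C p = Cod C q"
    and "ob a" "ob b" "ob c"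
    and "{|p|} \<star> (\<theta> (a \<box> b) c \<star> \<theta> a b) = {|q|} \<star> (\<theta> (a \<box> b) c \<star> \<theta> a b)"
  shows "p = q"
proof (rule arrow_eqI_3[OF assms(1-8)])
  have "{|r|} \<star> (\<theta> (a \<box> b) c \<star> \<theta> a b) = {|r|} \<star> \<theta> (a \<box> b) c \<star> \<theta> a b" if "ar r" "Dom C r = a \<box> b \<box> c" for r
    by (rule unary_push) (use that assms in simp_all)
  then show "{|p|} \<star> \<theta> (a \<box> b) c \<star> \<theta> a b = {|q|} \<star> \<theta> (a \<box> b) c \<star> \<theta> a b"
    using assms by simp
qed

lemma arrow_eqI_4':
  assumes "ar p" "ar q" "Dom C p = a \<box> b \<box> c \<box> d" "Dom C q = a \<box> b \<box> c \<box> d" "Cod C p = Cod C q"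
    and "ob a" "ob b" "ob c" "ob d"
    and "{|p|} \<star> (\<theta> (a \<box> b \<box> c) d \<star> \<theta> (a \<box> b) c \<star> \<theta> a b) = {|q|} \<star> (\<theta> (a \<box> b \<box> c) d \<star> \<theta> (a \<box> b) c \<star> \<theta> a b)"
  shows "p = q"
proof (rule arrow_eqI_4[OF assms(1-9)])
  note [simp] = assms(6-9)
  have "{|r|} \<star> (\<theta> (a \<box> b \<box> c) d \<star> \<theta> (a \<box> b) c \<star> \<theta> a b) = {|r|} \<star> \<theta> (a \<box> b \<box> c) d \<star> \<theta> (a \<box> b) c \<star> \<theta> a b"
    if [simp]: "ar r" "Dom C r = a \<box> b \<box> c \<box> d" for r
  proof -
    have "{|r|} \<star> (\<theta> (a \<box> b \<box> c) d \<star> \<theta> (a \<box> b) c \<star> \<theta> a b) = {|r|} \<star> (\<theta> (a \<box> b \<box> c) d \<star> \<theta> (a \<box> b) c) \<star> \<theta> a b"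
      by (rule unary_push; simp)
    also have "{|r|} \<star> (\<theta> (a \<box> b \<box> c) d \<star> \<theta> (a \<box> b) c) = {|r|} \<star> \<theta> (a \<box> b \<box> c) d \<star> \<theta> (a \<box> b) c"
      by (rule unary_push; simp)
    finally show ?thesis .
  qed
  then show "{|p|} \<star> \<theta> (a \<box> b \<box> c) d \<star> \<theta> (a \<box> b) c \<star> \<theta> a b = {|q|} \<star> \<theta> (a \<box> b \<box> c) d \<star> \<theta> (a \<box> b) c \<star> \<theta> a b"
    using assms by simp
qed

lemma K_alpha_nat:
  assumes "ar f" "ar g" "ar h"
  shows "Comp C (\<alpha> (Cod C f) (Cod C g) (Cod C h)) (f \<Otimes> g \<Otimes> h) =
    Comp C (f \<Otimes> (g \<Otimes> h)) (\<alpha> (Dom C f) (Dom C g) (Dom C h))"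
  by (rule arrow_eqI_3'[of _ _ "Dom C f" "Dom C g" "Dom C h"])
    (simp_all add: assms comp_push tensor3_left tensor3_right unary_push_3 alpha_theta)

lemma K_lambda_nat:
  assumes "ar f"
  shows "Comp C (\<Lambda> (Cod C f)) (Idn C I \<Otimes> f) = Comp C f (\<Lambda> (Dom C f))"
proof (rule arrow_eqI_2u[of _ _ "Dom C f"])
  note [simp] = assms
  let ?a = "Dom C f" and ?b = "Cod C f"
  have "{|Comp C (\<Lambda> ?b) (Idn C I \<Otimes> f)|} \<star> \<theta> I ?a = {|\<Lambda> ?b|} \<star> (\<theta> I ?b \<star>\<^sub>2 {|f|})"
    by (simp add: comp_push tensor_theta comp_at_idn)
  also have "\<dots> = {|\<Lambda> ?b|} \<star> \<theta> I ?b \<star>\<^sub>2 {|f|}" by (rule unary_push; simp)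
  finally have "{|Comp C (\<Lambda> ?b) (Idn C I \<Otimes> f)|} \<star> \<theta> I ?a \<star> u = {|\<Lambda> ?b|} \<star> \<theta> I ?b \<star>\<^sub>2 {|f|} \<star> u" by simp
  also have "\<dots> = {|\<Lambda> ?b|} \<star> \<theta> I ?b \<star> u \<star> {|f|}" by (rule parallel[symmetric]; simp)
  also have "\<dots> = jmap M {|Idn C ?b|} \<star> {|f|}" by (simp add: lambda_props)
  also have "\<dots> = jmap M {|f|}" by (simp add: idn_comp_at flip: jmap_pre)
  also have "\<dots> = {|f|} \<star> jmap M {|Idn C ?a|}" by (simp add: comp_at_idn flip: jmap_post)
  also have "\<dots> = {|f|} \<star> ({|\<Lambda> ?a|} \<star> \<theta> I ?a \<star> u)" by (simp add: lambda_props)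
  also have "\<dots> = {|f|} \<star> ({|\<Lambda> ?a|} \<star> \<theta> I ?a) \<star> u" by (rule unary_push; simp)
  finally show "{|Comp C (\<Lambda> ?b) (Idn C I \<Otimes> f)|} \<star> \<theta> I ?a \<star> u = {|Comp C f (\<Lambda> ?a)|} \<star> \<theta> I ?a \<star> u"
    by (simp add: comp_push)
qed (use assms in simp_all)

lemma K_rho_nat:
  assumes "ar f"
  shows "Comp C (\<rho> (Cod C f)) f = Comp C (f \<Otimes> Idn C I) (\<rho> (Dom C f))"
proof (rule unary_inj)
  note [simp] = assms
  have "{|Comp C (\<rho> (Cod C f)) f|} = \<theta> (Cod C f) I \<star>\<^sub>2 u \<star> {|f|}"
    by (simp add: unary_comp_arrow rho_unary)
  also have "\<dots> = \<theta> (Cod C f) I \<star> {|f|} \<star>\<^sub>2 u" by (rule parallel[symmetric]; simp)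
  also have "\<dots> = {|f \<Otimes> Idn C I|} \<star> \<theta> (Dom C f) I \<star>\<^sub>2 u" by (simp add: tensor_theta comp_at_idn)
  also have "\<dots> = {|f \<Otimes> Idn C I|} \<star> (\<theta> (Dom C f) I \<star>\<^sub>2 u)" by (rule unary_push[symmetric]; simp)
  finally show "{|Comp C (\<rho> (Cod C f)) f|} = {|Comp C (f \<Otimes> Idn C I) (\<rho> (Dom C f))|}"
    by (simp add: unary_comp_arrow rho_unary)
qed

lemma alpha_theta_2:
  assumes "ob a" "ob b" "ob c" "valid M f" "knd f = Tight" "length (src f) = 2 \<or> length (src f) = 1" "tgt f = c"
  shows "{|\<alpha> a b c|} \<star> (\<theta> (a \<box> b) c \<star>\<^sub>2 f \<star> \<theta> a b) = \<theta> a (b \<box> c) \<star>\<^sub>2 (\<theta> b c \<star>\<^sub>2 f)"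
proof -
  have "length (src f) = Suc (Suc 0) \<or> length (src f) = Suc 0" using assms by auto
  then have [simp]: "composable (Tight, Suc (Suc 0)) (Tight, length (src f))" "composable (Tight, Suc (Suc (Suc 0))) (Tight, length (src f))"
    "parallel_types (Tight, Suc (Suc 0)) (Tight, Suc (Suc 0)) (Tight, length (src f))"
    "assoc_types (Tight, Suc (Suc 0)) (Tight, Suc (Suc 0)) (Tight, length (src f))" by auto
  note [simp] = assms(1-5) assms(7)
  have "\<theta> (a \<box> b) c \<star>\<^sub>2 f \<star> \<theta> a b = \<theta> (a \<box> b) c \<star> \<theta> a b \<star>\<^sub>3 f" by (rule parallel[symmetric]; simp)
  then have "{|\<alpha> a b c|} \<star> (\<theta> (a \<box> b) c \<star>\<^sub>2 f \<star> \<theta> a b) = {|\<alpha> a b c|} \<star> (\<theta> (a \<box> b) c \<star> \<theta> a b \<star>\<^sub>3 f)" by simp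
  also have "\<dots> = {|\<alpha> a b c|} \<star> (\<theta> (a \<box> b) c \<star> \<theta> a b) \<star>\<^sub>3 f" by (rule unary_push; simp)
  also have "\<dots> = \<theta> a (b \<box> c) \<star>\<^sub>2 \<theta> b c \<star>\<^sub>3 f" by (simp add: alpha_theta)
  also have "\<dots> = \<theta> a (b \<box> c) \<star>\<^sub>2 (\<theta> b c \<star>\<^sub>2 f)" by (rule assoc[symmetric]; simp)
  finally show ?thesis .
qed

end

context representable
begin

text \<open>Both sides represent the quaternary map \<open>\<theta> \<star>\<^sub>2 (\<theta> \<star>\<^sub>2 \<theta>)\<close>.\<close>

lemma K_pentagon:
  assumes [simp]: "ob a" "ob b" "ob c" "ob d"
  shows "Comp C (\<alpha> a b (c \<box> d)) (\<alpha> (a \<box> b) c d) =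
    Comp C (Idn C a \<Otimes> \<alpha> b c d) (Comp C (\<alpha> a (b \<box> c) d) (\<alpha> a b c \<Otimes> Idn C d))"
proof (rule arrow_eqI_4'[of _ _ a b c d])
  let ?X = "\<theta> (a \<box> b \<box> c) d \<star> \<theta> (a \<box> b) c \<star> \<theta> a b"
  have "{|\<alpha> (a \<box> b) c d|} \<star> ?X = {|\<alpha> (a \<box> b) c d|} \<star> (\<theta> (a \<box> b \<box> c) d \<star> \<theta> (a \<box> b) c) \<star> \<theta> a b"
    by (rule unary_push; simp)
  also have "\<dots> = \<theta> (a \<box> b) (c \<box> d) \<star>\<^sub>2 \<theta> c d \<star> \<theta> a b"
    by (simp add: alpha_theta)
  finally have l: "{|Comp C (\<alpha> a b (c \<box> d)) (\<alpha> (a \<box> b) c d)|} \<star> ?X = \<theta> a (b \<box> (c \<box> d)) \<star>\<^sub>2 (\<theta> b (c \<box> d) \<star>\<^sub>2 \<theta> c d)"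
    by (simp add: comp_push alpha_theta_2)
  have "?X = \<theta> (a \<box> b \<box> c) d \<star> (\<theta> (a \<box> b) c \<star> \<theta> a b)"
    by (rule assoc[symmetric]; simp)
  then have "{|\<alpha> a b c \<Otimes> Idn C d|} \<star> ?X = \<theta> (a \<box> (b \<box> c)) d \<star> ({|\<alpha> a b c|} \<star> (\<theta> (a \<box> b) c \<star> \<theta> a b))"
    using whisker_left[of "\<alpha> a b c" d "\<theta> (a \<box> b) c \<star> \<theta> a b"] by (simp add: numeral_2_eq_2)
  also have "\<dots> = \<theta> (a \<box> (b \<box> c)) d \<star> (\<theta> a (b \<box> c) \<star>\<^sub>2 \<theta> b c)"
    by (simp add: alpha_theta)
  also have "\<dots> = \<theta> (a \<box> (b \<box> c)) d \<star> \<theta> a (b \<box> c) \<star>\<^sub>2 \<theta> b c"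
    by (rule assoc; simp)
  finally have "{|Comp C (\<alpha> a (b \<box> c) d) (\<alpha> a b c \<Otimes> Idn C d)|} \<star> ?X =
      {|\<alpha> a (b \<box> c) d|} \<star> (\<theta> (a \<box> (b \<box> c)) d \<star> \<theta> a (b \<box> c) \<star>\<^sub>2 \<theta> b c)"
    by (simp add: comp_push)
  also have "\<dots> = {|\<alpha> a (b \<box> c) d|} \<star> (\<theta> (a \<box> (b \<box> c)) d \<star> \<theta> a (b \<box> c)) \<star>\<^sub>2 \<theta> b c"
    by (rule unary_push; simp)
  also have "\<dots> = \<theta> a (b \<box> c \<box> d) \<star>\<^sub>2 \<theta> (b \<box> c) d \<star>\<^sub>2 \<theta> b c"
    by (simp add: alpha_theta)
  also have "\<dots> = \<theta> a (b \<box> c \<box> d) \<star>\<^sub>2 (\<theta> (b \<box> c) d \<star> \<theta> b c)"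
    by (rule assoc[symmetric]; simp)
  finally have "{|Comp C (Idn C a \<Otimes> \<alpha> b c d) (Comp C (\<alpha> a (b \<box> c) d) (\<alpha> a b c \<Otimes> Idn C d))|} \<star> ?X =
      \<theta> a (b \<box> (c \<box> d)) \<star>\<^sub>2 ({|\<alpha> b c d|} \<star> (\<theta> (b \<box> c) d \<star> \<theta> b c))"
    using whisker_right[of "\<alpha> b c d" a "\<theta> (b \<box> c) d \<star> \<theta> b c"] by (simp add: comp_push numeral_2_eq_2)
  with l show "{|Comp C (\<alpha> a b (c \<box> d)) (\<alpha> (a \<box> b) c d)|} \<star> ?X =
      {|Comp C (Idn C a \<Otimes> \<alpha> b c d) (Comp C (\<alpha> a (b \<box> c) d) (\<alpha> a b c \<Otimes> Idn C d))|} \<star> ?X"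
    by (simp add: alpha_theta)
qed simp_all

text \<open>Both sides represent the loose map \<open>j \<theta>\<close>.\<close>

lemma K_lambda_alpha:
  assumes [simp]: "ob a" "ob b"
  shows "Comp C (\<Lambda> (a \<box> b)) (\<alpha> I a b) = \<Lambda> a \<Otimes> Idn C b"
proof (rule arrow_eqI_3u[of _ _ a b])
  let ?X = "\<theta> (I \<box> a) b \<star> \<theta> I a"
  have push: "{|p|} \<star> \<theta> (I \<box> a) b \<star> \<theta> I a = {|p|} \<star> ?X" if "ar p" "Dom C p = I \<box> a \<box> b" for p
    by (rule unary_push[symmetric]) (use that in simp_all)
  have "{|Comp C (\<Lambda> (a \<box> b)) (\<alpha> I a b)|} \<star> ?X = {|\<Lambda> (a \<box> b)|} \<star> (\<theta> I (a \<box> b) \<star>\<^sub>2 \<theta> a b)"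
    by (simp add: comp_push alpha_theta)
  also have "\<dots> = {|\<Lambda> (a \<box> b)|} \<star> \<theta> I (a \<box> b) \<star>\<^sub>2 \<theta> a b"
    by (rule unary_push; simp)
  finally have "{|Comp C (\<Lambda> (a \<box> b)) (\<alpha> I a b)|} \<star> ?X \<star> u = {|\<Lambda> (a \<box> b)|} \<star> \<theta> I (a \<box> b) \<star>\<^sub>2 \<theta> a b \<star> u"
    by simp
  also have "\<dots> = {|\<Lambda> (a \<box> b)|} \<star> \<theta> I (a \<box> b) \<star> u \<star> \<theta> a b"
    by (rule parallel[symmetric]; simp)
  also have "\<dots> = jmap M (\<theta> a b)"
    using jmap_binary[of "\<theta> a b" a b "Idn C (a \<box> b)"] by (simp add: lambda_props idn_comp_at)
  finally have l: "{|Comp C (\<Lambda> (a \<box> b)) (\<alpha> I a b)|} \<star> ?X \<star> u = jmap M (\<theta> a b)" .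
  have "{|\<Lambda> a \<Otimes> Idn C b|} \<star> ?X \<star> u = \<theta> a b \<star> ({|\<Lambda> a|} \<star> \<theta> I a) \<star> u"
    using whisker_left[of "\<Lambda> a" b "\<theta> I a"] by (simp add: numeral_2_eq_2)
  also have "\<dots> = \<theta> a b \<star> ({|\<Lambda> a|} \<star> \<theta> I a \<star> u)"
    by (rule assoc[symmetric]; simp)
  also have "\<dots> = jmap M (\<theta> a b)"
    using jmap_first[of "\<theta> a b" "Idn C a" b] by (simp add: lambda_props comp_at_idn)
  finally show "{|Comp C (\<Lambda> (a \<box> b)) (\<alpha> I a b)|} \<star> \<theta> (I \<box> a) b \<star> \<theta> I a \<star> u =
      {|\<Lambda> a \<Otimes> Idn C b|} \<star> \<theta> (I \<box> a) b \<star> \<theta> I a \<star> u"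
    using l by (simp add: push)
qed simp_all

lemma K_alpha_rho:
  assumes [simp]: "ob a" "ob b"
  shows "Comp C (\<alpha> a b I) (\<rho> (a \<box> b)) = Idn C a \<Otimes> \<rho> b"
proof (rule arrow_eqI[of _ _ a b])
  have "{|Comp C (\<alpha> a b I) (\<rho> (a \<box> b))|} \<star> \<theta> a b = {|\<alpha> a b I|} \<star> (\<theta> (a \<box> b) I \<star>\<^sub>2 u \<star> \<theta> a b)"
    by (simp add: comp_push rho_unary)
  also have "\<theta> (a \<box> b) I \<star>\<^sub>2 u \<star> \<theta> a b = \<theta> (a \<box> b) I \<star> \<theta> a b \<star>\<^sub>3 u"
    by (rule parallel[symmetric]; simp)
  also have "{|\<alpha> a b I|} \<star> (\<theta> (a \<box> b) I \<star> \<theta> a b \<star>\<^sub>3 u) = {|\<alpha> a b I|} \<star> (\<theta> (a \<box> b) I \<star> \<theta> a b) \<star>\<^sub>3 u"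
    by (rule unary_push; simp)
  also have "\<dots> = \<theta> a (b \<box> I) \<star>\<^sub>2 \<theta> b I \<star>\<^sub>3 u" by (simp add: alpha_theta)
  also have "\<dots> = \<theta> a (b \<box> I) \<star>\<^sub>2 (\<theta> b I \<star>\<^sub>2 u)" by (rule assoc[symmetric]; simp)
  finally show "{|Comp C (\<alpha> a b I) (\<rho> (a \<box> b))|} \<star> \<theta> a b = {|Idn C a \<Otimes> \<rho> b|} \<star> \<theta> a b"
    by (simp add: tensor_theta comp_at_idn rho_unary)
qed simp_all

lemma K_lambda_alpha_rho:
  assumes [simp]: "ob a" "ob b"
  shows "Comp C (Idn C a \<Otimes> \<Lambda> b) (Comp C (\<alpha> a I b) (\<rho> a \<Otimes> Idn C b)) = Idn C (a \<box> b)"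
proof (rule arrow_eqI[of _ _ a b])
  have "{|\<rho> a \<Otimes> Idn C b|} \<star> \<theta> a b = \<theta> (a \<box> I) b \<star> (\<theta> a I \<star>\<^sub>2 u)"
    by (simp add: tensor_theta comp_at_idn rho_unary)
  also have "\<dots> = \<theta> (a \<box> I) b \<star> \<theta> a I \<star>\<^sub>2 u" by (rule assoc; simp)
  finally have "{|Comp C (\<alpha> a I b) (\<rho> a \<Otimes> Idn C b)|} \<star> \<theta> a b = {|\<alpha> a I b|} \<star> (\<theta> (a \<box> I) b \<star> \<theta> a I \<star>\<^sub>2 u)"
    by (simp add: comp_push)
  also have "\<dots> = {|\<alpha> a I b|} \<star> (\<theta> (a \<box> I) b \<star> \<theta> a I) \<star>\<^sub>2 u" by (rule unary_push; simp)
  also have "\<dots> = \<theta> a (I \<box> b) \<star>\<^sub>2 \<theta> I b \<star>\<^sub>2 u" by (simp add: alpha_theta)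
  also have "\<dots> = \<theta> a (I \<box> b) \<star>\<^sub>2 (\<theta> I b \<star> u)" by (rule assoc[symmetric]; simp)
  finally have "{|Comp C (Idn C a \<Otimes> \<Lambda> b) (Comp C (\<alpha> a I b) (\<rho> a \<Otimes> Idn C b))|} \<star> \<theta> a b =
      \<theta> a b \<star>\<^sub>2 ({|\<Lambda> b|} \<star> (\<theta> I b \<star> u))"
    using whisker_right[of "\<Lambda> b" a "\<theta> I b \<star> u"] by (simp add: comp_push numeral_2_eq_2)
  also have "\<dots> = \<theta> a b"
    using jmap_second[of "\<theta> a b" a "Idn C b"] by (simp add: lambda_theta comp_at_idn)
  finally show "{|Comp C (Idn C a \<Otimes> \<Lambda> b) (Comp C (\<alpha> a I b) (\<rho> a \<Otimes> Idn C b))|} \<star> \<theta> a b = {|Idn C (a \<box> b)|} \<star> \<theta> a b"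
    by (simp add: idn_comp_at)
qed simp_all

lemma K_lambda_rho: "Comp C (\<Lambda> I) (\<rho> I) = Idn C I"
proof (rule arrow_eqI_u)
  have "{|Comp C (\<Lambda> I) (\<rho> I)|} \<star> u = {|\<Lambda> I|} \<star> (\<theta> I I \<star>\<^sub>2 u) \<star> u"
    by (simp add: unary_comp_arrow rho_unary)
  also have "{|\<Lambda> I|} \<star> (\<theta> I I \<star>\<^sub>2 u) = {|\<Lambda> I|} \<star> \<theta> I I \<star>\<^sub>2 u" by (rule unary_push; simp)
  also have "\<dots> \<star> u = {|\<Lambda> I|} \<star> \<theta> I I \<star> u \<star> u" by (rule parallel[symmetric]; simp)
  also have "\<dots> = {|Idn C I|} \<star> u" by (simp add: lambda_props jmap_nullary)
  finally show "{|Comp C (\<Lambda> I) (\<rho> I)|} \<star> u = {|Idn C I|} \<star> u" .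
qed simp_all

lemma K_s_simps [simp]:
  "scat (K_s_obj D M) = C" "sobj (K_s_obj D M) = Obj C" "shom (K_s_obj D M) = hom C" "scomp (K_s_obj D M) = Comp C"
  "sid (K_s_obj D M) = Idn C" "sunit (K_s_obj D M) = I"
  "alpha (K_s_obj D M) = \<alpha>" "lambda (K_s_obj D M) = \<Lambda>" "rho (K_s_obj D M) = \<rho>"
  "ob a \<Longrightarrow> ob b \<Longrightarrow> tens_obj (K_s_obj D M) a b = a \<box> b"
  "ar p \<Longrightarrow> ar q \<Longrightarrow> tens_arr (K_s_obj D M) p q = p \<Otimes> q"
  by (simp_all add: K_s_obj_def sobj_def shom_def scomp_def sid_def tens_obj_def tens_arr_def)

lemma homs: "f \<in> hom C a b \<longleftrightarrow> f \<in> Arr C \<and> Dom C f = a \<and> Cod C f = b"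
  by (simp add: hom_def)

sublocale K: skew_monoidal_category "K_s_obj D M"
proof (rule skew_monoidal_category.intro)
  show "category (scat (K_s_obj D M))" using category by simp
  show "is_functor (prod_cat (scat (K_s_obj D M)) (scat (K_s_obj D M))) (scat (K_s_obj D M)) (stens (K_s_obj D M))"
  proof (rule is_functorI)
    show "category (prod_cat (scat (K_s_obj D M)) (scat (K_s_obj D M)))" "category (scat (K_s_obj D M))"
      using category by (simp_all add: category_prod)
  qed (auto simp: K_s_obj_def prod_cat_def hom_def tensor_idn tensor_comp)
qed (auto simp: homs K_alpha_nat K_lambda_nat K_rho_nat K_pentagon K_lambda_alpha K_alpha_rho K_lambda_alpha_rho K_lambda_rho
      intro: obj_simps)

end

subsection \<open>The braiding\<close>

lemma swap_at_simps [simp]: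
  "swap_at 2 [a, b, c] = [a, c, b]" "swap_at 2 [a, b, c, d] = [a, c, b, d]" "swap_at 3 [a, b, c, d] = [a, b, d, c]"
  by (simp_all add: swap_at_def)

context short_braiding
begin

definition \<beta>\<^sub>3 where "\<beta>\<^sub>3 f = TM Tight (swap_at 2 (src f)) (tgt f) (b32 B (src f) (tgt f) (elt f))"
definition \<beta>\<^sub>4\<^sub>2 where "\<beta>\<^sub>4\<^sub>2 f = TM Tight (swap_at 2 (src f)) (tgt f) (b42 B (src f) (tgt f) (elt f))"
definition \<beta>\<^sub>4\<^sub>3 where "\<beta>\<^sub>4\<^sub>3 f = TM Tight (swap_at 3 (src f)) (tgt f) (b43 B (src f) (tgt f) (elt f))"

lemma beta_sel [simp]:
  "knd (\<beta>\<^sub>3 f) = Tight" "src (\<beta>\<^sub>3 f) = swap_at 2 (src f)" "tgt (\<beta>\<^sub>3 f) = tgt f"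
  "knd (\<beta>\<^sub>4\<^sub>2 f) = Tight" "src (\<beta>\<^sub>4\<^sub>2 f) = swap_at 2 (src f)" "tgt (\<beta>\<^sub>4\<^sub>2 f) = tgt f"
  "knd (\<beta>\<^sub>4\<^sub>3 f) = Tight" "src (\<beta>\<^sub>4\<^sub>3 f) = swap_at 3 (src f)" "tgt (\<beta>\<^sub>4\<^sub>3 f) = tgt f"
  by (simp_all add: \<beta>\<^sub>3_def \<beta>\<^sub>4\<^sub>2_def \<beta>\<^sub>4\<^sub>3_def)

lemma exchange_bij:
  assumes ex: "is_exchange M n k \<beta>" and as: "length as = n" "set as \<subseteq> Obj C" "ob c" and k: "length (swap_at k as) = n"
  shows "bij_betw (ap (\<beta> (as, c))) (mm M Tight as c) (mm M Tight (swap_at k as) c)"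
proof -
  have o: "(as, c) \<in> Obj (mdom C n)" using as by (simp add: mdom_simps)
  note nt = ex[unfolded is_exchange_def nat_iso_def]
  have h: "\<beta> (as, c) \<in> hom set_cat (mm M Tight as c) (mm M Tight (swap_at k as) c)"
    using nat_transD(4)[OF conjunct1[OF nt] o] o k
    by (simp add: comp_functor_apply swap_functor_def mm_def as(1))
  have "is_iso set_cat (\<beta> (as, c))" using nt o by blast
  then show ?thesis using is_iso_set_cat[OF h] by blast
qed

lemma exchange_nat:
  assumes ex: "is_exchange M n k \<beta>" and ps: "length ps = n" "set ps \<subseteq> Arr C" "ar q" "length (swap_at k ps) = n"
    and f: "f \<in> mm M Tight (map (Cod C) ps) (Dom C q)"
  shows "ap (\<beta> (map (Dom C) ps, Cod C q)) (act Tight ps q f) = act Tight (swap_at k ps) q (ap (\<beta> (map (Cod C) ps, Dom C q)) f)"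
proof -
  have h: "(ps, q) \<in> hom (mdom C n) (map (Cod C) ps, Dom C q) (map (Dom C) ps, Cod C q)"
    using ps by (simp add: hom_def mdom_simps)
  have a: "(ps, q) \<in> Arr (mdom C n)" using h by (rule homD)
  note nt = ex[unfolded is_exchange_def nat_iso_def]
  show ?thesis
    using set_nat_trans_ap[OF conjunct1[OF nt] h, of f] a f ps
    by (simp add: act_def mm_def comp_functor_apply swap_functor_def)
qed

lemma beta_valid [simp]:
  assumes "valid M f" "knd f = Tight"
  shows "src f = [a1, a2, a3] \<Longrightarrow> valid M (\<beta>\<^sub>3 f)"
    and "src f = [a1, a2, a3, a4] \<Longrightarrow> valid M (\<beta>\<^sub>4\<^sub>2 f)"
    and "src f = [a1, a2, a3, a4] \<Longrightarrow> valid M (\<beta>\<^sub>4\<^sub>3 f)"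
  using bij_betw_apply[OF exchange_bij[OF beta32, of "src f" "tgt f"], of "elt f"]
    bij_betw_apply[OF exchange_bij[OF beta42, of "src f" "tgt f"], of "elt f"]
    bij_betw_apply[OF exchange_bij[OF beta43, of "src f" "tgt f"], of "elt f"] validD[OF assms(1)] assms(2)
  by (simp_all add: valid_def mtype_def \<beta>\<^sub>3_def \<beta>\<^sub>4\<^sub>2_def \<beta>\<^sub>4\<^sub>3_def b32_def b42_def b43_def)

lemma beta3_inj:
  assumes f: "valid M f" "knd f = Tight" "src f = [a1, a2, a3]" and g: "valid M g" "knd g = Tight" "src g = [a1, a2, a3]"
    and eq: "\<beta>\<^sub>3 f = \<beta>\<^sub>3 g"
  shows "f = g"
proof (rule tmap_eqI)
  show t: "tgt f = tgt g" using arg_cong[OF eq, of tgt] by simp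
  have "elt (\<beta>\<^sub>3 f) = elt (\<beta>\<^sub>3 g)" using eq by simp
  then show "elt f = elt g"
    using inj_onD[OF bij_betw_imp_inj_on[OF exchange_bij[OF beta32, of "src f" "tgt f"]], of "elt f" "elt g"]
      validD[OF f(1)] validD[OF g(1)] f g t by (simp add: \<beta>\<^sub>3_def b32_def)
qed (use f g in simp_all)

lemma beta3_surj:
  assumes f: "valid M f" "knd f = Tight" "src f = [a1, a3, a2]"
  shows "\<exists>g. valid M g \<and> knd g = Tight \<and> src g = [a1, a2, a3] \<and> tgt g = tgt f \<and> \<beta>\<^sub>3 g = f"
proof -
  have "elt f \<in> ap (beta32 B ([a1, a2, a3], tgt f)) ` mm M Tight [a1, a2, a3] (tgt f)"
    using bij_betw_imp_surj_on[OF exchange_bij[OF beta32, of "[a1, a2, a3]" "tgt f"]] validD[OF f(1)] f by simp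
  then obtain m where m: "m \<in> mm M Tight [a1, a2, a3] (tgt f)" "elt f = b32 B [a1, a2, a3] (tgt f) m" by (auto simp: b32_def)
  have "valid M (TM Tight [a1, a2, a3] (tgt f) m)" using m validD[OF f(1)] f by (simp add: valid_def mtype_def)
  moreover have "\<beta>\<^sub>3 (TM Tight [a1, a2, a3] (tgt f) m) = f" using m f by (intro tmap_eqI) (simp_all add: \<beta>\<^sub>3_def)
  ultimately show ?thesis by fastforce
qed

lemma beta_post:
  assumes f: "valid M f" "knd f = Tight" and q: "ar q" "Dom C q = tgt f"
  shows "src f = [a1, a2, a3] \<Longrightarrow> \<beta>\<^sub>3 ({|q|} \<star> f) = {|q|} \<star> \<beta>\<^sub>3 f"
    and "src f = [a1, a2, a3, a4] \<Longrightarrow> \<beta>\<^sub>4\<^sub>2 ({|q|} \<star> f) = {|q|} \<star> \<beta>\<^sub>4\<^sub>2 f"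
    and "src f = [a1, a2, a3, a4] \<Longrightarrow> \<beta>\<^sub>4\<^sub>3 ({|q|} \<star> f) = {|q|} \<star> \<beta>\<^sub>4\<^sub>3 f"
proof -
  note v = validD[OF f(1)] and p = unary_comp_at[OF f(1) q]
  show "\<beta>\<^sub>3 ({|q|} \<star> f) = {|q|} \<star> \<beta>\<^sub>3 f" if s: "src f = [a1, a2, a3]"
    unfolding p unary_comp_at[OF beta_valid(1)[OF f s], of q, simplified, OF q]
    using exchange_nat[OF beta32, of "map (Idn C) (src f)" q "elt f"] v f q s
    by (simp add: \<beta>\<^sub>3_def post_eq b32_def)
  show "\<beta>\<^sub>4\<^sub>2 ({|q|} \<star> f) = {|q|} \<star> \<beta>\<^sub>4\<^sub>2 f" if s: "src f = [a1, a2, a3, a4]"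
    unfolding p unary_comp_at[OF beta_valid(2)[OF f s], of q, simplified, OF q]
    using exchange_nat[OF beta42, of "map (Idn C) (src f)" q "elt f"] v f q s
    by (simp add: \<beta>\<^sub>4\<^sub>2_def post_eq b42_def)
  show "\<beta>\<^sub>4\<^sub>3 ({|q|} \<star> f) = {|q|} \<star> \<beta>\<^sub>4\<^sub>3 f" if s: "src f = [a1, a2, a3, a4]"
    unfolding p unary_comp_at[OF beta_valid(3)[OF f s], of q, simplified, OF q]
    using exchange_nat[OF beta43, of "map (Idn C) (src f)" q "elt f"] v f q s
    by (simp add: \<beta>\<^sub>4\<^sub>3_def post_eq b43_def)
qed

lemma beta3_pre:
  assumes f: "valid M f" "knd f = Tight" "src f = [a1, a2, a3]" and p: "ar p"
  shows "Cod C p = a1 \<Longrightarrow> \<beta>\<^sub>3 (f \<star> {|p|}) = \<beta>\<^sub>3 f \<star> {|p|}"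
    and "Cod C p = a2 \<Longrightarrow> \<beta>\<^sub>3 (f \<star>\<^sub>2 {|p|}) = \<beta>\<^sub>3 f \<star>\<^sub>3 {|p|}"
    and "Cod C p = a3 \<Longrightarrow> \<beta>\<^sub>3 (f \<star>\<^sub>3 {|p|}) = \<beta>\<^sub>3 f \<star>\<^sub>2 {|p|}"
proof -
  note v = validD[OF f(1)]
  show "Cod C p = a1 \<Longrightarrow> \<beta>\<^sub>3 (f \<star> {|p|}) = \<beta>\<^sub>3 f \<star> {|p|}"
    using exchange_nat[OF beta32, of "[p, Idn C a2, Idn C a3]" "Idn C (tgt f)" "elt f"] v f p
    by (simp add: comp_at_unary \<beta>\<^sub>3_def pre_eq b32_def)
  show "Cod C p = a2 \<Longrightarrow> \<beta>\<^sub>3 (f \<star>\<^sub>2 {|p|}) = \<beta>\<^sub>3 f \<star>\<^sub>3 {|p|}"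
    using exchange_nat[OF beta32, of "[Idn C a1, p, Idn C a3]" "Idn C (tgt f)" "elt f"] v f p
    by (simp add: comp_at_unary \<beta>\<^sub>3_def pre_eq b32_def)
  show "Cod C p = a3 \<Longrightarrow> \<beta>\<^sub>3 (f \<star>\<^sub>3 {|p|}) = \<beta>\<^sub>3 f \<star>\<^sub>2 {|p|}"
    using exchange_nat[OF beta32, of "[Idn C a1, Idn C a2, p]" "Idn C (tgt f)" "elt f"] v f p
    by (simp add: comp_at_unary \<beta>\<^sub>3_def pre_eq b32_def)
qed

lemma beta_yang_baxter:
  assumes "valid M h" "knd h = Tight" "src h = [a1, a2, a3, a4]"
  shows "\<beta>\<^sub>4\<^sub>2 (\<beta>\<^sub>4\<^sub>3 (\<beta>\<^sub>4\<^sub>2 h)) = \<beta>\<^sub>4\<^sub>3 (\<beta>\<^sub>4\<^sub>2 (\<beta>\<^sub>4\<^sub>3 h))"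
  using yang_baxter[of a1 a2 a3 a4 "tgt h" "elt h"] validD[OF assms(1)] assms
  by (simp add: \<beta>\<^sub>4\<^sub>2_def \<beta>\<^sub>4\<^sub>3_def)

lemma comp_beta3:
  assumes "valid M g" "knd g = Tight" "src g = [b1, b2]" and f: "valid M f" "knd f = Tight" "src f = [a1, a2, a3]"
  shows "tgt f = b1 \<Longrightarrow> g \<star> \<beta>\<^sub>3 f = \<beta>\<^sub>4\<^sub>2 (g \<star> f)" and "tgt f = b2 \<Longrightarrow> g \<star>\<^sub>2 \<beta>\<^sub>3 f = \<beta>\<^sub>4\<^sub>3 (g \<star>\<^sub>2 f)"
  using binary_ternary_1[of a1 a2 a3 b1 b2 "tgt g" "elt g" "elt f"] binary_ternary_2[of a1 a2 a3 b1 b2 "tgt g" "elt g" "elt f"]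
    validD[OF assms(1)] validD[OF f(1)] assms
  by (simp_all add: \<beta>\<^sub>3_def \<beta>\<^sub>4\<^sub>2_def \<beta>\<^sub>4\<^sub>3_def comp_at_def)

lemma beta3_comp:
  assumes g: "valid M g" "knd g = Tight" "src g = [b1, b2, b3]" and f: "valid M f" "knd f = Tight" "src f = [a1, a2]"
  shows "tgt f = b1 \<Longrightarrow> \<beta>\<^sub>4\<^sub>3 (g \<star> f) = \<beta>\<^sub>3 g \<star> f"
    and "tgt f = b2 \<Longrightarrow> \<beta>\<^sub>4\<^sub>2 (\<beta>\<^sub>4\<^sub>3 (g \<star>\<^sub>2 f)) = \<beta>\<^sub>3 g \<star>\<^sub>3 f"
    and "tgt f = b3 \<Longrightarrow> \<beta>\<^sub>4\<^sub>3 (\<beta>\<^sub>4\<^sub>2 (g \<star>\<^sub>3 f)) = \<beta>\<^sub>3 g \<star>\<^sub>2 f"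
  using ternary_binary_1[of a1 a2 b1 b2 b3 "tgt g" "elt g" "elt f"] ternary_binary_2[of a1 a2 b1 b2 b3 "tgt g" "elt g" "elt f"]
    ternary_binary_3[of a1 a2 b1 b2 b3 "tgt g" "elt g" "elt f"] validD[OF g(1)] validD[OF f(1)] assms
  by (simp_all add: \<beta>\<^sub>3_def \<beta>\<^sub>4\<^sub>2_def \<beta>\<^sub>4\<^sub>3_def comp_at_def)

end

locale representable_braiding = representable M D + short_braiding M B
  for M :: "('o, 'm) ssm" and D :: "('o, 'm) lr_data" and B :: "('o, 'm) sbraid"
begin

abbreviation s where "s \<equiv> K_braid D M B"

abbreviation \<Theta> where "\<Theta> a b c \<equiv> \<theta> (a \<box> b) c \<star> \<theta> a b"

lemma braid_props:
  assumes [simp]: "ob x" "ob a" "ob b"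
  shows "s x a b \<in> hom C (x \<box> a \<box> b) (x \<box> b \<box> a)" and "{|s x a b|} \<star> \<Theta> x a b = \<beta>\<^sub>3 (\<Theta> x b a)"
proof -
  let ?f = "\<beta>\<^sub>3 (\<Theta> x b a)"
  have f: "valid M ?f" "knd ?f = Tight" "src ?f = [x, a, b]" using beta_valid(1)[of "\<Theta> x b a" x b a] by simp_all
  have *: "{|h|} \<star> \<theta> (x \<box> a) b \<star> \<theta> x a = {|h|} \<star> \<Theta> x a b" if "h \<in> hom C (x \<box> a \<box> b) (tgt ?f)" for h
    by (rule unary_push[symmetric]) (use that in \<open>simp_all add: hom_def\<close>)
  have "s x a b = (THE h. h \<in> hom C (x \<box> a \<box> b) (tgt ?f) \<and> {|h|} \<star> \<Theta> x a b = ?f)"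
    unfolding K_braid_def Let_def
    by (rule arg_cong[where f = The]) (auto simp: fun_eq_iff comp_at_def \<theta>_def hom_def \<beta>\<^sub>3_def)
  also have "\<dots> = (THE h. h \<in> hom C (x \<box> a \<box> b) (tgt ?f) \<and> {|h|} \<star> \<theta> (x \<box> a) b \<star> \<theta> x a = ?f)"
    by (rule arg_cong[where f = The], rule ext, rule conj_cong) (simp_all only: *)
  finally have p: "s x a b \<in> hom C (x \<box> a \<box> b) (tgt ?f) \<and> {|s x a b|} \<star> \<theta> (x \<box> a) b \<star> \<theta> x a = ?f"
    using theI'[OF arrow_ex_3[OF f]] by simp
  then show "s x a b \<in> hom C (x \<box> a \<box> b) (x \<box> b \<box> a)" by simp
  show "{|s x a b|} \<star> \<Theta> x a b = ?f" using p *[of "s x a b"] by simp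
qed

lemma braid_arr [simp]:
  assumes "ob x" "ob a" "ob b"
  shows "s x a b \<in> Arr C" "Dom C (s x a b) = x \<box> a \<box> b" "Cod C (s x a b) = x \<box> b \<box> a"
  using homD[OF braid_props(1)[OF assms]] by auto

lemma braid_theta: "ob x \<Longrightarrow> ob a \<Longrightarrow> ob b \<Longrightarrow> {|s x a b|} \<star> \<Theta> x a b = \<beta>\<^sub>3 (\<Theta> x b a)"
  by (rule braid_props(2))

lemma K_braid_nat:
  assumes [simp]: "ar f" "ar g" "ar h"
  shows "Comp C (s (Cod C f) (Cod C g) (Cod C h)) (f \<Otimes> g \<Otimes> h) = Comp C (f \<Otimes> h \<Otimes> g) (s (Dom C f) (Dom C g) (Dom C h))"
proof (rule arrow_eqI_3'[of _ _ "Dom C f" "Dom C g" "Dom C h"])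
  let ?x = "Dom C f" and ?a = "Dom C g" and ?b = "Dom C h" and ?x' = "Cod C f" and ?a' = "Cod C g" and ?b' = "Cod C h"
  have sw: "t \<star> {|f|} \<star>\<^sub>2 {|g|} \<star>\<^sub>3 {|h|} = t \<star> {|f|} \<star>\<^sub>3 {|h|} \<star>\<^sub>2 {|g|}" if "valid M t" "knd t = Tight" "src t = [?x', ?a', ?b']" for t
    by (rule parallel) (use that in simp_all)
  have "{|f \<Otimes> h \<Otimes> g|} \<star> \<beta>\<^sub>3 (\<Theta> ?x ?b ?a) = \<beta>\<^sub>3 ({|f \<Otimes> h \<Otimes> g|} \<star> \<Theta> ?x ?b ?a)"
    by (rule beta_post(1)[symmetric]; simp)
  also have "\<dots> = \<beta>\<^sub>3 (\<Theta> ?x' ?b' ?a' \<star> {|f|} \<star>\<^sub>2 {|h|} \<star>\<^sub>3 {|g|})" by (simp add: tensor3_left)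
  also have "\<dots> = \<beta>\<^sub>3 (\<Theta> ?x' ?b' ?a' \<star> {|f|} \<star>\<^sub>2 {|h|}) \<star>\<^sub>2 {|g|}" by (rule beta3_pre(3); simp)
  also have "\<beta>\<^sub>3 (\<Theta> ?x' ?b' ?a' \<star> {|f|} \<star>\<^sub>2 {|h|}) = \<beta>\<^sub>3 (\<Theta> ?x' ?b' ?a' \<star> {|f|}) \<star>\<^sub>3 {|h|}" by (rule beta3_pre(2); simp)
  also have "\<beta>\<^sub>3 (\<Theta> ?x' ?b' ?a' \<star> {|f|}) = \<beta>\<^sub>3 (\<Theta> ?x' ?b' ?a') \<star> {|f|}" by (rule beta3_pre(1); simp)
  also have "\<beta>\<^sub>3 (\<Theta> ?x' ?b' ?a') \<star> {|f|} \<star>\<^sub>3 {|h|} \<star>\<^sub>2 {|g|} = \<beta>\<^sub>3 (\<Theta> ?x' ?b' ?a') \<star> {|f|} \<star>\<^sub>2 {|g|} \<star>\<^sub>3 {|h|}"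
    by (rule sw[symmetric]) (simp_all add: beta_valid(1)[of _ ?x' ?b' ?a'])
  finally show "{|Comp C (s ?x' ?a' ?b') (f \<Otimes> g \<Otimes> h)|} \<star> \<Theta> ?x ?a ?b = {|Comp C (f \<Otimes> h \<Otimes> g) (s ?x ?a ?b)|} \<star> \<Theta> ?x ?a ?b"
    by (simp add: comp_push tensor3_left unary_push_3 braid_theta)
qed simp_all

text \<open>The inverse of \<open>s x a b\<close> is represented by the preimage of \<open>\<Theta> x a b\<close> under the exchange.\<close>

lemma K_braid_iso:
  assumes [simp]: "ob x" "ob a" "ob b"
  shows "is_iso C (s x a b)"
proof -
  obtain w where w: "valid M w" "knd w = Tight" "src w = [x, b, a]" "tgt w = x \<box> a \<box> b" "\<beta>\<^sub>3 w = \<Theta> x a b"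
    using beta3_surj[of "\<Theta> x a b" x a b] by auto
  obtain t where t: "t \<in> hom C (x \<box> b \<box> a) (x \<box> a \<box> b)" "{|t|} \<star> \<theta> (x \<box> b) a \<star> \<theta> x b = w"
    using arrow_ex_3[OF w(1-3)] w(4) by auto
  have [simp]: "ar t" "Dom C t = x \<box> b \<box> a" "Cod C t = x \<box> a \<box> b" using homD[OF t(1)] by auto
  have tw: "{|t|} \<star> \<Theta> x b a = w" unfolding t(2)[symmetric] by (rule unary_push; simp)
  have ts: "Comp C t (s x a b) = Idn C (x \<box> a \<box> b)"
  proof (rule arrow_eqI_3'[of _ _ x a b])
    have "{|Comp C t (s x a b)|} \<star> \<Theta> x a b = {|t|} \<star> \<beta>\<^sub>3 (\<Theta> x b a)" by (simp add: comp_push braid_theta)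
    also have "\<dots> = \<beta>\<^sub>3 ({|t|} \<star> \<Theta> x b a)" by (rule beta_post(1)[symmetric]; simp)
    finally show "{|Comp C t (s x a b)|} \<star> \<Theta> x a b = {|Idn C (x \<box> a \<box> b)|} \<star> \<Theta> x a b"
      by (simp add: tw w(5) idn_comp_at)
  qed simp_all
  have st: "Comp C (s x a b) t = Idn C (x \<box> b \<box> a)"
  proof (rule arrow_eqI_3'[of _ _ x b a])
    show "{|Comp C (s x a b) t|} \<star> \<Theta> x b a = {|Idn C (x \<box> b \<box> a)|} \<star> \<Theta> x b a"
    proof (rule beta3_inj[of _ x b a])
      have "\<beta>\<^sub>3 ({|Comp C (s x a b) t|} \<star> \<Theta> x b a) = \<beta>\<^sub>3 ({|s x a b|} \<star> w)" by (simp add: comp_push tw)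
      also have "\<dots> = {|s x a b|} \<star> \<beta>\<^sub>3 w" by (rule beta_post(1)) (simp_all add: w)
      finally show "\<beta>\<^sub>3 ({|Comp C (s x a b) t|} \<star> \<Theta> x b a) = \<beta>\<^sub>3 ({|Idn C (x \<box> b \<box> a)|} \<star> \<Theta> x b a)"
        by (simp add: w(5) braid_theta idn_comp_at)
    qed simp_all
  qed simp_all
  show ?thesis unfolding is_iso_def
    using inverse_arrowsI[OF braid_props(1)[OF assms] t(1) ts st] by blast
qed

lemma beta4_valid [simp]:
  assumes "ob x" "ob a" "ob b" "ob c"
  shows "valid M (\<beta>\<^sub>3 (\<Theta> x a b))"
    and "valid M (\<beta>\<^sub>4\<^sub>2 (\<Theta> (x \<box> a) b c \<star> \<theta> x a))" and "valid M (\<beta>\<^sub>4\<^sub>3 (\<Theta> (x \<box> a) b c \<star> \<theta> x a))"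
  using beta_valid(1)[of "\<Theta> x a b" x a b] beta_valid(2,3)[of "\<Theta> (x \<box> a) b c \<star> \<theta> x a" x a b c] assms by simp_all

abbreviation \<Theta>4 where "\<Theta>4 x a b c \<equiv> \<Theta> (x \<box> a) b c \<star> \<theta> x a"

lemma Theta4_eq:
  assumes [simp]: "ob x" "ob a" "ob b" "ob c"
  shows "\<Theta>4 x a b c = \<theta> (x \<box> a \<box> b) c \<star> \<Theta> x a b"
  by (rule assoc[symmetric]; simp)

text \<open>On four inputs, a braiding of the last two factors is \<open>\<beta>\<^sub>4\<^sub>3\<close> and a whiskered braiding is \<open>\<beta>\<^sub>4\<^sub>2\<close>.\<close>

lemma braid_Theta4:
  assumes [simp]: "ob x" "ob a" "ob b" "ob c"
  shows "{|s (x \<box> a) b c|} \<star> \<Theta>4 x a b c = \<beta>\<^sub>4\<^sub>3 (\<Theta>4 x a c b)"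
    and "{|s x a b \<Otimes> Idn C c|} \<star> \<Theta>4 x a b c = \<beta>\<^sub>4\<^sub>2 (\<Theta>4 x b a c)"
proof -
  have "{|s (x \<box> a) b c|} \<star> \<Theta>4 x a b c = {|s (x \<box> a) b c|} \<star> \<Theta> (x \<box> a) b c \<star> \<theta> x a"
    by (rule unary_push; simp)
  also have "\<dots> = \<beta>\<^sub>3 (\<Theta> (x \<box> a) c b) \<star> \<theta> x a" by (simp add: braid_theta)
  also have "\<dots> = \<beta>\<^sub>4\<^sub>3 (\<Theta>4 x a c b)" by (rule beta3_comp(1)[symmetric]; simp)
  finally show "{|s (x \<box> a) b c|} \<star> \<Theta>4 x a b c = \<beta>\<^sub>4\<^sub>3 (\<Theta>4 x a c b)" .
  have "{|s x a b \<Otimes> Idn C c|} \<star> \<Theta>4 x a b c = \<theta> (x \<box> b \<box> a) c \<star> ({|s x a b|} \<star> \<Theta> x a b)"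
    unfolding Theta4_eq[OF assms] using whisker_left[of "s x a b" c "\<Theta> x a b"] by (simp add: numeral_2_eq_2)
  also have "\<dots> = \<theta> (x \<box> b \<box> a) c \<star> \<beta>\<^sub>3 (\<Theta> x b a)" by (simp add: braid_theta)
  also have "\<dots> = \<beta>\<^sub>4\<^sub>2 (\<theta> (x \<box> b \<box> a) c \<star> \<Theta> x b a)" by (rule comp_beta3(1); simp)
  also have "\<dots> = \<beta>\<^sub>4\<^sub>2 (\<Theta>4 x b a c)" by (simp add: Theta4_eq)
  finally show "{|s x a b \<Otimes> Idn C c|} \<star> \<Theta>4 x a b c = \<beta>\<^sub>4\<^sub>2 (\<Theta>4 x b a c)" .
qed

lemma alpha_Theta4:
  assumes [simp]: "ob x" "ob a" "ob b" "ob c"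
  shows "{|\<alpha> x a b \<Otimes> Idn C c|} \<star> \<Theta>4 x a b c = \<Theta> x (a \<box> b) c \<star>\<^sub>2 \<theta> a b"
    and "{|\<alpha> (x \<box> a) b c|} \<star> \<Theta>4 x a b c = \<Theta> x a (b \<box> c) \<star>\<^sub>3 \<theta> b c"
    and "{|\<alpha> x (a \<box> b) c|} \<star> (\<Theta> x (a \<box> b) c \<star>\<^sub>2 \<theta> a b) = \<theta> x (a \<box> b \<box> c) \<star>\<^sub>2 \<Theta> a b c"
proof -
  have "{|\<alpha> x a b \<Otimes> Idn C c|} \<star> \<Theta>4 x a b c = \<theta> (x \<box> (a \<box> b)) c \<star> ({|\<alpha> x a b|} \<star> \<Theta> x a b)"
    unfolding Theta4_eq[OF assms] using whisker_left[of "\<alpha> x a b" c "\<Theta> x a b"] by (simp add: numeral_2_eq_2)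
  also have "\<dots> = \<theta> (x \<box> (a \<box> b)) c \<star> (\<theta> x (a \<box> b) \<star>\<^sub>2 \<theta> a b)" by (simp add: alpha_theta)
  also have "\<dots> = \<Theta> x (a \<box> b) c \<star>\<^sub>2 \<theta> a b" by (rule assoc; simp)
  finally show "{|\<alpha> x a b \<Otimes> Idn C c|} \<star> \<Theta>4 x a b c = \<Theta> x (a \<box> b) c \<star>\<^sub>2 \<theta> a b" .
  have "{|\<alpha> (x \<box> a) b c|} \<star> \<Theta>4 x a b c = {|\<alpha> (x \<box> a) b c|} \<star> \<Theta> (x \<box> a) b c \<star> \<theta> x a"
    by (rule unary_push; simp)
  also have "\<dots> = \<theta> (x \<box> a) (b \<box> c) \<star>\<^sub>2 \<theta> b c \<star> \<theta> x a" by (simp add: alpha_theta)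
  also have "\<dots> = \<Theta> x a (b \<box> c) \<star>\<^sub>3 \<theta> b c" by (rule parallel[symmetric]; simp)
  finally show "{|\<alpha> (x \<box> a) b c|} \<star> \<Theta>4 x a b c = \<Theta> x a (b \<box> c) \<star>\<^sub>3 \<theta> b c" .
  have "{|\<alpha> x (a \<box> b) c|} \<star> (\<Theta> x (a \<box> b) c \<star>\<^sub>2 \<theta> a b) = {|\<alpha> x (a \<box> b) c|} \<star> \<Theta> x (a \<box> b) c \<star>\<^sub>2 \<theta> a b"
    by (rule unary_push; simp)
  also have "\<dots> = \<theta> x (a \<box> b \<box> c) \<star>\<^sub>2 \<theta> (a \<box> b) c \<star>\<^sub>2 \<theta> a b" by (simp add: alpha_theta)
  also have "\<dots> = \<theta> x (a \<box> b \<box> c) \<star>\<^sub>2 \<Theta> a b c" by (rule assoc[symmetric]; simp)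
  finally show "{|\<alpha> x (a \<box> b) c|} \<star> (\<Theta> x (a \<box> b) c \<star>\<^sub>2 \<theta> a b) = \<theta> x (a \<box> b \<box> c) \<star>\<^sub>2 \<Theta> a b c" .
qed

lemma beta4_push:
  assumes "valid M f" "knd f = Tight" "src f = [a1, a2, a3, a4]" "ar q" "Dom C q = tgt f"
  shows "{|q|} \<star> \<beta>\<^sub>4\<^sub>2 f = \<beta>\<^sub>4\<^sub>2 ({|q|} \<star> f)" and "{|q|} \<star> \<beta>\<^sub>4\<^sub>3 f = \<beta>\<^sub>4\<^sub>3 ({|q|} \<star> f)"
  using beta_post[OF assms(1,2,4,5)] assms(3) by simp_all

lemma K_braid_braid:
  assumes [simp]: "ob x" "ob a" "ob b" "ob c"
  shows "Comp C (s (x \<box> c) a b) (Comp C (s x a c \<Otimes> Idn C b) (s (x \<box> a) b c)) =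
    Comp C (s x b c \<Otimes> Idn C a) (Comp C (s (x \<box> b) a c) (s x a b \<Otimes> Idn C c))"
  by (rule arrow_eqI_4'[of _ _ x a b c]) (simp_all add: comp_push braid_Theta4 beta4_push beta_yang_baxter)

lemma K_braid_alpha_1:
  assumes [simp]: "ob x" "ob a" "ob b" "ob c"
  shows "Comp C (s x a (b \<box> c)) (\<alpha> (x \<box> a) b c) =
    Comp C (\<alpha> x b c \<Otimes> Idn C a) (Comp C (s (x \<box> b) a c) (s x a b \<Otimes> Idn C c))"
proof (rule arrow_eqI_4'[of _ _ x a b c])
  have "{|s x a (b \<box> c)|} \<star> (\<Theta> x a (b \<box> c) \<star>\<^sub>3 \<theta> b c) = {|s x a (b \<box> c)|} \<star> \<Theta> x a (b \<box> c) \<star>\<^sub>3 \<theta> b c"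
    by (rule unary_push; simp)
  also have "\<dots> = \<beta>\<^sub>3 (\<Theta> x (b \<box> c) a) \<star>\<^sub>3 \<theta> b c" by (simp add: braid_theta)
  also have "\<dots> = \<beta>\<^sub>4\<^sub>2 (\<beta>\<^sub>4\<^sub>3 (\<Theta> x (b \<box> c) a \<star>\<^sub>2 \<theta> b c))" by (rule beta3_comp(2)[symmetric]; simp)
  finally show "{|Comp C (s x a (b \<box> c)) (\<alpha> (x \<box> a) b c)|} \<star> \<Theta>4 x a b c =
      {|Comp C (\<alpha> x b c \<Otimes> Idn C a) (Comp C (s (x \<box> b) a c) (s x a b \<Otimes> Idn C c))|} \<star> \<Theta>4 x a b c"
    by (simp add: comp_push braid_Theta4 alpha_Theta4 beta4_push)
qed simp_all

lemma K_braid_alpha_2: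
  assumes [simp]: "ob x" "ob a" "ob b" "ob c"
  shows "Comp C (s x (a \<box> b) c) (\<alpha> x a b \<Otimes> Idn C c) =
    Comp C (\<alpha> (x \<box> c) a b) (Comp C (s x a c \<Otimes> Idn C b) (s (x \<box> a) b c))"
proof (rule arrow_eqI_4'[of _ _ x a b c])
  have "{|s x (a \<box> b) c|} \<star> (\<Theta> x (a \<box> b) c \<star>\<^sub>2 \<theta> a b) = {|s x (a \<box> b) c|} \<star> \<Theta> x (a \<box> b) c \<star>\<^sub>2 \<theta> a b"
    by (rule unary_push; simp)
  also have "\<dots> = \<beta>\<^sub>3 (\<Theta> x c (a \<box> b)) \<star>\<^sub>2 \<theta> a b" by (simp add: braid_theta)
  also have "\<dots> = \<beta>\<^sub>4\<^sub>3 (\<beta>\<^sub>4\<^sub>2 (\<Theta> x c (a \<box> b) \<star>\<^sub>3 \<theta> a b))" by (rule beta3_comp(3)[symmetric]; simp)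
  finally show "{|Comp C (s x (a \<box> b) c) (\<alpha> x a b \<Otimes> Idn C c)|} \<star> \<Theta>4 x a b c =
      {|Comp C (\<alpha> (x \<box> c) a b) (Comp C (s x a c \<Otimes> Idn C b) (s (x \<box> a) b c))|} \<star> \<Theta>4 x a b c"
    by (simp add: comp_push braid_Theta4 alpha_Theta4 beta4_push)
qed simp_all

lemma K_braid_alpha_3:
  assumes [simp]: "ob x" "ob a" "ob b" "ob c"
  shows "Comp C (Idn C x \<Otimes> s a b c) (Comp C (\<alpha> x (a \<box> b) c) (\<alpha> x a b \<Otimes> Idn C c)) =
    Comp C (\<alpha> x (a \<box> c) b) (Comp C (\<alpha> x a c \<Otimes> Idn C b) (s (x \<box> a) b c))"
proof (rule arrow_eqI_4'[of _ _ x a b c])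
  have "{|Idn C x \<Otimes> s a b c|} \<star> (\<theta> x (a \<box> b \<box> c) \<star>\<^sub>2 \<Theta> a b c) = \<theta> x (a \<box> c \<box> b) \<star>\<^sub>2 ({|s a b c|} \<star> \<Theta> a b c)"
    using whisker_right[of "s a b c" x "\<Theta> a b c"] by (simp add: numeral_2_eq_2)
  also have "\<dots> = \<theta> x (a \<box> c \<box> b) \<star>\<^sub>2 \<beta>\<^sub>3 (\<Theta> a c b)" by (simp add: braid_theta)
  also have "\<dots> = \<beta>\<^sub>4\<^sub>3 (\<theta> x (a \<box> c \<box> b) \<star>\<^sub>2 \<Theta> a c b)" by (rule comp_beta3(2); simp)
  finally show "{|Comp C (Idn C x \<Otimes> s a b c) (Comp C (\<alpha> x (a \<box> b) c) (\<alpha> x a b \<Otimes> Idn C c))|} \<star> \<Theta>4 x a b c =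
      {|Comp C (\<alpha> x (a \<box> c) b) (Comp C (\<alpha> x a c \<Otimes> Idn C b) (s (x \<box> a) b c))|} \<star> \<Theta>4 x a b c"
    by (simp add: comp_push braid_Theta4 alpha_Theta4 beta4_push)
qed simp_all

lemma K_braiding: "braiding (K_s_obj D M) s"
proof (intro braiding.intro braiding_axioms.intro)
  show "skew_monoidal_category (K_s_obj D M)" by (rule K.skew_monoidal_category_axioms)
qed (auto simp: homs K_braid_iso K_braid_nat K_braid_braid K_braid_alpha_1 K_braid_alpha_2 K_braid_alpha_3)

lemma K_symmetry:
  assumes "short_symmetry M B" shows "symmetry (K_s_obj D M) s"
proof -
  have bb: "\<beta>\<^sub>3 (\<beta>\<^sub>3 (\<Theta> x a b)) = \<Theta> x a b" if "ob x" "ob a" "ob b" for x a b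
  proof (rule tmap_eqI)
    have "elt (\<Theta> x a b) \<in> mm M Tight [x, a, b] (x \<box> a \<box> b)"
      using validD(4)[of "\<Theta> x a b"] that by simp
    then show "elt (\<beta>\<^sub>3 (\<beta>\<^sub>3 (\<Theta> x a b))) = elt (\<Theta> x a b)"
      using assms that by (simp add: short_symmetry_def \<beta>\<^sub>3_def)
  qed simp_all
  have ss: "Comp C (s x b a) (s x a b) = Idn C (x \<box> a \<box> b)" if [simp]: "ob x" "ob a" "ob b" for x a b
  proof (rule arrow_eqI_3'[of _ _ x a b])
    have "{|s x b a|} \<star> \<beta>\<^sub>3 (\<Theta> x b a) = \<beta>\<^sub>3 ({|s x b a|} \<star> \<Theta> x b a)" by (rule beta_post(1)[symmetric]; simp)
    then show "{|Comp C (s x b a) (s x a b)|} \<star> \<Theta> x a b = {|Idn C (x \<box> a \<box> b)|} \<star> \<Theta> x a b"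
      by (simp add: comp_push braid_theta bb idn_comp_at)
  qed simp_all
  show ?thesis
    using K_braiding ss by (auto simp: symmetry_def intro!: inverse_arrowsI braid_props(1))
qed

end

section \<open>Morphisms of short skew multicategories\<close>

definition app :: "('o, 'm) ssm_mor \<Rightarrow> ('o, 'm) tmap \<Rightarrow> ('o, 'm) tmap" where
  "app F f = TM (knd f) (map (fobj (mm_fun F)) (src f)) (fobj (mm_fun F) (tgt f))
     (mmap F (knd f) (src f) (tgt f) (elt f))"

lemma app_sel [simp]:
  "knd (app F f) = knd f" "src (app F f) = map (fobj (mm_fun F)) (src f)" "tgt (app F f) = fobj (mm_fun F) (tgt f)"
  by (simp_all add: app_def)

context short_skew_multicategory
begin

text \<open>The simultaneous action of arrows on all inputs is a composite of actions on single inputs; \<open>k\<close>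
  counts the inputs already treated.\<close>

definition act_upto :: "'m list \<Rightarrow> nat \<Rightarrow> ('o, 'm) tmap \<Rightarrow> ('o, 'm) tmap" where
  "act_upto ps k f = TM (knd f) (map (Dom C) (take k ps) @ drop k (src f)) (tgt f)
     (act (knd f) (take k ps @ map (Idn C) (drop k (src f))) (Idn C (tgt f)) (elt f))"

lemma act_upto_step:
  assumes f: "valid M f" and ps: "set ps \<subseteq> Arr C" "map (Cod C) ps = src f" and k: "k < length (src f)"
  shows "act_upto ps (Suc k) f = act_upto ps k f \<star>\<^bsub>Suc k\<^esub> {|ps ! k|}" "valid M (act_upto ps k f)"
proof -
  note v = validD[OF f]
  have l: "length ps = length (src f)" using arg_cong[OF ps(2), of length] by simp
  have nth [simp]: "ps ! i \<in> Arr C" "Cod C (ps ! i) = src f ! i" "src f ! i \<in> Obj C" if "i < length (src f)" for i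
    using that l subsetD[OF ps(1), of "ps ! i"] subsetD[OF v(2), of "src f ! i"] nth_map[of i ps "Cod C"] ps(2) by simp_all
  let ?ps = "take k ps @ map (Idn C) (drop k (src f))"
  let ?s = "map (Dom C) (take k ps) @ drop k (src f)"
  let ?ids = "(map (Idn C) ?s)[k := ps ! k]"
  have lp: "length ?ps = length (src f)" "length ?s = length (src f)" using k l by simp_all
  have a: "set ?ps \<subseteq> Arr C" "set ?ids \<subseteq> Arr C" and so: "set ?s \<subseteq> Obj C"
  proof -
    show "set ?ps \<subseteq> Arr C" using ps(1) v(2) by (auto dest!: in_set_takeD in_set_dropD)
    show s: "set ?s \<subseteq> Obj C" using ps(1) v(2) by (auto dest!: in_set_takeD in_set_dropD)
    show "set ?ids \<subseteq> Arr C" by (rule arr_list_update[OF s nth(1)[OF k]])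
  qed
  have c: "map (Cod C) ?ps = src f" "map (Dom C) ?ps = ?s"
    using k l by (auto intro!: nth_equalityI simp: nth_append)
  have ci: "map (Cod C) ?ids = ?s" by (rule cod_list_update[OF so]) (use k l in \<open>simp add: nth_append\<close>)
  have di: "?s[k := Dom C (ps ! k)] = map (Dom C) (take (Suc k) ps) @ drop (Suc k) (src f)"
    using k l by (auto intro!: nth_equalityI simp: nth_append nth_list_update less_Suc_eq)
  have m: "map2 (Comp C) ?ps ?ids = take (Suc k) ps @ map (Idn C) (drop (Suc k) (src f))"
    using k l by (auto intro!: nth_equalityI simp: nth_append nth_list_update less_Suc_eq)
  have el: "elt (act_upto ps k f) \<in> mm M (knd f) ?s (tgt f)"
    using act_in[of "knd f" ?ps "Idn C (tgt f)" "elt f"] lp v a c by (simp add: act_upto_def)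
  then show "valid M (act_upto ps k f)" using v lp so by (simp add: valid_def mtype_def act_upto_def)
  have "act (knd f) ?ids (Idn C (tgt f)) (act (knd f) ?ps (Idn C (tgt f)) (elt f)) =
      act (knd f) (take (Suc k) ps @ map (Idn C) (drop (Suc k) (src f))) (Idn C (tgt f)) (elt f)"
    by (rule act_act_eq[OF _ a(1) _ c(1) _ v(4) a(2) _ ci c(2) _ m]) (use v lp in simp_all)
  then show "act_upto ps (Suc k) f = act_upto ps k f \<star>\<^bsub>Suc k\<^esub> {|ps ! k|}"
    using lp k by (simp add: act_upto_def comp_at_unary pre_eq di)
qed

lemma act_upto_0: "valid M f \<Longrightarrow> act_upto ps 0 f = f"
  using act_idn[of "knd f" "src f" "tgt f" "elt f"] validD[of f] by (intro tmap_eqI) (simp_all add: act_upto_def)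

lemma act_upto_full:
  assumes f: "valid M f" and ps: "set ps \<subseteq> Arr C" "map (Cod C) ps = src f" and q: "ar q" "Dom C q = tgt f"
  shows "{|q|} \<star> act_upto ps (length (src f)) f = TM (knd f) (map (Dom C) ps) (Cod C q) (act (knd f) ps q (elt f))"
    and "valid M (act_upto ps (length (src f)) f)"
proof -
  note v = validD[OF f]
  have l: "length ps = length (src f)" using arg_cong[OF ps(2), of length] by simp
  have e: "act_upto ps (length (src f)) f = TM (knd f) (map (Dom C) ps) (tgt f) (act (knd f) ps (Idn C (tgt f)) (elt f))"
    using l by (simp add: act_upto_def)
  have so: "set (map (Dom C) ps) \<subseteq> Obj C" using ps(1) by auto
  show va: "valid M (act_upto ps (length (src f)) f)"
    using act_in[of "knd f" ps "Idn C (tgt f)" "elt f"] v ps so l unfolding e by (simp add: valid_def mtype_def)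
  have ma: "map2 (Comp C) ps (map (Idn C) (map (Dom C) ps)) = ps"
    using ps(1) by (intro nth_equalityI) (auto simp: subset_iff)
  have "act (knd f) (map (Idn C) (map (Dom C) ps)) q (act (knd f) ps (Idn C (tgt f)) (elt f)) = act (knd f) ps q (elt f)"
    by (rule act_act_eq[OF _ ps(1) _ ps(2) _ v(4) arr_idn[OF so] q(1) map_cod_idn[OF so] refl _ ma])
      (use v l q in simp_all)
  then show "{|q|} \<star> act_upto ps (length (src f)) f = TM (knd f) (map (Dom C) ps) (Cod C q) (act (knd f) ps q (elt f))"
    using unary_comp_at[OF va q(1)] q by (simp add: e post_eq)
qed

end

locale multi_pair = short_skew_multicategory M + N: short_skew_multicategory N
  for M :: "('o, 'm) ssm" and N :: "('o, 'm) ssm"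
begin

abbreviation target_comp_syntax ("_ \<star>''\<^bsub>_\<^esub> _" [65, 0, 66] 65) where "g \<star>'\<^bsub>i\<^esub> f \<equiv> comp_at N g i f"
abbreviation target_comp1_syntax (infixl "\<star>''" 65) where "g \<star>' f \<equiv> comp_at N g (Suc 0) f"
abbreviation target_comp2_syntax (infixl "\<star>''\<^sub>2" 65) where "g \<star>'\<^sub>2 f \<equiv> comp_at N g 2 f"
abbreviation target_comp3_syntax (infixl "\<star>''\<^sub>3" 65) where "g \<star>'\<^sub>3 f \<equiv> comp_at N g 3 f"
abbreviation target_unary_syntax ("{|_|}''") where "{|p|}' \<equiv> unary N p"

lemma functor_simps:
  assumes "is_functor C (mcat N) F"
  shows "ob a \<Longrightarrow> fobj F a \<in> Obj (mcat N)" "ar p \<Longrightarrow> fmap F p \<in> Arr (mcat N)"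
    "ar p \<Longrightarrow> Dom (mcat N) (fmap F p) = fobj F (Dom C p)" "ar p \<Longrightarrow> Cod (mcat N) (fmap F p) = fobj F (Cod C p)"
    "ob a \<Longrightarrow> fmap F (Idn C a) = Idn (mcat N) (fobj F a)"
  using is_functorD(5,7)[OF assms] is_functorD(6)[OF assms, of p "Dom C p" "Cod C p"] by (auto simp: hom_def)

lemma functor_Idn_list:
  assumes "is_functor C (mcat N) F" "set as \<subseteq> Obj C"
  shows "map (fmap F) (map (Idn C) as) = map (Idn (mcat N)) (map (fobj F) as)"
    and "ar p \<Longrightarrow> map (fmap F) ((map (Idn C) as)[i := p]) = (map (Idn (mcat N)) (map (fobj F) as))[i := fmap F p]"
proof -
  show 1: "map (fmap F) (map (Idn C) as) = map (Idn (mcat N)) (map (fobj F) as)"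
    using assms(2) functor_simps(5)[OF assms(1)] by (induction as) auto
  show "ar p \<Longrightarrow> map (fmap F) ((map (Idn C) as)[i := p]) = (map (Idn (mcat N)) (map (fobj F) as))[i := fmap F p]"
    unfolding map_update 1 ..
qed

context
  fixes F assumes F: "ssm_morphism M N F"
begin

lemma mor_functor: "is_functor C (mcat N) (mm_fun F)"
  using F by (simp add: ssm_morphism_def)

lemmas mor_simps [simp] = functor_simps[OF mor_functor]

lemma app_valid [simp]:
  assumes f: "valid M f" shows "valid N (app F f)"
proof -
  note v = validD[OF f]
  let ?k = "(knd f, length (src f))"
  have nt: "nat_trans (mdom C (snd ?k)) set_cat (mfun M ?k)
        (comp_functor (mdom C (snd ?k)) (mfun N ?k) (mdom_functor C (snd ?k) (mm_fun F))) (mm_maps F ?k)"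
    using F v(1) unfolding ssm_morphism_def by blast
  have o: "(src f, tgt f) \<in> Obj (mdom C (snd ?k))" using v by (simp add: mdom_simps)
  have "mmap F (knd f) (src f) (tgt f) (elt f) \<in> mm N (knd f) (map (fobj (mm_fun F)) (src f)) (fobj (mm_fun F) (tgt f))"
    using set_cat_ap(1)[OF nat_transD(4)[OF nt o]] v(4) o
    by (simp add: mmap_def mm_def comp_functor_apply mdom_functor_def)
  moreover have "set (map (fobj (mm_fun F)) (src f)) \<subseteq> Obj (mcat N)" using v(2) by auto
  ultimately show ?thesis using v by (simp add: valid_def mtype_def app_def)
qed

lemma mmap_act:
  assumes k: "(x, length ps) \<in> mm_kinds" and ps: "set ps \<subseteq> Arr C" "ar q" and f: "f \<in> mm M x (map (Cod C) ps) (Dom C q)"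
  shows "mmap F x (map (Dom C) ps) (Cod C q) (act x ps q f) =
    N.act x (map (fmap (mm_fun F)) ps) (fmap (mm_fun F) q) (mmap F x (map (Cod C) ps) (Dom C q) f)"
proof -
  let ?k = "(x, length ps)"
  have nt: "nat_trans (mdom C (snd ?k)) set_cat (mfun M ?k)
        (comp_functor (mdom C (snd ?k)) (mfun N ?k) (mdom_functor C (snd ?k) (mm_fun F))) (mm_maps F ?k)"
    using F k unfolding ssm_morphism_def by blast
  have h: "(ps, q) \<in> hom (mdom C (snd ?k)) (map (Cod C) ps, Dom C q) (map (Dom C) ps, Cod C q)"
    using ps by (simp add: hom_def mdom_simps)
  show ?thesis
    using set_nat_trans_ap[OF nt h, of f] f homD(1)[OF h]
    by (simp add: act_def N.act_def mm_def mmap_def comp_functor_apply mdom_functor_def)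
qed

lemma app_unary [simp]: "ar p \<Longrightarrow> app F {|p|} = {|fmap (mm_fun F) p|}'"
  using F by (intro tmap_eqI) (simp_all add: app_def ssm_morphism_def hom_def)

lemma app_comp_at:
  assumes g: "valid M g" and f: "valid M f" and t: "composable (knd g, length (src g)) (knd f, length (src f))"
    and i: "Suc 0 \<le> i" "i \<le> length (src g)" "tgt f = src g ! (i - Suc 0)"
  shows "app F (g \<star>\<^bsub>i\<^esub> f) = app F g \<star>'\<^bsub>i\<^esub> app F f"
proof -
  note vg = validD[OF g] and vf = validD[OF f]
  consider (sub) "(mtype g, mtype f) \<in> sub_cases" | (pre) "mtype f = (Tight, 1)" | (post) "mtype g = (Tight, 1)"
    using t by (auto simp: composable_def mtype_def)
  then show ?thesis
  proof cases
    case sub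
    have e: "mmap F (tl_comp (knd g) i (knd f)) (plug (src g) i (src f)) (tgt g)
        (msub M (knd g) (src g) (tgt g) i (knd f) (src f) (elt g) (elt f)) =
      msub N (knd g) (map (fobj (mm_fun F)) (src g)) (fobj (mm_fun F) (tgt g)) i (knd f) (map (fobj (mm_fun F)) (src f))
        (mmap F (knd g) (src g) (tgt g) (elt g)) (mmap F (knd f) (src f) (src g ! (i - 1)) (elt f))"
    proof -
      have *: "((knd g, length (src g)), knd f, length (src f)) \<in> sub_cases \<and>
        set (src g) \<subseteq> Obj C \<and> tgt g \<in> Obj C \<and> set (src f) \<subseteq> Obj C \<and> 1 \<le> i \<and> i \<le> length (src g) \<and>
        elt g \<in> mm M (knd g) (src g) (tgt g) \<and> elt f \<in> mm M (knd f) (src f) (src g ! (i - 1))"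
        using sub vg vf i by (simp add: mtype_def)
      then show ?thesis using F unfolding ssm_morphism_def by blast
    qed
    have s': "(mtype (app F g), mtype (app F f)) \<in> sub_cases" using sub by (simp add: mtype_def)
    have pl: "map (fobj (mm_fun F)) (plug (src g) i (src f)) = plug (map (fobj (mm_fun F)) (src g)) i (map (fobj (mm_fun F)) (src f))"
      by (simp add: plug_def take_map drop_map)
    show ?thesis unfolding comp_at_msub[OF sub] N.comp_at_msub[OF s']
      using e i(3) by (simp add: app_def pl)
  next
    case pre
    then obtain p where p: "ar p" "f = {|p|}" using unary_cases f by blast
    have c: "map (Cod C) ((map (Idn C) (src g))[i - 1 := p]) = src g"
      by (rule cod_list_update[OF vg(2)]) (use p i in simp)
    have d: "map (Dom C) ((map (Idn C) (src g))[i - 1 := p]) = (src g)[i - 1 := Dom C p]"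
      by (rule dom_list_update[OF vg(2)])
    show ?thesis
      using mmap_act[of "knd g" "(map (Idn C) (src g))[i - 1 := p]" "Idn C (tgt g)" "elt g"]
        arr_list_update[OF vg(2) p(1), of "i - 1"] vg p i
      unfolding c d functor_Idn_list(2)[OF mor_functor vg(2) p(1)]
      by (simp add: comp_at_unary N.comp_at_unary pre_eq N.pre_eq) (simp add: app_def map_update)
  next
    case post
    then obtain q where q: "ar q" "g = {|q|}" using unary_cases g by blast
    then have [simp]: "i = Suc 0" "Dom C q = tgt f" using i by auto
    have d: "Dom (mcat N) (fmap (mm_fun F) q) = tgt (app F f)" using q by simp
    show ?thesis
      using mmap_act[of "knd f" "map (Idn C) (src f)" q "elt f"] vf q arr_idn[OF vf(2)]
        unary_comp_at[OF f q(1)] N.unary_comp_at[OF app_valid[OF f] _ d]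
      unfolding map_cod_idn[OF vf(2)] map_dom_idn[OF vf(2)] functor_Idn_list(1)[OF mor_functor vf(2)]
      by (simp add: post_eq N.post_eq) (simp add: app_def)
  qed
qed

lemma app_jmap:
  assumes f: "valid M f" "knd f = Tight" "src f \<noteq> []" "length (src f) \<le> 2"
  shows "app F (jmap M f) = jmap N (app F f)"
proof -
  have n: "length (src f) \<in> {1, 2}" using f(2-4) by (cases "src f") (auto simp: le_Suc_eq numeral_2_eq_2)
  have "mmap F Loose (src f) (tgt f) (jm M (src f) (tgt f) (elt f)) =
      jm N (map (fobj (mm_fun F)) (src f)) (fobj (mm_fun F) (tgt f)) (mmap F Tight (src f) (tgt f) (elt f))"
    using F n validD[OF f(1)] f(2) unfolding ssm_morphism_def by metis
  then show ?thesis using f(2) by (simp add: app_def jmap_def)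
qed

end

text \<open>Conversely, an operation on typed multimaps that commutes with substitution and \<open>j\<close> is a morphism:
  naturality is the case of substitution with unary maps.\<close>

definition morphism_of :: "('o, 'm, 'o, 'm) functr \<Rightarrow> (('o, 'm) tmap \<Rightarrow> ('o, 'm) tmap) \<Rightarrow> ('o, 'm) ssm_mor" where
  "morphism_of F \<Phi> = \<lparr>mm_fun = F,
     mm_maps = (\<lambda>k\<in>mm_kinds. \<lambda>(as, b)\<in>Obj (mdom C (snd k)).
       (mm M (fst k) as b, \<lambda>f\<in>mm M (fst k) as b. elt (\<Phi> (TM (fst k) as b f)), mm N (fst k) (map (fobj F) as) (fobj F b)))\<rparr>"

lemma morphism_of:
  assumes F: "is_functor C (mcat N) F"
    and sel: "\<And>f. valid M f \<Longrightarrow> valid N (\<Phi> f) \<and> knd (\<Phi> f) = knd f \<and> src (\<Phi> f) = map (fobj F) (src f) \<and> tgt (\<Phi> f) = fobj F (tgt f)"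
    and un: "\<And>p. p \<in> Arr C \<Longrightarrow> \<Phi> {|p|} = {|fmap F p|}'"
    and comp: "\<And>g f i. \<lbrakk>valid M g; valid M f; composable (knd g, length (src g)) (knd f, length (src f));
      Suc 0 \<le> i; i \<le> length (src g); tgt f = src g ! (i - Suc 0)\<rbrakk> \<Longrightarrow> \<Phi> (g \<star>\<^bsub>i\<^esub> f) = \<Phi> g \<star>'\<^bsub>i\<^esub> \<Phi> f"
    and j: "\<And>f. \<lbrakk>valid M f; knd f = Tight; src f \<noteq> []; length (src f) \<le> 2\<rbrakk> \<Longrightarrow> \<Phi> (jmap M f) = jmap N (\<Phi> f)"
  shows "ssm_morphism M N (morphism_of F \<Phi>)" and "valid M f \<Longrightarrow> app (morphism_of F \<Phi>) f = \<Phi> f"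
proof -
  let ?F = "morphism_of F \<Phi>"
  have mfn: "mm_fun ?F = F" by (simp add: morphism_of_def)
  note [simp] = functor_simps[OF F]
  have mmap: "mmap ?F x as b f = elt (\<Phi> (TM x as b f))" if "valid M (TM x as b f)" for x as b f
    using validD[OF that] by (simp add: mmap_def morphism_of_def ap_def mdom_simps)
  show app: "app ?F f = \<Phi> f" if "valid M f" for f
    using sel[OF that] mmap[of "knd f" "src f" "tgt f" "elt f"] that by (intro tmap_eqI) (simp_all add: app_def mfn)
  have upto: "\<Phi> (act_upto ps k f) = N.act_upto (map (fmap F) ps) k (\<Phi> f)"
    if f: "valid M f" and ps: "set ps \<subseteq> Arr C" "map (Cod C) ps = src f" and k: "k \<le> length (src f)" for f ps k
    using k
  proof (induction k)
    case 0
    then show ?case using f sel[OF f] by (simp add: act_upto_0 N.act_upto_0)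
  next
    case (Suc k)
    have l: "length ps = length (src f)" using arg_cong[OF ps(2), of length] by simp
    have a: "ps ! k \<in> Arr C" using Suc.prems ps(1) l by auto
    have c: "Cod C (ps ! k) = src f ! k" using Suc.prems l nth_map[of k ps "Cod C"] ps(2) by simp
    have ps': "set (map (fmap F) ps) \<subseteq> Arr (mcat N)" "map (Cod (mcat N)) (map (fmap F) ps) = src (\<Phi> f)"
      using ps(1) sel[OF f] by (auto simp: ps(2)[symmetric])
    have k': "k < length (src f)" "k < length (src (\<Phi> f))" using Suc.prems sel[OF f] by auto
    have s: "knd (act_upto ps k f) = knd f" "length (src (act_upto ps k f)) = length (src f)" "src (act_upto ps k f) ! k = src f ! k"
      using k' l by (simp_all add: act_upto_def nth_append)
    have "\<Phi> (act_upto ps (Suc k) f) = \<Phi> (act_upto ps k f) \<star>'\<^bsub>Suc k\<^esub> \<Phi> {|ps ! k|}"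
      unfolding act_upto_step(1)[OF f ps k'(1)]
      by (rule comp) (use act_upto_step(2)[OF f ps k'(1)] a c s k' validD(1)[OF f] in simp_all)
    also have "\<dots> = N.act_upto (map (fmap F) ps) k (\<Phi> f) \<star>'\<^bsub>Suc k\<^esub> {|map (fmap F) ps ! k|}'"
      using Suc a k' l by (simp add: un)
    finally show ?case
      unfolding N.act_upto_step(1)[OF conjunct1[OF sel[OF f]] ps' k'(2)] .
  qed
  show "ssm_morphism M N ?F"
    unfolding ssm_morphism_def mfn
  proof (intro conjI ballI allI impI F)
    show "mm_maps ?F \<in> extensional mm_kinds" by (simp add: morphism_of_def)
    show "mmap ?F Tight [a] b f = fmap F f" if "ob a" "ob b" "f \<in> hom C a b" for a b f
    proof -
      have e: "TM Tight [a] b f = {|f|}" using that by (simp add: unary_def hom_def)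
      show ?thesis using mmap[of Tight "[a]" b f] un[of f] that unfolding e by (simp add: hom_def)
    qed
    show "mmap ?F (tl_comp x i y) (plug bs i as) c (msub M x bs c i y as g f) =
        msub N x (map (fobj F) bs) (fobj F c) i y (map (fobj F) as) (mmap ?F x bs c g) (mmap ?F y as (bs ! (i - 1)) f)"
      if *: "((x, length bs), (y, length as)) \<in> sub_cases \<and> set bs \<subseteq> Obj C \<and> ob c \<and> set as \<subseteq> Obj C \<and>
        1 \<le> i \<and> i \<le> length bs \<and> g \<in> mm M x bs c \<and> f \<in> mm M y as (bs ! (i - 1))" for x bs c i y as g f
    proof -
      have k: "(x, length bs) \<in> mm_kinds" "(y, length as) \<in> mm_kinds"
        using * unfolding sub_cases_def mm_kinds_def by auto
      have "i - 1 < length bs" using * by linarith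
      then have "bs ! (i - 1) \<in> set bs" by simp
      then have "bs ! (i - 1) \<in> Obj C" using * by blast
      then have g: "valid M (TM x bs c g)" and f: "valid M (TM y as (bs ! (i - 1)) f)"
        using * k by (simp_all add: valid_def mtype_def)
      have t: "composable (x, length bs) (y, length as)" using * by (simp add: composable_def)
      have s: "(mtype (TM x bs c g), mtype (TM y as (bs ! (i - 1)) f)) \<in> sub_cases" using * by (simp add: mtype_def)
      have gf: "valid M (TM x bs c g \<star>\<^bsub>i\<^esub> TM y as (bs ! (i - 1)) f)"
        by (rule valid_comp_at[OF g f]) (use * t in \<open>simp_all add: mtype_def\<close>)
      have s': "(mtype (\<Phi> (TM x bs c g)), mtype (\<Phi> (TM y as (bs ! (i - 1)) f))) \<in> sub_cases"
        using sel[OF g] sel[OF f] s by (simp add: mtype_def)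
      have "\<Phi> (TM x bs c g \<star>\<^bsub>i\<^esub> TM y as (bs ! (i - 1)) f) = \<Phi> (TM x bs c g) \<star>'\<^bsub>i\<^esub> \<Phi> (TM y as (bs ! (i - 1)) f)"
        by (rule comp[OF g f]) (use * t in simp_all)
      from arg_cong[OF this, of elt] show ?thesis
        unfolding N.comp_at_msub[OF s'] using sel[OF g] sel[OF f] mmap[OF g] mmap[OF f] gf mmap
        unfolding comp_at_msub[OF s] by simp
    qed
    show "mmap ?F Loose as b (jm M as b f) = jm N (map (fobj F) as) (fobj F b) (mmap ?F Tight as b f)"
      if *: "length as \<in> {1, 2} \<and> set as \<subseteq> Obj C \<and> ob b \<and> f \<in> mm M Tight as b" for as b f
    proof -
      have as: "as \<noteq> []" "length as \<le> 2" using * by auto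
      have "(Tight, length as) \<in> mm_kinds" using * unfolding mm_kinds_def by auto
      then have f: "valid M (TM Tight as b f)" using * by (simp add: valid_def mtype_def)
      have jf: "valid M (jmap M (TM Tight as b f))" by (rule jmap_valid[OF f]) (use as in simp_all)
      have "\<Phi> (jmap M (TM Tight as b f)) = jmap N (\<Phi> (TM Tight as b f))" by (rule j[OF f]) (use as in simp_all)
      from arg_cong[OF this, of elt] show ?thesis
        using sel[OF f] mmap[OF f] mmap jf by (simp add: jmap_def)
    qed
    fix k :: "tl \<times> nat" assume k: "k \<in> mm_kinds"
    obtain x n where [simp]: "k = (x, n)" by (cases k)
    show "nat_trans (mdom C (snd k)) set_cat (mfun M k)
        (comp_functor (mdom C (snd k)) (mfun N k) (mdom_functor C (snd k) F)) (mm_maps ?F k)"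
    proof (rule set_nat_transI)
      show "is_functor (mdom C (snd k)) set_cat (mfun M k)" using functorial k by simp
      show "is_functor (mdom C (snd k)) set_cat (comp_functor (mdom C (snd k)) (mfun N k) (mdom_functor C (snd k) F))"
        by (rule is_functor_comp[OF is_functor_mdom_functor[OF F]]) (use N.functorial k in simp)
      show "mm_maps ?F k \<in> extensional (Obj (mdom C (snd k)))" using k by (simp add: morphism_of_def)
      fix t assume t: "t \<in> Obj (mdom C (snd k))"
      obtain as b where tt [simp]: "t = (as, b)" by (cases t)
      have ob: "length as = n" "set as \<subseteq> Obj C" "ob b" using t by (simp_all add: mdom_simps)
      have "elt (\<Phi> (TM x as b f)) \<in> mm N x (map (fobj F) as) (fobj F b)" if "f \<in> mm M x as b" for f
      proof -
        have "valid M (TM x as b f)" using that ob k by (simp add: valid_def mtype_def)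
        from sel[OF this] N.validD(4)[of "\<Phi> (TM x as b f)"] show ?thesis by simp
      qed
      then have "mm_maps ?F k t \<in> hom set_cat (mm M x as b) (mm N x (map (fobj F) as) (fobj F b))"
        using k t by (auto simp: morphism_of_def hom_set_cat)
      then show "mm_maps ?F k t \<in> hom set_cat (fobj (mfun M k) t)
          (fobj (comp_functor (mdom C (snd k)) (mfun N k) (mdom_functor C (snd k) F)) t)"
        using t ob by (simp add: comp_functor_apply mdom_functor_def mm_def)
    next
      fix t A A' f assume t: "t \<in> hom (mdom C (snd k)) A A'" and fin: "f \<in> fobj (mfun M k) A"
      obtain ps q as b as' b' where tt [simp]: "t = (ps, q)" "A = (as, b)" "A' = (as', b')" by (cases t, cases A, cases A')
      have ps: "set ps \<subseteq> Arr C" "map (Cod C) ps = as" "length ps = n" "map (Dom C) ps = as'" "ar q" "Dom C q = b" "Cod C q = b'"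
        using t by (auto simp: hom_def mdom_simps)
      have la: "length as = n" "length as' = n" using ps by auto
      have ob: "set as \<subseteq> Obj C" "ob b" "set as' \<subseteq> Obj C" "ob b'" using ps by (auto simp: subset_iff)
      have fm: "f \<in> mm M x as b" using fin la by (simp add: mm_def)
      have f: "valid M (TM x as b f)" using fm la ob k by (simp add: valid_def mtype_def)
      have psf: "map (Cod C) ps = src (TM x as b f)" using ps by simp
      note full = act_upto_full[OF f ps(1) psf ps(5)]
      have ps': "set (map (fmap F) ps) \<subseteq> Arr (mcat N)" "map (Cod (mcat N)) (map (fmap F) ps) = src (\<Phi> (TM x as b f))"
        using ps(1) sel[OF f] by (auto simp: ps(2)[symmetric])
      have q': "Dom (mcat N) (fmap F q) = tgt (\<Phi> (TM x as b f))" using ps sel[OF f] by simp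
      note full' = N.act_upto_full[OF conjunct1[OF sel[OF f]] ps' functor_simps(2)[OF F ps(5)] q']
      have vu: "valid M (TM x as' b' (act x ps q f))"
        using act_in[of x ps q f] ps ob fm la k by (simp add: valid_def mtype_def)
      have tu: "tgt (act_upto ps (length as) (TM x as b f)) = b" by (simp add: act_upto_def)
      have "\<Phi> (TM x as' b' (act x ps q f)) = \<Phi> ({|q|} \<star> act_upto ps (length as) (TM x as b f))"
        using full(1) ps by simp
      also have "\<dots> = {|fmap F q|}' \<star>' \<Phi> (act_upto ps (length as) (TM x as b f))"
        unfolding un[OF ps(5), symmetric]
        by (rule comp) (use full(2) validD(1)[OF full(2)] ps tu in simp_all)
      also have "\<dots> = {|fmap F q|}' \<star>' N.act_upto (map (fmap F) ps) (length as) (\<Phi> (TM x as b f))"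
        using upto[OF f ps(1) psf, of "length as"] by simp
      also have "\<dots> = TM x (map (fobj F) as') (fobj F b') (N.act x (map (fmap F) ps) (fmap F q) (elt (\<Phi> (TM x as b f))))"
      proof -
        have "map (Dom (mcat N)) (map (fmap F) ps) = map (fobj F) as'" using ps(1) by (auto simp: ps(4)[symmetric])
        then show ?thesis using full'(1) sel[OF f] ps by simp
      qed
      finally have e: "mmap ?F x as' b' (act x ps q f) = N.act x (map (fmap F) ps) (fmap F q) (mmap ?F x as b f)"
        by (simp add: mmap[OF f] mmap[OF vu])
      show "ap (mm_maps ?F k A') (ap (fmap (mfun M k) t) f) =
          ap (fmap (comp_functor (mdom C (snd k)) (mfun N k) (mdom_functor C (snd k) F)) t) (ap (mm_maps ?F k A) f)"
        using e homD(1)[OF t] la ps(3) by (simp add: mmap_def act_def N.act_def comp_functor_apply mdom_functor_def)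
    qed
  qed
qed

end

lemma morphism_eqI:
  assumes M: "short_skew_multicategory M"
    and F: "ssm_morphism M N F" and G: "ssm_morphism M N G" and eq: "mm_fun F = mm_fun G"
    and app: "\<And>f. valid M f \<Longrightarrow> app F f = app G f"
  shows "F = (G :: ('o, 'm) ssm_mor)"
proof -
  interpret short_skew_multicategory M by fact
  have "mm_maps F = mm_maps G"
  proof (rule extensionalityI[of _ mm_kinds])
    show "mm_maps F \<in> extensional mm_kinds" "mm_maps G \<in> extensional mm_kinds"
      using F G by (simp_all add: ssm_morphism_def)
    fix k assume k: "k \<in> mm_kinds"
    obtain x n where [simp]: "k = (x, n)" by (cases k)
    have nt: "nat_trans (mdom C (snd k)) set_cat (mfun M k)
        (comp_functor (mdom C (snd k)) (mfun N k) (mdom_functor C (snd k) (mm_fun H))) (mm_maps H k)"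
      if "ssm_morphism M N H" for H using that k unfolding ssm_morphism_def by blast
    show "mm_maps F k = mm_maps G k"
    proof (rule extensionalityI)
      show "mm_maps F k \<in> extensional (Obj (mdom C (snd k)))" "mm_maps G k \<in> extensional (Obj (mdom C (snd k)))"
        using nat_transD(3)[OF nt[OF F]] nat_transD(3)[OF nt[OF G]] .
      fix t assume t: "t \<in> Obj (mdom C (snd k))"
      obtain as b where [simp]: "t = (as, b)" by (cases t)
      have ob: "length as = n" "set as \<subseteq> Obj C" "ob b" using t by (simp_all add: mdom_simps)
      show "mm_maps F k t = mm_maps G k t"
      proof (rule set_cat_eqI[OF nat_transD(4)[OF nt[OF F] t]])
        show "mm_maps G k t \<in> hom set_cat (fobj (mfun M k) t)
            (fobj (comp_functor (mdom C (snd k)) (mfun N k) (mdom_functor C (snd k) (mm_fun F))) t)"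
          using nat_transD(4)[OF nt[OF G] t] unfolding eq .
        fix f assume "f \<in> fobj (mfun M k) t"
        then have "valid M (TM x as b f)" using ob k by (simp add: valid_def mtype_def mm_def)
        from arg_cong[OF app[OF this], of elt] show "ap (mm_maps F k t) f = ap (mm_maps G k t) f"
          using ob by (simp add: app_def mmap_def)
      qed
    qed
  qed
  with eq show ?thesis by simp
qed

lemma ssm_id:
  assumes "short_skew_multicategory M"
  shows "ssm_morphism M M (ssm_id M)" and "valid M f \<Longrightarrow> app (ssm_id M) f = f"
proof -
  interpret multi_pair M M using assms by (simp add: multi_pair_def)
  have i: "map (fobj (id_functor C)) as = as" if "set as \<subseteq> Obj C" for as
    using that by (auto intro!: map_idI simp: id_functor_apply)
  have e: "ssm_id M = morphism_of (id_functor C) (\<lambda>f. f)"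
    unfolding ssm_id_def morphism_of_def
    by (auto simp: fun_eq_iff restrict_def mdom_simps set_cat_def cat_of_homs_def mm_def i id_functor_apply)
  note m = morphism_of[of "id_functor C" "\<lambda>f. f"]
  have "valid M f \<Longrightarrow> valid M f \<and> knd f = knd f \<and> src f = map (fobj (id_functor C)) (src f) \<and> tgt f = fobj (id_functor C) (tgt f)" for f
    using validD[of f] by (simp add: i id_functor_apply)
  note m = m[OF is_functor_id[OF category] this]
  show "ssm_morphism M M (ssm_id M)" unfolding e by (rule m(1)) (simp_all add: id_functor_apply)
  show "app (ssm_id M) f = f" if "valid M f" unfolding e by (rule m(2)) (simp_all add: id_functor_apply that)
qed

lemma ssm_comp:
  assumes M: "short_skew_multicategory M" and N: "short_skew_multicategory N" and L: "short_skew_multicategory L"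
    and F: "ssm_morphism M N F" and G: "ssm_morphism N L G"
  shows "ssm_morphism M L (ssm_comp M G F)" and "valid M f \<Longrightarrow> app (ssm_comp M G F) f = app G (app F f)"
proof -
  interpret MN: multi_pair M N using M N by (simp add: multi_pair_def)
  interpret NL: multi_pair N L using N L by (simp add: multi_pair_def)
  interpret multi_pair M L using M L by (simp add: multi_pair_def)
  let ?H = "comp_functor (mcat M) (mm_fun G) (mm_fun F)"
  have i: "map (fobj ?H) as = map (fobj (mm_fun G)) (map (fobj (mm_fun F)) as)" if "set as \<subseteq> Obj (mcat M)" for as
    using that by (auto simp: comp_functor_apply)
  have nt: "nat_trans (mdom (mcat M) (snd k)) set_cat (mfun M k)
        (comp_functor (mdom (mcat M) (snd k)) (mfun N k) (mdom_functor (mcat M) (snd k) (mm_fun F))) (mm_maps F k)" if "k \<in> mm_kinds" for k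
    using F that unfolding ssm_morphism_def by blast
  have nt': "nat_trans (mdom (mcat N) (snd k)) set_cat (mfun N k)
        (comp_functor (mdom (mcat N) (snd k)) (mfun L k) (mdom_functor (mcat N) (snd k) (mm_fun G))) (mm_maps G k)" if "k \<in> mm_kinds" for k
    using G that unfolding ssm_morphism_def by blast
  have e: "ssm_comp M G F = morphism_of ?H (app G \<circ> app F)"
  proof -
    have "Comp set_cat (mm_maps G (x, n) (map (fobj (mm_fun F)) as, fobj (mm_fun F) b)) (mm_maps F (x, n) (as, b)) =
        (mm M x as b, \<lambda>f\<in>mm M x as b. elt (app G (app F (TM x as b f))), mm L x (map (fobj ?H) as) (fobj ?H b))"
      if k: "(x, n) \<in> mm_kinds" and ob: "length as = n" "set as \<subseteq> Obj (mcat M)" "b \<in> Obj (mcat M)" for x n as b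
    proof -
      have o: "(as, b) \<in> Obj (mdom (mcat M) (snd (x, n)))" using ob by (simp add: mdom_simps)
      have ob': "set (map (fobj (mm_fun F)) as) \<subseteq> Obj (mcat N)" "fobj (mm_fun F) b \<in> Obj (mcat N)"
        using ob MN.mor_simps[OF F] by auto
      have o': "(map (fobj (mm_fun F)) as, fobj (mm_fun F) b) \<in> Obj (mdom (mcat N) (snd (x, n)))"
        using ob ob' by (simp add: mdom_simps)
      have h: "mm_maps F (x, n) (as, b) \<in> hom set_cat (mm M x as b) (mm N x (map (fobj (mm_fun F)) as) (fobj (mm_fun F) b))"
        using nat_transD(4)[OF nt[OF k] o] o ob by (simp add: comp_functor_apply mdom_functor_def mm_def)
      have h': "mm_maps G (x, n) (map (fobj (mm_fun F)) as, fobj (mm_fun F) b) \<in>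
          hom set_cat (mm N x (map (fobj (mm_fun F)) as) (fobj (mm_fun F) b)) (mm L x (map (fobj ?H) as) (fobj ?H b))"
        using nat_transD(4)[OF nt'[OF k] o'] o' ob by (simp add: comp_functor_apply mdom_functor_def mm_def i)
      show ?thesis
      proof (rule set_cat_eqI[OF category.comp_in_hom[OF category_set_cat h h']])
        have "elt (app G (app F (TM x as b f))) \<in> mm L x (map (fobj ?H) as) (fobj ?H b)" if "f \<in> mm M x as b" for f
        proof -
          have "valid M (TM x as b f)" using that ob k by (simp add: valid_def mtype_def)
          from NL.N.validD(4)[OF NL.app_valid[OF G MN.app_valid[OF F this]]] show ?thesis
            using ob by (simp add: i comp_functor_apply)
        qed
        then show "(mm M x as b, \<lambda>f\<in>mm M x as b. elt (app G (app F (TM x as b f))), mm L x (map (fobj ?H) as) (fobj ?H b))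
            \<in> hom set_cat (mm M x as b) (mm L x (map (fobj ?H) as) (fobj ?H b))"
          by (auto simp: hom_set_cat)
        fix f assume f: "f \<in> mm M x as b"
        then show "ap (Comp set_cat (mm_maps G (x, n) (map (fobj (mm_fun F)) as, fobj (mm_fun F) b)) (mm_maps F (x, n) (as, b))) f =
            ap (mm M x as b, \<lambda>f\<in>mm M x as b. elt (app G (app F (TM x as b f))), mm L x (map (fobj ?H) as) (fobj ?H b)) f"
          using ob(1) by (simp add: set_cat_ap(2)[OF h]) (simp add: ap_def app_def mmap_def)
      qed
    qed
    then show ?thesis
      unfolding ssm_comp_def morphism_of_def
      by (auto simp: fun_eq_iff restrict_def mdom_simps mdom_functor_def split: prod.splits)
  qed
  have sel: "valid L ((app G \<circ> app F) f) \<and> knd ((app G \<circ> app F) f) = knd f \<and>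
      src ((app G \<circ> app F) f) = map (fobj ?H) (src f) \<and> tgt ((app G \<circ> app F) f) = fobj ?H (tgt f)" if f: "valid M f" for f
    using MN.validD[OF f] NL.app_valid[OF G MN.app_valid[OF F f]] by (simp add: i comp_functor_apply)
  note m = morphism_of[OF is_functor_comp[OF MN.mor_functor[OF F] NL.mor_functor[OF G]] sel]
  have un: "(app G \<circ> app F) (unary M p) = unary L (fmap ?H p)" if "p \<in> Arr (mcat M)" for p
    using that MN.mor_simps(2)[OF F that] by (simp add: MN.app_unary[OF F] NL.app_unary[OF G] comp_functor_apply)
  have co: "(app G \<circ> app F) (comp_at M g i f) = comp_at L ((app G \<circ> app F) g) i ((app G \<circ> app F) f)"
    if "valid M g" "valid M f" "composable (knd g, length (src g)) (knd f, length (src f))"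
      "Suc 0 \<le> i" "i \<le> length (src g)" "tgt f = src g ! (i - Suc 0)" for g f i
    using MN.app_comp_at[OF F that]
      NL.app_comp_at[OF G MN.app_valid[OF F that(1)] MN.app_valid[OF F that(2)], of i] that by simp
  have j: "(app G \<circ> app F) (jmap M f) = jmap L ((app G \<circ> app F) f)"
    if "valid M f" "knd f = Tight" "src f \<noteq> []" "length (src f) \<le> 2" for f
    using MN.app_jmap[OF F that] NL.app_jmap[OF G MN.app_valid[OF F that(1)]] that by simp
  show "ssm_morphism M L (ssm_comp M G F)" unfolding e by (rule m(1)) (use un co j in simp_all)
  show "app (ssm_comp M G F) f = app G (app F f)" if "valid M f"
  proof -
    have "app (morphism_of (comp_functor (mcat M) (mm_fun G) (mm_fun F)) (app G \<circ> app F)) f = (app G \<circ> app F) f"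
      by (rule m(2)) (use un co j that in simp_all)
    then show ?thesis unfolding e by simp
  qed
qed

lemma mm_fun_ssm_id [simp]: "mm_fun (ssm_id M) = id_functor (mcat M)"
  and mm_fun_ssm_comp [simp]: "mm_fun (ssm_comp M G F) = comp_functor (mcat M) (mm_fun G) (mm_fun F)"
  by (simp_all add: ssm_id_def ssm_comp_def)

locale braided_pair = short_braiding M B + N: short_braiding N B'
  for M :: "('o, 'm) ssm" and B :: "('o, 'm) sbraid" and N :: "('o, 'm) ssm" and B' :: "('o, 'm) sbraid"
begin

sublocale multi_pair M N ..

lemma braided_morphism_iff:
  "braided_morphism (M, B) (N, B') F \<longleftrightarrow> ssm_morphism M N F \<and>
    (\<forall>a1 a2 a3 f. valid M f \<and> knd f = Tight \<and> src f = [a1, a2, a3] \<longrightarrow> app F (\<beta>\<^sub>3 f) = N.\<beta>\<^sub>3 (app F f)) \<and>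
    (\<forall>a1 a2 a3 a4 f. valid M f \<and> knd f = Tight \<and> src f = [a1, a2, a3, a4] \<longrightarrow>
      app F (\<beta>\<^sub>4\<^sub>2 f) = N.\<beta>\<^sub>4\<^sub>2 (app F f) \<and> app F (\<beta>\<^sub>4\<^sub>3 f) = N.\<beta>\<^sub>4\<^sub>3 (app F f))" (is "?L \<longleftrightarrow> ?R")
proof -
  have v3: "set [a1, a2, a3, c] \<subseteq> Obj C \<and> f \<in> mm M Tight [a1, a2, a3] c \<longleftrightarrow> valid M (TM Tight [a1, a2, a3] c f)"
    and v4: "set [a1, a2, a3, a4, c] \<subseteq> Obj C \<and> f \<in> mm M Tight [a1, a2, a3, a4] c \<longleftrightarrow> valid M (TM Tight [a1, a2, a3, a4] c f)"
    for a1 a2 a3 a4 c f by (auto simp: valid_def mtype_def)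
  have all3: "(\<forall>a1 a2 a3 f. valid M f \<and> knd f = Tight \<and> src f = [a1, a2, a3] \<longrightarrow> P f) \<longleftrightarrow>
      (\<forall>a1 a2 a3 c f. valid M (TM Tight [a1, a2, a3] c f) \<longrightarrow> P (TM Tight [a1, a2, a3] c f))"
    and all4: "(\<forall>a1 a2 a3 a4 f. valid M f \<and> knd f = Tight \<and> src f = [a1, a2, a3, a4] \<longrightarrow> P f) \<longleftrightarrow>
      (\<forall>a1 a2 a3 a4 c f. valid M (TM Tight [a1, a2, a3, a4] c f) \<longrightarrow> P (TM Tight [a1, a2, a3, a4] c f))" for P
    by (metis tmap.sel tmap.collapse)+
  show ?thesis
    unfolding braided_morphism_def prod.case v3 v4 all3 all4
    by (simp add: app_def \<beta>\<^sub>3_def N.\<beta>\<^sub>3_def \<beta>\<^sub>4\<^sub>2_def N.\<beta>\<^sub>4\<^sub>2_def \<beta>\<^sub>4\<^sub>3_def N.\<beta>\<^sub>4\<^sub>3_def)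
qed

lemma braided_morphismD:
  assumes "braided_morphism (M, B) (N, B') F"
  shows "ssm_morphism M N F"
    and "valid M f \<Longrightarrow> knd f = Tight \<Longrightarrow> src f = [a1, a2, a3] \<Longrightarrow> app F (\<beta>\<^sub>3 f) = N.\<beta>\<^sub>3 (app F f)"
    and "valid M f \<Longrightarrow> knd f = Tight \<Longrightarrow> src f = [a1, a2, a3, a4] \<Longrightarrow> app F (\<beta>\<^sub>4\<^sub>2 f) = N.\<beta>\<^sub>4\<^sub>2 (app F f)"
    and "valid M f \<Longrightarrow> knd f = Tight \<Longrightarrow> src f = [a1, a2, a3, a4] \<Longrightarrow> app F (\<beta>\<^sub>4\<^sub>3 f) = N.\<beta>\<^sub>4\<^sub>3 (app F f)"
  using assms unfolding braided_morphism_iff by blast+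

end

lemma braided_id:
  assumes "short_braiding M B" shows "braided_morphism (M, B) (M, B) (ssm_id M)"
proof -
  interpret short_braiding M B by fact
  interpret braided_pair M B M B ..
  show ?thesis unfolding braided_morphism_iff
    using ssm_id[OF short_skew_multicategory_axioms] beta_valid by fastforce
qed

lemma braided_comp:
  assumes M: "short_braiding M B" and N: "short_braiding N B'" and L: "short_braiding L B''"
    and F: "braided_morphism (M, B) (N, B') F" and G: "braided_morphism (N, B') (L, B'') G"
  shows "braided_morphism (M, B) (L, B'') (ssm_comp M G F)"
proof -
  interpret MN: braided_pair M B N B' using M N by (simp add: braided_pair_def)
  interpret NL: braided_pair N B' L B'' using N L by (simp add: braided_pair_def)
  interpret braided_pair M B L B'' using M L by (simp add: braided_pair_def)
  note F' = MN.braided_morphismD[OF F] and G' = NL.braided_morphismD[OF G]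
  have m: "short_skew_multicategory M" "short_skew_multicategory N" "short_skew_multicategory L"
    using M N L by (simp_all add: short_braiding_def)
  note c = ssm_comp[OF m F'(1) G'(1)]
  note v = MN.app_valid[OF F'(1)]
  show ?thesis unfolding braided_morphism_iff
    using c F' G' v MN.beta_valid by simp
qed

lemma category_BrdShSkMulti: "category (BrdShSkMulti_lr :: (('o, 'm) ssm \<times> ('o, 'm) sbraid,
    (('o, 'm) ssm \<times> ('o, 'm) sbraid) \<times> ('o, 'm) ssm_mor \<times> (('o, 'm) ssm \<times> ('o, 'm) sbraid)) cat)"
  unfolding BrdShSkMulti_lr_def
proof (rule category_cat_of_homs; clarsimp)
  fix M B assume "short_braiding M B"
  then show "braided_morphism (M, B) (M, B) (ssm_id M)" by (rule braided_id)
next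
  fix M B N B' L B'' F G
  assume "short_braiding M B" "short_braiding N B'" "short_braiding L B''"
    "braided_morphism (M, B) (N, B') F" "braided_morphism (N, B') (L, B'') G"
  then show "braided_morphism (M, B) (L, B'') (ssm_comp M G F)" by (rule braided_comp)
next
  fix M B N B' and F :: "('o, 'm) ssm_mor"
  assume M: "short_braiding M B" and N: "short_braiding N B'" and F: "braided_morphism (M, B) (N, B') F"
  interpret braided_pair M B N B' using M N by (simp add: braided_pair_def)
  note F' = braided_morphismD(1)[OF F]
  note MM = short_skew_multicategory_axioms and NN = N.short_skew_multicategory_axioms
  note i = ssm_id[OF MM] and i' = ssm_id[OF NN]
  note v = is_functorD(3,4)[OF mor_functor[OF F']]
  have f: "comp_functor C (mm_fun F) (id_functor C) = mm_fun F"
    by (rule functr_eqI[of _ "Obj C" _ "Arr C"]) (use v in \<open>simp_all add: comp_functor_apply id_functor_apply, simp_all add: comp_functor_def\<close>)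
  have f': "comp_functor C (id_functor (mcat N)) (mm_fun F) = mm_fun F"
    by (rule functr_eqI[of _ "Obj C" _ "Arr C"])
      (use v mor_simps[OF F'] in \<open>simp_all add: comp_functor_apply id_functor_apply, simp_all add: comp_functor_def\<close>)
  show "ssm_comp M F (ssm_id M) = F"
    by (rule morphism_eqI[OF MM ssm_comp(1)[OF MM MM NN i(1) F'] F'])
      (simp_all add: f ssm_comp(2)[OF MM MM NN i(1) F'] i(2))
  show "ssm_comp M (ssm_id N) F = F"
    by (rule morphism_eqI[OF MM ssm_comp(1)[OF MM NN NN F' i'(1)] F'])
      (simp_all add: f' ssm_comp(2)[OF MM NN NN F' i'(1)] i'(2) app_valid[OF F'])
next
  fix M B N B' L B'' K B3 and F G H :: "('o, 'm) ssm_mor"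
  assume M: "short_braiding M B" and N: "short_braiding N B'" and L: "short_braiding L B''" and K: "short_braiding K B3"
    and F: "braided_morphism (M, B) (N, B') F" and G: "braided_morphism (N, B') (L, B'') G"
    and H: "braided_morphism (L, B'') (K, B3) H"
  interpret MN: braided_pair M B N B' using M N by (simp add: braided_pair_def)
  interpret NL: braided_pair N B' L B'' using N L by (simp add: braided_pair_def)
  interpret LK: braided_pair L B'' K B3 using L K by (simp add: braided_pair_def)
  note F' = MN.braided_morphismD(1)[OF F] and G' = NL.braided_morphismD(1)[OF G] and H' = LK.braided_morphismD(1)[OF H]
  have m: "short_skew_multicategory M" "short_skew_multicategory N" "short_skew_multicategory L" "short_skew_multicategory K"
    using M N L K by (simp_all add: short_braiding_def)
  note GF = ssm_comp[OF m(1-3) F' G'] and HG = ssm_comp[OF m(2-4) G' H']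
  note l = ssm_comp[OF m(1,2,4) F' HG(1)] and r = ssm_comp[OF m(1,3,4) GF(1) H']
  show "ssm_comp M (ssm_comp N H G) F = ssm_comp M H (ssm_comp M G F)"
  proof (rule morphism_eqI[OF m(1) l(1) r(1)])
    show "mm_fun (ssm_comp M (ssm_comp N H G) F) = mm_fun (ssm_comp M H (ssm_comp M G F))"
      using MN.mor_simps[OF F'] by (auto simp: comp_functor_def compose_def fun_eq_iff)
    show "app (ssm_comp M (ssm_comp N H G) F) f = app (ssm_comp M H (ssm_comp M G F)) f" if "valid M f" for f
      using that by (simp add: l(2) r(2) GF(2) HG(2) MN.app_valid[OF F'])
  qed
qed

section \<open>The category of braided skew monoidal categories\<close>

context skew_monoidal_category
begin

sublocale cat: Defs.category "scat S" by (rule category)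

abbreviation arr where "arr f \<equiv> f \<in> Arr (scat S)"
abbreviation dom where "dom f \<equiv> Dom (scat S) f"
abbreviation cod where "cod f \<equiv> Cod (scat S) f"

lemma shom_iff: "f \<in> shom S a b \<longleftrightarrow> arr f \<and> dom f = a \<and> cod f = b"
  by (simp add: shom_def hom_def)

lemma unit_obj [simp]: "\<I> \<in> sobj S" by (rule unit)

lemma arr_obj [simp]: "arr f \<Longrightarrow> dom f \<in> sobj S" "arr f \<Longrightarrow> cod f \<in> sobj S"
  using cat.dom_in_Obj cat.cod_in_Obj by (auto simp: sobj_def)

lemma one_arr [simp]: "a \<in> sobj S \<Longrightarrow> arr (\<one> a)" "a \<in> sobj S \<Longrightarrow> dom (\<one> a) = a" "a \<in> sobj S \<Longrightarrow> cod (\<one> a) = a"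
  using cat.idn_in_hom by (auto simp: sobj_def sid_def hom_def)

lemma comp_arr [simp]:
  assumes "arr f" "arr g" "dom g = cod f"
  shows "arr (g \<bullet> f)" "dom (g \<bullet> f) = dom f" "cod (g \<bullet> f) = cod g"
  using cat.comp_in_hom[of f "dom f" "cod f" g "cod g"] assms by (auto simp: hom_def scomp_def)

lemma comp_one [simp]: "arr f \<Longrightarrow> dom f = a \<Longrightarrow> f \<bullet> \<one> a = f" "arr f \<Longrightarrow> cod f = a \<Longrightarrow> \<one> a \<bullet> f = f"
  using cat.comp_idn cat.idn_comp by (auto simp: hom_def scomp_def sid_def)

lemma comp_assoc [simp]:
  "arr f \<Longrightarrow> arr g \<Longrightarrow> arr h \<Longrightarrow> dom g = cod f \<Longrightarrow> dom h = cod g \<Longrightarrow> (h \<bullet> g) \<bullet> f = h \<bullet> (g \<bullet> f)"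
  using cat.comp_assoc[of f "dom f" "cod f" g "cod g" h "cod h"] by (simp add: hom_def scomp_def)

lemma comp_extend:
  "x \<bullet> y = z \<bullet> w \<Longrightarrow> arr x \<Longrightarrow> arr y \<Longrightarrow> arr z \<Longrightarrow> arr w \<Longrightarrow> arr t \<Longrightarrow> dom x = cod y \<Longrightarrow> dom z = cod w \<Longrightarrow>
    cod t = dom y \<Longrightarrow> dom w = dom y \<Longrightarrow> x \<bullet> (y \<bullet> t) = z \<bullet> (w \<bullet> t)"
  by (metis comp_assoc)

lemma tens_obj [simp]: "a \<in> sobj S \<Longrightarrow> b \<in> sobj S \<Longrightarrow> a \<odot> b \<in> sobj S"
  using is_functorD(5)[OF tensor] by (simp add: sobj_def tens_obj_def prod_cat_def)

lemma tens_arr [simp]: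
  assumes "arr f" "arr g"
  shows "arr (f \<otimes> g)" "dom (f \<otimes> g) = dom f \<odot> dom g" "cod (f \<otimes> g) = cod f \<odot> cod g"
  using is_functorD(6)[OF tensor, of "(f, g)" "(dom f, dom g)" "(cod f, cod g)"] assms
  by (auto simp: tens_arr_def tens_obj_def prod_cat_def hom_def)

lemma tens_one [simp]: "a \<in> sobj S \<Longrightarrow> b \<in> sobj S \<Longrightarrow> \<one> a \<otimes> \<one> b = \<one> (a \<odot> b)"
  using is_functorD(7)[OF tensor, of "(a, b)"] by (simp add: sobj_def tens_obj_def tens_arr_def prod_cat_def sid_def)

lemma interchange [simp]:
  assumes "arr f" "arr g" "arr h" "arr k" "dom f = cod h" "dom g = cod k"
  shows "(f \<otimes> g) \<bullet> (h \<otimes> k) = (f \<bullet> h) \<otimes> (g \<bullet> k)"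
  using is_functorD(8)[OF tensor, of "(h, k)" "(dom h, dom k)" "(cod h, cod k)" "(f, g)" "(cod f, cod g)"] assms
  by (simp add: tens_arr_def prod_cat_def hom_def scomp_def)

lemma interchange_extend [simp]:
  assumes "arr f" "arr g" "arr h" "arr k" "dom f = cod h" "dom g = cod k" "arr t" "cod t = dom h \<odot> dom k"
  shows "(f \<otimes> g) \<bullet> ((h \<otimes> k) \<bullet> t) = ((f \<bullet> h) \<otimes> (g \<bullet> k)) \<bullet> t"
  using comp_assoc[of t "h \<otimes> k" "f \<otimes> g"] assms by simp

lemma alpha_arr [simp]:
  assumes "a \<in> sobj S" "b \<in> sobj S" "c \<in> sobj S"
  shows "arr (alpha S a b c)" "dom (alpha S a b c) = (a \<odot> b) \<odot> c" "cod (alpha S a b c) = a \<odot> (b \<odot> c)"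
  using alpha[OF assms] by (auto simp: shom_iff)

lemma lambda_arr [simp]: "a \<in> sobj S \<Longrightarrow> arr (lambda S a)" "a \<in> sobj S \<Longrightarrow> dom (lambda S a) = \<I> \<odot> a" "a \<in> sobj S \<Longrightarrow> cod (lambda S a) = a"
  using lambda by (auto simp: shom_iff)

lemma rho_arr [simp]: "a \<in> sobj S \<Longrightarrow> arr (rho S a)" "a \<in> sobj S \<Longrightarrow> dom (rho S a) = a" "a \<in> sobj S \<Longrightarrow> cod (rho S a) = a \<odot> \<I>"
  using rho by (auto simp: shom_iff)

end

lemma (in braiding) braid_arr [simp]:
  assumes "x \<in> sobj S" "a \<in> sobj S" "b \<in> sobj S"
  shows "arr (s x a b)" "dom (s x a b) = (x \<odot> a) \<odot> b" "cod (s x a b) = (x \<odot> b) \<odot> a"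
  using braid[OF assms] by (auto simp: shom_iff)

context lax_monoidal_functor
begin

lemma F_obj [simp]: "a \<in> sobj S \<Longrightarrow> fobj (lax_fun L) a \<in> sobj T"
  using is_functorD(5)[OF functorial] by (simp add: sobj_def F_def)

lemma F_arr [simp]:
  assumes "source.arr f"
  shows "target.arr (fmap (lax_fun L) f)" "target.dom (fmap (lax_fun L) f) = fobj (lax_fun L) (source.dom f)"
    "target.cod (fmap (lax_fun L) f) = fobj (lax_fun L) (source.cod f)"
  using is_functorD(6)[OF functorial, of f "source.dom f" "source.cod f"] assms by (auto simp: hom_def F_def)

lemma F_one [simp]: "a \<in> sobj S \<Longrightarrow> fmap (lax_fun L) (\<one> a) = \<one>\<^bsub>T\<^esub> (fobj (lax_fun L) a)"
  using is_functorD(7)[OF functorial] by (simp add: sobj_def sid_def F_def)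

lemma F_comp [simp]:
  "source.arr f \<Longrightarrow> source.arr g \<Longrightarrow> source.dom g = source.cod f \<Longrightarrow>
    fmap (lax_fun L) (g \<bullet> f) = fmap (lax_fun L) g \<bullet>\<^bsub>T\<^esub> fmap (lax_fun L) f"
  using is_functorD(8)[OF functorial, of f "source.dom f" "source.cod f" g "source.cod g"] by (simp add: hom_def scomp_def F_def)

lemma lax0_arr [simp]:
  "target.arr (lax0 L)" "target.dom (lax0 L) = \<I>\<^bsub>T\<^esub>" "target.cod (lax0 L) = fobj (lax_fun L) \<I>"
  using lax0 by (auto simp: target.shom_iff F_def)

lemma lax2_arr [simp]:
  assumes "a \<in> sobj S" "b \<in> sobj S"
  shows "target.arr (lax2 L (a, b))" "target.dom (lax2 L (a, b)) = fobj (lax_fun L) a \<odot>\<^bsub>T\<^esub> fobj (lax_fun L) b"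
    "target.cod (lax2 L (a, b)) = fobj (lax_fun L) (a \<odot> b)"
  using lax2[OF assms] by (auto simp: target.shom_iff F_def F2_def)

lemma lax2_natural:
  assumes "source.arr f" "source.arr g" "source.cod f = a" "source.cod g = b"
  shows "lax2 L (a, b) \<bullet>\<^bsub>T\<^esub> (fmap (lax_fun L) f \<otimes>\<^bsub>T\<^esub> fmap (lax_fun L) g) =
    fmap (lax_fun L) (f \<otimes> g) \<bullet>\<^bsub>T\<^esub> lax2 L (source.dom f, source.dom g)"
  using lax2_nat[of f "source.dom f" "source.cod f" g "source.dom g" "source.cod g"] assms
  by (simp add: source.shom_iff F_def F2_def)

lemma lax2_natural_left:
  assumes "source.arr f" "source.cod f = a" "b \<in> sobj S"
  shows "lax2 L (a, b) \<bullet>\<^bsub>T\<^esub> (fmap (lax_fun L) f \<otimes>\<^bsub>T\<^esub> \<one>\<^bsub>T\<^esub> (fobj (lax_fun L) b)) =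
    fmap (lax_fun L) (f \<otimes> \<one> b) \<bullet>\<^bsub>T\<^esub> lax2 L (source.dom f, b)"
  using lax2_natural[of f "\<one> b" a b] assms by simp

lemma lax2_natural_right:
  assumes "source.arr f" "source.cod f = b" "a \<in> sobj S"
  shows "lax2 L (a, b) \<bullet>\<^bsub>T\<^esub> (\<one>\<^bsub>T\<^esub> (fobj (lax_fun L) a) \<otimes>\<^bsub>T\<^esub> fmap (lax_fun L) f) =
    fmap (lax_fun L) (\<one> a \<otimes> f) \<bullet>\<^bsub>T\<^esub> lax2 L (a, source.dom f)"
  using lax2_natural[of "\<one> a" f a b] assms by simp

lemmas lax_coherence = lax_alpha[unfolded F_def F2_def] lax_lambda[unfolded F_def F2_def] lax_rho[unfolded F_def F2_def]

end

lemma lax_id: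
  assumes "skew_monoidal_category S" shows "lax_monoidal_functor S S (lax_id S)"
proof -
  interpret skew_monoidal_category S by fact
  have o [simp]: "fobj (id_functor (scat S)) a = a" if "a \<in> sobj S" for a using that by (simp add: id_functor_apply sobj_def)
  have m [simp]: "fmap (id_functor (scat S)) f = f" if "arr f" for f using that by (simp add: id_functor_apply)
  show ?thesis
  proof (intro lax_monoidal_functor.intro lax_monoidal_functor_axioms.intro assms)
    show "is_functor (scat S) (scat S) (lax_fun (lax_id S))" by (simp add: lax_id_def is_functor_id category)
  qed (auto simp: lax_id_def shom_iff simp flip: shom_def)
qed

lemma lax_comp:
  fixes U (structure)
  assumes F: "lax_monoidal_functor S T F" and G: "lax_monoidal_functor T U G"
  shows "lax_monoidal_functor S U (lax_comp S T U G F)"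
proof -
  interpret F: lax_monoidal_functor S T F "lax_fun F" "\<lambda>a b. lax2 F (a, b)" by fact simp_all
  interpret G: lax_monoidal_functor T U G "lax_fun G" "\<lambda>a b. lax2 G (a, b)" by fact simp_all
  let ?F = "fobj (lax_fun F)" and ?G = "fobj (lax_fun G)" and ?Fm = "fmap (lax_fun F)" and ?Gm = "fmap (lax_fun G)"
  let ?H = "lax_comp S T U G F"
  have o [simp]: "fobj (lax_fun ?H) a = ?G (?F a)" if "a \<in> sobj S" for a
    using that by (simp add: comp_functor_apply sobj_def lax_comp_def)
  have m [simp]: "fmap (lax_fun ?H) f = ?Gm (?Fm f)" if "F.source.arr f" for f
    using that by (simp add: comp_functor_apply lax_comp_def)
  have l2 [simp]: "lax2 ?H (a, b) = ?Gm (lax2 F (a, b)) \<bullet> lax2 G (?F a, ?F b)" if "a \<in> sobj S" "b \<in> sobj S" for a b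
    using that by (simp add: lax_comp_def)
  have l0: "lax0 ?H = ?Gm (lax0 F) \<bullet> lax0 G" by (simp add: lax_comp_def)
  show ?thesis
  proof (intro lax_monoidal_functor.intro lax_monoidal_functor_axioms.intro)
    show "skew_monoidal_category S" "skew_monoidal_category U" by unfold_locales
    show "is_functor (scat S) (scat U) (lax_fun ?H)"
      using is_functor_comp[OF F.functorial G.functorial] by (simp add: lax_comp_def)
    show "lax0 ?H \<in> shom U \<I> (fobj (lax_fun ?H) \<I>\<^bsub>S\<^esub>)" by (simp add: l0 G.target.shom_iff)
    show "lax2 ?H \<in> extensional (sobj S \<times> sobj S)" by (simp add: lax_comp_def)
    show "lax2 ?H (a, b) \<in> shom U (fobj (lax_fun ?H) a \<odot> fobj (lax_fun ?H) b) (fobj (lax_fun ?H) (a \<odot>\<^bsub>S\<^esub> b))"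
      if "a \<in> sobj S" "b \<in> sobj S" for a b
      using that by (simp add: G.target.shom_iff)
    show "lax2 ?H (a', b') \<bullet> (fmap (lax_fun ?H) f \<otimes> fmap (lax_fun ?H) g) = fmap (lax_fun ?H) (f \<otimes>\<^bsub>S\<^esub> g) \<bullet> lax2 ?H (a, b)"
      if "f \<in> shom S a a'" "g \<in> shom S b b'" for f g a a' b b'
    proof -
      have [simp]: "F.source.arr f" "F.source.arr g" "F.source.dom f = a" "F.source.dom g = b" "F.source.cod f = a'" "F.source.cod g = b'"
        "a \<in> sobj S" "b \<in> sobj S" "a' \<in> sobj S" "b' \<in> sobj S"
        using that F.source.arr_obj[of f] F.source.arr_obj[of g] by (auto simp: F.source.shom_iff)
      have "?Gm (lax2 F (a', b')) \<bullet> (lax2 G (?F a', ?F b') \<bullet> (?Gm (?Fm f) \<otimes> ?Gm (?Fm g))) =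
          ?Gm (lax2 F (a', b') \<bullet>\<^bsub>T\<^esub> (?Fm f \<otimes>\<^bsub>T\<^esub> ?Fm g)) \<bullet> lax2 G (?F a, ?F b)"
        by (simp add: G.lax2_natural)
      also have "\<dots> = ?Gm (?Fm (f \<otimes>\<^bsub>S\<^esub> g) \<bullet>\<^bsub>T\<^esub> lax2 F (a, b)) \<bullet> lax2 G (?F a, ?F b)"
        by (simp only: F.lax2_natural[of f g a' b'] \<open>F.source.arr f\<close> \<open>F.source.arr g\<close> \<open>F.source.dom f = a\<close> \<open>F.source.dom g = b\<close>
            \<open>F.source.cod f = a'\<close> \<open>F.source.cod g = b'\<close>)
      finally show ?thesis by simp
    qed
    show "fmap (lax_fun ?H) (alpha S a b c) \<bullet> lax2 ?H (a \<odot>\<^bsub>S\<^esub> b, c) \<bullet> (lax2 ?H (a, b) \<otimes> \<one> (fobj (lax_fun ?H) c)) =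
        lax2 ?H (a, b \<odot>\<^bsub>S\<^esub> c) \<bullet> (\<one> (fobj (lax_fun ?H) a) \<otimes> lax2 ?H (b, c)) \<bullet>
          alpha U (fobj (lax_fun ?H) a) (fobj (lax_fun ?H) b) (fobj (lax_fun ?H) c)"
      if [simp]: "a \<in> sobj S" "b \<in> sobj S" "c \<in> sobj S" for a b c
    proof -
      let ?a = "?F a" and ?b = "?F b" and ?c = "?F c"
      have 1: "lax2 ?H (a, b) \<otimes> \<one> (?G ?c) =
          (?Gm (lax2 F (a, b)) \<otimes> \<one> (?G ?c)) \<bullet> (lax2 G (?a, ?b) \<otimes> \<one> (?G ?c))" by simp
      have 2: "lax2 G (?F (a \<odot>\<^bsub>S\<^esub> b), ?c) \<bullet> ((?Gm (lax2 F (a, b)) \<otimes> \<one> (?G ?c)) \<bullet> (lax2 G (?a, ?b) \<otimes> \<one> (?G ?c))) =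
          ?Gm (lax2 F (a, b) \<otimes>\<^bsub>T\<^esub> \<one>\<^bsub>T\<^esub> ?c) \<bullet> (lax2 G (?a \<odot>\<^bsub>T\<^esub> ?b, ?c) \<bullet> (lax2 G (?a, ?b) \<otimes> \<one> (?G ?c)))"
        by (rule G.target.comp_extend[OF G.lax2_natural_left[of "lax2 F (a, b)", simplified]]) simp_all
      have "fmap (lax_fun ?H) (alpha S a b c) \<bullet> lax2 ?H (a \<odot>\<^bsub>S\<^esub> b, c) \<bullet> (lax2 ?H (a, b) \<otimes> \<one> (fobj (lax_fun ?H) c)) =
          ?Gm (?Fm (alpha S a b c)) \<bullet> (?Gm (lax2 F (a \<odot>\<^bsub>S\<^esub> b, c)) \<bullet> (lax2 G (?F (a \<odot>\<^bsub>S\<^esub> b), ?c) \<bullet>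
            ((?Gm (lax2 F (a, b)) \<otimes> \<one> (?G ?c)) \<bullet> (lax2 G (?a, ?b) \<otimes> \<one> (?G ?c)))))"
        by simp
      also have "\<dots> = ?Gm (?Fm (alpha S a b c) \<bullet>\<^bsub>T\<^esub> lax2 F (a \<odot>\<^bsub>S\<^esub> b, c) \<bullet>\<^bsub>T\<^esub> (lax2 F (a, b) \<otimes>\<^bsub>T\<^esub> \<one>\<^bsub>T\<^esub> ?c)) \<bullet>
          (lax2 G (?a \<odot>\<^bsub>T\<^esub> ?b, ?c) \<bullet> (lax2 G (?a, ?b) \<otimes> \<one> (?G ?c)))"
        unfolding 2 by simp
      also have "\<dots> = ?Gm (lax2 F (a, b \<odot>\<^bsub>S\<^esub> c) \<bullet>\<^bsub>T\<^esub> (\<one>\<^bsub>T\<^esub> ?a \<otimes>\<^bsub>T\<^esub> lax2 F (b, c))) \<bullet>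
          (?Gm (alpha T ?a ?b ?c) \<bullet> lax2 G (?a \<odot>\<^bsub>T\<^esub> ?b, ?c) \<bullet> (lax2 G (?a, ?b) \<otimes> \<one> (?G ?c)))"
        unfolding F.lax_coherence(1)[OF that] by simp
      also have "\<dots> = ?Gm (lax2 F (a, b \<odot>\<^bsub>S\<^esub> c)) \<bullet> (?Gm (\<one>\<^bsub>T\<^esub> ?a \<otimes>\<^bsub>T\<^esub> lax2 F (b, c)) \<bullet>
          (lax2 G (?a, ?b \<odot>\<^bsub>T\<^esub> ?c) \<bullet> ((\<one> (?G ?a) \<otimes> lax2 G (?b, ?c)) \<bullet> alpha U (?G ?a) (?G ?b) (?G ?c))))"
        using G.lax_coherence(1)[of ?a ?b ?c] by simp
      also have "?Gm (\<one>\<^bsub>T\<^esub> ?a \<otimes>\<^bsub>T\<^esub> lax2 F (b, c)) \<bullet>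
          (lax2 G (?a, ?b \<odot>\<^bsub>T\<^esub> ?c) \<bullet> ((\<one> (?G ?a) \<otimes> lax2 G (?b, ?c)) \<bullet> alpha U (?G ?a) (?G ?b) (?G ?c))) =
          lax2 G (?a, ?F (b \<odot>\<^bsub>S\<^esub> c)) \<bullet> ((\<one> (?G ?a) \<otimes> ?Gm (lax2 F (b, c))) \<bullet>
            ((\<one> (?G ?a) \<otimes> lax2 G (?b, ?c)) \<bullet> alpha U (?G ?a) (?G ?b) (?G ?c)))"
        by (rule G.target.comp_extend[OF G.lax2_natural_right[of "lax2 F (b, c)" _ ?a, simplified, symmetric]]) simp_all
      finally show ?thesis by simp
    qed
    show "fmap (lax_fun ?H) (lambda S a) \<bullet> lax2 ?H (\<I>\<^bsub>S\<^esub>, a) \<bullet> (lax0 ?H \<otimes> \<one> (fobj (lax_fun ?H) a)) =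
        lambda U (fobj (lax_fun ?H) a)"
      if [simp]: "a \<in> sobj S" for a
    proof -
      let ?a = "?F a"
      have 1: "lax0 ?H \<otimes> \<one> (?G ?a) = (?Gm (lax0 F) \<otimes> \<one> (?G ?a)) \<bullet> (lax0 G \<otimes> \<one> (?G ?a))"
        by (simp add: l0)
      have 2: "lax2 G (?F \<I>\<^bsub>S\<^esub>, ?a) \<bullet> ((?Gm (lax0 F) \<otimes> \<one> (?G ?a)) \<bullet> (lax0 G \<otimes> \<one> (?G ?a))) =
          ?Gm (lax0 F \<otimes>\<^bsub>T\<^esub> \<one>\<^bsub>T\<^esub> ?a) \<bullet> (lax2 G (\<I>\<^bsub>T\<^esub>, ?a) \<bullet> (lax0 G \<otimes> \<one> (?G ?a)))"
        by (rule G.target.comp_extend[OF G.lax2_natural_left[of "lax0 F", simplified]]) simp_all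
      have "fmap (lax_fun ?H) (lambda S a) \<bullet> lax2 ?H (\<I>\<^bsub>S\<^esub>, a) \<bullet> (lax0 ?H \<otimes> \<one> (fobj (lax_fun ?H) a)) =
          ?Gm (?Fm (lambda S a)) \<bullet> (?Gm (lax2 F (\<I>\<^bsub>S\<^esub>, a)) \<bullet> (lax2 G (?F \<I>\<^bsub>S\<^esub>, ?a) \<bullet>
            ((?Gm (lax0 F) \<otimes> \<one> (?G ?a)) \<bullet> (lax0 G \<otimes> \<one> (?G ?a)))))"
        by (simp add: l0)
      also have "\<dots> = ?Gm (?Fm (lambda S a) \<bullet>\<^bsub>T\<^esub> lax2 F (\<I>\<^bsub>S\<^esub>, a) \<bullet>\<^bsub>T\<^esub> (lax0 F \<otimes>\<^bsub>T\<^esub> \<one>\<^bsub>T\<^esub> ?a)) \<bullet>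
          (lax2 G (\<I>\<^bsub>T\<^esub>, ?a) \<bullet> (lax0 G \<otimes> \<one> (?G ?a)))"
        unfolding 2 by simp
      also have "\<dots> = lambda U (?G ?a)"
        unfolding F.lax_coherence(2)[OF that] using G.lax_coherence(2)[of ?a] by simp
      finally show ?thesis by simp
    qed
    show "lax2 ?H (a, \<I>\<^bsub>S\<^esub>) \<bullet> (\<one> (fobj (lax_fun ?H) a) \<otimes> lax0 ?H) \<bullet> rho U (fobj (lax_fun ?H) a) = fmap (lax_fun ?H) (rho S a)"
      if [simp]: "a \<in> sobj S" for a
    proof -
      let ?a = "?F a"
      have 2: "lax2 G (?a, ?F \<I>\<^bsub>S\<^esub>) \<bullet> ((\<one> (?G ?a) \<otimes> ?Gm (lax0 F)) \<bullet> ((\<one> (?G ?a) \<otimes> lax0 G) \<bullet> rho U (?G ?a))) =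
          ?Gm (\<one>\<^bsub>T\<^esub> ?a \<otimes>\<^bsub>T\<^esub> lax0 F) \<bullet> (lax2 G (?a, \<I>\<^bsub>T\<^esub>) \<bullet> ((\<one> (?G ?a) \<otimes> lax0 G) \<bullet> rho U (?G ?a)))"
        by (rule G.target.comp_extend[OF G.lax2_natural_right[of "lax0 F", simplified]]) simp_all
      have "lax2 ?H (a, \<I>\<^bsub>S\<^esub>) \<bullet> (\<one> (fobj (lax_fun ?H) a) \<otimes> lax0 ?H) \<bullet> rho U (fobj (lax_fun ?H) a) =
          ?Gm (lax2 F (a, \<I>\<^bsub>S\<^esub>)) \<bullet> (lax2 G (?a, ?F \<I>\<^bsub>S\<^esub>) \<bullet> ((\<one> (?G ?a) \<otimes> ?Gm (lax0 F)) \<bullet> ((\<one> (?G ?a) \<otimes> lax0 G) \<bullet> rho U (?G ?a))))"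
        by (simp add: l0)
      also have "\<dots> = ?Gm (lax2 F (a, \<I>\<^bsub>S\<^esub>)) \<bullet> (?Gm (\<one>\<^bsub>T\<^esub> ?a \<otimes>\<^bsub>T\<^esub> lax0 F) \<bullet> ?Gm (rho T ?a))"
        unfolding 2 using G.lax_coherence(3)[of ?a] by simp
      also have "\<dots> = ?Gm (lax2 F (a, \<I>\<^bsub>S\<^esub>) \<bullet>\<^bsub>T\<^esub> (\<one>\<^bsub>T\<^esub> ?a \<otimes>\<^bsub>T\<^esub> lax0 F) \<bullet>\<^bsub>T\<^esub> rho T ?a)"
        by simp
      finally show ?thesis unfolding F.lax_coherence(3)[OF that] by simp
    qed
  qed
qed

lemma braided_lax_iff:
  "braided_lax (S, s) (T, t) L \<longleftrightarrow> lax_monoidal_functor S T L \<and>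
     (\<forall>x\<in>sobj S. \<forall>a\<in>sobj S. \<forall>b\<in>sobj S.
        fmap (lax_fun L) (s x a b) \<bullet>\<^bsub>T\<^esub> lax2 L (x \<odot>\<^bsub>S\<^esub> a, b) \<bullet>\<^bsub>T\<^esub> (lax2 L (x, a) \<otimes>\<^bsub>T\<^esub> \<one>\<^bsub>T\<^esub> (fobj (lax_fun L) b)) =
        lax2 L (x \<odot>\<^bsub>S\<^esub> b, a) \<bullet>\<^bsub>T\<^esub> (lax2 L (x, b) \<otimes>\<^bsub>T\<^esub> \<one>\<^bsub>T\<^esub> (fobj (lax_fun L) a)) \<bullet>\<^bsub>T\<^esub>
          t (fobj (lax_fun L) x) (fobj (lax_fun L) a) (fobj (lax_fun L) b))"
  by (simp add: braided_lax_def Let_def)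

lemma braided_lax_id:
  assumes "braiding S s" shows "braided_lax (S, s) (S, s) (lax_id S)"
proof -
  interpret braiding S s by fact
  have o [simp]: "fobj (id_functor (scat S)) a = a" if "a \<in> sobj S" for a using that by (simp add: id_functor_apply sobj_def)
  have m [simp]: "fmap (id_functor (scat S)) f = f" if "arr f" for f using that by (simp add: id_functor_apply)
  show ?thesis
    unfolding braided_lax_iff using lax_id[OF skew_monoidal_category_axioms] by (simp add: lax_id_def)
qed

lemma braided_lax_comp:
  fixes U (structure)
  assumes S: "braiding S s" and T: "braiding T t" and U: "braiding U v"
    and F: "braided_lax (S, s) (T, t) F" and G: "braided_lax (T, t) (U, v) G"
  shows "braided_lax (S, s) (U, v) (lax_comp S T U G F)"
proof -
  have lF: "lax_monoidal_functor S T F" and lG: "lax_monoidal_functor T U G" using F G by (simp_all add: braided_lax_iff)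
  interpret F: lax_monoidal_functor S T F "lax_fun F" "\<lambda>a b. lax2 F (a, b)" by fact simp_all
  interpret G: lax_monoidal_functor T U G "lax_fun G" "\<lambda>a b. lax2 G (a, b)" by fact simp_all
  interpret s: braiding S s by fact
  interpret t: braiding T t by fact
  interpret v: braiding U v by fact
  let ?F = "fobj (lax_fun F)" and ?G = "fobj (lax_fun G)" and ?Fm = "fmap (lax_fun F)" and ?Gm = "fmap (lax_fun G)"
  let ?H = "lax_comp S T U G F"
  have o [simp]: "fobj (lax_fun ?H) a = ?G (?F a)" if "a \<in> sobj S" for a
    using that by (simp add: comp_functor_apply sobj_def lax_comp_def)
  have m [simp]: "fmap (lax_fun ?H) f = ?Gm (?Fm f)" if "F.source.arr f" for f
    using that by (simp add: comp_functor_apply lax_comp_def)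
  have l2 [simp]: "lax2 ?H (a, b) = ?Gm (lax2 F (a, b)) \<bullet> lax2 G (?F a, ?F b)" if "a \<in> sobj S" "b \<in> sobj S" for a b
    using that by (simp add: lax_comp_def)
  show ?thesis unfolding braided_lax_iff
  proof (intro conjI ballI lax_comp[OF lF lG])
    fix x a b assume [simp]: "x \<in> sobj S" "a \<in> sobj S" "b \<in> sobj S"
    have E: "lax2 ?H (x \<odot>\<^bsub>S\<^esub> a, b) \<bullet> (lax2 ?H (x, a) \<otimes> \<one> (?G (?F b))) =
        ?Gm (lax2 F (x \<odot>\<^bsub>S\<^esub> a, b) \<bullet>\<^bsub>T\<^esub> (lax2 F (x, a) \<otimes>\<^bsub>T\<^esub> \<one>\<^bsub>T\<^esub> (?F b))) \<bullet>
          (lax2 G (?F x \<odot>\<^bsub>T\<^esub> ?F a, ?F b) \<bullet> (lax2 G (?F x, ?F a) \<otimes> \<one> (?G (?F b))))"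
      if [simp]: "x \<in> sobj S" "a \<in> sobj S" "b \<in> sobj S" for x a b
    proof -
      have 2: "lax2 G (?F (x \<odot>\<^bsub>S\<^esub> a), ?F b) \<bullet> ((?Gm (lax2 F (x, a)) \<otimes> \<one> (?G (?F b))) \<bullet> (lax2 G (?F x, ?F a) \<otimes> \<one> (?G (?F b)))) =
          ?Gm (lax2 F (x, a) \<otimes>\<^bsub>T\<^esub> \<one>\<^bsub>T\<^esub> (?F b)) \<bullet> (lax2 G (?F x \<odot>\<^bsub>T\<^esub> ?F a, ?F b) \<bullet> (lax2 G (?F x, ?F a) \<otimes> \<one> (?G (?F b))))"
        by (rule G.target.comp_extend[OF G.lax2_natural_left[of "lax2 F (x, a)", simplified]]) simp_all
      have "lax2 ?H (x \<odot>\<^bsub>S\<^esub> a, b) \<bullet> (lax2 ?H (x, a) \<otimes> \<one> (?G (?F b))) =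
          ?Gm (lax2 F (x \<odot>\<^bsub>S\<^esub> a, b)) \<bullet> (lax2 G (?F (x \<odot>\<^bsub>S\<^esub> a), ?F b) \<bullet>
            ((?Gm (lax2 F (x, a)) \<otimes> \<one> (?G (?F b))) \<bullet> (lax2 G (?F x, ?F a) \<otimes> \<one> (?G (?F b)))))"
        by simp
      then show ?thesis unfolding 2 by simp
    qed
    have "fmap (lax_fun ?H) (s x a b) \<bullet> lax2 ?H (x \<odot>\<^bsub>S\<^esub> a, b) \<bullet> (lax2 ?H (x, a) \<otimes> \<one> (fobj (lax_fun ?H) b)) =
        ?Gm (?Fm (s x a b) \<bullet>\<^bsub>T\<^esub> lax2 F (x \<odot>\<^bsub>S\<^esub> a, b) \<bullet>\<^bsub>T\<^esub> (lax2 F (x, a) \<otimes>\<^bsub>T\<^esub> \<one>\<^bsub>T\<^esub> (?F b))) \<bullet>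
          (lax2 G (?F x \<odot>\<^bsub>T\<^esub> ?F a, ?F b) \<bullet> (lax2 G (?F x, ?F a) \<otimes> \<one> (?G (?F b))))"
      using E[of x a b] by simp
    also have "?Fm (s x a b) \<bullet>\<^bsub>T\<^esub> lax2 F (x \<odot>\<^bsub>S\<^esub> a, b) \<bullet>\<^bsub>T\<^esub> (lax2 F (x, a) \<otimes>\<^bsub>T\<^esub> \<one>\<^bsub>T\<^esub> (?F b)) =
        lax2 F (x \<odot>\<^bsub>S\<^esub> b, a) \<bullet>\<^bsub>T\<^esub> (lax2 F (x, b) \<otimes>\<^bsub>T\<^esub> \<one>\<^bsub>T\<^esub> (?F a)) \<bullet>\<^bsub>T\<^esub> t (?F x) (?F a) (?F b)"
      using F unfolding braided_lax_iff by simp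
    also have "?Gm (lax2 F (x \<odot>\<^bsub>S\<^esub> b, a) \<bullet>\<^bsub>T\<^esub> (lax2 F (x, b) \<otimes>\<^bsub>T\<^esub> \<one>\<^bsub>T\<^esub> (?F a)) \<bullet>\<^bsub>T\<^esub> t (?F x) (?F a) (?F b)) \<bullet>
          (lax2 G (?F x \<odot>\<^bsub>T\<^esub> ?F a, ?F b) \<bullet> (lax2 G (?F x, ?F a) \<otimes> \<one> (?G (?F b)))) =
        ?Gm (lax2 F (x \<odot>\<^bsub>S\<^esub> b, a)) \<bullet> ?Gm (lax2 F (x, b) \<otimes>\<^bsub>T\<^esub> \<one>\<^bsub>T\<^esub> (?F a)) \<bullet>
          (?Gm (t (?F x) (?F a) (?F b)) \<bullet> lax2 G (?F x \<odot>\<^bsub>T\<^esub> ?F a, ?F b) \<bullet> (lax2 G (?F x, ?F a) \<otimes> \<one> (?G (?F b))))"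
      by simp
    also have "?Gm (t (?F x) (?F a) (?F b)) \<bullet> lax2 G (?F x \<odot>\<^bsub>T\<^esub> ?F a, ?F b) \<bullet> (lax2 G (?F x, ?F a) \<otimes> \<one> (?G (?F b))) =
        lax2 G (?F x \<odot>\<^bsub>T\<^esub> ?F b, ?F a) \<bullet> (lax2 G (?F x, ?F b) \<otimes> \<one> (?G (?F a))) \<bullet> v (?G (?F x)) (?G (?F a)) (?G (?F b))"
      using G unfolding braided_lax_iff by simp
    also have "?Gm (lax2 F (x \<odot>\<^bsub>S\<^esub> b, a)) \<bullet> ?Gm (lax2 F (x, b) \<otimes>\<^bsub>T\<^esub> \<one>\<^bsub>T\<^esub> (?F a)) \<bullet>
          (lax2 G (?F x \<odot>\<^bsub>T\<^esub> ?F b, ?F a) \<bullet> (lax2 G (?F x, ?F b) \<otimes> \<one> (?G (?F a))) \<bullet> v (?G (?F x)) (?G (?F a)) (?G (?F b))) =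
        (lax2 ?H (x \<odot>\<^bsub>S\<^esub> b, a) \<bullet> (lax2 ?H (x, b) \<otimes> \<one> (?G (?F a)))) \<bullet> v (?G (?F x)) (?G (?F a)) (?G (?F b))"
      unfolding E[OF \<open>x \<in> sobj S\<close> \<open>b \<in> sobj S\<close> \<open>a \<in> sobj S\<close>] by simp
    also have "\<dots> = lax2 ?H (x \<odot>\<^bsub>S\<^esub> b, a) \<bullet> ((lax2 ?H (x, b) \<otimes> \<one> (?G (?F a))) \<bullet> v (?G (?F x)) (?G (?F a)) (?G (?F b)))"
      by (rule G.target.comp_assoc) simp_all
    finally show "fmap (lax_fun ?H) (s x a b) \<bullet> lax2 ?H (x \<odot>\<^bsub>S\<^esub> a, b) \<bullet> (lax2 ?H (x, a) \<otimes> \<one> (fobj (lax_fun ?H) b)) =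
        lax2 ?H (x \<odot>\<^bsub>S\<^esub> b, a) \<bullet> (lax2 ?H (x, b) \<otimes> \<one> (fobj (lax_fun ?H) a)) \<bullet>
          v (fobj (lax_fun ?H) x) (fobj (lax_fun ?H) a) (fobj (lax_fun ?H) b)"
      by simp
  qed
qed

lemma lax_mor_eqI:
  assumes F: "lax_monoidal_functor S T F" and G: "lax_monoidal_functor S T G"
    and "\<And>a. a \<in> sobj S \<Longrightarrow> fobj (lax_fun F) a = fobj (lax_fun G) a"
    and "\<And>f. f \<in> Arr (scat S) \<Longrightarrow> fmap (lax_fun F) f = fmap (lax_fun G) f"
    and "lax0 F = lax0 G"
    and "\<And>a b. a \<in> sobj S \<Longrightarrow> b \<in> sobj S \<Longrightarrow> lax2 F (a, b) = lax2 G (a, b)"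
  shows "F = (G :: ('o, 'm) lax_mor)"
proof -
  interpret F: lax_monoidal_functor S T F "lax_fun F" "\<lambda>a b. lax2 F (a, b)" by fact simp_all
  interpret G: lax_monoidal_functor S T G "lax_fun G" "\<lambda>a b. lax2 G (a, b)" by fact simp_all
  have "lax_fun F = lax_fun G"
    by (rule functr_eqI[of _ "Obj (scat S)" _ "Arr (scat S)"])
      (use is_functorD(3,4)[OF F.functorial] is_functorD(3,4)[OF G.functorial] assms in \<open>simp_all add: sobj_def\<close>)
  moreover have "lax2 F = lax2 G"
    by (rule extensionalityI[OF F.lax2_ext G.lax2_ext]) (use assms in auto)
  ultimately show ?thesis using assms(5) by simp
qed

lemma comp_functor_apply_sobj:
  "a \<in> sobj S \<Longrightarrow> fobj (comp_functor (scat S) G F) a = fobj G (fobj F a)"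
  "f \<in> Arr (scat S) \<Longrightarrow> fmap (comp_functor (scat S) G F) f = fmap G (fmap F f)"
  by (simp_all add: comp_functor_apply sobj_def)

lemma id_functor_apply_sobj:
  "a \<in> sobj S \<Longrightarrow> fobj (id_functor (scat S)) a = a" "f \<in> Arr (scat S) \<Longrightarrow> fmap (id_functor (scat S)) f = f"
  by (simp_all add: id_functor_apply sobj_def)

lemma category_BrdSkMon: "category (BrdSkMon :: (('o, 'm) smc \<times> ('o \<Rightarrow> 'o \<Rightarrow> 'o \<Rightarrow> 'm),
    (('o, 'm) smc \<times> ('o \<Rightarrow> 'o \<Rightarrow> 'o \<Rightarrow> 'm)) \<times> ('o, 'm) lax_mor \<times> (('o, 'm) smc \<times> ('o \<Rightarrow> 'o \<Rightarrow> 'o \<Rightarrow> 'm))) cat)"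
  unfolding BrdSkMon_def
proof (rule category_cat_of_homs; clarsimp)
  fix S s assume "braiding S s"
  then show "braided_lax (S, s) (S, s) (lax_id S)" by (rule braided_lax_id)
next
  fix S s T t U v F G
  assume "braiding S s" "braiding T t" "braiding U v" "braided_lax (S, s) (T, t) F" "braided_lax (T, t) (U, v) G"
  then show "braided_lax (S, s) (U, v) (lax_comp S T U G F)" by (rule braided_lax_comp)
next
  fix S s T t and F :: "('o, 'm) lax_mor"
  assume S: "braiding S s" and T: "braiding T t" and F: "braided_lax (S, s) (T, t) F"
  have lF: "lax_monoidal_functor S T F" using F by (simp add: braided_lax_iff)
  interpret F: lax_monoidal_functor S T F "lax_fun F" "\<lambda>a b. lax2 F (a, b)" by fact simp_all
  have i: "lax_monoidal_functor S S (lax_id S)" "lax_monoidal_functor T T (lax_id T)"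
    by (rule lax_id, rule F.source.skew_monoidal_category_axioms, rule lax_id, rule F.target.skew_monoidal_category_axioms)
  show "lax_comp S S T F (lax_id S) = F"
    by (rule lax_mor_eqI[OF lax_comp[OF i(1) lF] lF])
      (simp_all add: lax_comp_def lax_id_def comp_functor_apply_sobj id_functor_apply_sobj)
  show "lax_comp S T T (lax_id T) F = F"
    by (rule lax_mor_eqI[OF lax_comp[OF lF i(2)] lF])
      (simp_all add: lax_comp_def lax_id_def comp_functor_apply_sobj id_functor_apply_sobj)
next
  fix S s T t U v W w and F G H :: "('o, 'm) lax_mor"
  assume "braided_lax (S, s) (T, t) F" "braided_lax (T, t) (U, v) G" "braided_lax (U, v) (W, w) H"
  then have l: "lax_monoidal_functor S T F" "lax_monoidal_functor T U G" "lax_monoidal_functor U W H"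
    by (simp_all add: braided_lax_iff)
  interpret F: lax_monoidal_functor S T F "lax_fun F" "\<lambda>a b. lax2 F (a, b)" by fact simp_all
  interpret G: lax_monoidal_functor T U G "lax_fun G" "\<lambda>a b. lax2 G (a, b)" by fact simp_all
  interpret H: lax_monoidal_functor U W H "lax_fun H" "\<lambda>a b. lax2 H (a, b)" by fact simp_all
  show "lax_comp S T W (lax_comp T U W H G) F = lax_comp S U W H (lax_comp S T U G F)"
    by (rule lax_mor_eqI[OF lax_comp[OF l(1) lax_comp[OF l(2,3)]] lax_comp[OF lax_comp[OF l(1,2)] l(3)]])
      (simp_all add: lax_comp_def comp_functor_apply_sobj)
qed

section \<open>The induced lax monoidal functors\<close>

context representable
begin

lemma compose_left:
  assumes "ar p" "Dom C p = x \<box> y" "ar q" "Dom C q = Cod C p \<box> w" "ob x" "ob y" "ob w"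
  shows "{|Comp C q (p \<Otimes> Idn C w)|} \<star> (\<theta> (x \<box> y) w \<star> \<theta> x y) = {|q|} \<star> \<theta> (Cod C p) w \<star> ({|p|} \<star> \<theta> x y)"
proof -
  note [simp] = assms
  have "{|Comp C q (p \<Otimes> Idn C w)|} \<star> (\<theta> (x \<box> y) w \<star> \<theta> x y) = {|q|} \<star> (\<theta> (Cod C p) w \<star> ({|p|} \<star> \<theta> x y))"
    using whisker_left[of p w "\<theta> x y"] by (simp add: comp_push numeral_2_eq_2)
  also have "\<dots> = {|q|} \<star> \<theta> (Cod C p) w \<star> ({|p|} \<star> \<theta> x y)" by (rule unary_push; simp)
  finally show ?thesis .
qed

lemma compose_right:
  assumes "ar p" "Dom C p = y \<box> w" "ar q" "Dom C q = x \<box> Cod C p" "ob x" "ob y" "ob w"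
  shows "{|Comp C q (Idn C x \<Otimes> p)|} \<star> (\<theta> x (y \<box> w) \<star>\<^sub>2 \<theta> y w) = {|q|} \<star> \<theta> x (Cod C p) \<star>\<^sub>2 ({|p|} \<star> \<theta> y w)"
proof -
  note [simp] = assms
  have "{|Comp C q (Idn C x \<Otimes> p)|} \<star> (\<theta> x (y \<box> w) \<star>\<^sub>2 \<theta> y w) = {|q|} \<star> (\<theta> x (Cod C p) \<star>\<^sub>2 ({|p|} \<star> \<theta> y w))"
    using whisker_right[of p x "\<theta> y w"] by (simp add: comp_push numeral_2_eq_2)
  also have "\<dots> = {|q|} \<star> \<theta> x (Cod C p) \<star>\<^sub>2 ({|p|} \<star> \<theta> y w)" by (rule unary_push; simp)
  finally show ?thesis .
qed

lemma multimap_cases [consumes 1, case_names unary theta u]: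
  assumes f: "valid M f"
  obtains p where "ar p" "f = {|p|}"
  | a b xs g where "ob a" "ob b" "length xs \<le> 2" "valid M g" "knd g = Tight" "src g = a \<box> b # xs"
      "knd f = Tight" "src f = a # b # xs" "f = g \<star> \<theta> a b"
  | xs g where "length xs \<le> 2" "valid M g" "knd g = Tight" "src g = I # xs" "knd f = Loose" "src f = xs" "f = g \<star> u"
proof (cases "knd f")
  case Loose
  then obtain g where "valid M g" "knd g = Tight" "src g = I # src f" "g \<star> u = f" using u_surj[OF f] by blast
  moreover have "length (src f) \<le> 2" using validD(1)[OF f] Loose unfolding mm_kinds_def by auto
  ultimately show ?thesis using that(3) Loose by metis
next
  case Tight
  show ?thesis
  proof (cases "src f")
    case Nil
    then show ?thesis using validD(1)[OF f] Tight unfolding mm_kinds_def by auto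
  next
    case (Cons a ys)
    show ?thesis
    proof (cases ys)
      case Nil
      then show ?thesis using unary_cases[OF f] that(1) Tight Cons by (auto simp: mtype_def)
    next
      case (Cons b xs)
      then have s: "src f = a # b # xs" using \<open>src f = a # ys\<close> by simp
      have xs: "length xs \<le> 2" using validD(1)[OF f] Tight s unfolding mm_kinds_def by auto
      obtain g where "valid M g" "knd g = Tight" "src g = a \<box> b # xs" "g \<star> \<theta> a b = f"
        using theta_surj[OF f Tight s xs] by auto
      moreover have "ob a" "ob b" using validD(2)[OF f] s by auto
      ultimately show ?thesis using that(2) Tight s xs by metis
    qed
  qed
qed

lemma composable_theta_u:
  "length xs \<le> 2 \<Longrightarrow> composable (Tight, Suc (length xs)) (Tight, Suc (Suc 0))"
  "length xs \<le> 2 \<Longrightarrow> composable (Tight, Suc (length xs)) (Loose, 0)"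
  unfolding composable_def sub_cases_def mm_kinds_def by (auto simp: le_Suc_eq numeral_2_eq_2)

text \<open>A tight multimap arises from a map with one input fewer, and a loose one from a tight one.\<close>

lemma multimap_induct [consumes 1, case_names unary theta u]:
  assumes f: "valid M f" and un: "\<And>p. p \<in> Arr C \<Longrightarrow> P {|p|}"
    and th: "\<And>a b xs g. \<lbrakk>ob a; ob b; length xs \<le> 2; valid M g; knd g = Tight; src g = a \<box> b # xs; P g\<rbrakk> \<Longrightarrow> P (g \<star> \<theta> a b)"
    and uu: "\<And>xs g. \<lbrakk>length xs \<le> 2; valid M g; knd g = Tight; src g = I # xs; P g\<rbrakk> \<Longrightarrow> P (g \<star> u)"
  shows "P f"
proof -
  have t: "P f" if "valid M f" "knd f = Tight" for f
    using that
  proof (induction "length (src f)" arbitrary: f rule: less_induct)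
    case less
    from less.prems(1) show ?case
    proof (cases rule: multimap_cases)
      case (theta a b xs g)
      then show ?thesis using th less.hyps[of g] by simp
    qed (use un less.prems in auto)
  qed
  from f show ?thesis
    by (cases rule: multimap_cases) (use t un th uu in auto)
qed

end

locale lr_pair = multi_pair M N + representable M D + N: representable N D'
  for M :: "('o, 'm) ssm" and N :: "('o, 'm) ssm" and D :: "('o, 'm) lr_data" and D' :: "('o, 'm) lr_data"
begin

context
  fixes F assumes F: "ssm_morphism M N F"
begin

abbreviation (input) Fo where "Fo \<equiv> fobj (mm_fun F)"
abbreviation (input) Fm where "Fm \<equiv> fmap (mm_fun F)"
abbreviation (input) H where "H \<equiv> K_s_mor D D' M N F"
abbreviation (input) f2 where "f2 a b \<equiv> lax2 H (a, b)"
abbreviation (input) f0 where "f0 \<equiv> lax0 H"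

lemmas F_simps [simp] = mor_simps[OF F] app_valid[OF F] app_unary[OF F]

lemma f2_props:
  assumes [simp]: "ob a" "ob b"
  shows "f2 a b \<in> hom N.C (N.tensor (Fo a) (Fo b)) (Fo (a \<box> b))" and "{|f2 a b|}' \<star>' N.\<theta> (Fo a) (Fo b) = app F (\<theta> a b)"
proof -
  have f: "valid N (app F (\<theta> a b))" "knd (app F (\<theta> a b)) = Tight" "src (app F (\<theta> a b)) = [Fo a, Fo b]" by simp_all
  have "f2 a b = (THE h. h \<in> hom N.C (N.tensor (Fo a) (Fo b)) (tgt (app F (\<theta> a b))) \<and> {|h|}' \<star>' N.\<theta> (Fo a) (Fo b) = app F (\<theta> a b))"
    by (simp add: K_s_mor_def Let_def)
      (rule arg_cong[where f = The], auto simp: fun_eq_iff comp_at_def \<theta>_def N.\<theta>_def hom_def app_def)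
  with theI'[OF N.arrow_ex[OF f]]
  show "f2 a b \<in> hom N.C (N.tensor (Fo a) (Fo b)) (Fo (a \<box> b))" "{|f2 a b|}' \<star>' N.\<theta> (Fo a) (Fo b) = app F (\<theta> a b)"
    by simp_all
qed

lemma f2_arr [simp]:
  assumes "ob a" "ob b"
  shows "f2 a b \<in> Arr N.C" "Dom N.C (f2 a b) = N.tensor (Fo a) (Fo b)" "Cod N.C (f2 a b) = Fo (a \<box> b)"
  using homD[OF f2_props(1)[OF assms]] by auto

lemma f0_props: "f0 \<in> hom N.C N.I (Fo I)" "{|f0|}' \<star>' N.u = app F u"
proof -
  have f: "valid N (app F u)" "knd (app F u) = Loose" "src (app F u) = []" by simp_all
  have "f0 = (THE h. h \<in> hom N.C N.I (tgt (app F u)) \<and> {|h|}' \<star>' N.u = app F u)"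
    by (simp add: K_s_mor_def Let_def)
      (rule arg_cong[where f = The], auto simp: fun_eq_iff comp_at_def u_def N.u_def hom_def app_def)
  with theI'[OF N.arrow_ex_u[OF f]] show "f0 \<in> hom N.C N.I (Fo I)" "{|f0|}' \<star>' N.u = app F u" by simp_all
qed

lemma f0_arr [simp]: "f0 \<in> Arr N.C" "Dom N.C f0 = N.I" "Cod N.C f0 = Fo I"
  using homD[OF f0_props(1)] by auto

lemma f2_nat:
  assumes [simp]: "ar f" "ar g"
  shows "Comp N.C (f2 (Cod C f) (Cod C g)) (N.tensor_arr (Fm f) (Fm g)) = Comp N.C (Fm (f \<Otimes> g)) (f2 (Dom C f) (Dom C g))"
proof (rule N.arrow_eqI[of _ _ "Fo (Dom C f)" "Fo (Dom C g)"])
  let ?t = "N.\<theta> (Fo (Cod C f)) (Fo (Cod C g))" and ?t' = "N.\<theta> (Fo (Dom C f)) (Fo (Dom C g))"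
  have "{|Comp N.C (f2 (Cod C f) (Cod C g)) (N.tensor_arr (Fm f) (Fm g))|}' \<star>' ?t' =
      {|f2 (Cod C f) (Cod C g)|}' \<star>' (?t \<star>' {|Fm f|}' \<star>'\<^sub>2 {|Fm g|}')"
    by (simp add: N.comp_push N.tensor_theta)
  also have "\<dots> = {|f2 (Cod C f) (Cod C g)|}' \<star>' (?t \<star>' {|Fm f|}') \<star>'\<^sub>2 {|Fm g|}'" by (rule N.unary_push; simp)
  also have "{|f2 (Cod C f) (Cod C g)|}' \<star>' (?t \<star>' {|Fm f|}') = {|f2 (Cod C f) (Cod C g)|}' \<star>' ?t \<star>' {|Fm f|}'"
    by (rule N.unary_push; simp)
  also have "\<dots> \<star>'\<^sub>2 {|Fm g|}' = app F (\<theta> (Cod C f) (Cod C g) \<star> {|f|} \<star>\<^sub>2 {|g|})"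
    by (simp add: f2_props(2) app_comp_at[OF F])
  also have "\<dots> = app F ({|f \<Otimes> g|} \<star> \<theta> (Dom C f) (Dom C g))" by (simp add: tensor_theta)
  also have "\<dots> = {|Fm (f \<Otimes> g)|}' \<star>' app F (\<theta> (Dom C f) (Dom C g))" by (simp add: app_comp_at[OF F])
  finally show "{|Comp N.C (f2 (Cod C f) (Cod C g)) (N.tensor_arr (Fm f) (Fm g))|}' \<star>' ?t' =
      {|Comp N.C (Fm (f \<Otimes> g)) (f2 (Dom C f) (Dom C g))|}' \<star>' ?t'"
    by (simp add: N.comp_push f2_props(2))
qed simp_all

text \<open>The structure arrow \<open>(FaFb)Fc \<rightarrow> F((ab)c)\<close> represents the image of the universal ternary map;
  both coherence with \<open>\<alpha>\<close> and compatibility with the braiding rest on this.\<close>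

lemma f2_Theta:
  assumes [simp]: "ob a" "ob b" "ob c"
  shows "{|Comp N.C (f2 (a \<box> b) c) (N.tensor_arr (f2 a b) (Idn N.C (Fo c)))|}' \<star>'
      (N.\<theta> (N.tensor (Fo a) (Fo b)) (Fo c) \<star>' N.\<theta> (Fo a) (Fo b)) = app F (\<theta> (a \<box> b) c \<star> \<theta> a b)"
  using N.compose_left[of "f2 a b" "Fo a" "Fo b" "f2 (a \<box> b) c" "Fo c"] by (simp add: f2_props(2) app_comp_at[OF F])

lemma f2_alpha:
  assumes [simp]: "ob a" "ob b" "ob c"
  shows "Comp N.C (Fm (\<alpha> a b c)) (Comp N.C (f2 (a \<box> b) c) (N.tensor_arr (f2 a b) (Idn N.C (Fo c)))) =
    Comp N.C (f2 a (b \<box> c)) (Comp N.C (N.tensor_arr (Idn N.C (Fo a)) (f2 b c)) (N.\<alpha> (Fo a) (Fo b) (Fo c)))"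
proof (rule N.arrow_eqI_3'[of _ _ "Fo a" "Fo b" "Fo c"])
  let ?X = "N.\<theta> (N.tensor (Fo a) (Fo b)) (Fo c) \<star>' N.\<theta> (Fo a) (Fo b)"
  let ?l = "Comp N.C (f2 (a \<box> b) c) (N.tensor_arr (f2 a b) (Idn N.C (Fo c)))"
  have "{|Comp N.C (Fm (\<alpha> a b c)) ?l|}' \<star>' ?X = {|Fm (\<alpha> a b c)|}' \<star>' ({|?l|}' \<star>' ?X)"
    by (rule N.comp_push; simp)
  also have "\<dots> = app F ({|\<alpha> a b c|} \<star> (\<theta> (a \<box> b) c \<star> \<theta> a b))"
    unfolding f2_Theta[OF assms] by (simp add: app_comp_at[OF F])
  also have "\<dots> = app F (\<theta> a (b \<box> c)) \<star>'\<^sub>2 app F (\<theta> b c)" by (simp add: alpha_theta app_comp_at[OF F])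
  also have "\<dots> = {|Comp N.C (f2 a (b \<box> c)) (N.tensor_arr (Idn N.C (Fo a)) (f2 b c))|}' \<star>'
      (N.\<theta> (Fo a) (N.tensor (Fo b) (Fo c)) \<star>'\<^sub>2 N.\<theta> (Fo b) (Fo c))"
    using N.compose_right[of "f2 b c" "Fo b" "Fo c" "f2 a (b \<box> c)" "Fo a"] by (simp add: f2_props(2))
  finally show "{|Comp N.C (Fm (\<alpha> a b c)) ?l|}' \<star>' ?X =
      {|Comp N.C (f2 a (b \<box> c)) (Comp N.C (N.tensor_arr (Idn N.C (Fo a)) (f2 b c)) (N.\<alpha> (Fo a) (Fo b) (Fo c)))|}' \<star>' ?X"
    by (simp add: N.comp_push N.alpha_theta)
qed simp_all

lemma f2_lambda:
  assumes [simp]: "ob a"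
  shows "Comp N.C (Fm (\<Lambda> a)) (Comp N.C (f2 I a) (N.tensor_arr f0 (Idn N.C (Fo a)))) = N.\<Lambda> (Fo a)"
proof (rule N.arrow_eqI_2u[of _ _ "Fo a"])
  let ?p = "Comp N.C (Fm (\<Lambda> a)) (Comp N.C (f2 I a) (N.tensor_arr f0 (Idn N.C (Fo a))))"
  have "{|?p|}' \<star>' N.\<theta> N.I (Fo a) = {|Fm (\<Lambda> a)|}' \<star>' ({|f2 I a|}' \<star>' (N.\<theta> (Fo I) (Fo a) \<star>' {|f0|}'))"
    by (simp add: N.comp_push N.tensor_theta N.comp_at_idn)
  also have "{|f2 I a|}' \<star>' (N.\<theta> (Fo I) (Fo a) \<star>' {|f0|}') = {|f2 I a|}' \<star>' N.\<theta> (Fo I) (Fo a) \<star>' {|f0|}'"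
    by (rule N.unary_push; simp)
  also have "\<dots> = app F (\<theta> I a) \<star>' {|f0|}'" by (simp add: f2_props(2))
  also have "{|Fm (\<Lambda> a)|}' \<star>' (app F (\<theta> I a) \<star>' {|f0|}') = {|Fm (\<Lambda> a)|}' \<star>' app F (\<theta> I a) \<star>' {|f0|}'"
    by (rule N.unary_push; simp)
  also have "\<dots> = app F ({|\<Lambda> a|} \<star> \<theta> I a) \<star>' {|f0|}'" by (simp add: app_comp_at[OF F])
  finally have "{|?p|}' \<star>' N.\<theta> N.I (Fo a) \<star>' N.u = app F ({|\<Lambda> a|} \<star> \<theta> I a) \<star>' {|f0|}' \<star>' N.u" by simp
  also have "\<dots> = app F ({|\<Lambda> a|} \<star> \<theta> I a) \<star>' ({|f0|}' \<star>' N.u)" by (rule N.assoc[symmetric]; simp)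
  also have "\<dots> = app F ({|\<Lambda> a|} \<star> \<theta> I a \<star> u)" by (simp add: f0_props(2) app_comp_at[OF F])
  also have "\<dots> = {|N.\<Lambda> (Fo a)|}' \<star>' N.\<theta> N.I (Fo a) \<star>' N.u"
    by (simp add: lambda_props N.lambda_props app_jmap[OF F])
  finally show "{|?p|}' \<star>' N.\<theta> N.I (Fo a) \<star>' N.u = {|N.\<Lambda> (Fo a)|}' \<star>' N.\<theta> N.I (Fo a) \<star>' N.u" .
qed simp_all

lemma f2_rho:
  assumes [simp]: "ob a"
  shows "Comp N.C (f2 a I) (Comp N.C (N.tensor_arr (Idn N.C (Fo a)) f0) (N.\<rho> (Fo a))) = Fm (\<rho> a)"
proof (rule N.unary_inj)
  have "{|Comp N.C (f2 a I) (Comp N.C (N.tensor_arr (Idn N.C (Fo a)) f0) (N.\<rho> (Fo a)))|}' =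
      {|f2 a I|}' \<star>' ({|N.tensor_arr (Idn N.C (Fo a)) f0|}' \<star>' (N.\<theta> (Fo a) N.I \<star>'\<^sub>2 N.u))"
    by (simp add: N.unary_comp_arrow N.rho_unary)
  also have "\<dots> = {|f2 a I|}' \<star>' (N.\<theta> (Fo a) (Fo I) \<star>'\<^sub>2 ({|f0|}' \<star>' N.u))"
    using N.whisker_right[of "f0" "Fo a" N.u] by (simp add: numeral_2_eq_2)
  also have "\<dots> = {|f2 a I|}' \<star>' N.\<theta> (Fo a) (Fo I) \<star>'\<^sub>2 ({|f0|}' \<star>' N.u)" by (rule N.unary_push; simp)
  also have "\<dots> = app F (\<theta> a I \<star>\<^sub>2 u)" by (simp add: f2_props(2) f0_props(2) app_comp_at[OF F])
  also have "\<dots> = app F {|\<rho> a|}" by (simp add: rho_unary(1))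
  finally show "{|Comp N.C (f2 a I) (Comp N.C (N.tensor_arr (Idn N.C (Fo a)) f0) (N.\<rho> (Fo a)))|}' = {|Fm (\<rho> a)|}'"
    by simp
qed

lemma K_mor_lax: "lax_monoidal_functor (K_s_obj D M) (K_s_obj D' N) H"
proof (intro lax_monoidal_functor.intro lax_monoidal_functor_axioms.intro)
  have l [simp]: "lax_fun H = mm_fun F" by (simp add: K_s_mor_def Let_def)
  show "skew_monoidal_category (K_s_obj D M)" "skew_monoidal_category (K_s_obj D' N)"
    by (rule K.skew_monoidal_category_axioms N.K.skew_monoidal_category_axioms)+
  show "is_functor (scat (K_s_obj D M)) (scat (K_s_obj D' N)) (lax_fun H)" using mor_functor[OF F] by simp
  show "lax2 H \<in> extensional (sobj (K_s_obj D M) \<times> sobj (K_s_obj D M))" by (simp add: K_s_mor_def Let_def)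
qed (auto simp: K_s_mor_def[of D D' M N F, THEN arg_cong[where f = lax_fun], unfolded Let_def, simplified]
    homs N.homs f2_nat f2_alpha f2_lambda f2_rho)

end

text \<open>\<open>K F\<close> is characterised by its defining equations, so that \<open>K\<close> of an identity or a composite need only
  be tested on the universal maps.\<close>

lemma K_mor_eqI:
  assumes F: "ssm_morphism M N F" and L: "lax_monoidal_functor (K_s_obj D M) (K_s_obj D' N) L"
    and l: "lax_fun L = mm_fun F" and l0: "{|lax0 L|}' \<star>' N.u = app F u"
    and l2: "\<And>a b. a \<in> Obj C \<Longrightarrow> ob b \<Longrightarrow>
      {|lax2 L (a, b)|}' \<star>' N.\<theta> (fobj (mm_fun F) a) (fobj (mm_fun F) b) = app F (\<theta> a b)"
  shows "K_s_mor D D' M N F = L"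
proof -
  note H = K_mor_lax[OF F] and f2 = f2_props[OF F] and f0 = f0_props[OF F]
  interpret L: lax_monoidal_functor "K_s_obj D M" "K_s_obj D' N" L "lax_fun L" "\<lambda>a b. lax2 L (a, b)" by fact simp_all
  note o = mor_simps[OF F]
  have lf: "lax_fun (K_s_mor D D' M N F) = mm_fun F" by (simp add: K_s_mor_def Let_def)
  show ?thesis
  proof (rule lax_mor_eqI[OF H L])
    show "lax0 (K_s_mor D D' M N F) = lax0 L"
      by (rule N.arrow_eqI_u) (use f0 l0 L.lax0_arr l o in \<open>auto simp: hom_def\<close>)
    show "lax2 (K_s_mor D D' M N F) (a, b) = lax2 L (a, b)"
      if "a \<in> sobj (K_s_obj D M)" "b \<in> sobj (K_s_obj D M)" for a b
      by (rule N.arrow_eqI[of _ _ "fobj (mm_fun F) a" "fobj (mm_fun F) b"])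
        (use that f2[of a b] l2[of a b] L.lax2_arr[of a b] l o in \<open>auto simp: hom_def\<close>)
  qed (simp_all add: l lf)
qed

text \<open>The structure arrows determine \<open>F\<close> on \<open>\<theta>\<close> and \<open>u\<close>, and these generate all multimaps.\<close>

lemma K_mor_faithful:
  assumes F: "ssm_morphism M N F" and G: "ssm_morphism M N G" and eq: "K_s_mor D D' M N F = K_s_mor D D' M N G"
  shows "F = G"
proof (rule morphism_eqI[OF short_skew_multicategory_axioms F G])
  have "lax_fun (K_s_mor D D' M N F) = mm_fun F" "lax_fun (K_s_mor D D' M N G) = mm_fun G" by (simp_all add: K_s_mor_def Let_def)
  with eq show mfn: "mm_fun F = mm_fun G" by simp
  have t: "app F (\<theta> a b) = app G (\<theta> a b)" if "ob a" "ob b" for a b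
    using f2_props(2)[OF F that] f2_props(2)[OF G that] eq mfn by simp
  have u: "app F u = app G u" using f0_props(2)[OF F] f0_props(2)[OF G] eq by simp
  note c = app_comp_at[OF F] app_comp_at[OF G] app_unary[OF F] app_unary[OF G] composable_theta_u
  show "app F f = app G f" if "valid M f" for f
    using that by (induction rule: multimap_induct) (simp_all add: c mfn t u)
qed

end

lemma K_mor_id:
  assumes "representable M D" shows "K_s_mor D D M M (ssm_id M) = lax_id (K_s_obj D M)"
proof -
  interpret representable M D by fact
  interpret lr_pair M M D D ..
  note i = ssm_id[OF short_skew_multicategory_axioms]
  show ?thesis
  proof (rule K_mor_eqI[OF i(1) lax_id[OF K.skew_monoidal_category_axioms]])
    show "lax_fun (lax_id (K_s_obj D M)) = mm_fun (ssm_id M)" by (simp add: lax_id_def)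
  qed (simp_all add: lax_id_def i(2) idn_comp_at id_functor_apply)
qed

lemma K_mor_comp:
  assumes M: "representable M D" and N: "representable N D'" and L: "representable L D''"
    and F: "ssm_morphism M N F" and G: "ssm_morphism N L G"
  shows "K_s_mor D D'' M L (ssm_comp M G F) =
    lax_comp (K_s_obj D M) (K_s_obj D' N) (K_s_obj D'' L) (K_s_mor D' D'' N L G) (K_s_mor D D' M N F)"
proof -
  interpret M: representable M D by fact
  interpret N: representable N D' by fact
  interpret L: representable L D'' by fact
  interpret MN: lr_pair M N D D' ..
  interpret NL: lr_pair N L D' D'' ..
  interpret MU: lr_pair M L D D'' ..
  note m = M.short_skew_multicategory_axioms N.short_skew_multicategory_axioms L.short_skew_multicategory_axioms
  note c = ssm_comp[OF m F G]
  note lF = MN.K_mor_lax[OF F] and lG = NL.K_mor_lax[OF G]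
  have lfn: "lax_fun (K_s_mor D D' M N F) = mm_fun F" "lax_fun (K_s_mor D' D'' N L G) = mm_fun G"
    by (simp_all add: K_s_mor_def Let_def)
  note [simp] = MN.F_simps[OF F] NL.F_simps[OF G] MN.f2_arr[OF F] NL.f2_arr[OF G] MN.f0_arr[OF F] NL.f0_arr[OF G]
  show ?thesis
  proof (rule MU.K_mor_eqI[OF c(1) lax_comp[OF lF lG]])
    show "lax_fun (lax_comp (K_s_obj D M) (K_s_obj D' N) (K_s_obj D'' L) (K_s_mor D' D'' N L G) (K_s_mor D D' M N F)) =
        mm_fun (ssm_comp M G F)"
      by (simp add: lax_comp_def lfn)
    have "app G (comp_at N (unary N (lax0 (K_s_mor D D' M N F))) (Suc 0) N.u) = app (ssm_comp M G F) M.u"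
      by (simp add: MN.f0_props[OF F] c(2))
    then show "comp_at L (unary L (lax0 (lax_comp (K_s_obj D M) (K_s_obj D' N) (K_s_obj D'' L) (K_s_mor D' D'' N L G) (K_s_mor D D' M N F)))) (Suc 0) L.u =
        app (ssm_comp M G F) M.u"
      by (simp add: lax_comp_def lfn L.comp_push NL.f0_props[OF G] NL.app_comp_at[OF G])
    fix a b assume [simp]: "a \<in> Obj (mcat M)" "b \<in> Obj (mcat M)"
    let ?Fa = "fobj (mm_fun F) a" and ?Fb = "fobj (mm_fun F) b"
    have "app G (comp_at N (unary N (lax2 (K_s_mor D D' M N F) (a, b))) (Suc 0) (N.\<theta> ?Fa ?Fb)) = app (ssm_comp M G F) (M.\<theta> a b)"
      by (simp add: MN.f2_props[OF F] c(2))
    then show "comp_at L (unary L (lax2 (lax_comp (K_s_obj D M) (K_s_obj D' N) (K_s_obj D'' L) (K_s_mor D' D'' N L G) (K_s_mor D D' M N F)) (a, b))) (Suc 0)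
          (L.\<theta> (fobj (mm_fun (ssm_comp M G F)) a) (fobj (mm_fun (ssm_comp M G F)) b)) = app (ssm_comp M G F) (M.\<theta> a b)"
      by (simp add: lax_comp_def lfn comp_functor_apply L.comp_push NL.f2_props[OF G] NL.app_comp_at[OF G])
  qed
qed

lemma K_mor_braided:
  assumes M: "representable_braiding M D B" and N: "representable_braiding N D' B'"
    and F: "braided_morphism (M, B) (N, B') F"
  shows "braided_lax (K_s_obj D M, K_braid D M B) (K_s_obj D' N, K_braid D' N B') (K_s_mor D D' M N F)"
proof -
  interpret M: representable_braiding M D B by fact
  interpret N: representable_braiding N D' B' by fact
  interpret BP: braided_pair M B N B' ..
  interpret LP: lr_pair M N D D' ..
  note F' = BP.braided_morphismD[OF F]
  note [simp] = LP.F_simps[OF F'(1)] LP.f2_arr[OF F'(1)] LP.f0_arr[OF F'(1)]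
  note T = LP.f2_Theta[OF F'(1)]
  have lfn: "lax_fun (K_s_mor D D' M N F) = mm_fun F" by (simp add: K_s_mor_def Let_def)
  let ?f2 = "\<lambda>a b. lax2 (K_s_mor D D' M N F) (a, b)" and ?Fo = "fobj (mm_fun F)" and ?Fm = "fmap (mm_fun F)"
  have "Comp (mcat N) (?Fm (M.s x a b)) (Comp (mcat N) (?f2 (M.tensor x a) b) (N.tensor_arr (?f2 x a) (Idn (mcat N) (?Fo b)))) =
      Comp (mcat N) (?f2 (M.tensor x b) a) (Comp (mcat N) (N.tensor_arr (?f2 x b) (Idn (mcat N) (?Fo a))) (N.s (?Fo x) (?Fo a) (?Fo b)))"
    if [simp]: "x \<in> Obj (mcat M)" "a \<in> Obj (mcat M)" "b \<in> Obj (mcat M)" for x a b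
  proof (rule N.arrow_eqI_3'[of _ _ "?Fo x" "?Fo a" "?Fo b"])
    let ?l = "\<lambda>a b. Comp (mcat N) (?f2 (M.tensor x a) b) (N.tensor_arr (?f2 x a) (Idn (mcat N) (?Fo b)))"
    have vT: "valid M (M.\<Theta> x b a)" "src (M.\<Theta> x b a) = [x, b, a]" by simp_all
    have "comp_at N (unary N (Comp (mcat N) (?Fm (M.s x a b)) (?l a b))) (Suc 0) (N.\<Theta> (?Fo x) (?Fo a) (?Fo b)) =
        comp_at N (unary N (?Fm (M.s x a b))) (Suc 0) (comp_at N (unary N (?l a b)) (Suc 0) (N.\<Theta> (?Fo x) (?Fo a) (?Fo b)))"
      by (rule N.comp_push; simp)
    also have "\<dots> = app F (M.\<beta>\<^sub>3 (M.\<Theta> x b a))"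
      unfolding T[OF that] M.braid_theta[OF that, symmetric] by (simp add: BP.app_comp_at[OF F'(1)])
    also have "\<dots> = N.\<beta>\<^sub>3 (app F (M.\<Theta> x b a))" by (rule F'(2)[OF vT(1) _ vT(2)]) simp
    also have "\<dots> = N.\<beta>\<^sub>3 (comp_at N (unary N (?l b a)) (Suc 0) (N.\<Theta> (?Fo x) (?Fo b) (?Fo a)))"
      unfolding T[OF that(1,3,2)] ..
    also have "\<dots> = comp_at N (unary N (?l b a)) (Suc 0) (N.\<beta>\<^sub>3 (N.\<Theta> (?Fo x) (?Fo b) (?Fo a)))"
      by (rule N.beta_post(1)) simp_all
    also have "\<dots> = comp_at N (unary N (Comp (mcat N) (?l b a) (N.s (?Fo x) (?Fo a) (?Fo b)))) (Suc 0) (N.\<Theta> (?Fo x) (?Fo a) (?Fo b))"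
      by (simp add: N.comp_push N.braid_theta)
    also have "Comp (mcat N) (?l b a) (N.s (?Fo x) (?Fo a) (?Fo b)) =
        Comp (mcat N) (?f2 (M.tensor x b) a) (Comp (mcat N) (N.tensor_arr (?f2 x b) (Idn (mcat N) (?Fo a))) (N.s (?Fo x) (?Fo a) (?Fo b)))"
      using N.K.comp_assoc[of "N.s (?Fo x) (?Fo a) (?Fo b)" "N.tensor_arr (?f2 x b) (Idn (mcat N) (?Fo a))" "?f2 (M.tensor x b) a"] by simp
    finally show "comp_at N (unary N (Comp (mcat N) (?Fm (M.s x a b)) (?l a b))) (Suc 0) (N.\<Theta> (?Fo x) (?Fo a) (?Fo b)) =
        comp_at N (unary N (Comp (mcat N) (?f2 (M.tensor x b) a) (Comp (mcat N) (N.tensor_arr (?f2 x b) (Idn (mcat N) (?Fo a))) (N.s (?Fo x) (?Fo a) (?Fo b))))) (Suc 0)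
          (N.\<Theta> (?Fo x) (?Fo a) (?Fo b))" .
  qed simp_all
  then show ?thesis
    unfolding braided_lax_iff using LP.K_mor_lax[OF F'(1)] by (simp add: lfn)
qed

section \<open>Multimaps transported along a lax monoidal functor\<close>

locale lr_pair_lax = lr_pair M N D D'
  for M :: "('o, 'm) ssm" and N :: "('o, 'm) ssm" and D :: "('o, 'm) lr_data" and D' :: "('o, 'm) lr_data" +
  fixes L :: "('o, 'm) lax_mor"
  assumes lax: "lax_monoidal_functor (K_s_obj D M) (K_s_obj D' N) L"
begin

abbreviation Lo where "Lo \<equiv> fobj (lax_fun L)"
abbreviation Lm where "Lm \<equiv> fmap (lax_fun L)"
abbreviation L2 where "L2 a b \<equiv> lax2 L (a, b)"

lemma L_functor: "is_functor C N.C (lax_fun L)"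
proof -
  interpret L: lax_monoidal_functor "K_s_obj D M" "K_s_obj D' N" L "lax_fun L" "\<lambda>a b. lax2 L (a, b)" using lax by simp_all
  show ?thesis using L.functorial by simp
qed

lemmas L_simps [simp] = functor_simps[OF L_functor]

lemma L_comp [simp]:
  "ar p \<Longrightarrow> ar q \<Longrightarrow> Dom C q = Cod C p \<Longrightarrow> Lm (Comp C q p) = Comp N.C (Lm q) (Lm p)"
  using is_functorD(8)[OF L_functor, of p "Dom C p" "Cod C p" q "Cod C q"] by (simp add: hom_def)

lemma L_coherence:
  shows L0_arr [simp]: "lax0 L \<in> Arr N.C" "Dom N.C (lax0 L) = N.I" "Cod N.C (lax0 L) = Lo I"
    and L2_arr [simp]: "ob a \<Longrightarrow> ob b \<Longrightarrow> L2 a b \<in> Arr N.C"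
      "ob a \<Longrightarrow> ob b \<Longrightarrow> Dom N.C (L2 a b) = N.tensor (Lo a) (Lo b)"
      "ob a \<Longrightarrow> ob b \<Longrightarrow> Cod N.C (L2 a b) = Lo (a \<box> b)"
    and L2_nat: "ar f \<Longrightarrow> ar g \<Longrightarrow>
      Comp N.C (L2 (Cod C f) (Cod C g)) (N.tensor_arr (Lm f) (Lm g)) = Comp N.C (Lm (f \<Otimes> g)) (L2 (Dom C f) (Dom C g))"
    and L2_alpha: "ob a \<Longrightarrow> ob b \<Longrightarrow> ob c \<Longrightarrow>
      Comp N.C (Lm (\<alpha> a b c)) (Comp N.C (L2 (a \<box> b) c) (N.tensor_arr (L2 a b) (Idn N.C (Lo c)))) =
      Comp N.C (L2 a (b \<box> c)) (Comp N.C (N.tensor_arr (Idn N.C (Lo a)) (L2 b c)) (N.\<alpha> (Lo a) (Lo b) (Lo c)))"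
    and L2_lambda: "ob a \<Longrightarrow>
      Comp N.C (Lm (\<Lambda> a)) (Comp N.C (L2 I a) (N.tensor_arr (lax0 L) (Idn N.C (Lo a)))) = N.\<Lambda> (Lo a)"
    and L2_rho: "ob a \<Longrightarrow>
      Comp N.C (L2 a I) (Comp N.C (N.tensor_arr (Idn N.C (Lo a)) (lax0 L)) (N.\<rho> (Lo a))) = Lm (\<rho> a)"
proof goal_cases
  interpret L: lax_monoidal_functor "K_s_obj D M" "K_s_obj D' N" L "lax_fun L" "\<lambda>a b. lax2 L (a, b)" using lax by simp_all
  have a0: "lax0 L \<in> Arr N.C" "Dom N.C (lax0 L) = N.I" "Cod N.C (lax0 L) = Lo I" using L.lax0_arr by simp_all
  have a2: "L2 a b \<in> Arr N.C" "Dom N.C (L2 a b) = N.tensor (Lo a) (Lo b)" "Cod N.C (L2 a b) = Lo (a \<box> b)"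
    if "ob a" "ob b" for a b using L.lax2_arr[of a b] that by simp_all
  { case 1 then show ?case by (rule a0) }
  { case 2 then show ?case by (rule a0) }
  { case 3 then show ?case by (rule a0) }
  { case 4 then show ?case by (rule a2) }
  { case 5 then show ?case by (rule a2) }
  { case 6 then show ?case by (rule a2) }
  { case 7 then show ?case using L.lax2_natural[of f g "Cod C f" "Cod C g"] by simp }
  { case 8 then show ?case using L.lax_coherence(1)[of a b c] a2 by simp }
  { case 9 then show ?case using L.lax_coherence(2)[of a] a0 by simp }
  { case 10 then show ?case using L.lax_coherence(3)[of a] a0 by simp }
qed

text \<open>The images of the universal multimaps.\<close>

definition \<phi> where "\<phi> a b = {|L2 a b|}' \<star>' N.\<theta> (Lo a) (Lo b)"
definition \<phi>0 where "\<phi>0 = {|lax0 L|}' \<star>' N.u"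

lemma phi_sel [simp]:
  assumes "ob a" "ob b"
  shows "valid N (\<phi> a b)" "knd (\<phi> a b) = Tight" "src (\<phi> a b) = [Lo a, Lo b]" "tgt (\<phi> a b) = Lo (a \<box> b)"
  using assms by (simp_all add: \<phi>_def)

lemma phi0_sel [simp]: "valid N \<phi>0" "knd \<phi>0 = Loose" "src \<phi>0 = []" "tgt \<phi>0 = Lo I"
  by (simp_all add: \<phi>0_def)

lemma phi_nat:
  assumes [simp]: "ar f" "ar g"
  shows "{|Lm (f \<Otimes> g)|}' \<star>' \<phi> (Dom C f) (Dom C g) = \<phi> (Cod C f) (Cod C g) \<star>' {|Lm f|}' \<star>'\<^sub>2 {|Lm g|}'"
proof -
  let ?t = "N.\<theta> (Lo (Cod C f)) (Lo (Cod C g))"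
  have "{|Lm (f \<Otimes> g)|}' \<star>' \<phi> (Dom C f) (Dom C g) =
      {|Comp N.C (L2 (Cod C f) (Cod C g)) (N.tensor_arr (Lm f) (Lm g))|}' \<star>' N.\<theta> (Lo (Dom C f)) (Lo (Dom C g))"
    unfolding L2_nat[OF assms] \<phi>_def by (rule N.comp_push[symmetric]; simp)
  also have "\<dots> = {|L2 (Cod C f) (Cod C g)|}' \<star>' (?t \<star>' {|Lm f|}' \<star>'\<^sub>2 {|Lm g|}')"
    by (simp add: N.comp_push N.tensor_theta)
  also have "\<dots> = {|L2 (Cod C f) (Cod C g)|}' \<star>' (?t \<star>' {|Lm f|}') \<star>'\<^sub>2 {|Lm g|}'" by (rule N.unary_push; simp)
  also have "{|L2 (Cod C f) (Cod C g)|}' \<star>' (?t \<star>' {|Lm f|}') = \<phi> (Cod C f) (Cod C g) \<star>' {|Lm f|}'"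
    unfolding \<phi>_def by (rule N.unary_push; simp)
  finally show ?thesis .
qed

lemma phi_nat_left:
  "ar p \<Longrightarrow> ob c \<Longrightarrow> {|Lm (p \<Otimes> Idn C c)|}' \<star>' \<phi> (Dom C p) c = \<phi> (Cod C p) c \<star>' {|Lm p|}'"
  using phi_nat[of p "Idn C c"] by (simp add: N.comp_at_idn)

lemma phi_nat_right:
  "ar p \<Longrightarrow> ob c \<Longrightarrow> {|Lm (Idn C c \<Otimes> p)|}' \<star>' \<phi> c (Dom C p) = \<phi> c (Cod C p) \<star>'\<^sub>2 {|Lm p|}'"
  using phi_nat[of "Idn C c" p] by (simp add: N.comp_at_idn)

lemma phi_phi:
  assumes [simp]: "ob a" "ob b" "ob c"
  shows "\<phi> (a \<box> b) c \<star>' \<phi> a b = {|Comp N.C (L2 (a \<box> b) c) (N.tensor_arr (L2 a b) (Idn N.C (Lo c)))|}' \<star>'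
      (N.\<theta> (N.tensor (Lo a) (Lo b)) (Lo c) \<star>' N.\<theta> (Lo a) (Lo b))"
    and "\<phi> a (b \<box> c) \<star>'\<^sub>2 \<phi> b c = {|Comp N.C (L2 a (b \<box> c)) (N.tensor_arr (Idn N.C (Lo a)) (L2 b c))|}' \<star>'
      (N.\<theta> (Lo a) (N.tensor (Lo b) (Lo c)) \<star>'\<^sub>2 N.\<theta> (Lo b) (Lo c))"
  using N.compose_left[of "L2 a b" "Lo a" "Lo b" "L2 (a \<box> b) c" "Lo c"]
    N.compose_right[of "L2 b c" "Lo b" "Lo c" "L2 a (b \<box> c)" "Lo a"] by (simp_all add: \<phi>_def)

lemma phi_alpha:
  assumes [simp]: "ob a" "ob b" "ob c"
  shows "{|Lm (\<alpha> a b c)|}' \<star>' (\<phi> (a \<box> b) c \<star>' \<phi> a b) = \<phi> a (b \<box> c) \<star>'\<^sub>2 \<phi> b c"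
proof -
  let ?X = "N.\<theta> (N.tensor (Lo a) (Lo b)) (Lo c) \<star>' N.\<theta> (Lo a) (Lo b)"
  let ?p = "L2 a (b \<box> c)" and ?q = "N.tensor_arr (Idn N.C (Lo a)) (L2 b c)" and ?r = "N.\<alpha> (Lo a) (Lo b) (Lo c)"
  have "{|Lm (\<alpha> a b c)|}' \<star>' (\<phi> (a \<box> b) c \<star>' \<phi> a b) = {|Comp N.C ?p (Comp N.C ?q ?r)|}' \<star>' ?X"
    unfolding phi_phi(1)[OF assms] L2_alpha[OF assms, symmetric] by (rule N.comp_push[symmetric]; simp)
  also have "Comp N.C ?p (Comp N.C ?q ?r) = Comp N.C (Comp N.C ?p ?q) ?r"
    using N.K.comp_assoc[of ?r ?q ?p] by simp
  also have "{|Comp N.C (Comp N.C ?p ?q) ?r|}' \<star>' ?X = {|Comp N.C ?p ?q|}' \<star>' ({|?r|}' \<star>' ?X)"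
    by (rule N.comp_push; simp)
  finally show ?thesis by (simp add: phi_phi(2) N.alpha_theta)
qed

lemma phi_lambda:
  assumes [simp]: "ob a"
  shows "{|Lm (\<Lambda> a)|}' \<star>' \<phi> I a \<star>' \<phi>0 = jmap N {|Idn N.C (Lo a)|}'"
proof -
  let ?t = "N.\<theta> N.I (Lo a)"
  have "{|Lm (\<Lambda> a)|}' \<star>' \<phi> I a \<star>' \<phi>0 = {|Lm (\<Lambda> a)|}' \<star>' \<phi> I a \<star>' {|lax0 L|}' \<star>' N.u"
    unfolding \<phi>0_def by (rule N.assoc; simp)
  also have "{|Lm (\<Lambda> a)|}' \<star>' \<phi> I a \<star>' {|lax0 L|}' = {|Lm (\<Lambda> a)|}' \<star>' (\<phi> I a \<star>' {|lax0 L|}')"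
    by (rule N.unary_push[symmetric]; simp)
  also have "\<phi> I a \<star>' {|lax0 L|}' = {|L2 I a|}' \<star>' (N.\<theta> (Lo I) (Lo a) \<star>' {|lax0 L|}')"
    unfolding \<phi>_def by (rule N.unary_push[symmetric]; simp)
  also have "{|Lm (\<Lambda> a)|}' \<star>' ({|L2 I a|}' \<star>' (N.\<theta> (Lo I) (Lo a) \<star>' {|lax0 L|}')) =
      {|Comp N.C (Lm (\<Lambda> a)) (Comp N.C (L2 I a) (N.tensor_arr (lax0 L) (Idn N.C (Lo a))))|}' \<star>' ?t"
    by (simp add: N.comp_push N.tensor_theta N.comp_at_idn)
  finally show ?thesis by (simp add: L2_lambda N.lambda_props)
qed

lemma phi_rho:
  assumes [simp]: "ob a"
  shows "\<phi> a I \<star>'\<^sub>2 \<phi>0 = {|Lm (\<rho> a)|}'"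
proof -
  have "\<phi> a I \<star>'\<^sub>2 \<phi>0 = {|L2 a I|}' \<star>' (N.\<theta> (Lo a) (Lo I) \<star>'\<^sub>2 \<phi>0)"
    unfolding \<phi>_def by (rule N.unary_push[symmetric]; simp)
  also have "\<dots> = {|L2 a I|}' \<star>' ({|N.tensor_arr (Idn N.C (Lo a)) (lax0 L)|}' \<star>' (N.\<theta> (Lo a) N.I \<star>'\<^sub>2 N.u))"
    using N.whisker_right[of "lax0 L" "Lo a" N.u] by (simp add: \<phi>0_def numeral_2_eq_2)
  also have "\<dots> = {|Comp N.C (L2 a I) (Comp N.C (N.tensor_arr (Idn N.C (Lo a)) (lax0 L)) (N.\<rho> (Lo a)))|}'"
    by (simp add: N.unary_comp_arrow N.rho_unary)
  finally show ?thesis by (simp add: L2_rho)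
qed

text \<open>Every multimap is an arrow composed with copies of \<open>\<theta>\<close>, and with \<open>u\<close> if it is loose. Its image
  \<open>\<Phi>\<close> replaces them by \<open>\<phi>\<close> and \<open>\<phi>0\<close>.\<close>

definition fac where
  "fac f = (SOME g. valid M g \<and> knd g = Tight \<and> src g = (hd (src f) \<box> hd (tl (src f))) # tl (tl (src f)) \<and>
     tgt g = tgt f \<and> g \<star> \<theta> (hd (src f)) (hd (tl (src f))) = f)"

definition facu where
  "facu f = (SOME g. valid M g \<and> knd g = Tight \<and> src g = I # src f \<and> tgt g = tgt f \<and> g \<star> u = f)"

primrec \<Phi>\<^sub>t where
  "\<Phi>\<^sub>t 0 f = {|Lm (elt f)|}'"
| "\<Phi>\<^sub>t (Suc n) f = \<Phi>\<^sub>t n (fac f) \<star>' \<phi> (hd (src f)) (hd (tl (src f)))"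

definition \<Phi> where
  "\<Phi> f = (if knd f = Tight then \<Phi>\<^sub>t (length (src f) - 1) f else \<Phi>\<^sub>t (length (src f)) (facu f) \<star>' \<phi>0)"

lemma Phi_unary [simp]: "ar p \<Longrightarrow> \<Phi> {|p|} = {|Lm p|}'"
  by (simp add: \<Phi>_def)

lemma fac_theta:
  assumes g: "valid M g" "knd g = Tight" "src g = a \<box> b # xs" and ab: "ob a" "ob b" and xs: "length xs \<le> 2"
    and f: "g \<star> \<theta> a b = f"
  shows "fac f = g"
proof -
  have s: "src f = a # b # xs" "tgt f = tgt g" using g(3) f by auto
  have "fac f = (SOME g'. valid M g' \<and> knd g' = Tight \<and> src g' = a \<box> b # xs \<and> tgt g' = tgt f \<and> g' \<star> \<theta> a b = f)"
    by (simp add: fac_def s)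
  also have "\<dots> = g"
  proof (rule some_equality)
    show "valid M g \<and> knd g = Tight \<and> src g = a \<box> b # xs \<and> tgt g = tgt f \<and> g \<star> \<theta> a b = f" using g f s by simp
    show "g' = g" if "valid M g' \<and> knd g' = Tight \<and> src g' = a \<box> b # xs \<and> tgt g' = tgt f \<and> g' \<star> \<theta> a b = f" for g'
      by (rule theta_inj[of _ a b xs]) (use that g f s ab xs in simp_all)
  qed
  finally show ?thesis .
qed

lemma Phi_theta:
  assumes g: "valid M g" "knd g = Tight" "src g = a \<box> b # xs" and ab: "ob a" "ob b" and xs: "length xs \<le> 2"
  shows "\<Phi> (g \<star> \<theta> a b) = \<Phi> g \<star>' \<phi> a b"
  using g fac_theta[OF assms refl] by (simp add: \<Phi>_def)

lemma Phi_u: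
  assumes g: "valid M g" "knd g = Tight" "src g = I # xs" and xs: "length xs \<le> 2"
  shows "\<Phi> (g \<star> u) = \<Phi> g \<star>' \<phi>0"
proof -
  have "facu (g \<star> u) = (SOME g'. valid M g' \<and> knd g' = Tight \<and> src g' = I # xs \<and> tgt g' = tgt g \<and> g' \<star> u = g \<star> u)"
    using g(3) by (simp add: facu_def)
  also have "\<dots> = g"
  proof (rule some_equality)
    show "valid M g \<and> knd g = Tight \<and> src g = I # xs \<and> tgt g = tgt g \<and> g \<star> u = g \<star> u" using g by simp
    show "g' = g" if "valid M g' \<and> knd g' = Tight \<and> src g' = I # xs \<and> tgt g' = tgt g \<and> g' \<star> u = g \<star> u" for g'
      by (rule u_inj[of _ xs]) (use that g xs in simp_all)
  qed
  finally show ?thesis using g by (simp add: \<Phi>_def)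
qed

lemma Phi_sel:
  assumes "valid M f"
  shows "valid N (\<Phi> f) \<and> knd (\<Phi> f) = knd f \<and> src (\<Phi> f) = map Lo (src f) \<and> tgt (\<Phi> f) = Lo (tgt f)"
  using assms
proof (induction rule: multimap_induct)
  case (theta a b xs g)
  then show ?case using composable_theta_u(1)[of xs] by (simp add: Phi_theta)
next
  case (u xs g)
  then show ?case using composable_theta_u(2)[of xs] by (simp add: Phi_u)
qed simp

lemma Phi_sel' [simp]:
  assumes "valid M f"
  shows "valid N (\<Phi> f)" "knd (\<Phi> f) = knd f" "src (\<Phi> f) = map Lo (src f)" "tgt (\<Phi> f) = Lo (tgt f)"
  using Phi_sel[OF assms] by auto

lemma Phi_basic [simp]: "ob a \<Longrightarrow> ob b \<Longrightarrow> \<Phi> (\<theta> a b) = \<phi> a b" "\<Phi> u = \<phi>0"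
proof -
  assume [simp]: "ob a" "ob b"
  have "\<Phi> ({|Idn C (a \<box> b)|} \<star> \<theta> a b) = {|Lm (Idn C (a \<box> b))|}' \<star>' \<phi> a b"
    using Phi_theta[of "{|Idn C (a \<box> b)|}" a b "[]"] by simp
  then show "\<Phi> (\<theta> a b) = \<phi> a b" by (simp add: idn_comp_at N.idn_comp_at)
next
  have "\<Phi> ({|Idn C I|} \<star> u) = {|Lm (Idn C I)|}' \<star>' \<phi>0"
    using Phi_u[of "{|Idn C I|}" "[]"] by simp
  then show "\<Phi> u = \<phi>0" by (simp add: idn_comp_at N.idn_comp_at)
qed

lemma Phi_post:
  assumes "valid M f" "ar q" "Dom C q = tgt f"
  shows "\<Phi> ({|q|} \<star> f) = {|Lm q|}' \<star>' \<Phi> f"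
  using assms
proof (induction rule: multimap_induct)
  case (unary p)
  then show ?case by (simp flip: unary_comp_arrow N.unary_comp_arrow)
next
  case (theta a b xs g)
  note [simp] = theta composable_theta_u(1)[OF theta(3)] kind_Cons_le[OF theta(3)]
  have "{|q|} \<star> (g \<star> \<theta> a b) = {|q|} \<star> g \<star> \<theta> a b" by (rule unary_push; simp)
  then have "\<Phi> ({|q|} \<star> (g \<star> \<theta> a b)) = {|Lm q|}' \<star>' \<Phi> g \<star>' \<phi> a b"
    using Phi_theta[of "{|q|} \<star> g" a b xs] by simp
  also have "\<dots> = {|Lm q|}' \<star>' (\<Phi> g \<star>' \<phi> a b)" by (rule N.unary_push[symmetric]; simp)
  finally show ?case using Phi_theta[of g a b xs] by simp
next
  case (u xs g)
  note [simp] = u composable_theta_u(2)[OF u(1)] kind_Cons_le[OF u(1)]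
  have "{|q|} \<star> (g \<star> local.u) = {|q|} \<star> g \<star> local.u" by (rule unary_push; simp)
  then have "\<Phi> ({|q|} \<star> (g \<star> local.u)) = {|Lm q|}' \<star>' \<Phi> g \<star>' \<phi>0"
    using Phi_u[of "{|q|} \<star> g" xs] by simp
  also have "\<dots> = {|Lm q|}' \<star>' (\<Phi> g \<star>' \<phi>0)" by (rule N.unary_push[symmetric]; simp)
  finally show ?case using Phi_u[of g xs] by simp
qed

lemma Phi_pre:
  assumes "valid M f" "ar p" "Suc 0 \<le> i" "i \<le> length (src f)" "Cod C p = src f ! (i - Suc 0)"
  shows "\<Phi> (f \<star>\<^bsub>i\<^esub> {|p|}) = \<Phi> f \<star>'\<^bsub>i\<^esub> {|Lm p|}'"
  using assms
proof (induction arbitrary: i p rule: multimap_induct)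
  case (unary q)
  then have "i = Suc 0" by simp
  then show ?case using unary by (simp flip: unary_comp_arrow N.unary_comp_arrow)
next
  case (theta a b xs g)
  note [simp] = theta(1-6,8) composable_theta_u(1)[OF theta(3)] kind_Cons_le[OF theta(3)]
  note Pg = Phi_theta[of g a b xs]
  consider (1) "i = Suc 0" "Cod C p = a" | (2) "i = 2" "Cod C p = b"
    | (3) k where "i = Suc (Suc (Suc k))" "k < length xs" "Cod C p = xs ! k"
  proof -
    obtain i' where i': "i = Suc i'" using theta.prems(2) by (cases i) auto
    show ?thesis
    proof (cases i')
      case 0 then show ?thesis using that(1) theta.prems i' by simp
    next
      case (Suc k)
      then show ?thesis using that(2,3) theta.prems i' by (cases k) auto
    qed
  qed
  then show ?case
  proof cases
    case 1
    note [simp] = 1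
    have ih: "\<Phi> (g \<star> {|p \<Otimes> Idn C b|}) = \<Phi> g \<star>' {|Lm (p \<Otimes> Idn C b)|}'" by (rule theta.IH) simp_all
    have "g \<star> \<theta> a b \<star> {|p|} = g \<star> (\<theta> a b \<star> {|p|})" by (rule assoc[symmetric]; simp)
    also have "\<theta> a b \<star> {|p|} = {|p \<Otimes> Idn C b|} \<star> \<theta> (Dom C p) b" by (simp add: tensor_theta comp_at_idn)
    also have "g \<star> ({|p \<Otimes> Idn C b|} \<star> \<theta> (Dom C p) b) = g \<star> {|p \<Otimes> Idn C b|} \<star> \<theta> (Dom C p) b"
      by (rule assoc; simp)
    finally have "\<Phi> (g \<star> \<theta> a b \<star> {|p|}) = \<Phi> g \<star>' {|Lm (p \<Otimes> Idn C b)|}' \<star>' \<phi> (Dom C p) b"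
      using Phi_theta[of "g \<star> {|p \<Otimes> Idn C b|}" "Dom C p" b xs] ih by simp
    also have "\<dots> = \<Phi> g \<star>' ({|Lm (p \<Otimes> Idn C b)|}' \<star>' \<phi> (Dom C p) b)" by (rule N.assoc[symmetric]; simp)
    also have "\<dots> = \<Phi> g \<star>' (\<phi> a b \<star>' {|Lm p|}')" by (simp add: phi_nat_left)
    also have "\<dots> = \<Phi> g \<star>' \<phi> a b \<star>' {|Lm p|}'" by (rule N.assoc; simp)
    finally show ?thesis using Pg by simp
  next
    case 2
    note [simp] = 2
    have ih: "\<Phi> (g \<star> {|Idn C a \<Otimes> p|}) = \<Phi> g \<star>' {|Lm (Idn C a \<Otimes> p)|}'" by (rule theta.IH) simp_all
    have "g \<star> \<theta> a b \<star>\<^sub>2 {|p|} = g \<star> (\<theta> a b \<star>\<^sub>2 {|p|})" by (rule assoc[symmetric]; simp)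
    also have "\<theta> a b \<star>\<^sub>2 {|p|} = {|Idn C a \<Otimes> p|} \<star> \<theta> a (Dom C p)" by (simp add: tensor_theta comp_at_idn)
    also have "g \<star> ({|Idn C a \<Otimes> p|} \<star> \<theta> a (Dom C p)) = g \<star> {|Idn C a \<Otimes> p|} \<star> \<theta> a (Dom C p)"
      by (rule assoc; simp)
    finally have "\<Phi> (g \<star> \<theta> a b \<star>\<^sub>2 {|p|}) = \<Phi> g \<star>' {|Lm (Idn C a \<Otimes> p)|}' \<star>' \<phi> a (Dom C p)"
      using Phi_theta[of "g \<star> {|Idn C a \<Otimes> p|}" a "Dom C p" xs] ih by simp
    also have "\<dots> = \<Phi> g \<star>' ({|Lm (Idn C a \<Otimes> p)|}' \<star>' \<phi> a (Dom C p))" by (rule N.assoc[symmetric]; simp)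
    also have "\<dots> = \<Phi> g \<star>' (\<phi> a b \<star>'\<^sub>2 {|Lm p|}')" by (simp add: phi_nat_right)
    also have "\<dots> = \<Phi> g \<star>' \<phi> a b \<star>'\<^sub>2 {|Lm p|}'" by (rule N.assoc; simp)
    finally show ?thesis using Pg by simp
  next
    case (3 k)
    note [simp] = 3 Suc_le_eq
    have ih: "\<Phi> (g \<star>\<^bsub>Suc (Suc k)\<^esub> {|p|}) = \<Phi> g \<star>'\<^bsub>Suc (Suc k)\<^esub> {|Lm p|}'" by (rule theta.IH) simp_all
    have s: "src (g \<star>\<^bsub>Suc (Suc k)\<^esub> {|p|}) = a \<box> b # xs[k := Dom C p]" by simp
    have "g \<star> \<theta> a b \<star>\<^bsub>i\<^esub> {|p|} = g \<star>\<^bsub>Suc (Suc k)\<^esub> {|p|} \<star> \<theta> a b" by (rule parallel; simp)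
    then have "\<Phi> (g \<star> \<theta> a b \<star>\<^bsub>i\<^esub> {|p|}) = \<Phi> g \<star>'\<^bsub>Suc (Suc k)\<^esub> {|Lm p|}' \<star>' \<phi> a b"
      using Phi_theta[of "g \<star>\<^bsub>Suc (Suc k)\<^esub> {|p|}" a b "xs[k := Dom C p]"] s ih by simp
    also have "\<dots> = \<Phi> g \<star>' \<phi> a b \<star>'\<^bsub>i\<^esub> {|Lm p|}'" by (rule N.parallel[symmetric]; simp)
    finally show ?thesis using Pg by simp
  qed
next
  case (u xs g)
  note [simp] = Suc_le_eq u(1-4,6) composable_theta_u(2)[OF u(1)] kind_Cons_le[OF u(1)]
  obtain k where [simp]: "i = Suc k" using u.prems(2) by (cases i) auto
  have k [simp]: "k < length xs" "Cod C p = xs ! k" using u.prems by simp_all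
  have ih: "\<Phi> (g \<star>\<^bsub>Suc (Suc k)\<^esub> {|p|}) = \<Phi> g \<star>'\<^bsub>Suc (Suc k)\<^esub> {|Lm p|}'" by (rule u.IH) simp_all
  have s: "src (g \<star>\<^bsub>Suc (Suc k)\<^esub> {|p|}) = I # xs[k := Dom C p]" by simp
  have "g \<star> local.u \<star>\<^bsub>i\<^esub> {|p|} = g \<star>\<^bsub>Suc (Suc k)\<^esub> {|p|} \<star> local.u" by (rule parallel; simp)
  then have "\<Phi> (g \<star> local.u \<star>\<^bsub>i\<^esub> {|p|}) = \<Phi> g \<star>'\<^bsub>Suc (Suc k)\<^esub> {|Lm p|}' \<star>' \<phi>0"
    using Phi_u[of "g \<star>\<^bsub>Suc (Suc k)\<^esub> {|p|}" "xs[k := Dom C p]"] s ih by simp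
  also have "\<dots> = \<Phi> g \<star>' \<phi>0 \<star>'\<^bsub>i\<^esub> {|Lm p|}'" by (rule N.parallel[symmetric]; simp)
  finally show ?case using Phi_u[of g xs] by simp
qed

end

context lr_pair_lax
begin

text \<open>It remains to see that \<open>\<Phi>\<close> preserves the substitutions of non-unary multimaps. Associativity
  reduces each of them to one of \<open>\<theta> \<star>\<^sub>2 \<theta>\<close> and \<open>\<theta> \<star>\<^sub>2 u\<close>, which are governed by
  \<open>\<alpha>\<close> and \<open>\<rho>\<close>.\<close>

definition preserves where
  "preserves i g f \<longleftrightarrow> \<Phi> (g \<star>\<^bsub>i\<^esub> f) = \<Phi> g \<star>'\<^bsub>i\<^esub> \<Phi> f"

text \<open>Since \<open>g \<star>\<^bsub>i\<^esub> (f \<star>\<^bsub>j\<^esub> h) = (g \<star>\<^bsub>i\<^esub> f) \<star>\<^bsub>k\<^esub> h\<close> holds on both sides, preservation passes between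
  the two bracketings.\<close>

lemma preserves_nested:
  assumes v: "valid M g" "valid M f" "valid M h"
    and t: "assoc_types (knd g, length (src g)) (knd f, length (src f)) (knd h, length (src h))"
      "composable (knd g, length (src g)) (knd f, length (src f))"
      "composable (knd f, length (src f)) (knd h, length (src h))"
    and i: "Suc 0 \<le> i" "i \<le> length (src g)" "tgt f = src g ! (i - Suc 0)"
    and j: "Suc 0 \<le> j" "j \<le> length (src f)" "tgt h = src f ! (j - Suc 0)" "k = j + i - Suc 0"
    and gf: "preserves i g f"
  shows "preserves i g (f \<star>\<^bsub>j\<^esub> h) \<and> preserves j f h \<longleftrightarrow> preserves k (g \<star>\<^bsub>i\<^esub> f) h \<and> preserves j f h"
proof -
  have "g \<star>\<^bsub>i\<^esub> (f \<star>\<^bsub>j\<^esub> h) = g \<star>\<^bsub>i\<^esub> f \<star>\<^bsub>k\<^esub> h" by (rule assoc[OF v t(1) i j])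
  moreover have "\<Phi> g \<star>'\<^bsub>i\<^esub> (\<Phi> f \<star>'\<^bsub>j\<^esub> \<Phi> h) = \<Phi> g \<star>'\<^bsub>i\<^esub> \<Phi> f \<star>'\<^bsub>k\<^esub> \<Phi> h"
    by (rule N.assoc) (use v t i j in simp_all)
  ultimately show ?thesis using gf by (auto simp: preserves_def)
qed

lemma preserves_unary:
  assumes "valid M f" "ar p"
  shows "Dom C p = tgt f \<Longrightarrow> preserves (Suc 0) {|p|} f"
    and "Suc 0 \<le> i \<Longrightarrow> i \<le> length (src f) \<Longrightarrow> Cod C p = src f ! (i - Suc 0) \<Longrightarrow> preserves i f {|p|}"
  using Phi_post[OF assms] Phi_pre[OF assms] assms by (simp_all add: preserves_def)

lemma preserves_theta:
  assumes "valid M g" "knd g = Tight" "src g = a \<box> b # xs" "ob a" "ob b" "length xs \<le> 2"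
  shows "preserves (Suc 0) g (\<theta> a b)"
  using Phi_theta[OF assms] assms by (simp add: preserves_def)

text \<open>The universal multimaps are treated uniformly: a map of the type of \<open>\<theta>\<close> or \<open>u\<close> is one of
  them followed by an arrow, and a ternary or loose unary map is one of them followed by a tight binary
  map.\<close>

definition basic where
  "basic e \<longleftrightarrow> e = u \<or> (\<exists>a b. ob a \<and> ob b \<and> e = \<theta> a b)"

definition small where
  "small f \<longleftrightarrow> knd f = Tight \<and> length (src f) = Suc (Suc 0) \<or> knd f = Loose \<and> src f = []"

lemma basicD: "basic e \<Longrightarrow> valid M e" "basic e \<Longrightarrow> small e"
  by (auto simp: basic_def small_def)

lemma small_types:
  assumes "small f"
  shows "composable (Tight, Suc (Suc 0)) (knd f, length (src f))" "length (src f) \<le> 2"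
    "assoc_types (Tight, Suc (Suc 0)) (Tight, Suc (Suc 0)) (knd f, length (src f))"
    "length xs \<le> 2 \<Longrightarrow> composable (Tight, Suc (length xs)) (knd f, length (src f))"
  using assms composable_theta_u[of xs] by (auto simp: small_def)

lemma preserves_basic:
  assumes e: "basic e" and g: "valid M g" "knd g = Tight" "src g = tgt e # xs" "length xs \<le> 2"
  shows "preserves (Suc 0) g e"
proof -
  consider "e = u" | a b where "ob a" "ob b" "e = \<theta> a b" using e unfolding basic_def by blast
  then show ?thesis
    by cases (use Phi_u[of g xs] preserves_theta[of g] g in \<open>simp_all add: preserves_def\<close>)
qed

text \<open>Here the coherence of \<open>L\<close> with \<open>\<alpha>\<close> and \<open>\<rho>\<close> is used.\<close>

lemma preserves_theta_basic:
  assumes e: "basic e" and [simp]: "ob a"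
  shows "preserves 2 (\<theta> a (tgt e)) e"
proof -
  have "preserves 2 (\<theta> a I) u" using rho_unary(1)[of a] by (simp add: preserves_def phi_rho flip: rho_unary(1))
  moreover have "preserves 2 (\<theta> a (b \<box> c)) (\<theta> b c)" if [simp]: "ob b" "ob c" for b c
  proof -
    have "\<Phi> (\<theta> (a \<box> b) c \<star> \<theta> a b) = \<phi> (a \<box> b) c \<star>' \<phi> a b"
      using Phi_theta[of "\<theta> (a \<box> b) c" a b "[c]"] by simp
    then have "\<Phi> ({|\<alpha> a b c|} \<star> (\<theta> (a \<box> b) c \<star> \<theta> a b)) = \<phi> a (b \<box> c) \<star>'\<^sub>2 \<phi> b c"
      by (simp add: Phi_post phi_alpha)
    then show ?thesis by (simp add: preserves_def alpha_theta)
  qed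
  ultimately show ?thesis using e by (auto simp: basic_def)
qed

lemma small_cases:
  assumes "valid M f" "small f"
  obtains q e where "basic e" "ar q" "Dom C q = tgt e" "Cod C q = tgt f" "f = {|q|} \<star> e" "knd e = knd f" "src e = src f"
proof (cases "knd f")
  case Loose
  then have s: "src f = []" using assms by (simp add: small_def)
  obtain q where "q \<in> hom C I (tgt f)" "{|q|} \<star> u = f" using arrow_ex_u[OF assms(1) Loose s] by blast
  then show ?thesis using Loose s by (intro that[of u q]) (auto simp: hom_def basic_def)
next
  case Tight
  then obtain a b where s: "src f = [a, b]" using assms by (auto simp: small_def length_Suc_conv)
  obtain q where "q \<in> hom C (a \<box> b) (tgt f)" "{|q|} \<star> \<theta> a b = f" using arrow_ex[OF assms(1) Tight s] by blast
  moreover have "ob a" "ob b" using validD(2)[OF assms(1)] s by auto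
  ultimately show ?thesis using Tight s by (intro that[of "\<theta> a b" q]) (auto simp: hom_def basic_def)
qed

lemma ternary_loose_cases:
  assumes "valid M f" "knd f = Tight \<and> length (src f) = 3 \<or> knd f = Loose \<and> length (src f) = 1"
  obtains h e a where "basic e" "valid M h" "knd h = Tight" "src h = [tgt e, a]" "tgt h = tgt f" "f = h \<star> e" "ob a"
    "knd e = knd f" "src f = src e @ [a]"
  using assms(2)
proof
  assume l: "knd f = Loose \<and> length (src f) = 1"
  then obtain a where s: "src f = [a]" by (auto simp: length_Suc_conv)
  obtain h where "valid M h" "knd h = Tight" "src h = [I, a]" "tgt h = tgt f" "h \<star> u = f" using u_surj[of f] assms(1) l s by auto
  moreover have "ob a" using validD(2)[OF assms(1)] s by simp
  ultimately show ?thesis using l s by (intro that[of u h a]) (simp_all add: basic_def)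
next
  assume t: "knd f = Tight \<and> length (src f) = 3"
  then obtain a b c where s: "src f = [a, b, c]" by (auto simp: numeral_3_eq_3 length_Suc_conv)
  obtain h where "valid M h" "knd h = Tight" "src h = [a \<box> b, c]" "tgt h = tgt f" "h \<star> \<theta> a b = f"
    using theta_surj[of f a b "[c]"] assms(1) t s by auto
  moreover have "ob a" "ob b" "ob c" using validD(2)[OF assms(1)] s by simp_all
  ultimately show ?thesis using t s by (intro that[of "\<theta> a b" h c]) (auto simp: basic_def)
qed

lemma preserves_first:
  assumes g: "valid M g" "knd g = Tight" "src g = b # xs" "length xs = 1 \<or> length xs = 2"
    and f: "valid M f" "small f" "tgt f = b"
  shows "preserves (Suc 0) g f"
proof -
  obtain q e where e: "basic e" and q [simp]: "ar q" "Dom C q = tgt e" "Cod C q = tgt f" and fq: "f = {|q|} \<star> e"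
    using small_cases[OF f(1,2)] .
  have xs: "length xs \<le> 2" using g(4) by auto
  note [simp] = g(1-3) f(1,3) basicD(1)[OF e] validD(1)[OF basicD(1)[OF e]] small_types[OF basicD(2)[OF e]] kind_Cons_le[OF xs] xs
  have "preserves (Suc 0) g ({|q|} \<star> e) \<and> preserves (Suc 0) {|q|} e \<longleftrightarrow>
      preserves (Suc 0) (g \<star> {|q|}) e \<and> preserves (Suc 0) {|q|} e"
    by (rule preserves_nested) (simp_all add: preserves_unary)
  moreover have "preserves (Suc 0) (g \<star> {|q|}) e" by (rule preserves_basic[OF e, of _ xs]) simp_all
  ultimately show ?thesis by (simp add: fq preserves_unary)
qed

text \<open>Writing \<open>f = q e\<close> with \<open>e\<close> universal and \<open>g \<star>\<^sub>2 q = p \<theta>\<close>, the map \<open>g \<star>\<^sub>2 f\<close> is \<open>p (\<theta> \<star>\<^sub>2 e)\<close>.\<close>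

lemma preserves_second:
  assumes g: "valid M g" "knd g = Tight" "src g = [a, b]" and f: "valid M f" "small f" "tgt f = b"
  shows "preserves 2 g f"
proof -
  obtain q e where e: "basic e" and q [simp]: "ar q" "Dom C q = tgt e" "Cod C q = tgt f" and fq: "f = {|q|} \<star> e"
    using small_cases[OF f(1,2)] .
  note [simp] = g f(1,3) basicD(1)[OF e] validD(1)[OF basicD(1)[OF e]] small_types[OF basicD(2)[OF e]]
  have a [simp]: "ob a" using validD(2)[OF g(1)] by simp
  have "valid M (g \<star>\<^sub>2 {|q|})" "knd (g \<star>\<^sub>2 {|q|}) = Tight" "src (g \<star>\<^sub>2 {|q|}) = [a, tgt e]" by simp_all
  from arrow_ex[OF this] obtain p where p [simp]: "ar p" "Dom C p = a \<box> tgt e" and gp: "g \<star>\<^sub>2 {|q|} = {|p|} \<star> \<theta> a (tgt e)"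
    by (auto simp: hom_def)
  have ob [simp]: "tgt e \<in> Obj C" using validD(3) by simp
  have "preserves (Suc 0) {|p|} (\<theta> a (tgt e) \<star>\<^sub>2 e) \<and> preserves 2 (\<theta> a (tgt e)) e \<longleftrightarrow>
      preserves 2 ({|p|} \<star> \<theta> a (tgt e)) e \<and> preserves 2 (\<theta> a (tgt e)) e"
    by (rule preserves_nested) (simp_all add: preserves_unary)
  then have "preserves 2 (g \<star>\<^sub>2 {|q|}) e" using preserves_theta_basic[OF e a] by (simp add: gp preserves_unary)
  moreover have "preserves 2 g ({|q|} \<star> e) \<and> preserves (Suc 0) {|q|} e \<longleftrightarrow> preserves 2 (g \<star>\<^sub>2 {|q|}) e \<and> preserves (Suc 0) {|q|} e"
    by (rule preserves_nested) (simp_all add: preserves_unary)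
  ultimately show ?thesis by (simp add: fq preserves_unary)
qed

lemma preserves_first_composite:
  assumes g: "valid M g" "knd g = Tight" "src g = [b1, b2]"
    and f: "valid M f" "knd f = Tight \<and> length (src f) = 3 \<or> knd f = Loose \<and> length (src f) = 1" "tgt f = b1"
  shows "preserves (Suc 0) g f"
proof -
  obtain h e a where e: "basic e" and h [simp]: "valid M h" "knd h = Tight" "src h = [tgt e, a]" "tgt h = tgt f" "ob a"
    and fh: "f = h \<star> e" using ternary_loose_cases[OF f(1,2)] by blast
  note [simp] = g f(1,3) basicD(1)[OF e] small_types[OF basicD(2)[OF e]] small_types(4)[OF basicD(2)[OF e], of "[a, a]", simplified]
  have he: "preserves (Suc 0) h e" by (rule preserves_basic[OF e, of _ "[a]"]) simp_all
  have gh: "preserves (Suc 0) g h" by (rule preserves_first[OF g]) (simp_all add: small_def)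
  have "preserves (Suc 0) g (h \<star> e) \<and> preserves (Suc 0) h e \<longleftrightarrow> preserves (Suc 0) (g \<star> h) e \<and> preserves (Suc 0) h e"
    by (rule preserves_nested) (simp_all add: gh)
  moreover have "preserves (Suc 0) (g \<star> h) e" by (rule preserves_basic[OF e, of _ "[a, b2]"]) simp_all
  ultimately show ?thesis using he by (simp add: fh)
qed

lemma preserves_ternary_second:
  assumes g: "valid M g" "knd g = Tight" "src g = [b1, b2, b3]" and f: "valid M f" "small f" "tgt f = b2"
  shows "preserves 2 g f"
proof -
  have [simp]: "ob b1" "ob b2" "ob b3" using validD(2)[OF g(1)] g(3) by simp_all
  obtain h where h [simp]: "valid M h" "knd h = Tight" "src h = [b1 \<box> b2, b3]" and gh: "g = h \<star> \<theta> b1 b2"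
    using theta_surj[OF g] by auto
  note [simp] = f(1,3) small_types[OF f(2)]
  have tf: "preserves 2 (\<theta> b1 b2) f" by (rule preserves_second[OF _ _ _ f(1,2)]) simp_all
  have hf: "preserves (Suc 0) h (\<theta> b1 b2 \<star>\<^sub>2 f)"
  proof (cases "knd f")
    case Tight
    then show ?thesis using f(2) by (intro preserves_first_composite) (simp_all add: small_def)
  next
    case Loose
    then have s: "mtype (\<theta> b1 b2 \<star>\<^sub>2 f) = (Tight, 1)" using f(2) by (auto simp: mtype_def small_def)
    have "valid M (\<theta> b1 b2 \<star>\<^sub>2 f)" by simp
    then obtain p where p: "ar p" "\<theta> b1 b2 \<star>\<^sub>2 f = {|p|}" using s by (rule unary_cases)
    have "Cod C p = b1 \<box> b2" using arg_cong[OF p(2), of tgt] by simp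
    then show ?thesis unfolding p(2) using p(1) by (intro preserves_unary) simp_all
  qed
  have "preserves (Suc 0) h (\<theta> b1 b2 \<star>\<^sub>2 f) \<and> preserves 2 (\<theta> b1 b2) f \<longleftrightarrow>
      preserves 2 (h \<star> \<theta> b1 b2) f \<and> preserves 2 (\<theta> b1 b2) f"
    by (rule preserves_nested) (simp_all add: preserves_theta[of _ _ _ "[b3]"])
  then show ?thesis using hf tf by (simp add: gh)
qed

lemma preserves_second_composite:
  assumes g: "valid M g" "knd g = Tight" "src g = [b1, b2]"
    and f: "valid M f" "knd f = Tight \<and> length (src f) = 3 \<or> knd f = Loose \<and> length (src f) = 1" "tgt f = b2"
  shows "preserves 2 g f"
proof -
  obtain h e a where e: "basic e" and h [simp]: "valid M h" "knd h = Tight" "src h = [tgt e, a]" "tgt h = tgt f" "ob a"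
    and fh: "f = h \<star> e" using ternary_loose_cases[OF f(1,2)] by blast
  note [simp] = g f(1,3) basicD(1)[OF e] small_types[OF basicD(2)[OF e]]
  have he: "preserves (Suc 0) h e" by (rule preserves_basic[OF e, of _ "[a]"]) simp_all
  have gh: "preserves 2 g h" by (rule preserves_second[OF g]) (simp_all add: small_def)
  have "preserves 2 g (h \<star> e) \<and> preserves (Suc 0) h e \<longleftrightarrow> preserves 2 (g \<star>\<^sub>2 h) e \<and> preserves (Suc 0) h e"
    by (rule preserves_nested) (simp_all add: gh)
  moreover have "preserves 2 (g \<star>\<^sub>2 h) e" by (rule preserves_ternary_second[OF _ _ _ basicD[OF e]]) simp_all
  ultimately show ?thesis using he by (simp add: fh)
qed

text \<open>With \<open>g = h \<star> e\<close>, substitution into the last input commutes with that of \<open>e\<close> into the first one, which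
  leaves a substitution into the second input of the binary map \<open>h\<close>.\<close>

lemma preserves_last:
  assumes g: "valid M g" "knd g = Tight \<and> length (src g) = 3 \<or> knd g = Loose \<and> length (src g) = 1"
    and f: "valid M f" "small f" "tgt f = last (src g)"
  shows "preserves (length (src g)) g f"
proof -
  obtain h e b where e: "basic e" and h [simp]: "valid M h" "knd h = Tight" "src h = [tgt e, b]" "tgt h = tgt g" "ob b"
    and gh: "g = h \<star> e" and k: "knd e = knd g" "src g = src e @ [b]" using ternary_loose_cases[OF g] by blast
  note [simp] = f(1) small_types[OF f(2)] basicD(1)[OF e] small_types[OF basicD(2)[OF e]]
  have tf [simp]: "tgt f = b" using f(3) k by simp
  have hf: "preserves 2 h f" by (rule preserves_second[OF h(1-3) f(1,2)]) simp
  have p: "parallel_types (Tight, Suc (Suc 0)) (knd e, length (src e)) (knd f, length (src f))"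
    "composable (knd g, length (src g)) (knd f, length (src f))"
    using f(2) basicD(2)[OF e] k by (auto simp: small_def)
  let ?k = "Suc (length (src e))"
  have "h \<star> e \<star>\<^bsub>?k\<^esub> f = h \<star>\<^sub>2 f \<star> e" by (rule parallel) (simp_all add: p)
  then have "\<Phi> (g \<star>\<^bsub>?k\<^esub> f) = \<Phi> h \<star>'\<^sub>2 \<Phi> f \<star>' \<Phi> e"
    using preserves_basic[OF e, of "h \<star>\<^sub>2 f" "src f"] hf by (simp add: gh preserves_def)
  also have "\<dots> = \<Phi> h \<star>' \<Phi> e \<star>'\<^bsub>?k\<^esub> \<Phi> f" by (rule N.parallel[symmetric]) (simp_all add: p)
  finally show ?thesis using preserves_basic[OF e, of h "[b]"] by (simp add: gh preserves_def k plug_1)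
qed

theorem Phi_comp_at:
  assumes g: "valid M g" and f: "valid M f" and t: "composable (knd g, length (src g)) (knd f, length (src f))"
    and i: "Suc 0 \<le> i" "i \<le> length (src g)" "tgt f = src g ! (i - Suc 0)"
  shows "\<Phi> (g \<star>\<^bsub>i\<^esub> f) = \<Phi> g \<star>'\<^bsub>i\<^esub> \<Phi> f"
proof -
  have len: "length xs = 2 \<longleftrightarrow> (\<exists>a b. xs = [a, b])" "length xs = 3 \<longleftrightarrow> (\<exists>a b c. xs = [a, b, c])"
    "length xs = 1 \<longleftrightarrow> (\<exists>a. xs = [a])" for xs :: "'o list"
    by (auto simp: numeral_2_eq_2 numeral_3_eq_3 length_Suc_conv)
  consider (u1) "mtype f = (Tight, 1)" | (u2) "mtype g = (Tight, 1)"
    | (2) "knd g = Tight" "length (src g) = 2" "small f"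
    | (3) "knd g = Tight" "length (src g) = 3" "small f"
    | (23) "knd g = Tight" "length (src g) = 2" "knd f = Tight \<and> length (src f) = 3 \<or> knd f = Loose \<and> length (src f) = 1"
    | (1) "knd g = Loose" "length (src g) = 1" "small f"
    using t unfolding composable_def sub_cases_def small_def mtype_def by auto
  then have "preserves i g f"
  proof cases
    case u1
    then obtain p where p: "ar p" "f = {|p|}" using unary_cases[OF f] by blast
    then show ?thesis using preserves_unary(2)[OF g p(1) i(1,2)] i(3) by simp
  next
    case u2
    then obtain p where p: "ar p" "g = {|p|}" using unary_cases[OF g] by blast
    then show ?thesis using preserves_unary(1)[OF f p(1)] i by simp
  next
    case 2
    then obtain b1 b2 where s: "src g = [b1, b2]" unfolding len by blast
    then have "i = Suc 0 \<or> i = 2" using i by auto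
    then show ?thesis using preserves_first[OF g 2(1) s _ f 2(3)] preserves_second[OF g 2(1) s f 2(3)] i(3) s by auto
  next
    case 3
    then obtain b1 b2 b3 where s: "src g = [b1, b2, b3]" unfolding len by blast
    then have "i = Suc 0 \<or> i = 2 \<or> i = 3" using i by auto
    then show ?thesis
      using preserves_first[OF g 3(1) s _ f 3(3)] preserves_ternary_second[OF g 3(1) s f 3(3)] preserves_last[OF g _ f 3(3)] 3(1,2) i(3) s
      by (auto simp: numeral_3_eq_3)
  next
    case 23
    then obtain b1 b2 where s: "src g = [b1, b2]" unfolding len by blast
    then have "i = Suc 0 \<or> i = 2" using i by auto
    then show ?thesis using preserves_first_composite[OF g 23(1) s f 23(3)] preserves_second_composite[OF g 23(1) s f 23(3)] i(3) s by auto
  next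
    case 1
    then obtain b where s: "src g = [b]" unfolding len by blast
    then have "i = Suc 0" using i by auto
    then show ?thesis using preserves_last[OF g _ f 1(3)] 1(1,2) i(3) s by auto
  qed
  then show ?thesis by (simp add: preserves_def)
qed

text \<open>By naturality it suffices to treat \<open>j\<close> of an identity, which is \<open>\<lambda>\<close> precomposed with \<open>\<theta>\<close> and \<open>u\<close>.\<close>

lemma Phi_jmap:
  assumes f: "valid M f" "knd f = Tight" "src f \<noteq> []" "length (src f) \<le> 2"
  shows "\<Phi> (jmap M f) = jmap N (\<Phi> f)"
proof -
  have idn: "\<Phi> (jmap M {|Idn C a|}) = jmap N {|Idn N.C (Lo a)|}'" if [simp]: "ob a" for a
  proof -
    have "\<Phi> ({|\<Lambda> a|} \<star> \<theta> I a \<star> u) = {|Lm (\<Lambda> a)|}' \<star>' \<phi> I a \<star>' \<phi>0"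
      by (simp add: Phi_comp_at)
    then show ?thesis by (simp add: lambda_props phi_lambda)
  qed
  consider (1) a where "src f = [a]" | (2) a b where "src f = [a, b]"
    using f(3,4) by (cases "src f"; cases "tl (src f)") (auto simp: numeral_2_eq_2)
  then show ?thesis
  proof cases
    case 1
    then obtain p where p [simp]: "ar p" and fp: "f = {|p|}" using unary_cases[OF f(1)] f(2) by (auto simp: mtype_def)
    have "jmap M {|p|} = {|p|} \<star> jmap M {|Idn C (Dom C p)|}" by (simp add: comp_at_idn flip: jmap_post)
    then have "\<Phi> (jmap M {|p|}) = {|Lm p|}' \<star>' jmap N {|Idn N.C (Lo (Dom C p))|}'" by (simp add: Phi_post idn)
    also have "\<dots> = jmap N {|Lm p|}'" by (simp add: N.comp_at_idn flip: N.jmap_post)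
    finally show ?thesis by (simp add: fp)
  next
    case (2 a b)
    have [simp]: "ob a" "ob b" using validD(2)[OF f(1)] 2 by auto
    note [simp] = f(1,2) 2
    have "jmap M f = f \<star> jmap M {|Idn C a|}" using jmap_first[of f "Idn C a" b] by (simp add: comp_at_idn)
    then have "\<Phi> (jmap M f) = \<Phi> f \<star>' jmap N {|Idn N.C (Lo a)|}'" by (simp add: Phi_comp_at idn)
    also have "\<dots> = jmap N (\<Phi> f)" using N.jmap_first[of "\<Phi> f" "Idn N.C (Lo a)" "Lo b"] by (simp add: N.comp_at_idn)
    finally show ?thesis .
  qed
qed

abbreviation "morphism_of_lax \<equiv> morphism_of (lax_fun L) \<Phi>"

lemma morphism_of_lax:
  shows "ssm_morphism M N morphism_of_lax" and "valid M f \<Longrightarrow> app morphism_of_lax f = \<Phi> f"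
    and "K_s_mor D D' M N morphism_of_lax = L"
proof -
  note m = morphism_of[OF L_functor Phi_sel]
  show mor: "ssm_morphism M N morphism_of_lax"
    by (rule m(1)) (simp_all add: Phi_comp_at Phi_jmap)
  show app: "app morphism_of_lax f = \<Phi> f" if "valid M f" for f
    by (rule m(2)) (simp_all add: Phi_comp_at Phi_jmap that)
  have fn: "mm_fun morphism_of_lax = lax_fun L" by (simp add: morphism_of_def)
  show "K_s_mor D D' M N morphism_of_lax = L"
    by (rule K_mor_eqI[OF mor lax]) (simp_all add: app fn \<phi>_def \<phi>0_def)
qed

end

text \<open>The short braiding of a universal ternary map is the braiding arrow precomposed with another such map, and
  \<open>L\<close> preserves the braiding; the exchanges of quaternary maps are reduced to those of ternary ones.\<close>

lemma K_mor_full: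
  assumes M: "representable_braiding M D B" and N: "representable_braiding N D' B'"
    and L: "braided_lax (K_s_obj D M, K_braid D M B) (K_s_obj D' N, K_braid D' N B') L"
  shows "\<exists>F. braided_morphism (M, B) (N, B') F \<and> K_s_mor D D' M N F = L"
proof -
  interpret M: representable_braiding M D B by fact
  interpret N: representable_braiding N D' B' by fact
  have lax: "lax_monoidal_functor (K_s_obj D M) (K_s_obj D' N) L" using L by (simp add: braided_lax_iff)
  have lr: "lr_pair M N D D'" by unfold_locales
  interpret P: lr_pair_lax M N D D' L using lr lax by (rule lr_pair_lax.intro[OF _ lr_pair_lax_axioms.intro])
  interpret BP: braided_pair M B N B' ..
  note mor = P.morphism_of_lax
  have T: "P.\<Phi> (M.\<Theta> a b c) = comp_at N (P.\<phi> (M.tensor a b) c) (Suc 0) (P.\<phi> a b)"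
    if "a \<in> Obj (mcat M)" "b \<in> Obj (mcat M)" "c \<in> Obj (mcat M)" for a b c
    using that by (simp add: P.Phi_comp_at)
  have braid: "comp_at N (unary N (P.Lm (M.s x a b))) (Suc 0) (comp_at N (P.\<phi> (M.tensor x a) b) (Suc 0) (P.\<phi> x a)) =
      N.\<beta>\<^sub>3 (comp_at N (P.\<phi> (M.tensor x b) a) (Suc 0) (P.\<phi> x b))"
    if [simp]: "x \<in> Obj (mcat M)" "a \<in> Obj (mcat M)" "b \<in> Obj (mcat M)" for x a b
  proof -
    let ?l = "\<lambda>a b. Comp (mcat N) (P.L2 (M.tensor x a) b) (N.tensor_arr (P.L2 x a) (Idn (mcat N) (P.Lo b)))"
    let ?s = "N.s (P.Lo x) (P.Lo a) (P.Lo b)" and ?X = "N.\<Theta> (P.Lo x) (P.Lo a) (P.Lo b)"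
    have e: "Comp (mcat N) (P.Lm (M.s x a b)) (?l a b) = Comp (mcat N) (?l b a) ?s"
      using L that N.K.comp_assoc[of ?s "N.tensor_arr (P.L2 x b) (Idn (mcat N) (P.Lo a))" "P.L2 (M.tensor x b) a"]
      unfolding braided_lax_iff by simp
    have "comp_at N (unary N (P.Lm (M.s x a b))) (Suc 0) (comp_at N (P.\<phi> (M.tensor x a) b) (Suc 0) (P.\<phi> x a)) =
        comp_at N (unary N (Comp (mcat N) (P.Lm (M.s x a b)) (?l a b))) (Suc 0) ?X"
      unfolding P.phi_phi(1)[OF that] by (rule N.comp_push[symmetric]; simp)
    also have "\<dots> = comp_at N (unary N (?l b a)) (Suc 0) (N.\<beta>\<^sub>3 (N.\<Theta> (P.Lo x) (P.Lo b) (P.Lo a)))"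
      unfolding e by (subst N.comp_push; simp add: N.braid_theta)
    also have "\<dots> = N.\<beta>\<^sub>3 (comp_at N (unary N (?l b a)) (Suc 0) (N.\<Theta> (P.Lo x) (P.Lo b) (P.Lo a)))"
      by (rule N.beta_post(1)[symmetric]) simp_all
    finally show ?thesis unfolding P.phi_phi(1)[OF that(1,3,2)] .
  qed
  have b3: "P.\<Phi> (M.\<beta>\<^sub>3 f) = N.\<beta>\<^sub>3 (P.\<Phi> f)" if f: "valid M f" "knd f = Tight" "src f = [a1, a2, a3]" for f a1 a2 a3
  proof -
    have [simp]: "a1 \<in> Obj (mcat M)" "a2 \<in> Obj (mcat M)" "a3 \<in> Obj (mcat M)" using M.validD(2)[OF f(1)] f(3) by auto
    obtain p where p: "p \<in> hom (mcat M) (M.tensor (M.tensor a1 a2) a3) (tgt f)"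
      "comp_at M (comp_at M (unary M p) (Suc 0) (M.\<theta> (M.tensor a1 a2) a3)) (Suc 0) (M.\<theta> a1 a2) = f"
      using M.arrow_ex_3[OF f] by auto
    have [simp]: "p \<in> Arr (mcat M)" "Dom (mcat M) p = M.tensor (M.tensor a1 a2) a3" "Cod (mcat M) p = tgt f" using p(1) by (auto simp: hom_def)
    have fp: "f = comp_at M (unary M p) (Suc 0) (M.\<Theta> a1 a2 a3)"
      unfolding p(2)[symmetric] by (rule M.unary_push[symmetric]; simp)
    have "M.\<beta>\<^sub>3 f = comp_at M (unary M p) (Suc 0) (comp_at M (unary M (M.s a1 a3 a2)) (Suc 0) (M.\<Theta> a1 a3 a2))"
      unfolding fp using M.beta_post(1)[of "M.\<Theta> a1 a2 a3" p a1 a2 a3] by (simp add: M.braid_theta)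
    then have "P.\<Phi> (M.\<beta>\<^sub>3 f) = comp_at N (unary N (P.Lm p)) (Suc 0) (N.\<beta>\<^sub>3 (comp_at N (P.\<phi> (M.tensor a1 a2) a3) (Suc 0) (P.\<phi> a1 a2)))"
      using T[of a1 a3 a2] braid[of a1 a3 a2] by (simp add: P.Phi_post)
    also have "\<dots> = N.\<beta>\<^sub>3 (comp_at N (unary N (P.Lm p)) (Suc 0) (comp_at N (P.\<phi> (M.tensor a1 a2) a3) (Suc 0) (P.\<phi> a1 a2)))"
      by (rule N.beta_post(1)[symmetric]) simp_all
    finally show ?thesis unfolding fp using T[of a1 a2 a3] by (simp add: P.Phi_post)
  qed
  have b43: "P.\<Phi> (M.\<beta>\<^sub>4\<^sub>3 f) = N.\<beta>\<^sub>4\<^sub>3 (P.\<Phi> f)" and b42: "P.\<Phi> (M.\<beta>\<^sub>4\<^sub>2 f) = N.\<beta>\<^sub>4\<^sub>2 (P.\<Phi> f)"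
    if f: "valid M f" "knd f = Tight" "src f = [a1, a2, a3, a4]" for f a1 a2 a3 a4
  proof -
    have [simp]: "a1 \<in> Obj (mcat M)" "a2 \<in> Obj (mcat M)" "a3 \<in> Obj (mcat M)" "a4 \<in> Obj (mcat M)"
      using M.validD(2)[OF f(1)] f(3) by auto
    obtain r where r [simp]: "valid M r" "knd r = Tight" "src r = [M.tensor a1 a2, a3, a4]" and fr: "comp_at M r (Suc 0) (M.\<theta> a1 a2) = f"
      using M.theta_surj[of f a1 a2 "[a3, a4]"] f by auto
    have vb [simp]: "valid M (M.\<beta>\<^sub>3 r)" by (rule M.beta_valid(1)) simp_all
    have "M.\<beta>\<^sub>4\<^sub>3 f = comp_at M (M.\<beta>\<^sub>3 r) (Suc 0) (M.\<theta> a1 a2)"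
      unfolding fr[symmetric] by (rule M.beta3_comp(1); simp)
    then have "P.\<Phi> (M.\<beta>\<^sub>4\<^sub>3 f) = comp_at N (N.\<beta>\<^sub>3 (P.\<Phi> r)) (Suc 0) (P.\<phi> a1 a2)"
      by (simp add: P.Phi_comp_at b3)
    also have "\<dots> = N.\<beta>\<^sub>4\<^sub>3 (comp_at N (P.\<Phi> r) (Suc 0) (P.\<phi> a1 a2))" by (rule N.beta3_comp(1)[symmetric]; simp)
    finally show "P.\<Phi> (M.\<beta>\<^sub>4\<^sub>3 f) = N.\<beta>\<^sub>4\<^sub>3 (P.\<Phi> f)" unfolding fr[symmetric] by (simp add: P.Phi_comp_at)
    obtain g where g [simp]: "valid M g" "knd g = Tight" "src g = [M.tensor (M.tensor a1 a2) a3, a4]"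
      and rg: "comp_at M g (Suc 0) (M.\<theta> (M.tensor a1 a2) a3) = r"
      using M.theta_surj[of r "M.tensor a1 a2" a3 "[a4]"] by auto
    have fg: "f = comp_at M g (Suc 0) (M.\<Theta> a1 a2 a3)"
      unfolding fr[symmetric] rg[symmetric] by (rule M.assoc[symmetric]; simp)
    have vb' [simp]: "valid M (M.\<beta>\<^sub>3 (M.\<Theta> a1 a2 a3))" by (rule M.beta_valid(1)) simp_all
    have "M.\<beta>\<^sub>4\<^sub>2 f = comp_at M g (Suc 0) (M.\<beta>\<^sub>3 (M.\<Theta> a1 a2 a3))"
      unfolding fg by (rule M.comp_beta3(1)[symmetric]; simp)
    then have "P.\<Phi> (M.\<beta>\<^sub>4\<^sub>2 f) = comp_at N (P.\<Phi> g) (Suc 0) (N.\<beta>\<^sub>3 (P.\<Phi> (M.\<Theta> a1 a2 a3)))"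
      using b3[of "M.\<Theta> a1 a2 a3" a1 a2 a3] by (simp add: P.Phi_comp_at)
    also have "\<dots> = N.\<beta>\<^sub>4\<^sub>2 (comp_at N (P.\<Phi> g) (Suc 0) (P.\<Phi> (M.\<Theta> a1 a2 a3)))" by (rule N.comp_beta3(1); simp)
    finally show "P.\<Phi> (M.\<beta>\<^sub>4\<^sub>2 f) = N.\<beta>\<^sub>4\<^sub>2 (P.\<Phi> f)" unfolding fg by (simp add: P.Phi_comp_at)
  qed
  have "braided_morphism (M, B) (N, B') P.morphism_of_lax"
    unfolding BP.braided_morphism_iff using mor(1,2) b3 b42 b43 M.beta_valid by simp
  then show ?thesis using mor(3) by blast
qed

section \<open>The short skew multicategory of a skew monoidal category\<close>

text \<open>Multimaps out of a list are arrows out of its left-bracketed tensor product, with an additional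
  leading unit if they are loose.\<close>

definition lprod :: "('o, 'm) smc \<Rightarrow> 'o list \<Rightarrow> 'o" where
  "lprod S as = foldl (tens_obj S) (hd as) (tl as)"

definition lprod_arr :: "('o, 'm) smc \<Rightarrow> 'm list \<Rightarrow> 'm" where
  "lprod_arr S ps = foldl (tens_arr S) (hd ps) (tl ps)"

definition lead :: "'a \<Rightarrow> tl \<Rightarrow> 'a list \<Rightarrow> 'a list" where
  "lead e x as = (if x = Loose then e # as else as)"

lemma lprod_simps [simp]: "lprod S [a] = a" "lprod S (a # b # as) = lprod S (tens_obj S a b # as)"
  by (simp_all add: lprod_def)

lemma lprod_arr_simps [simp]: "lprod_arr S [p] = p" "lprod_arr S (p # q # ps) = lprod_arr S (tens_arr S p q # ps)"
  by (simp_all add: lprod_arr_def)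

lemma lead_simps [simp]: "lead e Tight as = as" "lead e Loose as = e # as"
  by (simp_all add: lead_def)

lemma map_lead: "map f (lead e x as) = lead (f e) x (map f as)"
  by (cases x) simp_all

text \<open>The canonical arrow \<open>X a\<^sub>1 \<cdots> a\<^sub>n \<rightarrow> X (a\<^sub>1 \<cdots> a\<^sub>n)\<close>, with a unit in front of
  \<open>a\<^sub>1\<close> on the right if \<open>y\<close> is loose.\<close>

definition rebracket :: "('o, 'm) smc \<Rightarrow> 'o \<Rightarrow> tl \<Rightarrow> 'o list \<Rightarrow> 'm" where
  "rebracket S X y as = (if y = Tight then
      if length as = 2 then alpha S X (as ! 0) (as ! 1)
      else scomp S (alpha S X (tens_obj S (as ! 0) (as ! 1)) (as ! 2)) (tens_arr S (alpha S X (as ! 0) (as ! 1)) (sid S (as ! 2)))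
    else if as = [] then rho S X
      else scomp S (alpha S X (sunit S) (as ! 0)) (tens_arr S (rho S X) (sid S (as ! 0))))"

text \<open>Substitution of \<open>f\<close> between the inputs \<open>bs1\<close> and \<open>bs2\<close> of a map is precomposition with the
  following arrow.\<close>

definition whisker :: "('o, 'm) smc \<Rightarrow> tl \<Rightarrow> 'o list \<Rightarrow> tl \<Rightarrow> 'o list \<Rightarrow> 'o list \<Rightarrow> 'm \<Rightarrow> 'm" where
  "whisker S x bs1 y as bs2 f = (if x = Tight \<and> bs1 = [] then lprod_arr S (f # map (sid S) bs2)
     else let X = lprod S (lead (sunit S) x bs1) in
       lprod_arr S (scomp S (tens_arr S (sid S X) f) (rebracket S X y as) # map (sid S) bs2))"

definition multicategory_of :: "('o, 'm) smc \<Rightarrow> ('o, 'm) ssm" where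
  "multicategory_of S =
     \<lparr>mcat = scat S,
      mfun = (\<lambda>(x, n).
        \<lparr>fobj = (\<lambda>(as, b)\<in>Obj (mdom (scat S) n). shom S (lprod S (lead (sunit S) x as)) b),
         fmap = (\<lambda>(ps, q)\<in>Arr (mdom (scat S) n).
           (shom S (lprod S (lead (sunit S) x (map (Cod (scat S)) ps))) (Dom (scat S) q),
            \<lambda>f\<in>shom S (lprod S (lead (sunit S) x (map (Cod (scat S)) ps))) (Dom (scat S) q).
              scomp S q (scomp S f (lprod_arr S (lead (sid S (sunit S)) x ps))),
            shom S (lprod S (lead (sunit S) x (map (Dom (scat S)) ps))) (Cod (scat S) q)))\<rparr>),
      mj = (\<lambda>n. \<lambda>(as, b)\<in>Obj (mdom (scat S) n).
        (shom S (lprod S as) b,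
         \<lambda>f\<in>shom S (lprod S as) b. scomp S f (lprod_arr S (lambda S (hd as) # map (sid S) (tl as))),
         shom S (lprod S (sunit S # as)) b)),
      msub = (\<lambda>x bs c i y as g f. scomp S g (whisker S x (take (i - 1) bs) y as (drop i bs) f))\<rparr>"

context skew_monoidal_category
begin

abbreviation "T \<equiv> multicategory_of S"
abbreviation "lp \<equiv> lprod S"
abbreviation "lpa \<equiv> lprod_arr S"
abbreviation "ids \<equiv> map (sid S)"

lemma mcat_T [simp]: "mcat T = scat S"
  by (simp add: multicategory_of_def)

lemma lp_obj [simp]: "as \<noteq> [] \<Longrightarrow> set as \<subseteq> sobj S \<Longrightarrow> lp as \<in> sobj S"
proof (induction "length as" arbitrary: as rule: less_induct)
  case less
  then show ?case by (cases as; cases "tl as") auto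
qed

lemma lpa_arr [simp]:
  assumes "ps \<noteq> []" "set ps \<subseteq> Arr (scat S)"
  shows "arr (lpa ps)" "dom (lpa ps) = lp (map dom ps)" "cod (lpa ps) = lp (map cod ps)"
proof -
  have "arr (lpa (p # ps)) \<and> dom (lpa (p # ps)) = lp (map dom (p # ps)) \<and> cod (lpa (p # ps)) = lp (map cod (p # ps))"
    if "arr p" "set ps \<subseteq> Arr (scat S)" for p ps
    using that
  proof (induction ps arbitrary: p)
    case (Cons q ps)
    from Cons.IH[of "p \<otimes> q"] show ?case using Cons.prems by simp
  qed simp
  with assms show "arr (lpa ps)" "dom (lpa ps) = lp (map dom ps)" "cod (lpa ps) = lp (map cod ps)"
    by (cases ps; auto)+
qed

lemma lpa_ids [simp]: "as \<noteq> [] \<Longrightarrow> set as \<subseteq> sobj S \<Longrightarrow> lpa (ids as) = \<one> (lp as)"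
proof (induction "length as" arbitrary: as rule: less_induct)
  case less
  show ?case
  proof (cases as)
    case (Cons a bs)
    then show ?thesis using less.prems less.hyps[of "a \<odot> hd bs # tl bs"] by (cases bs) auto
  qed (use less.prems in simp)
qed

text \<open>The left-bracketed tensor product is functorial; the functoriality of the multimaps is a consequence.\<close>

lemma lpa_comp:
  assumes "ps \<noteq> []" "set ps \<subseteq> Arr (scat S)" "set qs \<subseteq> Arr (scat S)" "map dom qs = map cod ps"
  shows "lpa qs \<bullet> lpa ps = lpa (map2 (\<bullet>) qs ps)"
proof -
  have "lpa (q # qs) \<bullet> lpa (p # ps) = lpa (map2 (\<bullet>) (q # qs) (p # ps))"
    if "arr p" "arr q" "dom q = cod p" "set ps \<subseteq> Arr (scat S)" "set qs \<subseteq> Arr (scat S)" "map dom qs = map cod ps" for p ps q qs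
    using that
  proof (induction ps arbitrary: p q qs)
    case (Cons p' ps)
    then obtain q' qs' where qs: "qs = q' # qs'" by (cases qs) auto
    from Cons.IH[of "p \<otimes> p'" "q \<otimes> q'" qs'] show ?case using Cons.prems by (simp add: qs)
  qed simp
  with assms show ?thesis by (cases ps; cases qs) auto
qed

lemma lpa_append: "ps \<noteq> [] \<Longrightarrow> lpa (ps @ qs) = lpa (lpa ps # qs)"
  by (cases ps) (simp_all add: lprod_arr_def)

lemma lp_append: "as \<noteq> [] \<Longrightarrow> lp (as @ bs) = lp (lp as # bs)"
  by (cases as) (simp_all add: lprod_def)

lemma dom_ids [simp]: "set as \<subseteq> sobj S \<Longrightarrow> map dom (ids as) = as" "set as \<subseteq> sobj S \<Longrightarrow> map cod (ids as) = as"
  "A \<subseteq> sobj S \<Longrightarrow> sid S ` A \<subseteq> Arr (scat S)"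
  by (auto intro!: map_idI)

lemma dom_comp_ids [simp]: "set as \<subseteq> sobj S \<Longrightarrow> map (dom \<circ> sid S) as = as" "set as \<subseteq> sobj S \<Longrightarrow> map (cod \<circ> sid S) as = as"
  using dom_ids by simp_all

lemma map2_ids [simp]:
  "set ps \<subseteq> Arr (scat S) \<Longrightarrow> map cod ps = as \<Longrightarrow> map2 (\<bullet>) (ids as) ps = ps"
  "set ps \<subseteq> Arr (scat S) \<Longrightarrow> map dom ps = as \<Longrightarrow> map2 (\<bullet>) ps (ids as) = ps"
  by (auto intro!: nth_equalityI simp: subset_iff)

text \<open>Only lists of these types are substituted.\<close>

definition plain :: "tl \<Rightarrow> 'o list \<Rightarrow> bool" where
  "plain y as \<longleftrightarrow> (y, length as) \<in> {(Tight, 2), (Tight, 3), (Loose, 0), (Loose, 1)}"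

lemma plain_cases:
  assumes "plain y as"
  obtains a b where "y = Tight" "as = [a, b]" | a b c where "y = Tight" "as = [a, b, c]"
  | "y = Loose" "as = []" | a where "y = Loose" "as = [a]"
  using assms unfolding plain_def by (auto simp: numeral_2_eq_2 numeral_3_eq_3 length_Suc_conv)

lemma alpha_natural:
  "arr f \<Longrightarrow> arr g \<Longrightarrow> arr h \<Longrightarrow> cod f = a \<Longrightarrow> cod g = b \<Longrightarrow> cod h = c \<Longrightarrow>
    alpha S a b c \<bullet> ((f \<otimes> g) \<otimes> h) = (f \<otimes> (g \<otimes> h)) \<bullet> alpha S (dom f) (dom g) (dom h)"
  using alpha_nat[of f "dom f" "cod f" g "dom g" "cod g" h "dom h" "cod h"] by (simp add: shom_iff)

lemma rho_natural: "arr f \<Longrightarrow> cod f = a \<Longrightarrow> rho S a \<bullet> f = (f \<otimes> \<one> \<I>) \<bullet> rho S (dom f)"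
  using rho_nat[of f "dom f" "cod f"] by (simp add: shom_iff)

lemma lambda_natural: "arr f \<Longrightarrow> cod f = a \<Longrightarrow> lambda S a \<bullet> (\<one> \<I> \<otimes> f) = f \<bullet> lambda S (dom f)"
  using lambda_nat[of f "dom f" "cod f"] by (simp add: shom_iff)

lemma rebracket_arr [simp]:
  assumes "plain y as" "X \<in> sobj S" "set as \<subseteq> sobj S"
  shows "arr (rebracket S X y as)" "dom (rebracket S X y as) = lp (X # as)"
    "cod (rebracket S X y as) = X \<odot> lp (lead \<I> y as)"
  using assms(1) by (cases rule: plain_cases; use assms(2,3) in \<open>simp add: rebracket_def\<close>)+

text \<open>Naturality of \<open>\<alpha>\<close> and \<open>\<rho>\<close>, with the \<open>ps\<close> regrouped as one arrow.\<close>

lemma rebracket_natural: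
  assumes y: "plain y (map dom ps)" and p: "arr p" and ps: "set ps \<subseteq> Arr (scat S)"
  shows "rebracket S (cod p) y (map cod ps) \<bullet> lpa (p # ps) = (p \<otimes> lpa (lead (\<one> \<I>) y ps)) \<bullet> rebracket S (dom p) y (map dom ps)"
  using y
proof (cases rule: plain_cases)
  case (1 a b)
  then obtain f g where "ps = [f, g]" by auto
  then show ?thesis using 1 p ps by (simp add: rebracket_def alpha_natural)
next
  case (2 a b c)
  then obtain f g h where [simp]: "ps = [f, g, h]" by auto
  have [simp]: "arr f" "arr g" "arr h" "arr p" using p ps by auto
  let ?A = "alpha S (cod p) (cod f \<odot> cod g) (cod h)" and ?A' = "alpha S (dom p) (dom f \<odot> dom g) (dom h)"
  have "(?A \<bullet> (alpha S (cod p) (cod f) (cod g) \<otimes> \<one> (cod h))) \<bullet> (((p \<otimes> f) \<otimes> g) \<otimes> h) =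
      ?A \<bullet> ((alpha S (cod p) (cod f) (cod g) \<bullet> ((p \<otimes> f) \<otimes> g)) \<otimes> h)" by simp
  also have "\<dots> = ?A \<bullet> (((p \<otimes> (f \<otimes> g)) \<otimes> h) \<bullet> (alpha S (dom p) (dom f) (dom g) \<otimes> \<one> (dom h)))"
    by (simp add: alpha_natural)
  also have "\<dots> = (p \<otimes> ((f \<otimes> g) \<otimes> h)) \<bullet> (?A' \<bullet> (alpha S (dom p) (dom f) (dom g) \<otimes> \<one> (dom h)))"
    by (rule comp_extend) (simp_all add: alpha_natural)
  finally show ?thesis using 2 by (simp add: rebracket_def)
next
  case 3
  then show ?thesis using p by (simp add: rebracket_def rho_natural)
next
  case (4 a)
  then obtain f where [simp]: "ps = [f]" by auto
  have [simp]: "arr f" "arr p" using p ps by auto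
  have "(alpha S (cod p) \<I> (cod f) \<bullet> (rho S (cod p) \<otimes> \<one> (cod f))) \<bullet> (p \<otimes> f) = alpha S (cod p) \<I> (cod f) \<bullet> ((rho S (cod p) \<bullet> p) \<otimes> f)"
    by simp
  also have "\<dots> = alpha S (cod p) \<I> (cod f) \<bullet> (((p \<otimes> \<one> \<I>) \<otimes> f) \<bullet> (rho S (dom p) \<otimes> \<one> (dom f)))"
    by (simp add: rho_natural)
  also have "\<dots> = (p \<otimes> (\<one> \<I> \<otimes> f)) \<bullet> (alpha S (dom p) \<I> (dom f) \<bullet> (rho S (dom p) \<otimes> \<one> (dom f)))"
    by (rule comp_extend) (simp_all add: alpha_natural)
  finally show ?thesis using 4 by (simp add: rebracket_def)
qed

text \<open>Typing and naturality of whiskering, in terms of lists of arrows.\<close>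

lemma whisker_eq:
  "whisker S Tight [] y as bs2 f = lpa (f # ids bs2)"
  "lead \<I> x bs1 = X \<Longrightarrow> X \<noteq> [] \<Longrightarrow> whisker S x bs1 y as bs2 f = lpa (((\<one> (lp X) \<otimes> f) \<bullet> rebracket S (lp X) y as) # ids bs2)"
  by (auto simp: whisker_def Let_def lead_def)

context
  fixes x y :: tl and as bs1 bs2 :: "'o list" and b :: 'o
  assumes pl: "plain y as" and as: "set as \<subseteq> sobj S" and bs: "set bs1 \<subseteq> sobj S" "set bs2 \<subseteq> sobj S"
begin

lemma lead_lp [simp]: "lp (lead \<I> y as) \<in> sobj S" "lead \<I> y as \<noteq> []"
proof -
  show n: "lead \<I> y as \<noteq> []" using pl by (cases rule: plain_cases) auto
  show "lp (lead \<I> y as) \<in> sobj S" by (rule lp_obj[OF n]) (use as in \<open>auto simp: lead_def\<close>)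
qed

lemma lead_ne: "\<not> (x = Tight \<and> bs1 = []) \<Longrightarrow> lead \<I> x bs1 \<noteq> [] \<and> set (lead \<I> x bs1) \<subseteq> sobj S"
  using bs by (auto simp: lead_def split: tl.splits) (cases x; simp)

lemma whisker_arr:
  assumes f: "arr f" "dom f = lp (lead \<I> y as)" "cod f = b"
  shows "arr (whisker S x bs1 y as bs2 f)"
    "dom (whisker S x bs1 y as bs2 f) = lp (lead \<I> (tl_comp x (Suc (length bs1)) y) (bs1 @ as @ bs2))"
    "cod (whisker S x bs1 y as bs2 f) = lp (lead \<I> x (bs1 @ b # bs2))"
proof -
  have b: "b \<in> sobj S" using f by auto
  have "arr (whisker S x bs1 y as bs2 f) \<and>
    dom (whisker S x bs1 y as bs2 f) = lp (lead \<I> (tl_comp x (Suc (length bs1)) y) (bs1 @ as @ bs2)) \<and>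
    cod (whisker S x bs1 y as bs2 f) = lp (lead \<I> x (bs1 @ b # bs2))"
  proof (cases "x = Tight \<and> bs1 = []")
    case True
    have "lead \<I> y (as @ bs2) = lead \<I> y as @ bs2" by (simp add: lead_def)
    then show ?thesis using True f bs(2) by (simp add: whisker_eq lp_append)
  next
    case False
    let ?X = "lead \<I> x bs1"
    have X: "?X \<noteq> []" "set ?X \<subseteq> sobj S" using lead_ne[OF False] by auto
    have k: "tl_comp x (Suc (length bs1)) y = x" using False by (cases x; cases y) (auto simp: tl_comp_def)
    have l: "lead \<I> x (bs1 @ zs) = ?X @ zs" for zs by (simp add: lead_def)
    have "lp (?X @ as @ bs2) = lp (lp (?X @ as) # bs2)" using X by (simp flip: lp_append)
    moreover have "lp (?X @ as) = lp (lp ?X # as)" by (rule lp_append[OF X(1)])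
    ultimately show ?thesis using X f pl as bs by (simp add: whisker_eq(2)[OF refl X(1)] k l lp_append)
  qed
  then show "arr (whisker S x bs1 y as bs2 f)"
    "dom (whisker S x bs1 y as bs2 f) = lp (lead \<I> (tl_comp x (Suc (length bs1)) y) (bs1 @ as @ bs2))"
    "cod (whisker S x bs1 y as bs2 f) = lp (lead \<I> x (bs1 @ b # bs2))" by auto
qed

lemma whisker_dinatural:
  assumes f: "arr f" "dom f = lp (lead \<I> y as)" and p: "arr p" "dom p = cod f"
  shows "lpa (lead (\<one> \<I>) x (ids bs1 @ p # ids bs2)) \<bullet> whisker S x bs1 y as bs2 f = whisker S x bs1 y as bs2 (p \<bullet> f)"
proof (cases "x = Tight \<and> bs1 = []")
  case True
  then show ?thesis using f p bs(2) by (simp add: whisker_eq lpa_comp)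
next
  case False
  let ?X = "lead \<I> x bs1" and ?r = "rebracket S (lp (lead \<I> x bs1)) y as"
  have X: "?X \<noteq> []" "set ?X \<subseteq> sobj S" using lead_ne[OF False] by auto
  have "lead (\<one> \<I>) x (ids bs1 @ p # ids bs2) = ids ?X @ p # ids bs2" by (simp add: lead_def)
  then have "lpa (lead (\<one> \<I>) x (ids bs1 @ p # ids bs2)) = lpa ((\<one> (lp ?X) \<otimes> p) # ids bs2)"
    using X by (simp add: lpa_append)
  then show ?thesis using f p bs(2) X pl as by (simp add: whisker_eq(2)[OF refl X(1)] lpa_comp)
qed

lemma whisker_inner:
  assumes f: "arr f" "dom f = lp (lead \<I> y as)" and ps: "set ps \<subseteq> Arr (scat S)" "map cod ps = as"
  shows "whisker S x bs1 y (map dom ps) bs2 (f \<bullet> lpa (lead (\<one> \<I>) y ps)) =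
    whisker S x bs1 y as bs2 f \<bullet> lpa (lead (\<one> \<I>) (tl_comp x (Suc (length bs1)) y) (ids bs1 @ ps @ ids bs2))"
proof -
  have n: "lead (\<one> \<I>) y ps \<noteq> []" using lead_lp(2) ps(2) by (auto simp: lead_def split: if_splits)
  have lps: "set (lead (\<one> \<I>) y ps) \<subseteq> Arr (scat S)" using ps by (auto simp: lead_def)
  have c: "map cod (lead (\<one> \<I>) y ps) = lead \<I> y as" by (simp add: map_lead ps)
  show ?thesis
  proof (cases "x = Tight \<and> bs1 = []")
    case True
    have "lead (\<one> \<I>) y (ps @ ids bs2) = lead (\<one> \<I>) y ps @ ids bs2" by (simp add: lead_def)
    then show ?thesis using True f bs(2) n lps c by (simp add: whisker_eq lpa_append lpa_comp)
  next
    case False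
    let ?X = "lead \<I> x bs1" and ?r = "rebracket S (lp (lead \<I> x bs1)) y"
    have X: "?X \<noteq> []" "set ?X \<subseteq> sobj S" using lead_ne[OF False] by auto
    have k: "tl_comp x (Suc (length bs1)) y = x" using False by (cases x; cases y) (auto simp: tl_comp_def)
    have l: "lead (\<one> \<I>) x (ids bs1 @ ps @ ids bs2) = ids ?X @ ps @ ids bs2" by (simp add: lead_def)
    have "lpa (ids ?X @ ps @ ids bs2) = lpa (lpa (ids ?X @ ps) # ids bs2)" using X by (simp flip: lpa_append)
    also have "lpa (ids ?X @ ps) = lpa (\<one> (lp ?X) # ps)" using X by (simp add: lpa_append)
    finally have l2: "lpa (ids ?X @ ps @ ids bs2) = lpa (lpa (\<one> (lp ?X) # ps) # ids bs2)" .
    have pd: "plain y (map dom ps)" using pl ps by (auto simp: plain_def)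
    have sd: "set (map dom ps) \<subseteq> sobj S" using ps by auto
    have r: "(\<one> (lp ?X) \<otimes> (f \<bullet> lpa (lead (\<one> \<I>) y ps))) \<bullet> ?r (map dom ps) = ((\<one> (lp ?X) \<otimes> f) \<bullet> ?r as) \<bullet> lpa (\<one> (lp ?X) # ps)"
    proof -
      have "?r as \<bullet> lpa (\<one> (lp ?X) # ps) = (\<one> (lp ?X) \<otimes> lpa (lead (\<one> \<I>) y ps)) \<bullet> ?r (map dom ps)"
        using rebracket_natural[OF pd, of "\<one> (lp ?X)"] ps X by simp
      then show ?thesis using f n lps c X pl pd as sd ps by (simp add: map_lead)
    qed
    show ?thesis
      unfolding whisker_eq(2)[OF refl X(1)] k l l2 r
      using f n lps c X pl as bs(2) ps by (subst lpa_comp) simp_all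
  qed
qed

end

lemma whisker_outer:
  assumes pl: "plain y as" and as: "set as \<subseteq> sobj S"
    and f: "arr f" "dom f = lp (lead \<I> y as)"
    and qs: "set qs1 \<subseteq> Arr (scat S)" "set qs2 \<subseteq> Arr (scat S)"
  shows "lpa (lead (\<one> \<I>) x (qs1 @ \<one> (cod f) # qs2)) \<bullet> whisker S x (map dom qs1) y as (map dom qs2) f =
    whisker S x (map cod qs1) y as (map cod qs2) f \<bullet> lpa (lead (\<one> \<I>) (tl_comp x (Suc (length qs1)) y) (qs1 @ ids as @ qs2))"
proof -
  have o: "set (map dom qs1) \<subseteq> sobj S" "set (map cod qs1) \<subseteq> sobj S" "set (map dom qs2) \<subseteq> sobj S" "set (map cod qs2) \<subseteq> sobj S"
    using qs by auto
  show ?thesis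
  proof (cases "x = Tight \<and> qs1 = []")
    case True
    have "lead (\<one> \<I>) y (ids as @ qs2) = ids (lead \<I> y as) @ qs2" by (simp add: lead_def)
    moreover have "set (lead \<I> y as) \<subseteq> sobj S" using as by (auto simp: lead_def)
    ultimately show ?thesis
      using True f qs(2) o lead_lp[OF pl as] by (simp add: whisker_eq lpa_append lpa_comp del: map_map)
  next
    case False
    let ?Q = "lead (\<one> \<I>) x qs1"
    have Q: "?Q \<noteq> []" "set ?Q \<subseteq> Arr (scat S)" using False qs by (cases x; auto)+
    have d: "lead \<I> x (map dom qs1) = map dom ?Q" "lead \<I> x (map cod qs1) = map cod ?Q" by (simp_all add: map_lead)
    have n: "map dom ?Q \<noteq> []" "map cod ?Q \<noteq> []" using Q by auto
    have qo: "set (map dom ?Q) \<subseteq> sobj S" "set (map cod ?Q) \<subseteq> sobj S" using Q by auto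
    have k: "tl_comp x (Suc (length qs1)) y = x" using False by (cases x; cases y) (auto simp: tl_comp_def)
    have l: "lead (\<one> \<I>) x (qs1 @ zs) = ?Q @ zs" for zs by (simp add: lead_def)
    have "lpa (?Q @ ids as @ qs2) = lpa (lpa (?Q @ ids as) # qs2)" using Q by (simp flip: lpa_append)
    also have "lpa (?Q @ ids as) = lpa (lpa ?Q # ids as)" by (rule lpa_append[OF Q(1)])
    finally have l2: "lpa (?Q @ ids as @ qs2) = lpa (lpa (lpa ?Q # ids as) # qs2)" .
    have l3: "lpa (?Q @ \<one> (cod f) # qs2) = lpa ((lpa ?Q \<otimes> \<one> (cod f)) # qs2)" using Q by (simp add: lpa_append)
    let ?r = "\<lambda>X. rebracket S X y as"
    have r: "(lpa ?Q \<otimes> \<one> (cod f)) \<bullet> ((\<one> (lp (map dom ?Q)) \<otimes> f) \<bullet> ?r (lp (map dom ?Q))) =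
        ((\<one> (lp (map cod ?Q)) \<otimes> f) \<bullet> ?r (lp (map cod ?Q))) \<bullet> lpa (lpa ?Q # ids as)"
    proof -
      have "set (lead \<I> y as) \<subseteq> sobj S" using as by (auto simp: lead_def)
      moreover have "lead (\<one> \<I>) y (ids as) = ids (lead \<I> y as)" by (simp add: lead_def)
      ultimately have "?r (lp (map cod ?Q)) \<bullet> lpa (lpa ?Q # ids as) = (lpa ?Q \<otimes> \<one> (lp (lead \<I> y as))) \<bullet> ?r (lp (map dom ?Q))"
        using rebracket_natural[of y "ids as" "lpa ?Q"] pl as Q lead_lp[OF pl as] by simp
      then show ?thesis using f Q pl as qo n lead_lp[OF pl as] by simp
    qed
    have la: "lp (lp (map dom ?Q) # as) = dom (lpa (lpa ?Q # ids as))" using Q as by simp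
    show ?thesis
      unfolding whisker_eq(2)[OF d(1) n(1)] whisker_eq(2)[OF d(2) n(2)] k l l2 l3
      using f Q pl as qo n o qs lead_lp[OF pl as] r by (simp add: lpa_comp del: map_map)
  qed
qed

lemma cat_simps [simp]: "Obj (scat S) = sobj S" "hom (scat S) = shom S" "Comp (scat S) = scomp S" "Idn (scat S) = sid S"
  by (simp_all add: sobj_def shom_def scomp_def sid_def)

lemma lead_map_arr: "set ps \<subseteq> Arr (scat S) \<Longrightarrow> set (lead (\<one> \<I>) x ps) \<subseteq> Arr (scat S)"
  "map dom (lead (\<one> \<I>) x ps) = lead \<I> x (map dom ps)" "map cod (lead (\<one> \<I>) x ps) = lead \<I> x (map cod ps)"
  "lead e x ps = [] \<longleftrightarrow> x = Tight \<and> ps = []"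
  by (cases x; simp)+

lemma mm_T_iff:
  "set as \<subseteq> sobj S \<Longrightarrow> b \<in> sobj S \<Longrightarrow> f \<in> mm T x as b \<longleftrightarrow> arr f \<and> dom f = lp (lead \<I> x as) \<and> cod f = b"
  by (simp add: mm_def multicategory_of_def mdom_simps shom_iff)

lemma act_T:
  "set ps \<subseteq> Arr (scat S) \<Longrightarrow> arr q \<Longrightarrow> arr f \<Longrightarrow> dom f = lp (lead \<I> x (map cod ps)) \<Longrightarrow> cod f = dom q \<Longrightarrow>
    ap (fmap (mfun T (x, length ps)) (ps, q)) f = q \<bullet> (f \<bullet> lpa (lead (\<one> \<I>) x ps))"
  by (simp add: multicategory_of_def mdom_simps shom_iff ap_def)

lemma post_T:
  assumes "(x, length as) \<in> mm_kinds" "set as \<subseteq> sobj S" "arr f" "dom f = lp (lead \<I> x as)" "arr q" "dom q = cod f"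
  shows "post T x as q f = q \<bullet> f"
proof -
  have n: "lead \<I> x as \<noteq> []" using assms(1) by (auto simp: lead_map_arr mm_kinds_def)
  have s: "set (lead \<I> x as) \<subseteq> sobj S" using assms(2) by (auto simp: lead_def)
  have l: "lead (\<one> \<I>) x (ids as) = ids (lead \<I> x as)" by (simp add: lead_def)
  show ?thesis using act_T[of "ids as" q f x] assms n s by (simp add: post_def l del: map_map)
qed

lemma pre_T:
  assumes "set bs1 \<subseteq> sobj S" "set bs2 \<subseteq> sobj S" "arr g" "dom g = lp (lead \<I> x (bs1 @ cod p # bs2))" "arr p"
  shows "pre T x (bs1 @ cod p # bs2) (cod g) (Suc (length bs1)) p g = g \<bullet> lpa (lead (\<one> \<I>) x (ids bs1 @ p # ids bs2))"
proof -
  have s: "set (ids bs1 @ p # ids bs2) \<subseteq> Arr (scat S)" using assms by auto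
  have n: "lead (\<one> \<I>) x (ids bs1 @ p # ids bs2) \<noteq> []" by (simp add: lead_map_arr)
  have "pre T x (bs1 @ cod p # bs2) (cod g) (Suc (length bs1)) p g = 
    \<one> (cod g) \<bullet> (g \<bullet> lpa (lead (\<one> \<I>) x (ids bs1 @ p # ids bs2)))"
    using act_T[OF s, of "\<one> (cod g)" g x] assms by (simp add: pre_def list_update_append)
  then show ?thesis using assms n lead_map_arr(1)[OF s, of x] by (simp add: lead_map_arr)
qed

lemma functorial_T:
  assumes "(x, n) \<in> mm_kinds"
  shows "is_functor (mdom (scat S) n) set_cat (mfun T (x, n))"
proof (rule is_functorI)
  let ?F = "mfun T (x, n)"
  have ne: "lead e x (zs :: 'a list) \<noteq> []" if "length zs = n" for e :: 'a and zs 
    using assms that by (auto simp: lead_map_arr mm_kinds_def)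
  have fo: "fobj ?F (as, b) = shom S (lp (lead \<I> x as)) b" if "length as = n" "set as \<subseteq> sobj S" "b \<in> sobj S" for as b
    using that by (simp add: multicategory_of_def mdom_simps)
  have fm: "ap (fmap ?F (ps, q)) f = q \<bullet> (f \<bullet> lpa (lead (\<one> \<I>) x ps))"
    if "length ps = n" "set ps \<subseteq> Arr (scat S)" "arr q" "arr f" "dom f = lp (lead \<I> x (map cod ps))" "cod f = dom q" for ps q f
    using act_T[of ps q f x] that by simp
  show "fobj ?F a \<in> Obj set_cat" for a by (simp add: set_cat_def cat_of_homs_def)
  show h: "fmap ?F t \<in> hom set_cat (fobj ?F a) (fobj ?F b)" if "t \<in> hom (mdom (scat S) n) a b" for t a b
  proof -
    obtain ps q where [simp]: "t = (ps, q)" by (cases t)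
    have t: "length ps = n" "set ps \<subseteq> Arr (scat S)" "arr q" "a = (map cod ps, dom q)" "b = (map dom ps, cod q)"
      using that by (auto simp: hom_def mdom_simps)
    have ob: "set (map cod ps) \<subseteq> sobj S" "set (map dom ps) \<subseteq> sobj S" using t(2) by auto
    show ?thesis
      unfolding hom_set_cat t(4,5) using t(1-3) ob ne[of ps] lead_map_arr(1)[OF t(2), of x]
      by (auto simp: multicategory_of_def mdom_simps shom_iff lead_map_arr)
  qed
  note hs = category.comp_in_hom[OF category_mdom[OF category]]
  show "fmap ?F (Idn (mdom (scat S) n) a) = Idn set_cat (fobj ?F a)" if "a \<in> Obj (mdom (scat S) n)" for a
  proof (rule set_cat_eqI)
    have i: "Idn (mdom (scat S) n) a \<in> hom (mdom (scat S) n) a a"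
      using category.idn_in_hom[OF category_mdom[OF category] that] .
    show "fmap ?F (Idn (mdom (scat S) n) a) \<in> hom set_cat (fobj ?F a) (fobj ?F a)" by (rule h[OF i])
    show "Idn set_cat (fobj ?F a) \<in> hom set_cat (fobj ?F a) (fobj ?F a)"
      by (rule category.idn_in_hom[OF category_set_cat]) (simp add: set_cat_def cat_of_homs_def)
    show "ap (fmap ?F (Idn (mdom (scat S) n) a)) f = ap (Idn set_cat (fobj ?F a)) f" if f: "f \<in> fobj ?F a" for f
    proof -
      obtain as b where a: "a = (as, b)" "length as = n" "set as \<subseteq> sobj S" "b \<in> sobj S"
        using \<open>a \<in> _\<close> by (cases a) (auto simp: mdom_simps)
      have l: "lead (\<one> \<I>) x (ids as) = ids (lead \<I> x as)" "set (lead \<I> x as) \<subseteq> sobj S" using a(3) by (auto simp: lead_def)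
      have "ap (fmap ?F (ids as, \<one> b)) f = \<one> b \<bullet> (f \<bullet> lpa (lead (\<one> \<I>) x (ids as)))"
        using a f by (intro fm) (auto simp: fo shom_iff)
      then show ?thesis using a f l ne[of as] by (simp add: fo shom_iff mdom_simps set_cat_ap(3))
    qed
  qed
  show "fmap ?F (Comp (mdom (scat S) n) u t) = Comp set_cat (fmap ?F u) (fmap ?F t)"
    if tu: "t \<in> hom (mdom (scat S) n) a b" "u \<in> hom (mdom (scat S) n) b c" for t u a b c
  proof (rule set_cat_eqI)
    show "fmap ?F (Comp (mdom (scat S) n) u t) \<in> hom set_cat (fobj ?F a) (fobj ?F c)" by (rule h[OF hs[OF tu]])
    show "Comp set_cat (fmap ?F u) (fmap ?F t) \<in> hom set_cat (fobj ?F a) (fobj ?F c)"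
      by (rule category.comp_in_hom[OF category_set_cat h[OF tu(1)] h[OF tu(2)]])
    show "ap (fmap ?F (Comp (mdom (scat S) n) u t)) f = ap (Comp set_cat (fmap ?F u) (fmap ?F t)) f" if f: "f \<in> fobj ?F a" for f
    proof -
      obtain ps q ps' q' where [simp]: "t = (ps, q)" "u = (ps', q')" by (cases t, cases u)
      have t: "length ps = n" "set ps \<subseteq> Arr (scat S)" "arr q" "a = (map cod ps, dom q)" "b = (map dom ps, cod q)"
        "length ps' = n" "set ps' \<subseteq> Arr (scat S)" "arr q'" "map cod ps' = map dom ps" "dom q' = cod q"
        using tu by (auto simp: hom_def mdom_simps)
      have ob: "set (map cod ps) \<subseteq> sobj S" using t(2) by auto
      have f': "arr f" "dom f = lp (lead \<I> x (map cod ps))" "cod f = dom q"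
        using f t(1,3) ob unfolding t(4) by (simp_all add: fo shom_iff)
      have m: "map2 (\<bullet>) (lead (\<one> \<I>) x ps) (lead (\<one> \<I>) x ps') = lead (\<one> \<I>) x (map2 (\<bullet>) ps ps')" by (cases x) simp_all
      have c: "set (map2 (\<bullet>) ps ps') \<subseteq> Arr (scat S)" "map cod (map2 (\<bullet>) ps ps') = map cod ps"
      proof -
        have nth: "ps ! k \<in> Arr (scat S)" "ps' ! k \<in> Arr (scat S)" "dom (ps ! k) = cod (ps' ! k)" if "k < n" for k
          using t that nth_map[of k ps dom] nth_map[of k ps' cod] by auto
        then show "set (map2 (\<bullet>) ps ps') \<subseteq> Arr (scat S)" "map cod (map2 (\<bullet>) ps ps') = map cod ps"
          using t(1,6) by (auto simp: set_conv_nth intro!: nth_equalityI)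
      qed
      let ?l = "lpa (lead (\<one> \<I>) x ps)" and ?l' = "lpa (lead (\<one> \<I>) x ps')"
      have l: "arr ?l" "arr ?l'" "dom ?l = lp (lead \<I> x (map dom ps))" "cod ?l = dom f" "cod ?l' = dom ?l"
        using lead_map_arr(1)[OF t(2), of x] lead_map_arr(1)[OF t(7), of x] ne[OF t(1)] ne[OF t(6)] t(9) f'
        by (simp_all add: lead_map_arr)
      have "lpa (lead (\<one> \<I>) x (map2 (\<bullet>) ps ps')) = ?l \<bullet> ?l'"
        unfolding m[symmetric] using lead_map_arr(1)[OF t(2), of x] lead_map_arr(1)[OF t(7), of x] ne[OF t(6)] t(9)
        by (intro lpa_comp[symmetric]) (simp_all add: lead_map_arr)
      moreover have "ap (fmap ?F (map2 (\<bullet>) ps ps', q' \<bullet> q)) f = (q' \<bullet> q) \<bullet> (f \<bullet> lpa (lead (\<one> \<I>) x (map2 (\<bullet>) ps ps')))"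
        using t c f' by (intro fm) simp_all
      moreover have "ap (fmap ?F (ps, q)) f = q \<bullet> (f \<bullet> ?l)" using t f' by (intro fm) simp_all
      moreover have "ap (fmap ?F (ps', q')) (q \<bullet> (f \<bullet> ?l)) = q' \<bullet> ((q \<bullet> (f \<bullet> ?l)) \<bullet> ?l')" using t f' l by (intro fm) simp_all
      moreover have "ap (Comp set_cat (fmap ?F u) (fmap ?F t)) f = ap (fmap ?F u) (ap (fmap ?F t) f)"
        by (rule set_cat_ap(2)[OF h[OF tu(1)] f])
      ultimately show ?thesis using t f' l by (simp add: mdom_simps)
    qed
  qed
qed (use category_mdom[OF category] category_set_cat in \<open>auto simp: multicategory_of_def\<close>)

end

lemma split_at:
  assumes "1 \<le> i" "i \<le> length bs"
  obtains bs1 b bs2 where "bs = bs1 @ b # bs2" "i = Suc (length bs1)"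
proof (rule that)
  show "bs = take (i - 1) bs @ bs ! (i - 1) # drop i bs" using id_take_nth_drop[of "i - 1" bs] assms by simp
  show "i = Suc (length (take (i - 1) bs))" using assms by simp
qed

lemma plug_append [simp]: "plug (bs1 @ b # bs2) (Suc (length bs1)) as = bs1 @ as @ bs2"
  by (simp add: plug_def)

context skew_monoidal_category
begin

lemma sub_T: "msub T x (bs1 @ b # bs2) c (Suc (length bs1)) y as g f = g \<bullet> whisker S x bs1 y as bs2 f"
  by (simp add: multicategory_of_def)

lemma sub_cases_plain: "(k, (y, length as)) \<in> sub_cases \<Longrightarrow> plain y as"
  by (auto simp: sub_cases_def plain_def)

lemma jm_T:
  assumes "as \<noteq> []" "set as \<subseteq> sobj S" "arr f" "dom f = lp as"
  shows "jm T as (cod f) f = f \<bullet> lpa (lambda S (hd as) # ids (tl as))"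
  using assms by (simp add: jm_def multicategory_of_def mdom_simps ap_def shom_iff)

lemma j_nat_T:
  assumes "n \<in> {1, 2}"
  shows "nat_trans (mdom (scat S) n) set_cat (mfun T (Tight, n)) (mfun T (Loose, n)) (mj T n)"
proof (rule set_nat_transI)
  show "is_functor (mdom (scat S) n) set_cat (mfun T (Tight, n))" "is_functor (mdom (scat S) n) set_cat (mfun T (Loose, n))"
    using assms by (auto intro!: functorial_T simp: mm_kinds_def)
  have ne: "as \<noteq> []" if "length as = n" for as :: "'a list" using that assms by auto
  have js: "arr (lpa (lambda S (hd as) # ids (tl as)))" "dom (lpa (lambda S (hd as) # ids (tl as))) = lp (\<I> # as)"
    "cod (lpa (lambda S (hd as) # ids (tl as))) = lp as" if "length as = n" "set as \<subseteq> sobj S" for as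
    using ne[OF that(1)] that(2) by (cases as; simp)+
  show "mj T n \<in> extensional (Obj (mdom (scat S) n))" by (simp add: multicategory_of_def)
  show "mj T n a \<in> hom set_cat (fobj (mfun T (Tight, n)) a) (fobj (mfun T (Loose, n)) a)" if a: "a \<in> Obj (mdom (scat S) n)" for a
  proof -
    obtain as b where [simp]: "a = (as, b)" by (cases a)
    have "length as = n" "set as \<subseteq> sobj S" "b \<in> sobj S" using a by (simp_all add: mdom_simps)
    then show ?thesis using js[of as] unfolding hom_set_cat by (auto simp: multicategory_of_def mdom_simps shom_iff)
  qed
  show "ap (mj T n b) (ap (fmap (mfun T (Tight, n)) t) f) = ap (fmap (mfun T (Loose, n)) t) (ap (mj T n a) f)"
    if t: "t \<in> hom (mdom (scat S) n) a b" and f: "f \<in> fobj (mfun T (Tight, n)) a" for t a b f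
  proof -
    obtain ps q where [simp]: "t = (ps, q)" by (cases t)
    have t': "length ps = n" "set ps \<subseteq> Arr (scat S)" "arr q" "a = (map cod ps, dom q)" "b = (map dom ps, cod q)"
      using t by (auto simp: hom_def mdom_simps)
    have ob: "set (map cod ps) \<subseteq> sobj S" "set (map dom ps) \<subseteq> sobj S" using t'(2) by auto
    have f': "arr f" "dom f = lp (map cod ps)" "cod f = dom q"
      using f t'(1,3) ob by (simp_all add: t' multicategory_of_def mdom_simps shom_iff)
    have j: "ap (mj T n (as, b)) g = g \<bullet> lpa (lambda S (hd as) # ids (tl as))"
      if "length as = n" "set as \<subseteq> sobj S" "arr g" "dom g = lp as" "cod g = b" for as b g
      using jm_T[of as g] that ne[OF that(1)] by (simp add: jm_def)
    have l: "arr (lpa ps)" "dom (lpa ps) = lp (map dom ps)" "cod (lpa ps) = lp (map cod ps)" using ne[OF t'(1)] t'(2) by auto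
    have l': "arr (lpa (\<one> \<I> # ps))" "dom (lpa (\<one> \<I> # ps)) = lp (\<I> # map dom ps)" "cod (lpa (\<one> \<I> # ps)) = lp (\<I> # map cod ps)"
      using t'(2) by auto
    have nat: "lpa ps \<bullet> lpa (lambda S (hd (map dom ps)) # ids (tl (map dom ps))) =
        lpa (lambda S (hd (map cod ps)) # ids (tl (map cod ps))) \<bullet> lpa (\<one> \<I> # ps)"
    proof (cases ps)
      case (Cons r rs)
      then have "arr r" "set rs \<subseteq> Arr (scat S)" "dom ` set rs \<subseteq> sobj S" "cod ` set rs \<subseteq> sobj S" using t'(2) by auto
      then show ?thesis using Cons by (simp add: lpa_comp lambda_natural del: map_map)
    qed (use ne[OF t'(1)] in simp)
    have "ap (fmap (mfun T (Tight, n)) (ps, q)) f = q \<bullet> (f \<bullet> lpa ps)" using act_T[of ps q f Tight] t' f' by simp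
    moreover have "ap (fmap (mfun T (Loose, n)) (ps, q)) (f \<bullet> lpa (lambda S (hd (map cod ps)) # ids (tl (map cod ps)))) =
        q \<bullet> ((f \<bullet> lpa (lambda S (hd (map cod ps)) # ids (tl (map cod ps)))) \<bullet> lpa (\<one> \<I> # ps))"
      using act_T[of ps q "f \<bullet> lpa (lambda S (hd (map cod ps)) # ids (tl (map cod ps)))" Loose] t' f' js[OF _ ob(1)] by simp
    moreover have "ap (mj T n b) (q \<bullet> (f \<bullet> lpa ps)) = (q \<bullet> (f \<bullet> lpa ps)) \<bullet> lpa (lambda S (hd (map dom ps)) # ids (tl (map dom ps)))"
      unfolding t'(5) using t' f' l ob by (intro j) simp_all
    moreover have "ap (mj T n a) f = f \<bullet> lpa (lambda S (hd (map cod ps)) # ids (tl (map cod ps)))"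
      unfolding t'(4) using t' f' ob by (intro j) simp_all
    ultimately show ?thesis using t' f' l l' js[OF _ ob(1)] js[OF _ ob(2)] nat by simp
  qed
qed

text \<open>Split \<open>bs\<close> at the position of the substitution; each law is then one of the properties of whiskering.\<close>

lemma short_skew_multicategory_T_naturality:
  assumes t: "((x, length bs), (y, length as)) \<in> sub_cases"
    and ob: "set bs \<subseteq> sobj S" "c \<in> sobj S" "set as \<subseteq> sobj S" and i: "1 \<le> i" "i \<le> length bs"
    and g: "g \<in> mm T x bs c"
  shows "f \<in> mm T y as (bs ! (i - 1)) \<Longrightarrow> msub T x bs c i y as g f \<in> mm T (tl_comp x i y) (plug bs i as) c"
    and "f \<in> mm T y as (bs ! (i - 1)) \<Longrightarrow> q \<in> shom S c c' \<Longrightarrow>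
       msub T x bs c' i y as (post T x bs q g) f = post T (tl_comp x i y) (plug bs i as) q (msub T x bs c i y as g f)"
    and "f \<in> mm T y as (bs ! (i - 1)) \<Longrightarrow> 1 \<le> k \<Longrightarrow> k \<le> length as \<Longrightarrow> p \<in> shom S a' (as ! (k - 1)) \<Longrightarrow>
       msub T x bs c i y (as[k - 1 := a']) g (pre T y as (bs ! (i - 1)) k p f) =
       pre T (tl_comp x i y) (plug bs i as) c (i + k - 1) p (msub T x bs c i y as g f)"
    and "f \<in> mm T y as (bs ! (i - 1)) \<Longrightarrow> 1 \<le> k \<Longrightarrow> k \<le> length bs \<Longrightarrow> k \<noteq> i \<Longrightarrow> p \<in> shom S a' (bs ! (k - 1)) \<Longrightarrow>
       msub T x (bs[k - 1 := a']) c i y as (pre T x bs c k p g) f =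
       pre T (tl_comp x i y) (plug bs i as) c (if k < i then k else k + length as - 1) p (msub T x bs c i y as g f)"
    and "p \<in> shom S a' (bs ! (i - 1)) \<Longrightarrow> f \<in> mm T y as a' \<Longrightarrow>
       msub T x (bs[i - 1 := a']) c i y as (pre T x bs c i p g) f = msub T x bs c i y as g (post T y as p f)"
proof -
  obtain bs1 b bs2 where bs [simp]: "bs = bs1 @ b # bs2" "i = Suc (length bs1)" using split_at[OF i] .
  note pl = sub_cases_plain[OF t]
  have o [simp]: "set bs1 \<subseteq> sobj S" "set bs2 \<subseteq> sobj S" "b \<in> sobj S" using ob by auto
  have g' [simp]: "arr g" "dom g = lp (lead \<I> x (bs1 @ b # bs2))" "cod g = c" using g ob by (simp_all add: mm_T_iff)
  note W = whisker_arr[OF pl ob(3) o(1,2)] and D = whisker_dinatural[OF pl ob(3) o(1,2)] and I = whisker_inner[OF pl ob(3) o(1,2)]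
  have s: "set (plug bs i as) \<subseteq> sobj S" using ob by (auto simp: plug_def)
  have k: "(x, length bs) \<in> mm_kinds" "(y, length as) \<in> mm_kinds" "(tl_comp x i y, length (plug bs i as)) \<in> mm_kinds"
    using t composable_comp_kinds[of x bs y as i] i by (auto simp: sub_cases_def mm_kinds_def composable_def)
  have nl: "lead (\<one> \<I>) x (ids bs1 @ p # ids bs2) \<noteq> []" for p by (simp add: lead_map_arr)
  have sl: "arr p \<Longrightarrow> set (lead (\<one> \<I>) x (ids bs1 @ p # ids bs2)) \<subseteq> Arr (scat S)" for p by (intro lead_map_arr(1)) simp
  {
    assume "f \<in> mm T y as (bs ! (i - 1))"
    then have f: "arr f" "dom f = lp (lead \<I> y as)" "cod f = b" using ob by (simp_all add: mm_T_iff)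
    show 1: "msub T x bs c i y as g f \<in> mm T (tl_comp x i y) (plug bs i as) c"
      using W[OF f, of x] ob s by (simp add: sub_T mm_T_iff)
    show "msub T x bs c' i y as (post T x bs q g) f = post T (tl_comp x i y) (plug bs i as) q (msub T x bs c i y as g f)"
      if "q \<in> shom S c c'"
      using that W[OF f, of x] s k ob post_T[OF k(3), of "g \<bullet> whisker S x bs1 y as bs2 f" q] post_T[OF k(1), of g q]
      by (simp add: sub_T shom_iff)
    show "msub T x bs c i y (as[k - 1 := a']) g (pre T y as (bs ! (i - 1)) k p f) =
       pre T (tl_comp x i y) (plug bs i as) c (i + k - 1) p (msub T x bs c i y as g f)"
      if k: "1 \<le> k" "k \<le> length as" and p: "p \<in> shom S a' (as ! (k - 1))"
    proof -
      obtain as1 a as2 where as: "as = as1 @ a # as2" "k = Suc (length as1)" using split_at[OF k] .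
      have p: "arr p" "dom p = a'" "cod p = a" using p as by (simp_all add: shom_iff)
      have oa: "set as1 \<subseteq> sobj S" "set as2 \<subseteq> sobj S" "a \<in> sobj S" using ob(3) as by auto
      let ?ps = "ids as1 @ p # ids as2"
      have ps: "set ?ps \<subseteq> Arr (scat S)" "map cod ?ps = as" "map dom ?ps = as1 @ a' # as2" using p oa as by auto
      have "pre T y as (bs ! (i - 1)) k p f = f \<bullet> lpa (lead (\<one> \<I>) y ?ps)"
        using pre_T[of as1 as2 f y p] f p oa as by simp
      moreover have "pre T (tl_comp x i y) (plug bs i as) c (i + k - 1) p (g \<bullet> whisker S x bs1 y as bs2 f) =
          (g \<bullet> whisker S x bs1 y as bs2 f) \<bullet> lpa (lead (\<one> \<I>) (tl_comp x i y) (ids bs1 @ ?ps @ ids bs2))"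
        using pre_T[of "bs1 @ as1" "as2 @ bs2" "g \<bullet> whisker S x bs1 y as bs2 f" "tl_comp x i y" p] W[OF f, of x] p oa ob as by simp
      moreover have "whisker S x bs1 y (as1 @ a' # as2) bs2 (f \<bullet> lpa (lead (\<one> \<I>) y ?ps)) =
          whisker S x bs1 y as bs2 f \<bullet> lpa (lead (\<one> \<I>) (tl_comp x (Suc (length bs1)) y) (ids bs1 @ ?ps @ ids bs2))"
        using I[OF f(1,2) ps(1,2), of x] unfolding ps(3) .
      moreover have "as[k - 1 := a'] = as1 @ a' # as2" using as by simp
      moreover have "lead (\<one> \<I>) (tl_comp x i y) (ids bs1 @ ?ps @ ids bs2) \<noteq> []" by (simp add: lead_map_arr)
      moreover have "set (lead (\<one> \<I>) (tl_comp x i y) (ids bs1 @ ?ps @ ids bs2)) \<subseteq> Arr (scat S)"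
        by (intro lead_map_arr(1)) (use p oa in simp)
      moreover have "map cod (ids bs1 @ ?ps @ ids bs2) = bs1 @ as @ bs2" using p oa as by simp
      ultimately show ?thesis using W[OF f, of x] by (simp add: sub_T lead_map_arr del: map_append)
    qed
    show "msub T x (bs[k - 1 := a']) c i y as (pre T x bs c k p g) f =
       pre T (tl_comp x i y) (plug bs i as) c (if k < i then k else k + length as - 1) p (msub T x bs c i y as g f)"
      if k: "1 \<le> k" "k \<le> length bs" "k \<noteq> i" and p: "p \<in> shom S a' (bs ! (k - 1))"
    proof -
      have O: "(g \<bullet> lpa (lead (\<one> \<I>) x (qs1 @ \<one> b # qs2))) \<bullet> whisker S x (map dom qs1) y as (map dom qs2) f =
          (g \<bullet> whisker S x bs1 y as bs2 f) \<bullet> lpa (lead (\<one> \<I>) (tl_comp x i y) (qs1 @ ids as @ qs2))"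
        if q: "set qs1 \<subseteq> Arr (scat S)" "set qs2 \<subseteq> Arr (scat S)" "map cod qs1 = bs1" "map cod qs2 = bs2" for qs1 qs2
      proof -
        have oq: "set (map dom qs1) \<subseteq> sobj S" "set (map dom qs2) \<subseteq> sobj S" using q by auto
        have l: "length bs1 = length qs1" using q(3) by auto
        have "lead (\<one> \<I>) x (qs1 @ \<one> b # qs2) \<noteq> []" "set (lead (\<one> \<I>) x (qs1 @ \<one> b # qs2)) \<subseteq> Arr (scat S)"
          using q(1,2) by (auto simp: lead_def)
        moreover have "lead (\<one> \<I>) (tl_comp x i y) (qs1 @ ids as @ qs2) \<noteq> []"
          using q(3) pl by (cases y) (auto simp: lead_map_arr plain_def tl_comp_def)
        moreover have "set (lead (\<one> \<I>) (tl_comp x i y) (qs1 @ ids as @ qs2)) \<subseteq> Arr (scat S)"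
          by (intro lead_map_arr(1)) (use q(1,2) ob(3) in auto)
        ultimately show ?thesis
          using whisker_outer[OF pl ob(3) f(1,2) q(1,2), of x] whisker_arr[OF pl ob(3) oq f, of x] W[OF f, of x] ob(3) q(3,4)
          by (simp add: f(3) l lead_map_arr)
      qed
      have P: "plug bs i as = bs1 @ as @ bs2" by simp
      have M: "msub T x bs c i y as g f = g \<bullet> whisker S x bs1 y as bs2 f" by (simp add: sub_T)
      show ?thesis
      proof (cases "k < i")
        case True
        with k obtain c1 d c2 where c: "bs1 = c1 @ d # c2" "k = Suc (length c1)" using split_at[of k bs1] by auto
        have p': "arr p" "dom p = a'" "cod p = d" using p c by (simp_all add: shom_iff)
        have oc: "set c1 \<subseteq> sobj S" "set c2 \<subseteq> sobj S" "d \<in> sobj S" using o(1) c by auto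
        let ?qs = "ids c1 @ p # ids c2"
        have "pre T x bs c k p g = g \<bullet> lpa (lead (\<one> \<I>) x (?qs @ \<one> b # ids bs2))"
          using pre_T[of c1 "c2 @ b # bs2" g x p] p' oc c by simp
        moreover have "pre T (tl_comp x i y) (bs1 @ as @ bs2) c k p (g \<bullet> whisker S x bs1 y as bs2 f) =
            (g \<bullet> whisker S x bs1 y as bs2 f) \<bullet> lpa (lead (\<one> \<I>) (tl_comp x i y) (?qs @ ids as @ ids bs2))"
          using pre_T[of c1 "c2 @ as @ bs2" "g \<bullet> whisker S x bs1 y as bs2 f" "tl_comp x i y" p] W[OF f, of x] p' oc ob c by simp
        moreover have "msub T x (bs[k - 1 := a']) c i y as h f = h \<bullet> whisker S x (c1 @ a' # c2) y as bs2 f" for h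
          using sub_T[of x "c1 @ a' # c2" b bs2 c y as h f] c by (simp add: list_update_append)
        moreover have "map dom ?qs = c1 @ a' # c2" "map cod ?qs = bs1" "set ?qs \<subseteq> Arr (scat S)" using p' oc c by auto
        moreover have "map dom (ids bs2) = bs2" "map cod (ids bs2) = bs2" "set (ids bs2) \<subseteq> Arr (scat S)" by simp_all
        ultimately show ?thesis
          using O[of ?qs "ids bs2"] True unfolding P M by (simp only: if_True)
      next
        case False
        with k have k': "1 \<le> k - i" "k - i \<le> length bs2" by auto
        then obtain c1 d c2 where c: "bs2 = c1 @ d # c2" "k - i = Suc (length c1)" by (rule split_at)
        have kl: "k = Suc (length (bs1 @ b # c1))" using c(2) k' by simp
        have bs': "bs = (bs1 @ b # c1) @ d # c2" using c by simp
        have p': "arr p" "dom p = a'" "cod p = d"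
          using p nth_append_length[of "bs1 @ b # c1" d c2] unfolding kl bs' by (simp_all add: shom_iff)
        have oc: "set c1 \<subseteq> sobj S" "set c2 \<subseteq> sobj S" "d \<in> sobj S" using o(2) c by auto
        let ?qs = "ids c1 @ p # ids c2"
        have "pre T x bs c k p g = g \<bullet> lpa (lead (\<one> \<I>) x (ids bs1 @ \<one> b # ?qs))"
          unfolding bs' kl using pre_T[of "bs1 @ b # c1" c2 g x p] p' oc c by simp
        moreover have "pre T (tl_comp x i y) (bs1 @ as @ bs2) c (k + length as - 1) p (g \<bullet> whisker S x bs1 y as bs2 f) =
            (g \<bullet> whisker S x bs1 y as bs2 f) \<bullet> lpa (lead (\<one> \<I>) (tl_comp x i y) (ids bs1 @ ids as @ ?qs))"
        proof -
          have "k + length as - 1 = Suc (length (bs1 @ as @ c1))" unfolding kl by simp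
          then show ?thesis
            using pre_T[of "bs1 @ as @ c1" c2 "g \<bullet> whisker S x bs1 y as bs2 f" "tl_comp x i y" p] W[OF f, of x] p' oc ob c by simp
        qed
        moreover have "msub T x (bs[k - 1 := a']) c i y as h f = h \<bullet> whisker S x bs1 y as (c1 @ a' # c2) f" for h
        proof -
          have "bs[k - 1 := a'] = bs1 @ b # (c1 @ a' # c2)" unfolding bs' kl by (simp add: list_update_append)
          then show ?thesis by (simp add: sub_T)
        qed
        moreover have "map dom ?qs = c1 @ a' # c2" "map cod ?qs = bs2" "set ?qs \<subseteq> Arr (scat S)" using p' oc c by auto
        moreover have "map dom (ids bs1) = bs1" "map cod (ids bs1) = bs1" "set (ids bs1) \<subseteq> Arr (scat S)" by simp_all
        ultimately show ?thesis
          using O[of "ids bs1" ?qs] False unfolding P M by (simp only: if_False)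
      qed
    qed
  }
  show "msub T x (bs[i - 1 := a']) c i y as (pre T x bs c i p g) f = msub T x bs c i y as g (post T y as p f)"
    if p: "p \<in> shom S a' (bs ! (i - 1))" and f: "f \<in> mm T y as a'"
  proof -
    have p': "arr p" "dom p = a'" "cod p = b" using p by (simp_all add: shom_iff)
    have f': "arr f" "dom f = lp (lead \<I> y as)" "cod f = a'" using f ob p' by (auto simp: mm_T_iff)
    have "pre T x bs c i p g = g \<bullet> lpa (lead (\<one> \<I>) x (ids bs1 @ p # ids bs2))" using pre_T[of bs1 bs2 g x p] p' by simp
    moreover have "post T y as p f = p \<bullet> f" using post_T[OF k(2), of f p] ob f' p' by simp
    moreover have "bs[i - 1 := a'] = bs1 @ a' # bs2" by simp
    ultimately show ?thesis
      using W[OF f', of x] D[OF f'(1,2) p'(1), of x] p' f' sl[OF p'(1)] nl[of p] by (simp add: sub_T lead_map_arr)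
  qed
qed

lemma circ_T:
  assumes "plain y as" "x = Tight \<Longrightarrow> bs1 = [] \<Longrightarrow> bs2 = [] \<Longrightarrow> False"
  shows "circ T x (bs1 @ b # bs2) c (Suc (length bs1)) y as g f = g \<bullet> whisker S x bs1 y as bs2 f"
  using assms by (auto simp: circ_def sub_T plain_def)

lemma circ_T_inst:
  "plain y as \<Longrightarrow> x = Loose \<or> bs \<noteq> [] \<Longrightarrow> circ T x (b # bs) c (Suc 0) y as g f = g \<bullet> whisker S x [] y as bs f"
  "plain y as \<Longrightarrow> circ T x (b # b' # bs) c 2 y as g f = g \<bullet> whisker S x [b] y as bs f"
  "plain y as \<Longrightarrow> circ T x (b # b' # b'' # bs) c 3 y as g f = g \<bullet> whisker S x [b, b'] y as bs f"
  using circ_T[of y as x "[]" bs b c g f] circ_T[of y as x "[b]" bs b' c g f] circ_T[of y as x "[b, b']" bs b'' c g f]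
  by (auto simp: numeral_2_eq_2 numeral_3_eq_3)

lemma circ_T_unary:
  "arr g \<Longrightarrow> dom g = lp (lead \<I> x (b # bs)) \<Longrightarrow> cod g = c \<Longrightarrow> set bs \<subseteq> sobj S \<Longrightarrow> arr p \<Longrightarrow> cod p = b \<Longrightarrow>
    circ T x (b # bs) c (Suc 0) Tight [a] g p = g \<bullet> lpa (lead (\<one> \<I>) x (p # ids bs))"
  "arr g \<Longrightarrow> dom g = b' \<odot> b \<Longrightarrow> cod g = c \<Longrightarrow> b' \<in> sobj S \<Longrightarrow> arr p \<Longrightarrow> cod p = b \<Longrightarrow>
    circ T Tight [b', b] c 2 Tight [a] g p = g \<bullet> (\<one> b' \<otimes> p)"
  using pre_T[of "[]" bs g x p] pre_T[of "[b']" "[]" g Tight p] by (auto simp: circ_def numeral_2_eq_2)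

lemma circ_T_unary_left:
  assumes "(y, length as) \<in> mm_kinds" "(y, length as) \<noteq> (Tight, 1)" "set as \<subseteq> sobj S" "arr f" "dom f = lp (lead \<I> y as)" "arr q" "dom q = cod f"
  shows "circ T Tight [b] c i y as q f = q \<bullet> f"
  using post_T[of y as f q] assms by (auto simp: circ_def)

lemma alpha_fused:
  assumes [simp]: "arr f" "arr g" "arr h" "arr k" "cod k = dom f \<odot> dom g" and "cod f = a" "cod g = b" "cod h = c"
  shows "alpha S a b c \<bullet> (((f \<otimes> g) \<bullet> k) \<otimes> h) = (f \<otimes> (g \<otimes> h)) \<bullet> (alpha S (dom f) (dom g) (dom h) \<bullet> (k \<otimes> \<one> (dom h)))"
proof -
  have "((f \<otimes> g) \<bullet> k) \<otimes> h = ((f \<otimes> g) \<otimes> h) \<bullet> (k \<otimes> \<one> (dom h))" by simp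
  then show ?thesis using comp_extend[OF alpha_natural[of f g h], where t = "k \<otimes> \<one> (dom h)"] assms(6-8) by auto
qed

lemma alpha_natural_last:
  assumes [simp]: "a \<in> sobj S" "b \<in> sobj S" "arr h" "arr k" "cod k = (a \<odot> b) \<odot> dom h" and "cod h = c"
  shows "alpha S a b c \<bullet> ((\<one> (a \<odot> b) \<otimes> h) \<bullet> k) = (\<one> a \<otimes> (\<one> b \<otimes> h)) \<bullet> (alpha S a b (dom h) \<bullet> k)"
  using comp_extend[OF alpha_natural[of "\<one> a" "\<one> b" h a b c], of k] assms(6) by auto

lemmas T_laws = alpha_fused alpha_natural_last pentagon alpha_rho lambda_alpha lambda_alpha_rho lambda_rho rho_natural
lemmas T_unfold = circ_T_inst circ_T_unary circ_T_unary_left mm_kinds_def plain_def whisker_eq rebracket_def plug_def tl_comp_def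

text \<open>With \<open>i = j = 2\<close> the law is the pentagon if \<open>h\<close> is binary, and the compatibility of \<open>\<alpha>\<close> with \<open>\<rho>\<close> if
  \<open>h\<close> is nullary. The other cases are naturality of \<open>\<alpha>\<close> and functoriality of the tensor product.\<close>

lemma short_skew_T_assoc:
  assumes o: "(z, length ds) \<in> {(Tight, 2), (Loose, 0)}" "length bs = 2" "length as = 2"
        "set bs \<subseteq> sobj S" "c \<in> sobj S" "set as \<subseteq> sobj S" "set ds \<subseteq> sobj S"
        "1 \<le> i" "i \<le> 2" "1 \<le> j" "j \<le> 2"
    and f: "f \<in> mm T Tight bs c" and g: "g \<in> mm T Tight as (bs ! (i - 1))" and h: "h \<in> mm T z ds (as ! (j - 1))"
  shows "circ T Tight bs c i (tl_comp Tight j z) (plug as j ds) f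
         (circ T Tight as (bs ! (i - 1)) j z ds g h) =
       circ T (tl_comp Tight i Tight) (plug bs i as) c (j + i - 1) z ds
         (circ T Tight bs c i Tight as f g) h"
proof -
  obtain b1 b2 a1 a2 where [simp]: "bs = [b1, b2]" "as = [a1, a2]" 
    using o(2,3) by (auto simp: numeral_2_eq_2 length_Suc_conv)
  have [simp]: "b1 \<in> sobj S" "b2 \<in> sobj S" "a1 \<in> sobj S" "a2 \<in> sobj S" "c \<in> sobj S" using o by auto
  have [simp]: "arr f" "dom f = b1 \<odot> b2" "cod f = c" using f by (simp_all add: mm_T_iff)
  have g': "arr g" "dom g = a1 \<odot> a2" "cod g = bs ! (i - 1)" using g o(4,8,9) by (auto simp: mm_T_iff nth_Cons split: nat.splits)
  have zd: "z = Tight \<and> (\<exists>d1 d2. ds = [d1, d2]) \<or> z = Loose \<and> ds = []" using o(1) by (auto simp: numeral_2_eq_2 length_Suc_conv)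
  have ij: "i = Suc 0 \<or> i = 2" "j = Suc 0 \<or> j = 2" using o by auto
  have h': "arr h" "dom h = lp (lead \<I> z ds)" "cod h = as ! (j - 1)" using h o ij by (auto simp: mm_T_iff)
  have d: "set ds \<subseteq> sobj S" by fact
  show ?thesis
    using ij zd g' h' d
    apply (elim disjE conjE exE)
           apply simp_all
           apply (simp_all add: T_unfold T_laws flip: numeral_2_eq_2)
    done
qed

lemma short_skew_T_parallel:
  assumes o: "(y, length as) \<in> {(Tight, 2), (Loose, 0)}" "(z, length ds) \<in> {(Tight, 2), (Loose, 0)}"
        "b1 \<in> sobj S" "b2 \<in> sobj S" "c \<in> sobj S" "set as \<subseteq> sobj S" "set ds \<subseteq> sobj S"
    and f: "f \<in> mm T Tight [b1, b2] c" and g: "g \<in> mm T y as b1" and h: "h \<in> mm T z ds b2"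
  shows "circ T (tl_comp Tight 1 y) (as @ [b2]) c (length as + 1) z ds (circ T Tight [b1, b2] c 1 y as f g) h =
       circ T (tl_comp Tight 2 z) (b1 # ds) c 1 y as (circ T Tight [b1, b2] c 2 z ds f h) g"
proof -
  have [simp]: "arr f" "dom f = b1 \<odot> b2" "cod f = c" using f o by (simp_all add: mm_T_iff)
  have g': "arr g" "dom g = lp (lead \<I> y as)" "cod g = b1" using g o by (auto simp: mm_T_iff)
  have h': "arr h" "dom h = lp (lead \<I> z ds)" "cod h = b2" using h o by (auto simp: mm_T_iff)
  have yz: "y = Tight \<and> (\<exists>d1 d2. as = [d1, d2]) \<or> y = Loose \<and> as = []" "z = Tight \<and> (\<exists>d1 d2. ds = [d1, d2]) \<or> z = Loose \<and> ds = []"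
    using o(1,2) by (auto simp: numeral_2_eq_2 length_Suc_conv)
  show ?thesis
    using yz g' h' o(3-)
    apply (elim disjE conjE exE)
       apply simp_all
       apply (simp_all add: T_unfold T_laws alpha_natural flip: numeral_2_eq_2 numeral_3_eq_3)
    done
qed

text \<open>The unit laws of a skew monoidal category that involve \<open>\<lambda>\<close> enter here: the one with \<open>\<alpha>\<close> and \<open>\<rho>\<close> for the
  second input, the one with \<open>\<alpha>\<close> for binary maps and the one with \<open>\<rho>\<close> for nullary maps.\<close>

lemma short_skew_T_j:
  shows "\<lbrakk>a \<in> sobj S; b1 \<in> sobj S; b2 \<in> sobj S; c \<in> sobj S; g \<in> mm T Tight [b1, b2] c; p \<in> shom S a b2\<rbrakk> \<Longrightarrow>
       circ T Tight [b1, b2] c 2 Loose [a] g (jm T [a] b2 p) = circ T Tight [b1, b2] c 2 Tight [a] g p"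
    and "\<lbrakk>a \<in> sobj S; b1 \<in> sobj S; b2 \<in> sobj S; c \<in> sobj S; g \<in> mm T Tight [b1, b2] c; p \<in> shom S a b1\<rbrakk> \<Longrightarrow>
       circ T Tight [b1, b2] c 1 Loose [a] g (jm T [a] b1 p) = jm T [a, b2] c (circ T Tight [b1, b2] c 1 Tight [a] g p)"
    and "\<lbrakk>p \<in> shom S a b; q \<in> shom S b c\<rbrakk> \<Longrightarrow>
       circ T Tight [b] c 1 Loose [a] q (jm T [a] b p) = jm T [a] c (circ T Tight [b] c 1 Tight [a] q p)"
    and "\<lbrakk>a1 \<in> sobj S; a2 \<in> sobj S; g \<in> mm T Tight [a1, a2] b; p \<in> shom S b c\<rbrakk> \<Longrightarrow>
       circ T Loose [b] c 1 Tight [a1, a2] (jm T [b] c p) g = jm T [a1, a2] c (circ T Tight [b] c 1 Tight [a1, a2] p g)"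
    and "\<lbrakk>v \<in> mm T Loose [] b; p \<in> shom S b c\<rbrakk> \<Longrightarrow>
       circ T Loose [b] c 1 Loose [] (jm T [b] c p) v = circ T Tight [b] c 1 Loose [] p v"
proof -
  have j1: "jm T [a] b p = p \<bullet> lambda S a" if "arr p" "dom p = a" "cod p = b" for a b p using jm_T[of "[a]" p] that by auto
  have j2: "jm T [a, b] c p = p \<bullet> (lambda S a \<otimes> \<one> b)" if "arr p" "dom p = a \<odot> b" "cod p = c" "a \<in> sobj S" "b \<in> sobj S" for a b c p
    using jm_T[of "[a, b]" p] that by auto
  have lam: "lambda S b \<bullet> ((\<one> \<I> \<otimes> f) \<bullet> t) = f \<bullet> (lambda S (dom f) \<bullet> t)" if "arr f" "cod f = b" "arr t" "cod t = \<I> \<odot> dom f" for f b t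
    using comp_extend[OF lambda_natural, of f b t] that arr_obj[of f] by simp
  have ob: "arr p \<Longrightarrow> cod p = b \<Longrightarrow> b \<in> sobj S" "arr p \<Longrightarrow> dom p = b \<Longrightarrow> b \<in> sobj S" for p b by auto
  have lar: "(\<one> b \<otimes> p) \<bullet> ((\<one> b \<otimes> lambda S (dom p)) \<bullet> (alpha S b \<I> (dom p) \<bullet> (rho S b \<otimes> \<one> (dom p)))) = \<one> b \<otimes> p"
    if "arr p" "b \<in> sobj S" for p b
    using that lambda_alpha_rho[of b "dom p"] by (simp del: interchange_extend)
  show "\<lbrakk>a \<in> sobj S; b1 \<in> sobj S; b2 \<in> sobj S; c \<in> sobj S; g \<in> mm T Tight [b1, b2] c; p \<in> shom S a b2\<rbrakk> \<Longrightarrow>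
       circ T Tight [b1, b2] c 2 Loose [a] g (jm T [a] b2 p) = circ T Tight [b1, b2] c 2 Tight [a] g p"
    using lar[of p b1] by (simp add: mm_T_iff shom_iff j1 T_unfold)
  show "\<lbrakk>a \<in> sobj S; b1 \<in> sobj S; b2 \<in> sobj S; c \<in> sobj S; g \<in> mm T Tight [b1, b2] c; p \<in> shom S a b1\<rbrakk> \<Longrightarrow>
       circ T Tight [b1, b2] c 1 Loose [a] g (jm T [a] b1 p) = jm T [a, b2] c (circ T Tight [b1, b2] c 1 Tight [a] g p)"
    by (simp add: mm_T_iff shom_iff j1 j2 T_unfold)
  show "\<lbrakk>p \<in> shom S a b; q \<in> shom S b c\<rbrakk> \<Longrightarrow>
       circ T Tight [b] c 1 Loose [a] q (jm T [a] b p) = jm T [a] c (circ T Tight [b] c 1 Tight [a] q p)"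
    using ob[of p] by (auto simp add: shom_iff j1 T_unfold)
  show "\<lbrakk>a1 \<in> sobj S; a2 \<in> sobj S; g \<in> mm T Tight [a1, a2] b; p \<in> shom S b c\<rbrakk> \<Longrightarrow>
       circ T Loose [b] c 1 Tight [a1, a2] (jm T [b] c p) g = jm T [a1, a2] c (circ T Tight [b] c 1 Tight [a1, a2] p g)"
    using ob[of p] by (auto simp add: mm_T_iff shom_iff j1 j2 T_unfold lam T_laws)
  show "\<lbrakk>v \<in> mm T Loose [] b; p \<in> shom S b c\<rbrakk> \<Longrightarrow>
       circ T Loose [b] c 1 Loose [] (jm T [b] c p) v = circ T Tight [b] c 1 Loose [] p v"
    using ob[of p] by (auto simp add: mm_T_iff shom_iff j1 j2 T_unfold lam T_laws)
qed

lemma short_skew_multicategory_T: "short_skew_multicategory T"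
proof (rule short_skew_multicategory.intro)
  show "Defs.category (mcat T)" using category by simp
  show "is_functor (mdom (mcat T) n) set_cat (mfun T (z, n))" if "(z, n) \<in> mm_kinds" for z n
    using functorial_T[OF that] by simp
  show "mm T Tight [a] b = hom (mcat T) a b" if "a \<in> Obj (mcat T)" "b \<in> Obj (mcat T)" for a b
    using that by (auto simp: mm_T_iff shom_iff)
  show "ap (fmap (mfun T (Tight, 1)) ([p], q)) f = Comp (mcat T) q (Comp (mcat T) f p)"
    if "p \<in> hom (mcat T) a' a" "f \<in> hom (mcat T) a b" "q \<in> hom (mcat T) b b'" for p f q a a' b b'
    using that act_T[of "[p]" q f Tight] by (simp add: shom_iff)
qed (use j_nat_T short_skew_T_j short_skew_T_assoc short_skew_T_parallel short_skew_multicategory_T_naturality in \<open>simp_all\<close>)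

end

context skew_monoidal_category
begin

text \<open>Precomposition with the universal maps does not change the underlying arrow, so that the required
  bijections are identities.\<close>

lemma is_lr_data_T: "is_lr_data T \<lparr>lr_tensor = (\<odot>), lr_theta = \<lambda>a b. \<one> (a \<odot> b), lr_unit = \<I>, lr_u = \<one> \<I>\<rparr>"
proof -
  have id: "bij_betw h A A'" if "\<And>f. f \<in> A \<Longrightarrow> h f = f" "A = A'" for h and A A' :: "'m set"
    using that by (auto simp: bij_betw_def inj_on_def)
  have k: "(Tight, Suc (length xs)) \<in> mm_kinds" if "length xs \<le> 2" for xs :: "'o list"
    using that by (auto simp: mm_kinds_def le_Suc_eq numeral_2_eq_2)
  have t: "circ T Tight (a \<odot> b # xs) (cod f) (Suc 0) Tight [a, b] f (\<one> (a \<odot> b)) = f"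
    if "a \<in> sobj S" "b \<in> sobj S" "set xs \<subseteq> sobj S" "arr f" "dom f = lp (a \<odot> b # xs)" for a b xs f
    using that lpa_ids[of "(a \<odot> b) # xs"] by (cases "xs = []") (simp_all add: mm_T_iff T_unfold)
  have i: "circ T Tight (\<I> # xs) (cod f) (Suc 0) Loose [] f (\<one> \<I>) = f"
    if "set xs \<subseteq> sobj S" "arr f" "dom f = lp (\<I> # xs)" for xs f
    using that lpa_ids[of "\<I> # xs"] by (cases "xs = []") (simp_all add: mm_T_iff T_unfold)
  show ?thesis
    unfolding is_lr_data_def by (auto simp: mm_T_iff t i intro!: id)
qed

end

subsection \<open>Its short braiding\<close>

text \<open>The isomorphisms of a short braiding are precompositions with a family of arrows of \<open>S\<close>; the list of inputs
  is that of the map before the exchange.\<close>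

definition precomposition :: "('o, 'm) smc \<Rightarrow> nat \<Rightarrow> nat \<Rightarrow> ('o list \<Rightarrow> 'm) \<Rightarrow> 'o list \<times> 'o \<Rightarrow> 'm set_arr" where
  "precomposition S n k r = (\<lambda>(as, c)\<in>Obj (mdom (scat S) n).
     (shom S (lprod S as) c, \<lambda>f\<in>shom S (lprod S as) c. scomp S f (r as), shom S (lprod S (swap_at k as)) c))"

definition short_braiding_of :: "('o, 'm) smc \<Rightarrow> ('o \<Rightarrow> 'o \<Rightarrow> 'o \<Rightarrow> 'm) \<Rightarrow> ('o, 'm) sbraid" where
  "short_braiding_of S s =
     \<lparr>beta32 = precomposition S 3 2 (\<lambda>as. s (as ! 0) (as ! 2) (as ! 1)),
      beta42 = precomposition S 4 2 (\<lambda>as. tens_arr S (s (as ! 0) (as ! 2) (as ! 1)) (sid S (as ! 3))),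
      beta43 = precomposition S 4 3 (\<lambda>as. s (tens_obj S (as ! 0) (as ! 1)) (as ! 3) (as ! 2))\<rparr>"

lemma swap_at_map: "1 \<le> k \<Longrightarrow> k < length as \<Longrightarrow> swap_at k (map f as) = map f (swap_at k as)"
  by (simp add: swap_at_def map_update)

lemma swap_at_map2:
  "1 \<le> k \<Longrightarrow> k < length as \<Longrightarrow> length bs = length as \<Longrightarrow> swap_at k (map2 f as bs) = map2 f (swap_at k as) (swap_at k bs)"
  by (simp add: swap_at_def map_update zip_update)

lemma set_swap_at: "1 \<le> k \<Longrightarrow> k < length as \<Longrightarrow> set (swap_at k as) = set as"
  unfolding swap_at_def by (subst set_swap) simp_all

lemma length_swap_at [simp]: "length (swap_at k as) = length as"
  by (simp add: swap_at_def)

lemma swap_at_Nil [simp]: "swap_at k as = [] \<longleftrightarrow> as = []"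
  by (simp add: swap_at_def)

lemma is_functor_swap:
  assumes "category C" "1 \<le> k" "k < n"
  shows "is_functor (mdom C n) (mdom C n) (swap_functor C n k)"
proof (rule is_functorI)
  have c: "category (mdom C n)" by (rule category_mdom[OF assms(1)])
  have i: "Idn C x \<in> Arr C" if "x \<in> Obj C" for x using category.idn_in_hom[OF assms(1) that] by (rule homD)
  show "category (mdom C n)" "category (mdom C n)" by (rule c)+
  show "fmap (swap_functor C n k) (Idn (mdom C n) a) = Idn (mdom C n) (fobj (swap_functor C n k) a)" if "a \<in> Obj (mdom C n)" for a
    using that assms(2,3) i by (cases a) (auto simp: swap_functor_def mdom_simps swap_at_map set_swap_at)
  fix f g a b c
  show "fmap (swap_functor C n k) f \<in> hom (mdom C n) (fobj (swap_functor C n k) a) (fobj (swap_functor C n k) b)"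
    if f: "f \<in> hom (mdom C n) a b"
  proof -
    note ab = category.hom_objD[OF c f]
    show ?thesis using f ab assms(2,3)
      by (cases f; cases a; cases b) (auto simp: hom_def mdom_simps swap_functor_def set_swap_at swap_at_map)
  qed
  show "fmap (swap_functor C n k) (Comp (mdom C n) g f) = Comp (mdom C n) (fmap (swap_functor C n k) g) (fmap (swap_functor C n k) f)"
    if f: "f \<in> hom (mdom C n) a b" "g \<in> hom (mdom C n) b c"
    using f category.comp_in_hom[OF c f] assms(2,3)
    by (cases f; cases g) (auto simp: hom_def mdom_simps swap_functor_def swap_at_map2)
qed (use assms in \<open>auto simp: swap_functor_def mdom_simps set_swap_at\<close>)

context skew_monoidal_category
begin

lemma ap_precomposition:
  "length as = n \<Longrightarrow> set as \<subseteq> sobj S \<Longrightarrow> c \<in> sobj S \<Longrightarrow> arr f \<Longrightarrow> dom f = lp as \<Longrightarrow> cod f = c \<Longrightarrow>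
    ap (precomposition S n k r (as, c)) f = f \<bullet> r as"
  by (simp add: precomposition_def mdom_simps ap_def shom_iff)

lemma is_exchange_precomposition:
  assumes n: "n \<in> {3, 4}" and k: "1 \<le> k" "k < n"
    and r: "\<And>as. length as = n \<Longrightarrow> set as \<subseteq> sobj S \<Longrightarrow> inverse_arrows (scat S) (r as) (r' as) \<and> r as \<in> shom S (lp (swap_at k as)) (lp as)"
    and nat: "\<And>ps. length ps = n \<Longrightarrow> set ps \<subseteq> Arr (scat S) \<Longrightarrow> r (map cod ps) \<bullet> lpa (swap_at k ps) = lpa ps \<bullet> r (map dom ps)"
  shows "is_exchange T n k (precomposition S n k r)"
proof -
  let ?X = "mdom (scat S) n" and ?F = "mfun T (Tight, n)" and ?\<beta> = "precomposition S n k r"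
  let ?G = "comp_functor ?X ?F (swap_functor (scat S) n k)"
  have kn: "(Tight, n) \<in> mm_kinds" using n by (auto simp: mm_kinds_def)
  have F: "is_functor ?X set_cat ?F" by (rule functorial_T[OF kn])
  have w: "is_functor ?X ?X (swap_functor (scat S) n k)" by (rule is_functor_swap[OF category k])
  have G: "is_functor ?X set_cat ?G" by (rule is_functor_comp[OF w F])
  have ob: "fobj ?F (as, c) = shom S (lp as) c" "fobj ?G (as, c) = shom S (lp (swap_at k as)) c"
    if "length as = n" "set as \<subseteq> sobj S" "c \<in> sobj S" for as c
    using that k by (simp_all add: comp_functor_apply swap_functor_def mdom_simps set_swap_at, simp_all add: multicategory_of_def mdom_simps set_swap_at)
  have ra: "arr (r as)" "dom (r as) = lp (swap_at k as)" "cod (r as) = lp as" "arr (r' as)" "dom (r' as) = lp as" "cod (r' as) = lp (swap_at k as)"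
    "r as \<bullet> r' as = \<one> (lp as)" "r' as \<bullet> r as = \<one> (lp (swap_at k as))" if "length as = n" "set as \<subseteq> sobj S" for as
    using r[OF that] by (auto simp: inverse_arrows_def shom_iff)
  have h: "?\<beta> a \<in> hom set_cat (fobj ?F a) (fobj ?G a)" if a: "a \<in> Obj ?X" for a
  proof -
    obtain as c where [simp]: "a = (as, c)" by (cases a)
    have v: "length as = n" "set as \<subseteq> sobj S" "c \<in> sobj S" using a by (simp_all add: mdom_simps)
    show ?thesis using v ra[OF v(1,2)] unfolding hom_set_cat by (auto simp: precomposition_def mdom_simps ob shom_iff)
  qed
  have "nat_trans ?X set_cat ?F ?G ?\<beta>"
  proof (rule set_nat_transI[OF F G _ h])
    show "?\<beta> \<in> extensional (Obj ?X)" by (simp add: precomposition_def)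
    show "ap (?\<beta> b) (ap (fmap ?F t) f) = ap (fmap ?G t) (ap (?\<beta> a) f)" if t: "t \<in> hom ?X a b" and f: "f \<in> fobj ?F a" for t a b f
    proof -
      obtain ps q where [simp]: "t = (ps, q)" by (cases t)
      have v: "length ps = n" "set ps \<subseteq> Arr (scat S)" "arr q" "a = (map cod ps, dom q)" "b = (map dom ps, cod q)"
        using t by (auto simp: hom_def mdom_simps)
      have o: "set (map cod ps) \<subseteq> sobj S" "set (map dom ps) \<subseteq> sobj S" using v(2) by auto
      have f': "arr f" "dom f = lp (map cod ps)" "cod f = dom q" using f v(1,3) o by (simp_all add: v ob shom_iff)
      have ne: "ps \<noteq> []" "swap_at k ps \<noteq> []" using v(1) k length_swap_at[of k ps] by auto
      have sw: "set (swap_at k ps) \<subseteq> Arr (scat S)" "map cod (swap_at k ps) = swap_at k (map cod ps)"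
        "map dom (swap_at k ps) = swap_at k (map dom ps)" using v k by (simp_all add: set_swap_at swap_at_map)
      note rc = ra[of "map cod ps"] ra[of "map dom ps"]
      have "ap (fmap ?F (ps, q)) f = q \<bullet> (f \<bullet> lpa ps)" using act_T[of ps q f Tight] v f' by simp
      moreover have "fmap ?G (ps, q) = fmap ?F (swap_at k ps, q)" using v by (simp add: comp_functor_apply mdom_simps swap_functor_def)
      moreover have "ap (fmap ?F (swap_at k ps, q)) (f \<bullet> r (map cod ps)) = q \<bullet> ((f \<bullet> r (map cod ps)) \<bullet> lpa (swap_at k ps))"
        using act_T[of "swap_at k ps" q "f \<bullet> r (map cod ps)" Tight] v f' rc o sw by simp
      moreover have "ap (?\<beta> a) f = f \<bullet> r (map cod ps)" unfolding v(4) using v f' o by (intro ap_precomposition) simp_all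
      moreover have "ap (?\<beta> b) (q \<bullet> (f \<bullet> lpa ps)) = (q \<bullet> (f \<bullet> lpa ps)) \<bullet> r (map dom ps)"
        unfolding v(5) using v f' o ne by (intro ap_precomposition) simp_all
      ultimately show ?thesis using nat[OF v(1,2)] v f' o sw rc ne by simp
    qed
  qed
  moreover have "is_iso set_cat (?\<beta> a)" if a: "a \<in> Obj ?X" for a
  proof -
    obtain as c where [simp]: "a = (as, c)" by (cases a)
    have v: "length as = n" "set as \<subseteq> sobj S" "c \<in> sobj S" using a by (simp_all add: mdom_simps)
    note R = ra[OF v(1,2)]
    have "bij_betw (ap (?\<beta> a)) (shom S (lp as) c) (shom S (lp (swap_at k as)) c)"
      by (rule bij_betw_byWitness[where f' = "\<lambda>f. f \<bullet> r' as"])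
        (use v R in \<open>auto simp: ap_precomposition shom_iff\<close>)
    then show ?thesis using is_iso_set_cat[OF h[OF a]] v by (simp add: ob)
  qed
  ultimately show ?thesis by (simp add: is_exchange_def nat_iso_def)
qed

end

context braiding
begin

abbreviation "B \<equiv> short_braiding_of S s"

lemma braid_natural:
  "arr f \<Longrightarrow> arr g \<Longrightarrow> arr h \<Longrightarrow> cod f = a \<Longrightarrow> cod g = b \<Longrightarrow> cod h = c \<Longrightarrow>
    s a b c \<bullet> ((f \<otimes> g) \<otimes> h) = ((f \<otimes> h) \<otimes> g) \<bullet> s (dom f) (dom g) (dom h)"
  using braid_nat[of f "dom f" "cod f" g "dom g" "cod g" h "dom h" "cod h"] by (simp add: shom_iff)

lemma B_apply:
  "set [a1, a2, a3] \<subseteq> sobj S \<Longrightarrow> arr f \<Longrightarrow> dom f = (a1 \<odot> a2) \<odot> a3 \<Longrightarrow> cod f = c \<Longrightarrow> b32 B [a1, a2, a3] c f = f \<bullet> s a1 a3 a2"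
  "set [a1, a2, a3, a4] \<subseteq> sobj S \<Longrightarrow> arr f \<Longrightarrow> dom f = ((a1 \<odot> a2) \<odot> a3) \<odot> a4 \<Longrightarrow> cod f = c \<Longrightarrow>
    b42 B [a1, a2, a3, a4] c f = f \<bullet> (s a1 a3 a2 \<otimes> \<one> a4)"
  "set [a1, a2, a3, a4] \<subseteq> sobj S \<Longrightarrow> arr f \<Longrightarrow> dom f = ((a1 \<odot> a2) \<odot> a3) \<odot> a4 \<Longrightarrow> cod f = c \<Longrightarrow>
    b43 B [a1, a2, a3, a4] c f = f \<bullet> s (a1 \<odot> a2) a4 a3"
  using arr_obj(2)[of f] by (simp_all add: b32_def b42_def b43_def short_braiding_of_def ap_precomposition)

text \<open>Apart from naturality of \<open>s\<close> and functoriality of the tensor product, the axioms of a short braiding are the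
  four axioms of a braiding.\<close>

lemma short_braiding_T: "short_braiding T B"
proof -
  have "\<forall>x a b. \<exists>t. x \<in> sobj S \<longrightarrow> a \<in> sobj S \<longrightarrow> b \<in> sobj S \<longrightarrow> inverse_arrows (scat S) (s x a b) t"
    using braid_iso unfolding is_iso_def by blast
  then obtain t where t: "\<And>x a b. x \<in> sobj S \<Longrightarrow> a \<in> sobj S \<Longrightarrow> b \<in> sobj S \<Longrightarrow> inverse_arrows (scat S) (s x a b) (t x a b)"
    by metis
  have ti [simp]: "arr (t x a b)" "dom (t x a b) = (x \<odot> b) \<odot> a" "cod (t x a b) = (x \<odot> a) \<odot> b"
    "t x a b \<bullet> s x a b = \<one> ((x \<odot> a) \<odot> b)" "s x a b \<bullet> t x a b = \<one> ((x \<odot> b) \<odot> a)"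
    if "x \<in> sobj S" "a \<in> sobj S" "b \<in> sobj S" for x a b
    using t[OF that] that by (auto simp: inverse_arrows_def)
  have l3: "\<exists>a b c. as = [a, b, c]" if "length as = 3" for as :: "'a list" using that by (auto simp: numeral_3_eq_3 length_Suc_conv)
  have l4: "\<exists>a b c d. as = [a, b, c, d]" if "length as = 4" for as :: "'a list" using that by (auto simp: eval_nat_numeral length_Suc_conv)
  have 1: "(\<one> x \<otimes> (f \<bullet> s a b c)) \<bullet> (alpha S x (a \<odot> b) c \<bullet> (alpha S x a b \<otimes> \<one> c)) =
      (\<one> x \<otimes> f) \<bullet> (alpha S x (a \<odot> c) b \<bullet> ((alpha S x a c \<otimes> \<one> b) \<bullet> s (x \<odot> a) b c))"
    if [simp]: "x \<in> sobj S" "a \<in> sobj S" "b \<in> sobj S" "c \<in> sobj S" "arr f" "dom f = (a \<odot> c) \<odot> b" for x a b c f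
    unfolding braid_alpha_3[OF that(1-4), symmetric] by simp
  have 2: "s x b (cod f) \<bullet> ((\<one> (x \<odot> b) \<otimes> f) \<bullet> alpha S (x \<odot> b) a c) =
      ((\<one> x \<otimes> f) \<bullet> alpha S x a c) \<otimes> \<one> b \<bullet> (s (x \<odot> a) b c \<bullet> (s x b a \<otimes> \<one> c))"
    if [simp]: "x \<in> sobj S" "a \<in> sobj S" "b \<in> sobj S" "c \<in> sobj S" "arr f" "dom f = a \<odot> c" for x a b c f
    using comp_extend[OF braid_natural[of "\<one> x" "\<one> b" f x b "cod f"], of "alpha S (x \<odot> b) a c"] braid_alpha_1[of x b a c] by simp
  have 3: "s x (cod f) b \<bullet> (((\<one> x \<otimes> f) \<bullet> alpha S x a c) \<otimes> \<one> b) =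
      (\<one> (x \<odot> b) \<otimes> f) \<bullet> (alpha S (x \<odot> b) a c \<bullet> ((s x a b \<otimes> \<one> c) \<bullet> s (x \<odot> a) c b))"
    if [simp]: "x \<in> sobj S" "a \<in> sobj S" "b \<in> sobj S" "c \<in> sobj S" "arr f" "dom f = a \<odot> c" for x a b c f
    using comp_extend[OF braid_natural[of "\<one> x" f "\<one> b" x "cod f" b], of "alpha S x a c \<otimes> \<one> b"] braid_alpha_2[of x a c b] by simp
  show ?thesis
  proof (intro short_braiding.intro short_skew_multicategory_T short_braiding_axioms.intro)
    show "is_exchange T 3 2 (beta32 B)"
      unfolding short_braiding_of_def sbraid.simps
      by (rule is_exchange_precomposition[where r' = "\<lambda>as. t (as ! 0) (as ! 2) (as ! 1)"])
        (auto dest!: l3 simp: inverse_arrows_def shom_iff braid_natural)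
    show "is_exchange T 4 2 (beta42 B)"
      unfolding short_braiding_of_def sbraid.simps
      by (rule is_exchange_precomposition[where r' = "\<lambda>as. t (as ! 0) (as ! 2) (as ! 1) \<otimes> \<one> (as ! 3)"])
        (auto dest!: l4 simp: inverse_arrows_def shom_iff braid_natural)
    show "is_exchange T 4 3 (beta43 B)"
      unfolding short_braiding_of_def sbraid.simps
      by (rule is_exchange_precomposition[where r' = "\<lambda>as. t (as ! 0 \<odot> as ! 1) (as ! 3) (as ! 2)"])
        (auto dest!: l4 simp: inverse_arrows_def shom_iff braid_natural)
  qed (simp_all add: mm_T_iff B_apply T_unfold braid_braid braid_natural, auto simp: 1 2 3)
qed

lemma short_symmetry_T: "symmetry S s \<Longrightarrow> short_symmetry T B"
  using short_braiding_T arr_obj by (auto simp: short_symmetry_def symmetry_def inverse_arrows_def mm_T_iff B_apply)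

end

section \<open>The equivalences\<close>

lemma hom_cat_of_homs:
  "h \<in> hom (cat_of_homs Ob H c i) X Y \<longleftrightarrow> X \<in> Ob \<and> Y \<in> Ob \<and> (\<exists>f\<in>H X Y. h = (X, f, Y))"
  by (auto simp: hom_def cat_of_homs_def)

lemma BrdSkMon_simps:
  "Obj BrdSkMon = {(S, s). braiding S s}" "Idn BrdSkMon X = (X, lax_id (fst X), X)"
  "Comp BrdSkMon (Y, G, Z) (X, F, Y') = (X, lax_comp (fst X) (fst Y) (fst Z) G F, Z)"
  "h \<in> hom BrdSkMon (S, s) (T, t) \<longleftrightarrow> braiding S s \<and> braiding T t \<and> (\<exists>L. braided_lax (S, s) (T, t) L \<and> h = ((S, s), L, (T, t)))"
  by (simp_all add: BrdSkMon_def hom_cat_of_homs, simp_all add: cat_of_homs_def)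

lemma BrdShSkMulti_simps:
  "Obj BrdShSkMulti_lr = {(M, B). short_braiding M B \<and> left_representable M}" "Idn BrdShSkMulti_lr X = (X, ssm_id (fst X), X)"
  "Comp BrdShSkMulti_lr (Y, G, Z) (X, F, Y') = (X, ssm_comp (fst X) G F, Z)"
  "h \<in> hom BrdShSkMulti_lr (M, B) (N, B') \<longleftrightarrow> short_braiding M B \<and> left_representable M \<and> short_braiding N B' \<and> left_representable N \<and>
    (\<exists>F. braided_morphism (M, B) (N, B') F \<and> h = ((M, B), F, (N, B')))"
  by (simp_all add: BrdShSkMulti_lr_def hom_cat_of_homs, simp_all add: cat_of_homs_def)

lemma (in category) iso_comp:
  assumes "f \<in> hom C a b" "is_iso C f" "g \<in> hom C b c" "is_iso C g"
  shows "is_iso C (g \<cdot> f)"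
proof -
  obtain f' g' where fg: "inverse_arrows C f f'" "inverse_arrows C g g'" using assms unfolding is_iso_def by blast
  note f' = inverse_arrows_homD[OF fg(1) assms(1)] and g' = inverse_arrows_homD[OF fg(2) assms(3)]
  note c = comp_in_hom[OF assms(1,3)] comp_in_hom[OF g'(1) f'(1)]
  have "f' \<cdot> (g' \<cdot> (g \<cdot> f)) = Idn C a"
    using comp_assoc[OF assms(1,3) g'(1)] idn_comp[OF assms(1)] f'(2) g'(2) by simp
  moreover have "g \<cdot> (f \<cdot> (f' \<cdot> g')) = Idn C c"
    using comp_assoc[OF g'(1) f'(1) assms(1)] idn_comp[OF g'(1)] f'(3) g'(3) by simp
  ultimately have "inverse_arrows C (g \<cdot> f) (f' \<cdot> g')"
    using comp_assoc[OF c(1) g'(1) f'(1)] comp_assoc[OF c(2) assms(1,3)] by (intro inverse_arrowsI[OF c]) simp_all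
  then show ?thesis unfolding is_iso_def by blast
qed

text \<open>The structure arrows are arbitrary functions outside the objects, so that two skew monoidal categories
  with the same structure need not be equal; but the identity functor is an isomorphism between them.\<close>

lemma agreeing_structures_iso:
  assumes S: "braiding S s" and S': "braiding S' s'"
    and sc: "scat S' = scat S" and st: "stens S' = stens S" and su: "sunit S' = sunit S"
    and al: "\<And>a b c. a \<in> sobj S \<Longrightarrow> b \<in> sobj S \<Longrightarrow> c \<in> sobj S \<Longrightarrow> alpha S' a b c = alpha S a b c \<and> s' a b c = s a b c"
    and lr: "\<And>a. a \<in> sobj S \<Longrightarrow> lambda S' a = lambda S a \<and> rho S' a = rho S a"
  shows "((S', s'), lax_id S, (S, s)) \<in> hom BrdSkMon (S', s') (S, s)" "is_iso BrdSkMon ((S', s'), lax_id S, (S, s))"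
proof -
  have e [simp]: "sobj S' = sobj S" "shom S' = shom S" "scomp S' = scomp S" "sid S' = sid S" "tens_obj S' = tens_obj S"
    "tens_arr S' = tens_arr S"
    by (auto simp: sobj_def shom_def scomp_def sid_def tens_obj_def tens_arr_def sc st fun_eq_iff)
  interpret braiding S s by fact
  interpret S': braiding S' s' by fact
  have i: "lax_id S' = lax_id S" by (simp add: lax_id_def sc su)
  have o [simp]: "fobj (id_functor (scat S)) a = a" if "a \<in> sobj S" for a using that by (simp add: id_functor_apply)
  have m [simp]: "fmap (id_functor (scat S)) f = f" if "arr f" for f using that by (simp add: id_functor_apply)
  have l: "braided_lax (S', s') (S, s) (lax_id S)" "braided_lax (S, s) (S', s') (lax_id S)"
    unfolding braided_lax_iff
    by (intro conjI lax_monoidal_functor.intro lax_monoidal_functor_axioms.intro skew_monoidal_category_axioms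
        S'.skew_monoidal_category_axioms; auto simp: lax_id_def shom_iff sc su al lr is_functor_id category)+
  interpret L: category "BrdSkMon :: (('a, 'b) smc \<times> ('a \<Rightarrow> 'a \<Rightarrow> 'a \<Rightarrow> 'b),
    (('a, 'b) smc \<times> ('a \<Rightarrow> 'a \<Rightarrow> 'a \<Rightarrow> 'b)) \<times> ('a, 'b) lax_mor \<times> (('a, 'b) smc \<times> ('a \<Rightarrow> 'a \<Rightarrow> 'a \<Rightarrow> 'b))) cat"
    by (rule category_BrdSkMon)
  have c: "lax_comp S S S (lax_id S) (lax_id S) = lax_id S"
    using L.comp_idn[OF L.idn_in_hom, of "(S, s)"] S by (simp add: BrdSkMon_simps)
  have c': "lax_comp S S' S (lax_id S) (lax_id S) = lax_id S" "lax_comp S' S S' (lax_id S) (lax_id S) = lax_id S"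
    using c by (simp_all add: lax_comp_def sc)
  show h: "((S', s'), lax_id S, (S, s)) \<in> hom BrdSkMon (S', s') (S, s)" using S S' l by (simp add: BrdSkMon_simps)
  have h': "((S, s), lax_id S, (S', s')) \<in> hom BrdSkMon (S, s) (S', s')" using S S' l by (simp add: BrdSkMon_simps)
  show "is_iso BrdSkMon ((S', s'), lax_id S, (S, s))"
    unfolding is_iso_def by (rule exI, rule inverse_arrowsI[OF h h']) (simp_all add: BrdSkMon_simps c' i)
qed

text \<open>Functoriality of \<open>K\<close>, with different choices at the source and the target of the identity of \<open>M\<close>.\<close>

lemma K_independent_of_choice:
  assumes D: "representable_braiding M D B" and D': "representable_braiding M D' B"
  shows "((K_s_obj D M, K_braid D M B), K_s_mor D D' M M (ssm_id M), (K_s_obj D' M, K_braid D' M B))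
      \<in> hom BrdSkMon (K_s_obj D M, K_braid D M B) (K_s_obj D' M, K_braid D' M B)" (is "?h D D' \<in> ?H D D'")
    "is_iso BrdSkMon ((K_s_obj D M, K_braid D M B), K_s_mor D D' M M (ssm_id M), (K_s_obj D' M, K_braid D' M B))"
proof -
  interpret D: representable_braiding M D B by fact
  interpret D': representable_braiding M D' B by fact
  have i: "braided_morphism (M, B) (M, B) (ssm_id M)" by (rule braided_id) unfold_locales
  then have m: "ssm_morphism M M (ssm_id M)" by (simp add: braided_morphism_def)
  interpret L: category "BrdShSkMulti_lr :: (('a, 'b) ssm \<times> ('a, 'b) sbraid,
    (('a, 'b) ssm \<times> ('a, 'b) sbraid) \<times> ('a, 'b) ssm_mor \<times> (('a, 'b) ssm \<times> ('a, 'b) sbraid)) cat"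
    by (rule category_BrdShSkMulti)
  have "left_representable M" using D.lr unfolding left_representable_def by blast
  then have "ssm_comp M (ssm_id M) (ssm_id M) = ssm_id M"
    using L.comp_idn[OF L.idn_in_hom, of "(M, B)"] D.short_braiding_axioms by (simp add: BrdShSkMulti_simps)
  then have c: "lax_comp (K_s_obj D M) (K_s_obj D' M) (K_s_obj D M) (K_s_mor D' D M M (ssm_id M)) (K_s_mor D D' M M (ssm_id M)) =
      lax_id (K_s_obj D M)" if "representable M D" "representable M D'" for D D'
    using K_mor_comp[OF that that(1) m m] K_mor_id[OF that(1)] by simp
  have h: "?h D D' \<in> ?H D D'" if "representable_braiding M D B" "representable_braiding M D' B" for D D'
    using representable_braiding.K_braiding[OF that(1)] representable_braiding.K_braiding[OF that(2)] K_mor_braided[OF that i]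
    by (simp add: BrdSkMon_simps)
  show "?h D D' \<in> ?H D D'" by (rule h[OF D D'])
  show "is_iso BrdSkMon (?h D D')"
    unfolding is_iso_def
    by (rule exI, rule inverse_arrowsI[OF h[OF D D'] h[OF D' D]])
      (simp_all add: BrdSkMon_simps c D.representable_axioms D'.representable_axioms)
qed

context braiding
begin

lemma K_identity_data:
  assumes D: "D = \<lparr>lr_tensor = (\<odot>), lr_theta = \<lambda>a b. \<one> (a \<odot> b), lr_unit = \<I>, lr_u = \<one> \<I>\<rparr>" and lr: "is_lr_data T D"
  shows "((K_s_obj D T, K_braid D T B), lax_id S, (S, s)) \<in> hom BrdSkMon (K_s_obj D T, K_braid D T B) (S, s)"
    "is_iso BrdSkMon ((K_s_obj D T, K_braid D T B), lax_id S, (S, s))"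
proof -
  interpret R: representable_braiding T D B
    using short_braiding_T lr short_skew_multicategory_T
    by (intro representable_braiding.intro representable.intro representable_axioms.intro)
  have [simp]: "lr_tensor D = (\<odot>)" "lr_unit D = \<I>" "lr_theta D a b = \<one> (a \<odot> b)" "lr_u D = \<one> \<I>" for a b by (simp_all add: D)
  note un = comp_at_def R.\<theta>_def R.u_def unary_def jmap_def T_unfold
  have t: "K_tens_arr D T p q = p \<otimes> q" if "arr p" "arr q" for p q
    using R.tensor_theta[of p q "dom p" "dom q"] R.tensor_arr[of p q] that by (simp add: un)
  have a: "K_alpha D T a b c = alpha S a b c" if "a \<in> sobj S" "b \<in> sobj S" "c \<in> sobj S" for a b c
    using R.alpha_theta[of a b c] R.alpha_arr[of a b c] that by (simp add: un)
  have l: "K_lambda D T a = lambda S a" "K_rho D T a = rho S a" if "a \<in> sobj S" for a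
    using R.lambda_theta[of a] R.lambda_arr[of a] R.rho_unary(1)[of a] jm_T[of "[a]" "\<one> a"] that by (simp_all add: un)
  have b: "K_braid D T B x a b = s x a b" if "x \<in> sobj S" "a \<in> sobj S" "b \<in> sobj S" for x a b
    using R.braid_theta[of x a b] R.braid_arr[of x a b] that by (simp add: un R.\<beta>\<^sub>3_def B_apply)
  have st: "stens (K_s_obj D T) = stens S"
    by (rule functr_eqI[where A = "sobj S \<times> sobj S" and B = "Arr (scat S) \<times> Arr (scat S)"])
      (use is_functorD(3,4)[OF tensor] in \<open>auto simp: K_s_obj_def prod_cat_def t, auto simp: tens_obj_def tens_arr_def\<close>)
  have K: "braiding (K_s_obj D T) (K_braid D T B)" by (rule R.K_braiding)
  have sc: "scat (K_s_obj D T) = scat S" "sunit (K_s_obj D T) = \<I>" by (simp_all add: K_s_obj_def)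
  have al: "alpha (K_s_obj D T) = K_alpha D T" "lambda (K_s_obj D T) = K_lambda D T" "rho (K_s_obj D T) = K_rho D T"
    by (simp_all add: K_s_obj_def)
  show "((K_s_obj D T, K_braid D T B), lax_id S, (S, s)) \<in> hom BrdSkMon (K_s_obj D T, K_braid D T B) (S, s)"
    "is_iso BrdSkMon ((K_s_obj D T, K_braid D T B), lax_id S, (S, s))"
    using agreeing_structures_iso[OF braiding_axioms K sc(1) st sc(2)] a b l unfolding al by blast+
qed

end

lemma representable_braiding_ofI: "short_braiding M B \<Longrightarrow> is_lr_data M D \<Longrightarrow> representable_braiding M D B"
  by (intro representable_braiding.intro representable.intro representable_axioms.intro)
    (simp_all add: short_braiding_def)

lemma (in braiding) K_essentially_surjective:
  assumes "is_lr_data T D"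
  shows "\<exists>h\<in>hom BrdSkMon (K_s_obj D T, K_braid D T B) (S, s). is_iso BrdSkMon h"
proof -
  interpret L: category "BrdSkMon :: (('a, 'b) smc \<times> ('a \<Rightarrow> 'a \<Rightarrow> 'a \<Rightarrow> 'b),
    (('a, 'b) smc \<times> ('a \<Rightarrow> 'a \<Rightarrow> 'a \<Rightarrow> 'b)) \<times> ('a, 'b) lax_mor \<times> (('a, 'b) smc \<times> ('a \<Rightarrow> 'a \<Rightarrow> 'a \<Rightarrow> 'b))) cat"
    by (rule category_BrdSkMon)
  define D0 where "D0 = \<lparr>lr_tensor = (\<odot>), lr_theta = \<lambda>a b. \<one> (a \<odot> b), lr_unit = \<I>, lr_u = \<one> \<I>\<rparr>"
  have D0: "is_lr_data T D0" unfolding D0_def by (rule is_lr_data_T)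
  note i = K_identity_data[OF D0_def D0]
    and j = K_independent_of_choice[OF assms[THEN representable_braiding_ofI[OF short_braiding_T]] D0[THEN representable_braiding_ofI[OF short_braiding_T]]]
  show ?thesis using L.iso_comp[OF j i] L.comp_in_hom[OF j(1) i(1)] by blast
qed

lemma (in braiding) T_object: "(T, B) \<in> Obj BrdShSkMulti_lr"
  using short_braiding_T is_lr_data_T unfolding BrdShSkMulti_simps left_representable_def by blast

locale chosen_representations =
  fixes ch :: "('o, 'm) ssm \<Rightarrow> ('o, 'm) lr_data"
  assumes ch: "\<And>M. short_skew_multicategory M \<Longrightarrow> left_representable M \<Longrightarrow> is_lr_data M (ch M)"
begin

lemma chosen_data:
  assumes "(M, B) \<in> Obj BrdShSkMulti_lr" shows "representable_braiding M (ch M) B"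
  using assms ch[of M] by (auto simp: BrdShSkMulti_simps short_braiding_def intro!: representable_braiding_ofI)

lemma K_brd_apply:
  "X \<in> Obj BrdShSkMulti_lr \<Longrightarrow> fobj (K_brd ch) X = K_brd_obj ch X"
  "(X, F, Y) \<in> Arr BrdShSkMulti_lr \<Longrightarrow>
    fmap (K_brd ch) (X, F, Y) = (K_brd_obj ch X, K_s_mor (ch (fst X)) (ch (fst Y)) (fst X) (fst Y) F, K_brd_obj ch Y)"
  by (simp_all add: K_brd_def)

lemma is_functor_K_brd: "is_functor BrdShSkMulti_lr BrdSkMon (K_brd ch)"
proof (rule is_functorI[OF category_BrdShSkMulti category_BrdSkMon])
  show "fobj (K_brd ch) X \<in> Obj BrdSkMon" if "X \<in> Obj BrdShSkMulti_lr" for X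
    using representable_braiding.K_braiding[OF chosen_data] that
    by (cases X) (simp add: K_brd_apply K_brd_obj_def BrdSkMon_simps)
  interpret M: category "BrdShSkMulti_lr :: (('o, 'm) ssm \<times> ('o, 'm) sbraid,
    (('o, 'm) ssm \<times> ('o, 'm) sbraid) \<times> ('o, 'm) ssm_mor \<times> (('o, 'm) ssm \<times> ('o, 'm) sbraid)) cat"
    by (rule category_BrdShSkMulti)
  fix f g and X Y Z :: "('o, 'm) ssm \<times> ('o, 'm) sbraid"
  {
    fix f and X Y :: "('o, 'm) ssm \<times> ('o, 'm) sbraid" assume f: "f \<in> hom BrdShSkMulti_lr X Y"
    obtain M B N B' where [simp]: "X = (M, B)" "Y = (N, B')" by (cases X, cases Y)
    note o = M.hom_objD[OF f]
    obtain F where F: "f = ((M, B), F, (N, B'))" "braided_morphism (M, B) (N, B') F" using f by (auto simp: BrdShSkMulti_simps)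
    have r: "representable_braiding M (ch M) B" "representable_braiding N (ch N) B'" using o by (simp_all add: chosen_data)
    show "fmap (K_brd ch) f \<in> hom BrdSkMon (fobj (K_brd ch) X) (fobj (K_brd ch) Y)"
      using K_mor_braided[OF r F(2)] homD(1)[OF f] o r[THEN representable_braiding.K_braiding]
      by (simp add: F K_brd_apply K_brd_obj_def BrdSkMon_simps)
  }
  show "fmap (K_brd ch) (Idn BrdShSkMulti_lr X) = Idn BrdSkMon (fobj (K_brd ch) X)" if X: "X \<in> Obj BrdShSkMulti_lr"
  proof -
    have "Idn BrdShSkMulti_lr X \<in> Arr BrdShSkMulti_lr" using M.idn_in_hom[OF X] by (rule homD)
    moreover have "representable (fst X) (ch (fst X))" using chosen_data[of "fst X" "snd X"] X by (simp add: representable_braiding_def)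
    ultimately show ?thesis
      using X by (cases X) (simp add: BrdShSkMulti_simps BrdSkMon_simps K_brd_apply K_mor_id, simp add: K_brd_obj_def)
  qed
  show "fmap (K_brd ch) (Comp BrdShSkMulti_lr g f) = Comp BrdSkMon (fmap (K_brd ch) g) (fmap (K_brd ch) f)"
    if fg: "f \<in> hom BrdShSkMulti_lr X Y" "g \<in> hom BrdShSkMulti_lr Y Z"
  proof -
    obtain M B N B' L B'' where [simp]: "X = (M, B)" "Y = (N, B')" "Z = (L, B'')" by (cases X, cases Y, cases Z)
    obtain F G where F: "f = ((M, B), F, (N, B'))" "g = ((N, B'), G, (L, B''))" "ssm_morphism M N F" "ssm_morphism N L G"
      using fg by (auto simp: BrdShSkMulti_simps braided_morphism_def)
    have r: "representable M (ch M)" "representable N (ch N)" "representable L (ch L)"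
      using chosen_data M.hom_objD[OF fg(1)] M.hom_objD[OF fg(2)] by (simp_all add: representable_braiding_def)
    show ?thesis
      using homD(1)[OF fg(1)] homD(1)[OF fg(2)] homD(1)[OF M.comp_in_hom[OF fg]] K_mor_comp[OF r F(3,4)]
      by (simp add: F(1,2) BrdShSkMulti_simps BrdSkMon_simps K_brd_apply, simp add: K_brd_obj_def)
  qed
qed (simp_all add: K_brd_def)

lemma K_brd_fully_faithful: "fully_faithful BrdShSkMulti_lr BrdSkMon (K_brd ch)"
  unfolding fully_faithful_def
proof (intro ballI)
  fix X Y :: "('o, 'm) ssm \<times> ('o, 'm) sbraid" assume XY: "X \<in> Obj BrdShSkMulti_lr" "Y \<in> Obj BrdShSkMulti_lr"
  obtain M B N B' where [simp]: "X = (M, B)" "Y = (N, B')" by (cases X, cases Y)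
  have r: "representable_braiding M (ch M) B" "representable_braiding N (ch N) B'" using XY by (simp_all add: chosen_data)
  interpret M: representable_braiding M "ch M" B by (rule r)
  interpret N: representable_braiding N "ch N" B' by (rule r)
  interpret lr_pair M N "ch M" "ch N" ..
  note k = is_functorD(6)[OF is_functor_K_brd]
  show "bij_betw (fmap (K_brd ch)) (hom BrdShSkMulti_lr X Y) (hom BrdSkMon (fobj (K_brd ch) X) (fobj (K_brd ch) Y))"
    unfolding bij_betw_def
  proof
    show "inj_on (fmap (K_brd ch)) (hom BrdShSkMulti_lr X Y)"
    proof (rule inj_onI)
      fix f g assume fg: "f \<in> hom BrdShSkMulti_lr X Y" "g \<in> hom BrdShSkMulti_lr X Y" "fmap (K_brd ch) f = fmap (K_brd ch) g"
      then obtain F G where "f = (X, F, Y)" "g = (X, G, Y)" "ssm_morphism M N F" "ssm_morphism M N G"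
        by (auto simp: BrdShSkMulti_simps braided_morphism_def)
      then show "f = g" using fg homD(1)[OF fg(1)] homD(1)[OF fg(2)] K_mor_faithful[of F G] by (simp add: K_brd_apply)
    qed
    show "fmap (K_brd ch) ` hom BrdShSkMulti_lr X Y = hom BrdSkMon (fobj (K_brd ch) X) (fobj (K_brd ch) Y)"
    proof
      show "fmap (K_brd ch) ` hom BrdShSkMulti_lr X Y \<subseteq> hom BrdSkMon (fobj (K_brd ch) X) (fobj (K_brd ch) Y)"
        by (rule image_subsetI) (rule k)
      show "hom BrdSkMon (fobj (K_brd ch) X) (fobj (K_brd ch) Y) \<subseteq> fmap (K_brd ch) ` hom BrdShSkMulti_lr X Y"
      proof
        fix h assume "h \<in> hom BrdSkMon (fobj (K_brd ch) X) (fobj (K_brd ch) Y)"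
        then obtain L where L: "braided_lax (K_s_obj (ch M) M, M.s) (K_s_obj (ch N) N, N.s) L" "h = (K_brd_obj ch X, L, K_brd_obj ch Y)"
          using XY by (auto simp: BrdSkMon_simps K_brd_apply K_brd_obj_def)
        obtain F where F: "braided_morphism (M, B) (N, B') F" "K_s_mor (ch M) (ch N) M N F = L" using K_mor_full[OF r L(1)] by blast
        then have f: "(X, F, Y) \<in> hom BrdShSkMulti_lr X Y" using XY by (simp add: BrdShSkMulti_simps)
        have "fmap (K_brd ch) (X, F, Y) = h" using homD(1)[OF f] by (simp add: K_brd_apply L F)
        with f show "h \<in> fmap (K_brd ch) ` hom BrdShSkMulti_lr X Y" by blast
      qed
    qed
  qed
qed

lemma K_brd_eso:
  assumes "braiding S s"
  shows "\<exists>h\<in>hom BrdSkMon (fobj (K_brd ch) (multicategory_of S, short_braiding_of S s)) (S, s). is_iso BrdSkMon h"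
proof -
  interpret braiding S s by fact
  have "is_lr_data T (ch T)" using chosen_data[OF T_object] by (simp add: representable_braiding_def representable_def representable_axioms_def)
  from K_essentially_surjective[OF this] show ?thesis using T_object by (simp add: K_brd_apply K_brd_obj_def)
qed

end

theorem theorem5p22:
  fixes ch :: "('o, 'm) ssm \<Rightarrow> ('o, 'm) lr_data"
  assumes "\<And>M. short_skew_multicategory M \<Longrightarrow> left_representable M \<Longrightarrow> is_lr_data M (ch M)"
  shows "equivalence_of_categories BrdShSkMulti_lr BrdSkMon (K_brd ch)
       \<and> equivalence_of_categories SymShSkMulti_lr SymSkMon (K_sym ch)"
proof
  interpret chosen_representations ch by unfold_locales (rule assms)
  note F = is_functor_K_brd and ff = K_brd_fully_faithful and eso = K_brd_eso
  have T: "(multicategory_of S, short_braiding_of S s) \<in> Obj BrdShSkMulti_lr" if "braiding S s" for S s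
    using braiding.T_object[OF that] .
  show "equivalence_of_categories BrdShSkMulti_lr BrdSkMon (K_brd ch)"
  proof (rule equivalence_if_fully_faithful[OF F ff])
    fix d :: "('o, 'm) smc \<times> ('o \<Rightarrow> 'o \<Rightarrow> 'o \<Rightarrow> 'm)" assume "d \<in> Obj BrdSkMon"
    then obtain S s where d: "d = (S, s)" "braiding S s" by (auto simp: BrdSkMon_simps)
    show "\<exists>c\<in>Obj BrdShSkMulti_lr. \<exists>h\<in>hom BrdSkMon (fobj (K_brd ch) c) d. is_iso BrdSkMon h"
      unfolding d(1) using eso[OF d(2)] T[OF d(2)] by blast
  qed
  show "equivalence_of_categories SymShSkMulti_lr SymSkMon (K_sym ch)"
    unfolding K_sym_def SymShSkMulti_lr_def SymSkMon_def
  proof (rule equivalence_full_subcat[OF F ff])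
    fix c :: "('o, 'm) ssm \<times> ('o, 'm) sbraid" assume "c \<in> Obj BrdShSkMulti_lr" "case c of (M, B) \<Rightarrow> short_symmetry M B"
    then show "case fobj (K_brd ch) c of (S, s) \<Rightarrow> symmetry S s"
      using representable_braiding.K_symmetry[OF chosen_data] by (cases c) (simp add: K_brd_apply K_brd_obj_def)
  next
    fix d :: "('o, 'm) smc \<times> ('o \<Rightarrow> 'o \<Rightarrow> 'o \<Rightarrow> 'm)"
    assume "d \<in> Obj BrdSkMon" "case d of (S, s) \<Rightarrow> symmetry S s"
    then obtain S s where d: "d = (S, s)" "braiding S s" "symmetry S s" by (auto simp: BrdSkMon_simps)
    show "\<exists>c\<in>Obj BrdShSkMulti_lr. (case c of (M, B) \<Rightarrow> short_symmetry M B) \<and> (\<exists>h\<in>hom BrdSkMon (fobj (K_brd ch) c) d. is_iso BrdSkMon h)"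
      unfolding d(1)
      by (rule bexI[OF _ T[OF d(2)]]) (use eso[OF d(2)] braiding.short_symmetry_T[OF d(2,3)] in simp)
  qed
qed

end
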